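(* Let $\mathbb{K}$ be a field, $R$ a Frobenius-separable $\mathbb{K}$-algebra with idempotent Frobenius system $(\psi,e^{(1)}\otimes e^{(2)})$, $\Lambda$ a non-empty finite set, $X$ a finite set, $\deg\colon X\to G$ a map, and $\sigma=\{\sigma^{ab}_{cd}\}_{a,b,c,d\in X}$ a family in $M_\Lambda(R)$ such that $\sigma^{ab}_{cd}(\lambda)\in Z(R)$ for all $\lambda\in\Lambda$, $a,b,c,d\in X$, and such that $\lambda\deg(d)\deg(b)\neq\lambda\deg(c)\deg(a)$ implies $\sigma^{bd}_{ac}(\lambda)=0$. Let $A_\sigma$, $\mathfrak{A}(w_\sigma)$ be the weak bialgebras and $\Phi\colon\mathfrak{A}(w_\sigma)\to A_\sigma$ the homomorphism described in the context. If $\sigma$ is rigid, then the pair $(A_\sigma,\Phi)$ satisfies the following universal property: for any $\mathbb{K}$-algebra $A$ and any $\mathbb{K}$-algebra homomorphism $f^+\colon\mathfrak{A}(w_\sigma)\to A$ with an antipode $f^-$, there exists a unique $\mathbb{K}$-algebra homomorphism $F\colon A_\sigma\to A$ such that $F\circ\Phi=f^+$. Moreover, if this $\mathbb{K}$-algebra $A$ has a weak bialgebra structure $(A,\Delta,\varepsilon)$ and $f^+$ is a weak bialgebra homomorphism, then so is $F$.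
   Context: Algebras are associative and unital, and algebra homomorphisms are unital. $Z(R)$ is the center of $R$. WEAK BIALGEBRAS. A weak bialgebra is a $\mathbb{K}$-algebra $B$ with a $\mathbb{K}$-coalgebra structure $\Delta(a)=a_{(1)}\otimes a_{(2)}$, $\varepsilon$ such that $\Delta(ab)=\Delta(a)\Delta(b)$; $(\Delta(1)\otimes1)(1\otimes\Delta(1))=1_{(1)}\otimes1_{(2)}\otimes1_{(3)}=(1\otimes\Delta(1))(\Delta(1)\otimes1)$; $\varepsilon(ab_{(1)})\varepsilon(b_{(2)}c)=\varepsilon(abc)=\varepsilon(ab_{(2)})\varepsilon(b_{(1)}c)$. A weak bialgebra homomorphism is a map that is both a $\mathbb{K}$-algebra and a $\mathbb{K}$-coalgebra homomorphism. Put $\varepsilon_s(a)=1_{(1)}\varepsilon(a1_{(2)})$, $\varepsilon_t(a)=\varepsilon(1_{(1)}a)1_{(2)}$. ANTIPODE OF A HOMOMORPHISM. For a weak bialgebra $H$, a $\mathbb{K}$-algebra $A$ and a $\mathbb{K}$-algebra homomorphism $f^+\colon H\to A$, a $\mathbb{K}$-linear map $f^-\colon H\to A$ is an antipode of $f^+$ if, for the convolution product $(f\star g)(c)=f(c_{(1)})g(c_{(2)})$ on $\mathrm{Hom}_{\mathbb{K}}(H,A)$: $f^-\star f^+=f^+\circ\varepsilon_s$, $f^+\star f^-=f^+\circ\varepsilon_t$, $f^+\star f^-\star f^+=f^+$, $f^-\star f^+\star f^-=f^-$. (It is unique if it exists.) FROBENIUS-SEPARABLE ALGEBRAS. A $\mathbb{K}$-algebra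 $L$ is Frobenius-separable with idempotent Frobenius system $(\psi,e^{(1)}\otimes e^{(2)})$ if $\psi\colon L\to\mathbb{K}$ is $\mathbb{K}$-linear, $e^{(1)}\otimes e^{(2)}\in L\otimes_{\mathbb{K}}L$ (implicit sum), $l=\psi(le^{(1)})e^{(2)}=e^{(1)}\psi(e^{(2)}l)$ for all $l\in L$, and $e^{(1)}e^{(2)}=1_L$. LEFT BIALGEBROIDS AND WEAK BIALGEBRAS. A left bialgebroid is $(A,L,s_L,t_L,\Delta_L,\pi_L)$ where $s_L\colon L\to A$, $t_L\colon L^{op}\to A$ are $\mathbb{K}$-algebra homomorphisms with commuting images, $A$ is an $(L,L)$-bimodule by $l\cdot a=s_L(l)a$, $a\cdot l=t_L(l)a$, and $(A,\Delta_L,\pi_L)$ is a comonoid in $(L,L)$-bimodules such that, with $\Delta_L(a)=a_{[1]}\otimes a_{[2]}\in A\otimes_LA$: $a_{[1]}t_L(l)\otimes a_{[2]}=a_{[1]}\otimes a_{[2]}s_L(l)$, $\Delta_L$ is unital and multiplicative, $\pi_L(1_A)=1_L$, $\pi_L(as_L(\pi_L(b)))=\pi_L(ab)=\pi_L(at_L(\pi_L(b)))$. If $L$ has an idempotent Frobenius system $(\psi_L,e_L^{(1)}\otimes e_L^{(2)})$, then $A$ is a weak bialgebra with $\Delta(a)=t_L(e_L^{(1)})a_{[1]}\otimes s_L(e_L^{(2)})a_{[2]}$ and $\varepsilon=\psi_L\circ\pi_L$ (known). NOTATION. $M_\Lambda(R)$ is the $\mathbb{K}$-algebra of maps $\Lambda\to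 R$ (pointwise). $r_M$ is the constant map with value $r\in R$; $\delta_\lambda(\mu)=\delta_{\lambda,\mu}$. $M_\Lambda(R)$ carries the idempotent Frobenius system $f\mapsto\sum_{\lambda}\psi(f(\lambda))$, $\sum_{\lambda}e^{(1)}_M\delta_\lambda\otimes e^{(2)}_M\delta_\lambda$; with it, all left bialgebroids over $M_\Lambda(R)$ below are regarded as weak bialgebras. $G$ is the opposite group of the symmetric group on $\Lambda$, acting on the right on $\Lambda$ by $\lambda\alpha=\alpha(\lambda)$. $T_\alpha(f)(\lambda)=f(\lambda\alpha)$ for $\alpha\in G$, $f\in M_\Lambda(R)$. THE LEFT BIALGEBROID $A_\sigma$. Let $\Lambda X=(M_\Lambda(R)\otimes_{\mathbb{K}}M_\Lambda(R)^{op})\sqcup\{L_{ab}\}_{a,b\in X}\sqcup\{(L^{-1})_{ab}\}_{a,b\in X}$ and $\mathbb{K}\langle\Lambda X\rangle$ the free $\mathbb{K}$-algebra on it, with empty word $\emptyset$. $A_\sigma=\mathbb{K}\langle\Lambda X\rangle/I_\sigma$, $I_\sigma$ being the two-sided ideal generated by (write $1=1_{M_\Lambda(R)}$): (1) the elements identifying addition, scalar multiplication and multiplication of elements of $M_\Lambda(R)\otimes_{\mathbb{K}}M_\Lambda(R)^{op}$ in the free algebra with those in $M_\Lambda(R)\otimes_{\mathbb{K}}M_\Lambda(R)^{op}$; (2) $\sum_{c}L_{ac}(L^{-1})_{cb}-\delta_{a,b}\emptyset$, $\sum_{c}(L^{-1})_{ac}L_{cb}-\delta_{a,b}\emptyset$;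 (3) $(T_{\deg(a)}(f)\otimes1)L_{ab}-L_{ab}(f\otimes1)$, $(1\otimes T_{\deg(b)}(f))L_{ab}-L_{ab}(1\otimes f)$, $(f\otimes1)(L^{-1})_{ab}-(L^{-1})_{ab}(T_{\deg(b)}(f)\otimes1)$, $(1\otimes f)(L^{-1})_{ab}-(L^{-1})_{ab}(1\otimes T_{\deg(a)}(f))$; (4) $\sum_{x,y\in X}(\sigma^{xy}_{ac}\otimes1)L_{yd}L_{xb}-\sum_{x,y\in X}(1\otimes\sigma^{bd}_{xy})L_{cy}L_{ax}$; (5) $\emptyset-1\otimes1$; for all $a,b,c,d\in X$, $f\in M_\Lambda(R)$. It is a left bialgebroid over $M_\Lambda(R)$ with $s(f)=f\otimes1+I_\sigma$, $t(f)=1\otimes f+I_\sigma$; multiplicative comultiplication induced by $f\otimes g\mapsto s(f)\otimes t(g)$, $L_{ab}\mapsto\sum_cL_{ac}\otimes L_{cb}$, $(L^{-1})_{ab}\mapsto\sum_c(L^{-1})_{cb}\otimes(L^{-1})_{ac}$; and $\pi(a)=\chi(a)(1)$, where $\chi\colon A_\sigma\to\mathrm{End}_{\mathbb{K}}(M_\Lambda(R))$ is the algebra homomorphism with $\chi(f\otimes g)(h)=fhg$, $\chi(L_{ab})=\delta_{a,b}T_{\deg(a)}$, $\chi((L^{-1})_{ab})=\delta_{a,b}T_{\deg(a)^{-1}}$. RIGIDITY. $\sigma$ is rigid if for any $a,b\in X$ there exist $x_{ab},y_{ab}\in A_\sigma$ such that for all $a,b\in X$ (classes mod $I_\sigma$)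 $\sum_c(L^{-1})_{cb}x_{ac}=\sum_cx_{cb}(L^{-1})_{ac}=\sum_cL_{cb}y_{ac}=\sum_cy_{cb}L_{ac}=\delta_{a,b}1_{A_\sigma}$. THE LEFT BIALGEBROID $\mathfrak{A}(w_\sigma)$. Let $Q=\Lambda\times X$ with $\mathfrak{s}(\lambda,x)=\lambda$, $\mathfrak{t}(\lambda,x)=\lambda\deg(x)$; $Q^{(0)}=\Lambda$ (with $\mathfrak{s}=\mathfrak{t}=\mathrm{id}$), $Q^{(1)}=Q$, $Q^{(m)}=\{(q_1,\dots,q_m)\in Q^m\mid\mathfrak{t}(q_i)=\mathfrak{s}(q_{i+1})\}$ with $\mathfrak{s}(q)=\mathfrak{s}(q_1)$, $\mathfrak{t}(q)=\mathfrak{t}(q_m)$. Put $\mathbf{w}^{(\lambda,a),(\lambda',b)}_{(\mu,c),(\mu',d)}=\delta_{\lambda,\mu}\sigma^{ba}_{dc}(\lambda)$ for $((\lambda,a),(\lambda',b)),((\mu,c),(\mu',d))\in Q^{(2)}$. $\mathfrak{G}(Q)$ is the $\mathbb{K}$-algebra with basis $\mathbf{e}^{p}_{q}$ ($p,q\in Q^{(m)}$, $m\ge0$), product $\mathbf{e}^{p}_{q}\mathbf{e}^{p'}_{q'}=\delta_{\mathfrak{t}(p),\mathfrak{s}(p')}\delta_{\mathfrak{t}(q),\mathfrak{s}(q')}\mathbf{e}^{pp'}_{qq'}$ (concatenation, elements of $\Lambda$ being trivial paths), unit $\sum_{\lambda,\mu}\mathbf{e}^{\lambda}_{\mu}$.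 $\mathfrak{A}(w_\sigma)=\mathfrak{H}(Q)/\mathfrak{I}_{\mathbf{w}}$ with $\mathfrak{H}(Q)=R\otimes_{\mathbb{K}}R^{op}\otimes_{\mathbb{K}}\mathfrak{G}(Q)$ and $\mathfrak{I}_{\mathbf{w}}$ the two-sided ideal generated by $\sum_{(x,y)\in Q^{(2)}}\mathbf{w}^{x,y}_{a,b}\otimes1_R\otimes\mathbf{e}^{x}_{c}\mathbf{e}^{y}_{d}-\sum_{(x,y)\in Q^{(2)}}1_R\otimes\mathbf{w}^{c,d}_{x,y}\otimes\mathbf{e}^{a}_{x}\mathbf{e}^{b}_{y}$, $(a,b),(c,d)\in Q^{(2)}$. It is a left bialgebroid over $M_\Lambda(R)$ with (classes mod $\mathfrak{I}_{\mathbf{w}}$) $s(f)=\sum_{\lambda,\mu}f(\lambda)\otimes1_R\otimes\mathbf{e}^{\lambda}_{\mu}$, $t(f)=\sum_{\lambda,\mu}1_R\otimes f(\lambda)\otimes\mathbf{e}^{\mu}_{\lambda}$, comultiplication $r\otimes r'\otimes\mathbf{e}^{p}_{q}\mapsto\sum_{u\in Q^{(m)}}(r\otimes1_R\otimes\mathbf{e}^{p}_{u})\otimes(1_R\otimes r'\otimes\mathbf{e}^{u}_{q})$, and $\pi(r\otimes r'\otimes\mathbf{e}^{p}_{q})=\delta_{p,q}(rr')_M\delta_{\mathfrak{s}(q)}$. THE MAP $\Phi$. $\Phi\colon\mathfrak{A}(w_\sigma)\to A_\sigma$ is the $\mathbb{K}$-algebra homomorphism with $\Phi(r\otimes r'\otimes\mathbf{e}^{p}_{q}+\mathfrak{I}_{\mathbf{w}})=(r_M\otimes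 r'_M)(\delta_{\mathfrak{s}(p)}\otimes\delta_{\mathfrak{s}(q)})L_{x_1y_1}\cdots L_{x_my_m}+I_\sigma$ for $p=((\lambda_i,x_i))_{i=1}^m$, $q=((\mu_i,y_i))_{i=1}^m\in Q^{(m)}$ (for $m=0$ the product of $L$'s is empty). *)

theory Defs
  imports "HOL-Library.Poly_Mapping" "HOL-Algebra.QuotRing" "HOL-Algebra.Module"
begin

section \<open>Algebras over a field\<close>

text \<open>
  The ground field is a type \<open>'k\<close> of class \<open>field\<close>; algebras over it are \<open>HOL-Algebra\<close> structures
  of type \<open>('k, 'a) module\<close>. The zero algebra is allowed.
\<close>

definition scalars :: "('k::field, 'k) module" where
  "scalars = \<lparr>carrier = UNIV, mult = (*), one = 1, zero = 0, add = (+), smult = (*)\<rparr>"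

definition kalgebra :: "('k::field, 'a) module \<Rightarrow> bool" where
  "kalgebra A \<longleftrightarrow> ring A \<and> module scalars A \<and>
     (\<forall>c. \<forall>x\<in>carrier A. \<forall>y\<in>carrier A.
        (c \<odot>\<^bsub>A\<^esub> x) \<otimes>\<^bsub>A\<^esub> y = c \<odot>\<^bsub>A\<^esub> (x \<otimes>\<^bsub>A\<^esub> y) \<and>
        x \<otimes>\<^bsub>A\<^esub> (c \<odot>\<^bsub>A\<^esub> y) = c \<odot>\<^bsub>A\<^esub> (x \<otimes>\<^bsub>A\<^esub> y))"

definition lin_map :: "('k::field, 'v) module \<Rightarrow> ('k, 'w) module \<Rightarrow> ('v \<Rightarrow> 'w) set" where
  "lin_map V W = {h. h \<in> carrier V \<rightarrow> carrier W \<and>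
     (\<forall>x\<in>carrier V. \<forall>y\<in>carrier V. h (x \<oplus>\<^bsub>V\<^esub> y) = h x \<oplus>\<^bsub>W\<^esub> h y) \<and>
     (\<forall>c. \<forall>x\<in>carrier V. h (c \<odot>\<^bsub>V\<^esub> x) = c \<odot>\<^bsub>W\<^esub> h x)}"

definition alg_hom :: "('k::field, 'a) module \<Rightarrow> ('k, 'b) module \<Rightarrow> ('a \<Rightarrow> 'b) set" where
  "alg_hom A B = ring_hom A B \<inter> lin_map A B"

definition center :: "('k, 'a) module \<Rightarrow> 'a set" where
  "center A = {z \<in> carrier A. \<forall>x\<in>carrier A. z \<otimes>\<^bsub>A\<^esub> x = x \<otimes>\<^bsub>A\<^esub> z}"

definition opp :: "('k, 'a) module \<Rightarrow> ('k, 'a) module" where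
  "opp A = A\<lparr>mult := (\<lambda>x y. y \<otimes>\<^bsub>A\<^esub> x)\<rparr>"

definition end_alg :: "('k::field, 'v) module \<Rightarrow> ('k, 'v \<Rightarrow> 'v) module" where
  "end_alg V =
    \<lparr>carrier = lin_map V V \<inter> extensional (carrier V),
     mult = (\<lambda>g h. \<lambda>x\<in>carrier V. g (h x)), one = (\<lambda>x\<in>carrier V. x),
     zero = (\<lambda>x\<in>carrier V. \<zero>\<^bsub>V\<^esub>), add = (\<lambda>g h. \<lambda>x\<in>carrier V. g x \<oplus>\<^bsub>V\<^esub> h x),
     smult = (\<lambda>c g. \<lambda>x\<in>carrier V. c \<odot>\<^bsub>V\<^esub> g x)\<rparr>"

definition lin_hull :: "('k::field, 'v) module \<Rightarrow> 'v set \<Rightarrow> 'v set" where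
  "lin_hull V S = \<Inter>{U. submodule U scalars V \<and> S \<subseteq> U}"

definition quot_alg :: "('k, 'a) module \<Rightarrow> 'a set \<Rightarrow> ('k, 'a set) module" where
  "quot_alg A I =
    \<lparr>carrier = a_rcosets\<^bsub>A\<^esub> I, mult = rcoset_mult A I, one = I +>\<^bsub>A\<^esub> \<one>\<^bsub>A\<^esub>,
     zero = I, add = set_add A, smult = (\<lambda>c C. \<Union>x\<in>C. I +>\<^bsub>A\<^esub> (c \<odot>\<^bsub>A\<^esub> x))\<rparr>"

text \<open>The map induced by \<open>h\<close> on a quotient, for \<open>h\<close> constant on cosets.\<close>

definition induced :: "('a \<Rightarrow> 'b) \<Rightarrow> 'a set \<Rightarrow> 'b" where
  "induced h C = h (SOME x. x \<in> C)"


section \<open>Free modules, free algebras, tensor products\<close>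

definition pm_scale :: "'k::field \<Rightarrow> ('s \<Rightarrow>\<^sub>0 'k) \<Rightarrow> ('s \<Rightarrow>\<^sub>0 'k)" where
  "pm_scale c p = Poly_Mapping.map ((*) c) p"

definition lin_ext :: "('k::field, 'v) module \<Rightarrow> ('s \<Rightarrow> 'v) \<Rightarrow> ('s \<Rightarrow>\<^sub>0 'k) \<Rightarrow> 'v" where
  "lin_ext V \<phi> p = (\<Oplus>\<^bsub>V\<^esub>x\<in>Poly_Mapping.keys p. Poly_Mapping.lookup p x \<odot>\<^bsub>V\<^esub> \<phi> x)"

definition monoid_alg :: "('s, 'z) monoid_scheme \<Rightarrow> ('k::field, 's \<Rightarrow>\<^sub>0 'k) module" where
  "monoid_alg S =
    \<lparr>carrier = {p. Poly_Mapping.keys p \<subseteq> carrier S},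
     mult = (\<lambda>p q. \<Sum>x\<in>Poly_Mapping.keys p. \<Sum>y\<in>Poly_Mapping.keys q.
       Poly_Mapping.single (x \<otimes>\<^bsub>S\<^esub> y) (Poly_Mapping.lookup p x * Poly_Mapping.lookup q y)),
     one = Poly_Mapping.single \<one>\<^bsub>S\<^esub> 1, zero = 0, add = (+), smult = pm_scale\<rparr>"

definition free_alg :: "'s set \<Rightarrow> ('k::field, 's list \<Rightarrow>\<^sub>0 'k) module" where
  "free_alg S = monoid_alg \<lparr>carrier = lists S, mult = (@), one = []\<rparr>"

definition word :: "'s list \<Rightarrow> ('s list \<Rightarrow>\<^sub>0 'k::field)" where
  "word w = Poly_Mapping.single w 1"

definition word_prod :: "('k, 'a) module \<Rightarrow> ('s \<Rightarrow> 'a) \<Rightarrow> 's list \<Rightarrow> 'a" where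
  "word_prod A \<phi> w = foldr (\<lambda>s a. \<phi> s \<otimes>\<^bsub>A\<^esub> a) w \<one>\<^bsub>A\<^esub>"

definition alg_ext :: "('k::field, 'a) module \<Rightarrow> ('s \<Rightarrow> 'a) \<Rightarrow> ('s list \<Rightarrow>\<^sub>0 'k) \<Rightarrow> 'a" where
  "alg_ext A \<phi> = lin_ext A (word_prod A \<phi>)"

text \<open>
  The tensor product over the ground field is the free module on pairs modulo the bilinearity
  relations. The span of these relations is a two-sided ideal of the monoid algebra of
  \<open>A \<times>\<times> B\<close> (multiplicative monoids), so the quotient carries the usual algebra structure.
\<close>

type_synonym ('k, 'a, 'b) tens = "('a \<times> 'b \<Rightarrow>\<^sub>0 'k) set"

definition tensor_rels ::
    "('k::field, 'a) module \<Rightarrow> ('k, 'b) module \<Rightarrow> ('a \<times> 'b \<Rightarrow>\<^sub>0 'k) set" where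
  "tensor_rels A B =
     {Poly_Mapping.single (a \<oplus>\<^bsub>A\<^esub> a', b) 1 - Poly_Mapping.single (a, b) 1
        - Poly_Mapping.single (a', b) 1 | a a' b.
        a \<in> carrier A \<and> a' \<in> carrier A \<and> b \<in> carrier B}
   \<union> {Poly_Mapping.single (a, b \<oplus>\<^bsub>B\<^esub> b') 1 - Poly_Mapping.single (a, b) 1
        - Poly_Mapping.single (a, b') 1 | a b b'.
        a \<in> carrier A \<and> b \<in> carrier B \<and> b' \<in> carrier B}
   \<union> {Poly_Mapping.single (c \<odot>\<^bsub>A\<^esub> a, b) 1 - Poly_Mapping.single (a, b) c | c a b.
        a \<in> carrier A \<and> b \<in> carrier B}
   \<union> {Poly_Mapping.single (a, c \<odot>\<^bsub>B\<^esub> b) 1 - Poly_Mapping.single (a, b) c | c a b.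
        a \<in> carrier A \<and> b \<in> carrier B}"

definition tensor_null ::
    "('k::field, 'a) module \<Rightarrow> ('k, 'b) module \<Rightarrow> ('a \<times> 'b \<Rightarrow>\<^sub>0 'k) set" where
  "tensor_null A B = lin_hull (monoid_alg (A \<times>\<times> B)) (tensor_rels A B)"

definition tensor ::
    "('k::field, 'a) module \<Rightarrow> ('k, 'b) module \<Rightarrow> ('k, ('k, 'a, 'b) tens) module" where
  "tensor A B = quot_alg (monoid_alg (A \<times>\<times> B)) (tensor_null A B)"

definition tens ::
    "('k::field, 'a) module \<Rightarrow> ('k, 'b) module \<Rightarrow> 'a \<Rightarrow> 'b \<Rightarrow> ('k, 'a, 'b) tens" where
  "tens A B a b =
     tensor_null A B +>\<^bsub>monoid_alg (A \<times>\<times> B)\<^esub> Poly_Mapping.single (a, b) 1"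

text \<open>
  \<open>tlift V \<beta> t\<close> is the value at \<open>t\<close> of the linear map into \<open>V\<close> induced by the bilinear map \<open>\<beta>\<close>.
  In implicit-sum notation, for \<open>t = x \<otimes> y\<close>, this is \<open>\<beta> x y\<close>.
\<close>

definition tlift ::
    "('k::field, 'v) module \<Rightarrow> ('a \<Rightarrow> 'b \<Rightarrow> 'v) \<Rightarrow> ('k, 'a, 'b) tens \<Rightarrow> 'v" where
  "tlift V \<beta> = induced (lin_ext V (\<lambda>(x, y). \<beta> x y))"


section \<open>Weak bialgebras and antipodes of homomorphisms\<close>

text \<open>Iterated tensor powers associate to the right: the triple product is \<open>B \<otimes> (B \<otimes> B)\<close>.\<close>

definition coalgebra ::
    "('k::field, 'b) module \<Rightarrow> ('b \<Rightarrow> ('k, 'b, 'b) tens) \<Rightarrow> ('b \<Rightarrow> 'k) \<Rightarrow> bool" where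
  "coalgebra B \<Delta> \<epsilon> \<longleftrightarrow>
     \<Delta> \<in> lin_map B (tensor B B) \<and> \<epsilon> \<in> lin_map B scalars \<and>
     (\<forall>a\<in>carrier B.
        tlift (tensor B (tensor B B))
          (\<lambda>x y. tlift (tensor B (tensor B B))
             (\<lambda>u v. tens B (tensor B B) u (tens B B v y)) (\<Delta> x)) (\<Delta> a)
        = tlift (tensor B (tensor B B)) (\<lambda>x y. tens B (tensor B B) x (\<Delta> y)) (\<Delta> a)) \<and>
     (\<forall>a\<in>carrier B. tlift B (\<lambda>x y. \<epsilon> x \<odot>\<^bsub>B\<^esub> y) (\<Delta> a) = a \<and>
                     tlift B (\<lambda>x y. \<epsilon> y \<odot>\<^bsub>B\<^esub> x) (\<Delta> a) = a)"

definition weak_bialgebra ::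
    "('k::field, 'b) module \<Rightarrow> ('b \<Rightarrow> ('k, 'b, 'b) tens) \<Rightarrow> ('b \<Rightarrow> 'k) \<Rightarrow> bool" where
  "weak_bialgebra B \<Delta> \<epsilon> \<longleftrightarrow>
     kalgebra B \<and> coalgebra B \<Delta> \<epsilon> \<and>
     (\<forall>a\<in>carrier B. \<forall>b\<in>carrier B. \<Delta> (a \<otimes>\<^bsub>B\<^esub> b) = \<Delta> a \<otimes>\<^bsub>tensor B B\<^esub> \<Delta> b) \<and>
     (let T3 = tensor B (tensor B B);
          D1 = tlift T3 (\<lambda>x y. tens B (tensor B B) x (tens B B y \<one>\<^bsub>B\<^esub>)) (\<Delta> \<one>\<^bsub>B\<^esub>);
          D2 = tens B (tensor B B) \<one>\<^bsub>B\<^esub> (\<Delta> \<one>\<^bsub>B\<^esub>);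
          D = tlift T3 (\<lambda>x y. tens B (tensor B B) x (\<Delta> y)) (\<Delta> \<one>\<^bsub>B\<^esub>)
      in D1 \<otimes>\<^bsub>T3\<^esub> D2 = D \<and> D2 \<otimes>\<^bsub>T3\<^esub> D1 = D) \<and>
     (\<forall>a\<in>carrier B. \<forall>b\<in>carrier B. \<forall>c\<in>carrier B.
        tlift scalars (\<lambda>x y. \<epsilon> (a \<otimes>\<^bsub>B\<^esub> x) * \<epsilon> (y \<otimes>\<^bsub>B\<^esub> c)) (\<Delta> b)
          = \<epsilon> (a \<otimes>\<^bsub>B\<^esub> b \<otimes>\<^bsub>B\<^esub> c) \<and>
        tlift scalars (\<lambda>x y. \<epsilon> (a \<otimes>\<^bsub>B\<^esub> y) * \<epsilon> (x \<otimes>\<^bsub>B\<^esub> c)) (\<Delta> b)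
          = \<epsilon> (a \<otimes>\<^bsub>B\<^esub> b \<otimes>\<^bsub>B\<^esub> c))"

definition weak_bialgebra_hom ::
    "('k::field, 'b) module \<Rightarrow> ('b \<Rightarrow> ('k, 'b, 'b) tens) \<Rightarrow> ('b \<Rightarrow> 'k) \<Rightarrow>
     ('k, 'c) module \<Rightarrow> ('c \<Rightarrow> ('k, 'c, 'c) tens) \<Rightarrow> ('c \<Rightarrow> 'k) \<Rightarrow> ('b \<Rightarrow> 'c) set" where
  "weak_bialgebra_hom B \<Delta>B \<epsilon>B C \<Delta>C \<epsilon>C =
     {h \<in> alg_hom B C. \<forall>a\<in>carrier B.
        \<Delta>C (h a) = tlift (tensor C C) (\<lambda>x y. tens C C (h x) (h y)) (\<Delta>B a) \<and>
        \<epsilon>C (h a) = \<epsilon>B a}"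

definition eps_s ::
    "('k::field, 'b) module \<Rightarrow> ('b \<Rightarrow> ('k, 'b, 'b) tens) \<Rightarrow> ('b \<Rightarrow> 'k) \<Rightarrow> 'b \<Rightarrow> 'b" where
  "eps_s B \<Delta> \<epsilon> a = tlift B (\<lambda>x y. \<epsilon> (a \<otimes>\<^bsub>B\<^esub> y) \<odot>\<^bsub>B\<^esub> x) (\<Delta> \<one>\<^bsub>B\<^esub>)"

definition eps_t ::
    "('k::field, 'b) module \<Rightarrow> ('b \<Rightarrow> ('k, 'b, 'b) tens) \<Rightarrow> ('b \<Rightarrow> 'k) \<Rightarrow> 'b \<Rightarrow> 'b" where
  "eps_t B \<Delta> \<epsilon> a = tlift B (\<lambda>x y. \<epsilon> (x \<otimes>\<^bsub>B\<^esub> a) \<odot>\<^bsub>B\<^esub> y) (\<Delta> \<one>\<^bsub>B\<^esub>)"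

definition conv ::
    "('b \<Rightarrow> ('k::field, 'b, 'b) tens) \<Rightarrow> ('k, 'a) module \<Rightarrow> ('b \<Rightarrow> 'a) \<Rightarrow> ('b \<Rightarrow> 'a) \<Rightarrow> 'b \<Rightarrow> 'a" where
  "conv \<Delta> A f g a = tlift A (\<lambda>x y. f x \<otimes>\<^bsub>A\<^esub> g y) (\<Delta> a)"

definition antipode_of ::
    "('k::field, 'b) module \<Rightarrow> ('b \<Rightarrow> ('k, 'b, 'b) tens) \<Rightarrow> ('b \<Rightarrow> 'k) \<Rightarrow>
     ('k, 'a) module \<Rightarrow> ('b \<Rightarrow> 'a) \<Rightarrow> ('b \<Rightarrow> 'a) \<Rightarrow> bool" where
  "antipode_of H \<Delta> \<epsilon> A fp fm \<longleftrightarrow>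
     fm \<in> lin_map H A \<and>
     (\<forall>h\<in>carrier H.
        conv \<Delta> A fm fp h = fp (eps_s H \<Delta> \<epsilon> h) \<and>
        conv \<Delta> A fp fm h = fp (eps_t H \<Delta> \<epsilon> h) \<and>
        conv \<Delta> A (conv \<Delta> A fp fm) fp h = fp h \<and>
        conv \<Delta> A (conv \<Delta> A fm fp) fm h = fm h)"


section \<open>Idempotent Frobenius systems; from left bialgebroids to weak bialgebras\<close>

definition idempotent_frobenius_system ::
    "('k::field, 'r) module \<Rightarrow> ('r \<Rightarrow> 'k) \<Rightarrow> ('k, 'r, 'r) tens \<Rightarrow> bool" where
  "idempotent_frobenius_system L \<psi> e \<longleftrightarrow>
     \<psi> \<in> lin_map L scalars \<and> e \<in> carrier (tensor L L) \<and>
     (\<forall>l\<in>carrier L. tlift L (\<lambda>x y. \<psi> (l \<otimes>\<^bsub>L\<^esub> x) \<odot>\<^bsub>L\<^esub> y) e = l \<and>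
                     tlift L (\<lambda>x y. \<psi> (y \<otimes>\<^bsub>L\<^esub> l) \<odot>\<^bsub>L\<^esub> x) e = l) \<and>
     tlift L (\<lambda>x y. x \<otimes>\<^bsub>L\<^esub> y) e = \<one>\<^bsub>L\<^esub>"

text \<open>
  \<open>tensor_over A L s t\<close> is \<open>A \<otimes>\<^sub>L A\<close> for the bimodule structure \<open>l \<cdot> a = s(l) a\<close>, \<open>a \<cdot> l = t(l) a\<close>,
  as a quotient of \<open>tensor A A\<close>. The null space is only a right ideal, so the componentwise
  product is meaningful only on the Takeuchi subalgebra, the classes with
  \<open>x\<^sub>1 t(l) \<otimes> x\<^sub>2 = x\<^sub>1 \<otimes> x\<^sub>2 s(l)\<close>; the comultiplication of a left bialgebroid takes its values there.
\<close>

definition tensor_over_null ::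
    "('k::field, 'a) module \<Rightarrow> ('k, 'l) module \<Rightarrow> ('l \<Rightarrow> 'a) \<Rightarrow> ('l \<Rightarrow> 'a) \<Rightarrow>
     ('k, 'a, 'a) tens set" where
  "tensor_over_null A L s t = lin_hull (tensor A A)
     {tens A A (t l \<otimes>\<^bsub>A\<^esub> a) b \<ominus>\<^bsub>tensor A A\<^esub> tens A A a (s l \<otimes>\<^bsub>A\<^esub> b) | l a b.
        l \<in> carrier L \<and> a \<in> carrier A \<and> b \<in> carrier A}"

definition tensor_over ::
    "('k::field, 'a) module \<Rightarrow> ('k, 'l) module \<Rightarrow> ('l \<Rightarrow> 'a) \<Rightarrow> ('l \<Rightarrow> 'a) \<Rightarrow>
     ('k, ('k, 'a, 'a) tens set) module" where
  "tensor_over A L s t = quot_alg (tensor A A) (tensor_over_null A L s t)"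

definition tens_over ::
    "('k::field, 'a) module \<Rightarrow> ('k, 'l) module \<Rightarrow> ('l \<Rightarrow> 'a) \<Rightarrow> ('l \<Rightarrow> 'a) \<Rightarrow>
     'a \<Rightarrow> 'a \<Rightarrow> ('k, 'a, 'a) tens set" where
  "tens_over A L s t a b = tensor_over_null A L s t +>\<^bsub>tensor A A\<^esub> tens A A a b"

definition wb_comult ::
    "('k::field, 'a) module \<Rightarrow> ('l \<Rightarrow> 'a) \<Rightarrow> ('l \<Rightarrow> 'a) \<Rightarrow> ('k, 'l, 'l) tens \<Rightarrow>
     ('a \<Rightarrow> ('k, 'a, 'a) tens set) \<Rightarrow> 'a \<Rightarrow> ('k, 'a, 'a) tens" where
  "wb_comult A s t e D a =
     induced (\<lambda>X. tlift (tensor A A) (\<lambda>e1 e2. tlift (tensor A A)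
       (\<lambda>a1 a2. tens A A (t e1 \<otimes>\<^bsub>A\<^esub> a1) (s e2 \<otimes>\<^bsub>A\<^esub> a2)) X) e) (D a)"

definition wb_counit :: "('l \<Rightarrow> 'k) \<Rightarrow> ('a \<Rightarrow> 'l) \<Rightarrow> 'a \<Rightarrow> 'k" where
  "wb_counit \<psi> \<pi> a = \<psi> (\<pi> a)"


section \<open>The base algebra of functions\<close>

definition fun_alg :: "('k, 'r) module \<Rightarrow> ('k, 'l \<Rightarrow> 'r) module" where
  "fun_alg R =
    \<lparr>carrier = {f. \<forall>l. f l \<in> carrier R},
     mult = (\<lambda>f g l. f l \<otimes>\<^bsub>R\<^esub> g l), one = (\<lambda>l. \<one>\<^bsub>R\<^esub>), zero = (\<lambda>l. \<zero>\<^bsub>R\<^esub>),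
     add = (\<lambda>f g l. f l \<oplus>\<^bsub>R\<^esub> g l), smult = (\<lambda>c f l. c \<odot>\<^bsub>R\<^esub> f l)\<rparr>"

definition cst :: "'r \<Rightarrow> 'l \<Rightarrow> 'r" where
  "cst r = (\<lambda>_. r)"

definition delta :: "('k, 'r) module \<Rightarrow> 'l \<Rightarrow> 'l \<Rightarrow> 'r" where
  "delta R l = (\<lambda>m. if l = m then \<one>\<^bsub>R\<^esub> else \<zero>\<^bsub>R\<^esub>)"

definition frob_form :: "('r \<Rightarrow> 'k::field) \<Rightarrow> ('l::finite \<Rightarrow> 'r) \<Rightarrow> 'k" where
  "frob_form \<psi> f = (\<Sum>l\<in>UNIV. \<psi> (f l))"

definition frob_elt ::
    "('k::field, 'r) module \<Rightarrow> ('k, 'r, 'r) tens \<Rightarrow> ('k, 'l::finite \<Rightarrow> 'r, 'l \<Rightarrow> 'r) tens" where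
  "frob_elt R e =
     (\<Oplus>\<^bsub>tensor (fun_alg R) (fun_alg R)\<^esub>l\<in>UNIV. tlift (tensor (fun_alg R) (fun_alg R))
        (\<lambda>x y. tens (fun_alg R) (fun_alg R)
           (cst x \<otimes>\<^bsub>fun_alg R\<^esub> delta R l) (cst y \<otimes>\<^bsub>fun_alg R\<^esub> delta R l)) e)"

text \<open>
  The group acting on \<open>'l\<close> from the right is the opposite of the symmetric group: its elements are
  the bijections of \<open>'l\<close>, and \<open>l \<triangleleft> \<alpha> \<triangleleft> \<beta>\<close> is \<open>\<beta> (\<alpha> l)\<close>. Its inverses are inverse functions.
\<close>

abbreviation (input) ract :: "'l \<Rightarrow> ('l \<Rightarrow> 'l) \<Rightarrow> 'l" (infixl "\<triangleleft>" 75) where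
  "l \<triangleleft> \<alpha> \<equiv> \<alpha> l"

definition shift :: "('l \<Rightarrow> 'l) \<Rightarrow> ('l \<Rightarrow> 'r) \<Rightarrow> 'l \<Rightarrow> 'r" where
  "shift \<alpha> f = (\<lambda>l. f (l \<triangleleft> \<alpha>))"


section \<open>The left bialgebroid \<open>A\<^sub>\<sigma>\<close>\<close>

text \<open>
  Index convention: \<open>\<sigma>\<close> with upper indices \<open>a, b\<close> and lower indices \<open>c, d\<close> is \<open>\<sigma> a b c d\<close>.
  Generators are words in the letters, so that multiplication is concatenation; \<open>bt R f g\<close> is
  \<open>f \<otimes> g\<close> in \<open>M \<otimes> M\<^sup>o\<^sup>p\<close>. Comultiplication, \<open>\<chi>\<close> and \<open>\<Phi>\<close> are evaluated on an
  arbitrary representative of a class.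
\<close>

datatype ('u, 'x) letter = Scal 'u | L 'x 'x | Linv 'x 'x

type_synonym ('k, 'r, 'l) base_env = "('k, 'l \<Rightarrow> 'r, 'l \<Rightarrow> 'r) tens"
type_synonym ('k, 'r, 'l, 'x) lett = "(('k, 'r, 'l) base_env, 'x) letter"
type_synonym ('k, 'r, 'l, 'x) asig = "(('k, 'r, 'l, 'x) lett list \<Rightarrow>\<^sub>0 'k) set"

definition base_env ::
    "('k::field, 'r) module \<Rightarrow> ('k, ('k, 'r, 'l::finite) base_env) module" where
  "base_env R = tensor (fun_alg R) (opp (fun_alg R))"

definition bt ::
    "('k::field, 'r) module \<Rightarrow> ('l::finite \<Rightarrow> 'r) \<Rightarrow> ('l \<Rightarrow> 'r) \<Rightarrow> ('k, 'r, 'l) base_env" where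
  "bt R = tens (fun_alg R) (opp (fun_alg R))"

definition letters ::
    "('k::field, 'r) module \<Rightarrow> 'x set \<Rightarrow> ('k, 'r, 'l::finite, 'x) lett set" where
  "letters R X = Scal ` carrier (base_env R)
     \<union> {L a b | a b. a \<in> X \<and> b \<in> X} \<union> {Linv a b | a b. a \<in> X \<and> b \<in> X}"

definition asig_rels ::
    "('k::field, 'r) module \<Rightarrow> 'x set \<Rightarrow> ('x \<Rightarrow> 'l::finite \<Rightarrow> 'l) \<Rightarrow>
     ('x \<Rightarrow> 'x \<Rightarrow> 'x \<Rightarrow> 'x \<Rightarrow> 'l \<Rightarrow> 'r) \<Rightarrow> (('k, 'r, 'l, 'x) lett list \<Rightarrow>\<^sub>0 'k) set" where
  "asig_rels R X deg \<sigma> =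
     {word [Scal u] + word [Scal v] - word [Scal (u \<oplus>\<^bsub>base_env R\<^esub> v)] | u v.
        u \<in> carrier (base_env R) \<and> v \<in> carrier (base_env R)}
   \<union> {pm_scale c (word [Scal u]) - word [Scal (c \<odot>\<^bsub>base_env R\<^esub> u)] | c u.
        u \<in> carrier (base_env R)}
   \<union> {word [Scal u, Scal v] - word [Scal (u \<otimes>\<^bsub>base_env R\<^esub> v)] | u v.
        u \<in> carrier (base_env R) \<and> v \<in> carrier (base_env R)}
   \<union> {(\<Sum>c\<in>X. word [L a c, Linv c b]) - (if a = b then word [] else 0) | a b. a \<in> X \<and> b \<in> X}
   \<union> {(\<Sum>c\<in>X. word [Linv a c, L c b]) - (if a = b then word [] else 0) | a b. a \<in> X \<and> b \<in> X}
   \<union> {word [Scal (bt R (shift (deg a) f) \<one>\<^bsub>fun_alg R\<^esub>), L a b]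
        - word [L a b, Scal (bt R f \<one>\<^bsub>fun_alg R\<^esub>)] | a b f.
        a \<in> X \<and> b \<in> X \<and> f \<in> carrier (fun_alg R)}
   \<union> {word [Scal (bt R \<one>\<^bsub>fun_alg R\<^esub> (shift (deg b) f)), L a b]
        - word [L a b, Scal (bt R \<one>\<^bsub>fun_alg R\<^esub> f)] | a b f.
        a \<in> X \<and> b \<in> X \<and> f \<in> carrier (fun_alg R)}
   \<union> {word [Scal (bt R f \<one>\<^bsub>fun_alg R\<^esub>), Linv a b]
        - word [Linv a b, Scal (bt R (shift (deg b) f) \<one>\<^bsub>fun_alg R\<^esub>)] | a b f.
        a \<in> X \<and> b \<in> X \<and> f \<in> carrier (fun_alg R)}
   \<union> {word [Scal (bt R \<one>\<^bsub>fun_alg R\<^esub> f), Linv a b]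
        - word [Linv a b, Scal (bt R \<one>\<^bsub>fun_alg R\<^esub> (shift (deg a) f))] | a b f.
        a \<in> X \<and> b \<in> X \<and> f \<in> carrier (fun_alg R)}
   \<union> {(\<Sum>x\<in>X. \<Sum>y\<in>X. word [Scal (bt R (\<sigma> x y a c) \<one>\<^bsub>fun_alg R\<^esub>), L y d, L x b])
        - (\<Sum>x\<in>X. \<Sum>y\<in>X. word [Scal (bt R \<one>\<^bsub>fun_alg R\<^esub> (\<sigma> b d x y)), L c y, L a x])
        | a b c d. a \<in> X \<and> b \<in> X \<and> c \<in> X \<and> d \<in> X}
   \<union> {word [] - word [Scal (bt R \<one>\<^bsub>fun_alg R\<^esub> \<one>\<^bsub>fun_alg R\<^esub>)]}"

definition asig_ideal ::
    "('k::field, 'r) module \<Rightarrow> 'x set \<Rightarrow> ('x \<Rightarrow> 'l::finite \<Rightarrow> 'l) \<Rightarrow>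
     ('x \<Rightarrow> 'x \<Rightarrow> 'x \<Rightarrow> 'x \<Rightarrow> 'l \<Rightarrow> 'r) \<Rightarrow> (('k, 'r, 'l, 'x) lett list \<Rightarrow>\<^sub>0 'k) set" where
  "asig_ideal R X deg \<sigma> = genideal (free_alg (letters R X)) (asig_rels R X deg \<sigma>)"

definition Asig ::
    "('k::field, 'r) module \<Rightarrow> 'x set \<Rightarrow> ('x \<Rightarrow> 'l::finite \<Rightarrow> 'l) \<Rightarrow>
     ('x \<Rightarrow> 'x \<Rightarrow> 'x \<Rightarrow> 'x \<Rightarrow> 'l \<Rightarrow> 'r) \<Rightarrow> ('k, ('k, 'r, 'l, 'x) asig) module" where
  "Asig R X deg \<sigma> = quot_alg (free_alg (letters R X)) (asig_ideal R X deg \<sigma>)"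

definition aword ::
    "('k::field, 'r) module \<Rightarrow> 'x set \<Rightarrow> ('x \<Rightarrow> 'l::finite \<Rightarrow> 'l) \<Rightarrow>
     ('x \<Rightarrow> 'x \<Rightarrow> 'x \<Rightarrow> 'x \<Rightarrow> 'l \<Rightarrow> 'r) \<Rightarrow> ('k, 'r, 'l, 'x) lett list \<Rightarrow> ('k, 'r, 'l, 'x) asig" where
  "aword R X deg \<sigma> w = asig_ideal R X deg \<sigma> +>\<^bsub>free_alg (letters R X)\<^esub> word w"

definition asig_s ::
    "('k::field, 'r) module \<Rightarrow> 'x set \<Rightarrow> ('x \<Rightarrow> 'l::finite \<Rightarrow> 'l) \<Rightarrow>
     ('x \<Rightarrow> 'x \<Rightarrow> 'x \<Rightarrow> 'x \<Rightarrow> 'l \<Rightarrow> 'r) \<Rightarrow> ('l \<Rightarrow> 'r) \<Rightarrow> ('k, 'r, 'l, 'x) asig" where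
  "asig_s R X deg \<sigma> f = aword R X deg \<sigma> [Scal (bt R f \<one>\<^bsub>fun_alg R\<^esub>)]"

definition asig_t ::
    "('k::field, 'r) module \<Rightarrow> 'x set \<Rightarrow> ('x \<Rightarrow> 'l::finite \<Rightarrow> 'l) \<Rightarrow>
     ('x \<Rightarrow> 'x \<Rightarrow> 'x \<Rightarrow> 'x \<Rightarrow> 'l \<Rightarrow> 'r) \<Rightarrow> ('l \<Rightarrow> 'r) \<Rightarrow> ('k, 'r, 'l, 'x) asig" where
  "asig_t R X deg \<sigma> f = aword R X deg \<sigma> [Scal (bt R \<one>\<^bsub>fun_alg R\<^esub> f)]"

definition asig_comultL ::
    "('k::field, 'r) module \<Rightarrow> 'x set \<Rightarrow> ('x \<Rightarrow> 'l::finite \<Rightarrow> 'l) \<Rightarrow>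
     ('x \<Rightarrow> 'x \<Rightarrow> 'x \<Rightarrow> 'x \<Rightarrow> 'l \<Rightarrow> 'r) \<Rightarrow>
     ('k, 'r, 'l, 'x) asig \<Rightarrow> ('k, ('k, 'r, 'l, 'x) asig, ('k, 'r, 'l, 'x) asig) tens set" where
  "asig_comultL R X deg \<sigma> =
     (let s = asig_s R X deg \<sigma>; t = asig_t R X deg \<sigma>; A = Asig R X deg \<sigma>;
          T = tensor_over A (fun_alg R) s t; tt = tens_over A (fun_alg R) s t;
          w = aword R X deg \<sigma>
      in induced (alg_ext T (\<lambda>z. case z of
             Scal u \<Rightarrow> tlift T (\<lambda>f g. tt (s f) (t g)) u
           | L a b \<Rightarrow> (\<Oplus>\<^bsub>T\<^esub>c\<in>X. tt (w [L a c]) (w [L c b]))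
           | Linv a b \<Rightarrow> (\<Oplus>\<^bsub>T\<^esub>c\<in>X. tt (w [Linv c b]) (w [Linv a c])))))"

definition asig_chi ::
    "('k::field, 'r) module \<Rightarrow> ('x \<Rightarrow> 'l::finite \<Rightarrow> 'l) \<Rightarrow>
     ('k, 'r, 'l, 'x) asig \<Rightarrow> ('l \<Rightarrow> 'r) \<Rightarrow> ('l \<Rightarrow> 'r)" where
  "asig_chi R deg =
     (let M = fun_alg R; E = end_alg M
      in induced (alg_ext E (\<lambda>z. case z of
             Scal u \<Rightarrow> tlift E (\<lambda>f g. \<lambda>h\<in>carrier M. f \<otimes>\<^bsub>M\<^esub> h \<otimes>\<^bsub>M\<^esub> g) u
           | L a b \<Rightarrow> (if a = b then (\<lambda>h\<in>carrier M. shift (deg a) h) else \<zero>\<^bsub>E\<^esub>)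
           | Linv a b \<Rightarrow> (if a = b then (\<lambda>h\<in>carrier M. shift (inv_into UNIV (deg a)) h)
                          else \<zero>\<^bsub>E\<^esub>))))"

definition asig_pi ::
    "('k::field, 'r) module \<Rightarrow> ('x \<Rightarrow> 'l::finite \<Rightarrow> 'l) \<Rightarrow> ('k, 'r, 'l, 'x) asig \<Rightarrow> ('l \<Rightarrow> 'r)" where
  "asig_pi R deg a = asig_chi R deg a \<one>\<^bsub>fun_alg R\<^esub>"

definition asig_comult ::
    "('k::field, 'r) module \<Rightarrow> ('k, 'r, 'r) tens \<Rightarrow> 'x set \<Rightarrow> ('x \<Rightarrow> 'l::finite \<Rightarrow> 'l) \<Rightarrow>
     ('x \<Rightarrow> 'x \<Rightarrow> 'x \<Rightarrow> 'x \<Rightarrow> 'l \<Rightarrow> 'r) \<Rightarrow>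
     ('k, 'r, 'l, 'x) asig \<Rightarrow> ('k, ('k, 'r, 'l, 'x) asig, ('k, 'r, 'l, 'x) asig) tens" where
  "asig_comult R e X deg \<sigma> =
     wb_comult (Asig R X deg \<sigma>) (asig_s R X deg \<sigma>) (asig_t R X deg \<sigma>) (frob_elt R e)
       (asig_comultL R X deg \<sigma>)"

definition asig_counit ::
    "('k::field, 'r) module \<Rightarrow> ('r \<Rightarrow> 'k) \<Rightarrow> ('x \<Rightarrow> 'l::finite \<Rightarrow> 'l) \<Rightarrow>
     ('k, 'r, 'l, 'x) asig \<Rightarrow> 'k" where
  "asig_counit R \<psi> deg = wb_counit (frob_form \<psi>) (asig_pi R deg)"

definition rigid ::
    "('k::field, 'r) module \<Rightarrow> 'x set \<Rightarrow> ('x \<Rightarrow> 'l::finite \<Rightarrow> 'l) \<Rightarrow>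
     ('x \<Rightarrow> 'x \<Rightarrow> 'x \<Rightarrow> 'x \<Rightarrow> 'l \<Rightarrow> 'r) \<Rightarrow> bool" where
  "rigid R X deg \<sigma> \<longleftrightarrow>
     (let A = Asig R X deg \<sigma>; w = aword R X deg \<sigma>
      in \<exists>x y. (\<forall>a\<in>X. \<forall>b\<in>X. x a b \<in> carrier A \<and> y a b \<in> carrier A) \<and>
           (\<forall>a\<in>X. \<forall>b\<in>X.
              let d = (if a = b then \<one>\<^bsub>A\<^esub> else \<zero>\<^bsub>A\<^esub>)
              in (\<Oplus>\<^bsub>A\<^esub>c\<in>X. w [Linv c b] \<otimes>\<^bsub>A\<^esub> x a c) = d \<and>
                 (\<Oplus>\<^bsub>A\<^esub>c\<in>X. x c b \<otimes>\<^bsub>A\<^esub> w [Linv a c]) = d \<and>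
                 (\<Oplus>\<^bsub>A\<^esub>c\<in>X. w [L c b] \<otimes>\<^bsub>A\<^esub> y a c) = d \<and>
                 (\<Oplus>\<^bsub>A\<^esub>c\<in>X. y c b \<otimes>\<^bsub>A\<^esub> w [L a c]) = d))"


section \<open>The left bialgebroid \<open>\<AA>(w\<^sub>\<sigma>)\<close>\<close>

text \<open>
  An arrow \<open>(l, x)\<close> runs from \<open>l\<close> to \<open>l \<triangleleft> deg x\<close>. A path is stored as its source together with its
  list of arrows, so that \<open>(l, [])\<close> is the trivial path at \<open>l\<close>; for a non-empty list the
  source is redundant.
\<close>

type_synonym ('l, 'x) path = "'l \<times> ('l \<times> 'x) list"
type_synonym ('k, 'l, 'x) path_pairs = "('l, 'x) path \<times> ('l, 'x) path \<Rightarrow>\<^sub>0 'k"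

definition atgt :: "('x \<Rightarrow> 'l \<Rightarrow> 'l) \<Rightarrow> 'l \<times> 'x \<Rightarrow> 'l" where
  "atgt deg q = fst q \<triangleleft> deg (snd q)"

definition paths :: "'x set \<Rightarrow> ('x \<Rightarrow> 'l \<Rightarrow> 'l) \<Rightarrow> nat \<Rightarrow> ('l, 'x) path set" where
  "paths X deg n = {(l, qs). length qs = n \<and> set qs \<subseteq> UNIV \<times> X \<and>
     (\<forall>i. Suc i < n \<longrightarrow> atgt deg (qs ! i) = fst (qs ! Suc i)) \<and>
     (qs \<noteq> [] \<longrightarrow> l = fst (hd qs))}"

definition psrc :: "('l, 'x) path \<Rightarrow> 'l" where
  "psrc p = fst p"

definition ptgt :: "('x \<Rightarrow> 'l \<Rightarrow> 'l) \<Rightarrow> ('l, 'x) path \<Rightarrow> 'l" where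
  "ptgt deg p = (if snd p = [] then fst p else atgt deg (last (snd p)))"

definition pconc :: "('l, 'x) path \<Rightarrow> ('l, 'x) path \<Rightarrow> ('l, 'x) path" where
  "pconc p p' = (fst p, snd p @ snd p')"

definition arr :: "'l \<times> 'x \<Rightarrow> ('l, 'x) path" where
  "arr q = (fst q, [q])"

definition ebas :: "('l, 'x) path \<Rightarrow> ('l, 'x) path \<Rightarrow> ('k::field, 'l, 'x) path_pairs" where
  "ebas p q = Poly_Mapping.single (p, q) 1"

definition path_alg ::
    "'x set \<Rightarrow> ('x \<Rightarrow> 'l::finite \<Rightarrow> 'l) \<Rightarrow> ('k::field, ('k, 'l, 'x) path_pairs) module" where
  "path_alg X deg =
    \<lparr>carrier = {g. Poly_Mapping.keys g \<subseteq> (\<Union>n. paths X deg n \<times> paths X deg n)},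
     mult = (\<lambda>g h. \<Sum>(p, q)\<in>Poly_Mapping.keys g. \<Sum>(p', q')\<in>Poly_Mapping.keys h.
       if ptgt deg p = psrc p' \<and> ptgt deg q = psrc q'
       then Poly_Mapping.single (pconc p p', pconc q q')
              (Poly_Mapping.lookup g (p, q) * Poly_Mapping.lookup h (p', q'))
       else 0),
     one = (\<Sum>l\<in>UNIV. \<Sum>m\<in>UNIV. ebas (l, []) (m, [])),
     zero = 0, add = (+), smult = pm_scale\<rparr>"

type_synonym ('k, 'r, 'l, 'x) hq = "('k, 'r, ('k, 'r, ('k, 'l, 'x) path_pairs) tens) tens"
type_synonym ('k, 'r, 'l, 'x) aw = "('k, 'r, 'l, 'x) hq set"

definition hq_alg ::
    "('k::field, 'r) module \<Rightarrow> 'x set \<Rightarrow> ('x \<Rightarrow> 'l::finite \<Rightarrow> 'l) \<Rightarrow>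
     ('k, ('k, 'r, 'l, 'x) hq) module" where
  "hq_alg R X deg = tensor R (tensor (opp R) (path_alg X deg))"

definition hq3 ::
    "('k::field, 'r) module \<Rightarrow> 'x set \<Rightarrow> ('x \<Rightarrow> 'l::finite \<Rightarrow> 'l) \<Rightarrow>
     'r \<Rightarrow> 'r \<Rightarrow> ('k, 'l, 'x) path_pairs \<Rightarrow> ('k, 'r, 'l, 'x) hq" where
  "hq3 R X deg r r' g =
     tens R (tensor (opp R) (path_alg X deg)) r (tens (opp R) (path_alg X deg) r' g)"

text \<open>The linear map on \<open>R \<otimes> R\<^sup>o\<^sup>p \<otimes> \<GG>(Q)\<close> with prescribed values at \<open>r \<otimes> r' \<otimes> e p q\<close>.\<close>

definition hq_lift ::
    "('k::field, 'v) module \<Rightarrow> ('r \<Rightarrow> 'r \<Rightarrow> ('l, 'x) path \<Rightarrow> ('l, 'x) path \<Rightarrow> 'v) \<Rightarrow>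
     ('k, 'r, 'l, 'x) hq \<Rightarrow> 'v" where
  "hq_lift V \<tau> = tlift V (\<lambda>r. tlift V (\<lambda>r'. lin_ext V (\<lambda>(p, q). \<tau> r r' p q)))"

text \<open>\<open>wsig R \<sigma> x y a b\<close> has upper indices \<open>x, y\<close> and lower indices \<open>a, b\<close>.\<close>

definition wsig ::
    "('k, 'r) module \<Rightarrow> ('x \<Rightarrow> 'x \<Rightarrow> 'x \<Rightarrow> 'x \<Rightarrow> 'l \<Rightarrow> 'r) \<Rightarrow>
     'l \<times> 'x \<Rightarrow> 'l \<times> 'x \<Rightarrow> 'l \<times> 'x \<Rightarrow> 'l \<times> 'x \<Rightarrow> 'r" where
  "wsig R \<sigma> x y a b =
     (if fst x = fst a then \<sigma> (snd y) (snd x) (snd b) (snd a) (fst x) else \<zero>\<^bsub>R\<^esub>)"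

definition arrow_pairs :: "'x set \<Rightarrow> ('x \<Rightarrow> 'l \<Rightarrow> 'l) \<Rightarrow> (('l \<times> 'x) \<times> ('l \<times> 'x)) set" where
  "arrow_pairs X deg = {(x, y). x \<in> UNIV \<times> X \<and> y \<in> UNIV \<times> X \<and> atgt deg x = fst y}"

definition aw_rels ::
    "('k::field, 'r) module \<Rightarrow> 'x set \<Rightarrow> ('x \<Rightarrow> 'l::finite \<Rightarrow> 'l) \<Rightarrow>
     ('x \<Rightarrow> 'x \<Rightarrow> 'x \<Rightarrow> 'x \<Rightarrow> 'l \<Rightarrow> 'r) \<Rightarrow> ('k, 'r, 'l, 'x) hq set" where
  "aw_rels R X deg \<sigma> =
     (let H = hq_alg R X deg; G = path_alg X deg in
      {(\<Oplus>\<^bsub>H\<^esub>z\<in>arrow_pairs X deg. case z of (x, y) \<Rightarrow>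
           hq3 R X deg (wsig R \<sigma> x y a b) \<one>\<^bsub>R\<^esub> (ebas (arr x) (arr c) \<otimes>\<^bsub>G\<^esub> ebas (arr y) (arr d)))
       \<ominus>\<^bsub>H\<^esub>
       (\<Oplus>\<^bsub>H\<^esub>z\<in>arrow_pairs X deg. case z of (x, y) \<Rightarrow>
           hq3 R X deg \<one>\<^bsub>R\<^esub> (wsig R \<sigma> c d x y) (ebas (arr a) (arr x) \<otimes>\<^bsub>G\<^esub> ebas (arr b) (arr y)))
       | a b c d. (a, b) \<in> arrow_pairs X deg \<and> (c, d) \<in> arrow_pairs X deg})"

definition aw_ideal ::
    "('k::field, 'r) module \<Rightarrow> 'x set \<Rightarrow> ('x \<Rightarrow> 'l::finite \<Rightarrow> 'l) \<Rightarrow>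
     ('x \<Rightarrow> 'x \<Rightarrow> 'x \<Rightarrow> 'x \<Rightarrow> 'l \<Rightarrow> 'r) \<Rightarrow> ('k, 'r, 'l, 'x) hq set" where
  "aw_ideal R X deg \<sigma> = genideal (hq_alg R X deg) (aw_rels R X deg \<sigma>)"

definition Aw ::
    "('k::field, 'r) module \<Rightarrow> 'x set \<Rightarrow> ('x \<Rightarrow> 'l::finite \<Rightarrow> 'l) \<Rightarrow>
     ('x \<Rightarrow> 'x \<Rightarrow> 'x \<Rightarrow> 'x \<Rightarrow> 'l \<Rightarrow> 'r) \<Rightarrow> ('k, ('k, 'r, 'l, 'x) aw) module" where
  "Aw R X deg \<sigma> = quot_alg (hq_alg R X deg) (aw_ideal R X deg \<sigma>)"

definition aw3 ::
    "('k::field, 'r) module \<Rightarrow> 'x set \<Rightarrow> ('x \<Rightarrow> 'l::finite \<Rightarrow> 'l) \<Rightarrow>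
     ('x \<Rightarrow> 'x \<Rightarrow> 'x \<Rightarrow> 'x \<Rightarrow> 'l \<Rightarrow> 'r) \<Rightarrow>
     'r \<Rightarrow> 'r \<Rightarrow> ('k, 'l, 'x) path_pairs \<Rightarrow> ('k, 'r, 'l, 'x) aw" where
  "aw3 R X deg \<sigma> r r' g = aw_ideal R X deg \<sigma> +>\<^bsub>hq_alg R X deg\<^esub> hq3 R X deg r r' g"

definition aw_s ::
    "('k::field, 'r) module \<Rightarrow> 'x set \<Rightarrow> ('x \<Rightarrow> 'l::finite \<Rightarrow> 'l) \<Rightarrow>
     ('x \<Rightarrow> 'x \<Rightarrow> 'x \<Rightarrow> 'x \<Rightarrow> 'l \<Rightarrow> 'r) \<Rightarrow> ('l \<Rightarrow> 'r) \<Rightarrow> ('k, 'r, 'l, 'x) aw" where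
  "aw_s R X deg \<sigma> f = (\<Oplus>\<^bsub>Aw R X deg \<sigma>\<^esub>z\<in>UNIV. case z of (l, m) \<Rightarrow>
     aw3 R X deg \<sigma> (f l) \<one>\<^bsub>R\<^esub> (ebas (l, []) (m, [])))"

definition aw_t ::
    "('k::field, 'r) module \<Rightarrow> 'x set \<Rightarrow> ('x \<Rightarrow> 'l::finite \<Rightarrow> 'l) \<Rightarrow>
     ('x \<Rightarrow> 'x \<Rightarrow> 'x \<Rightarrow> 'x \<Rightarrow> 'l \<Rightarrow> 'r) \<Rightarrow> ('l \<Rightarrow> 'r) \<Rightarrow> ('k, 'r, 'l, 'x) aw" where
  "aw_t R X deg \<sigma> f = (\<Oplus>\<^bsub>Aw R X deg \<sigma>\<^esub>z\<in>UNIV. case z of (l, m) \<Rightarrow>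
     aw3 R X deg \<sigma> \<one>\<^bsub>R\<^esub> (f l) (ebas (m, []) (l, [])))"

definition aw_comultL ::
    "('k::field, 'r) module \<Rightarrow> 'x set \<Rightarrow> ('x \<Rightarrow> 'l::finite \<Rightarrow> 'l) \<Rightarrow>
     ('x \<Rightarrow> 'x \<Rightarrow> 'x \<Rightarrow> 'x \<Rightarrow> 'l \<Rightarrow> 'r) \<Rightarrow>
     ('k, 'r, 'l, 'x) aw \<Rightarrow> ('k, ('k, 'r, 'l, 'x) aw, ('k, 'r, 'l, 'x) aw) tens set" where
  "aw_comultL R X deg \<sigma> =
     (let s = aw_s R X deg \<sigma>; t = aw_t R X deg \<sigma>; A = Aw R X deg \<sigma>;
          T = tensor_over A (fun_alg R) s t; tt = tens_over A (fun_alg R) s t;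
          v = aw3 R X deg \<sigma>
      in induced (hq_lift T (\<lambda>r r' p q.
           \<Oplus>\<^bsub>T\<^esub>u\<in>paths X deg (length (snd p)).
             tt (v r \<one>\<^bsub>R\<^esub> (ebas p u)) (v \<one>\<^bsub>R\<^esub> r' (ebas u q)))))"

definition aw_pi ::
    "('k::field, 'r) module \<Rightarrow> ('k, 'r, 'l::finite, 'x) aw \<Rightarrow> ('l \<Rightarrow> 'r)" where
  "aw_pi R = induced (hq_lift (fun_alg R) (\<lambda>r r' p q.
     if p = q then cst (r \<otimes>\<^bsub>R\<^esub> r') \<otimes>\<^bsub>fun_alg R\<^esub> delta R (psrc q) else \<zero>\<^bsub>fun_alg R\<^esub>))"

definition aw_comult ::
    "('k::field, 'r) module \<Rightarrow> ('k, 'r, 'r) tens \<Rightarrow> 'x set \<Rightarrow> ('x \<Rightarrow> 'l::finite \<Rightarrow> 'l) \<Rightarrow>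
     ('x \<Rightarrow> 'x \<Rightarrow> 'x \<Rightarrow> 'x \<Rightarrow> 'l \<Rightarrow> 'r) \<Rightarrow>
     ('k, 'r, 'l, 'x) aw \<Rightarrow> ('k, ('k, 'r, 'l, 'x) aw, ('k, 'r, 'l, 'x) aw) tens" where
  "aw_comult R e X deg \<sigma> =
     wb_comult (Aw R X deg \<sigma>) (aw_s R X deg \<sigma>) (aw_t R X deg \<sigma>) (frob_elt R e)
       (aw_comultL R X deg \<sigma>)"

definition aw_counit ::
    "('k::field, 'r) module \<Rightarrow> ('r \<Rightarrow> 'k) \<Rightarrow> ('k, 'r, 'l::finite, 'x) aw \<Rightarrow> 'k" where
  "aw_counit R \<psi> = wb_counit (frob_form \<psi>) (aw_pi R)"


section \<open>The homomorphism \<open>\<Phi>\<close>\<close>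

definition Phi ::
    "('k::field, 'r) module \<Rightarrow> 'x set \<Rightarrow> ('x \<Rightarrow> 'l::finite \<Rightarrow> 'l) \<Rightarrow>
     ('x \<Rightarrow> 'x \<Rightarrow> 'x \<Rightarrow> 'x \<Rightarrow> 'l \<Rightarrow> 'r) \<Rightarrow>
     ('k, 'r, 'l, 'x) aw \<Rightarrow> ('k, 'r, 'l, 'x) asig" where
  "Phi R X deg \<sigma> = induced (hq_lift (Asig R X deg \<sigma>) (\<lambda>r r' p q.
     aword R X deg \<sigma>
       (Scal (bt R (cst r) (cst r') \<otimes>\<^bsub>base_env R\<^esub> bt R (delta R (psrc p)) (delta R (psrc q)))
        # map2 (\<lambda>x y. L (snd x) (snd y)) (snd p) (snd q))))"

end

theory Submission
  imports Defs
begin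

text \<open>
  Write \<open>M\<close> for the algebra of functions, \<open>S\<close>, \<open>T\<close> for the images of source and target and \<open>l\<^sub>a\<^sub>b\<close> for the
  image of \<open>L\<^sub>a\<^sub>b\<close>. In \<open>\<AA>(w\<^sub>\<sigma>)\<close> the sums of \<open>1 \<otimes> 1 \<otimes> e\<close> over all arrows with given labels form a
  matrix \<open>L\<close>; together with source and target it generates the algebra and satisfies the relations of
  \<open>A\<^sub>\<sigma>\<close> that do not involve \<open>L\<^sup>-\<^sup>1\<close> (locale \<open>quad\<close>). Conversely, elements of an algebra satisfying these
  relations define a homomorphism on \<open>\<AA>(w\<^sub>\<sigma>)\<close>: a path is sent to the product of the entries named by
  its labels, cut down by the idempotents of its two sources (\<open>theta\<close>). So \<open>A\<^sub>\<sigma>\<close> arises from \<open>\<AA>(w\<^sub>\<sigma>)\<close>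
  by adjoining an inverse of the matrix \<open>L\<close> with the right commutation rules.

  An antipode \<open>f\<^sup>-\<close> supplies such an inverse in \<open>A\<close>, namely \<open>k\<^sub>a\<^sub>b = f\<^sup>-(L\<^sub>a\<^sub>b)\<close>. Written on elements
  \<open>s(f) t(g) L\<^sub>a\<^sub>b\<close>, the antipode axioms are matrix identities with an idempotent Frobenius element
  inserted between the factors (\<open>quad_antipode\<close>). Expanding \<open>f\<^sup>-\<close> by \<open>f\<^sup>- \<star> f\<^sup>+ \<star> f\<^sup>- = f\<^sup>-\<close> and
  bracketing the product in the two possible ways moves \<open>S\<close> and \<open>T\<close> past \<open>k\<close> (\<open>S_km\<close>, \<open>km_T\<close>); the
  Frobenius elements then contract to \<open>1\<close>, and \<open>k\<close> is inverse to \<open>l\<close> (\<open>km_el\<close>, \<open>el_km\<close>). This gives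
  \<open>F\<close>. It is unique because \<open>F \<circ> \<Phi> = f\<^sup>+\<close> prescribes \<open>F\<close> on source, target and \<open>L\<close>, and an inverse matrix
  is determined by the matrix (\<open>inverse_matrix_unique\<close>).

  For the last assertion it suffices to compare on words in the generators. The comultiplications
  agree on source, target and \<open>L\<close> because they do so in \<open>\<AA>(w\<^sub>\<sigma>)\<close>. On \<open>L\<^sup>-\<^sup>1\<close> both sides are inverse to
  the same matrix \<open>\<Delta>(l)\<close> over the corner cut out by \<open>\<Delta>(1)\<close> (\<open>Delta_k\<close>). For the counits,
  \<open>\<epsilon>(x F(z) S(h)) = \<epsilon>(x S(\<chi>(z)(h)))\<close> for every generator \<open>z\<close> and every \<open>x\<close> (\<open>eps_letter\<close>), which
  lets \<open>\<chi>\<close> absorb a word letter by letter.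
\<close>

text \<open>Single-letter indices of algebraic structures may be written as plain subscripts.\<close>

abbreviation (input) "single == Poly_Mapping.single"
abbreviation (input) "keys == Poly_Mapping.keys"
abbreviation (input) "lookup == Poly_Mapping.lookup"

syntax (input) "_index" :: "logic => index" ("\<^sub>_" [1000] 1000)

section \<open>Vector spaces and algebras in locale form\<close>

lemma scalars_simps [simp]:
  "carrier scalars = UNIV" "a \<otimes>\<^bsub>scalars\<^esub> b = a * b" "\<one>\<^bsub>scalars\<^esub> = 1"
  "\<zero>\<^bsub>scalars\<^esub> = 0" "a \<oplus>\<^bsub>scalars\<^esub> b = a + b" "a \<odot>\<^bsub>scalars\<^esub> b = a * b"
  by (simp_all add: scalars_def)

locale kspace = abelian_group V for V :: "('k::field, 'v) module" (structure) +
  assumes smult_closed [simp, intro]: "x \<in> carrier V ==> c \<odot> x \<in> carrier V"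
    and smult_add_left: "x \<in> carrier V ==> (c + d) \<odot> x = c \<odot> x \<oplus> d \<odot> x"
    and smult_add_right:
      "[|x \<in> carrier V; y \<in> carrier V|] ==> c \<odot> (x \<oplus> y) = c \<odot> x \<oplus> c \<odot> y"
    and smult_smult: "x \<in> carrier V ==> (c * d) \<odot> x = c \<odot> (d \<odot> x)"
    and smult_one [simp]: "x \<in> carrier V ==> 1 \<odot> x = x"

locale kalg = kspace A + ring A for A :: "('k::field, 'a) module" (structure) +
  assumes smult_mult_left:
      "[|x \<in> carrier A; y \<in> carrier A|] ==> (c \<odot> x) \<otimes> y = c \<odot> (x \<otimes> y)"
    and smult_mult_right:
      "[|x \<in> carrier A; y \<in> carrier A|] ==> x \<otimes> (c \<odot> y) = c \<odot> (x \<otimes> y)"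

lemma cring_scalars: "cring (scalars :: ('k::field, 'k) module)"
proof (rule cringI)
  show "abelian_group (scalars :: ('k, 'k) module)"
  proof (rule abelian_groupI)
    fix x :: 'k
    show "\<exists>y\<in>carrier scalars. y \<oplus>\<^bsub>scalars\<^esub> x = \<zero>\<^bsub>scalars\<^esub>"
      by (rule bexI[of _ "- x"]) auto
  qed (auto simp: algebra_simps)
  show "comm_monoid (scalars :: ('k, 'k) module)"
    by (rule comm_monoidI) (auto simp: algebra_simps)
qed (auto simp: algebra_simps)

lemma kspace_iff: "module scalars V \<longleftrightarrow> kspace V"
proof
  assume "module scalars V"
  then interpret m: module scalars V .
  show "kspace V"
  proof unfold_locales
    fix x y c d assume "x \<in> carrier V"
    then show "c \<odot>\<^sub>V x \<in> carrier V" "(c + d) \<odot>\<^sub>V x = c \<odot>\<^sub>V x \<oplus>\<^sub>V d \<odot>\<^sub>V x"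
      "(c * d) \<odot>\<^sub>V x = c \<odot>\<^sub>V (d \<odot>\<^sub>V x)" "1 \<odot>\<^sub>V x = x"
      using m.smult_closed[of c x] m.smult_l_distr[of c d x] m.smult_assoc1[of c d x]
        m.smult_one[of x] by auto
    assume "y \<in> carrier V"
    with \<open>x \<in> carrier V\<close> show "c \<odot>\<^sub>V (x \<oplus>\<^sub>V y) = c \<odot>\<^sub>V x \<oplus>\<^sub>V c \<odot>\<^sub>V y"
      using m.smult_r_distr[of c x y] by auto
  qed
next
  assume "kspace V"
  then interpret kspace V .
  show "module scalars V"
    by (rule moduleI)
      (auto simp: cring_scalars abelian_group_axioms smult_add_left smult_add_right smult_smult)
qed

lemma kalgebra_iff: "kalgebra A \<longleftrightarrow> kalg A"
  unfolding kalgebra_def kspace_iff kalg_def kalg_axioms_def by blast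

lemma kspace_scalars: "kspace scalars"
  unfolding kspace_iff[symmetric]
  by (rule moduleI)
    (auto simp: cring_scalars algebra_simps intro: cring.axioms ring.is_abelian_group cring_scalars)

context kspace
begin

lemmas ks = kspace_axioms

lemma smult_zero_left [simp]:
  assumes x: "x \<in> carrier V" shows "0 \<odot> x = \<zero>"
proof -
  have "0 \<odot> x = 0 \<odot> x \<oplus> 0 \<odot> x"
    using smult_add_left[OF x, of 0 0] by simp
  then show ?thesis using x by (metis add.r_cancel_one' smult_closed)
qed

lemma smult_zero_right [simp]: "c \<odot> \<zero> = \<zero>"
proof -
  have "c \<odot> \<zero> = c \<odot> \<zero> \<oplus> c \<odot> \<zero>"
    using smult_add_right[of \<zero> \<zero> c] by simp
  then show ?thesis by (metis add.r_cancel_one' smult_closed zero_closed)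
qed

lemma smult_minus_one: "x \<in> carrier V ==> (- 1) \<odot> x = \<ominus> x"
  using smult_add_left[of x "-1" 1]
  by (metis smult_one smult_zero_left add.left_inverse minus_equality smult_closed)

lemma finsum_smult:
  assumes "finite S" "f \<in> S \<rightarrow> carrier V"
  shows "c \<odot> (\<Oplus>i\<in>S. f i) = (\<Oplus>i\<in>S. c \<odot> f i)"
  using assms
proof (induction S rule: finite_induct)
  case (insert a S)
  then have "f \<in> S \<rightarrow> carrier V" "f a \<in> carrier V" "(\<lambda>i. c \<odot> f i) \<in> S \<rightarrow> carrier V" by auto
  then show ?case using insert by (simp add: smult_add_right)
qed auto

end

context abelian_monoid
begin

lemma finsum_eqI:
  "[|\<And>i. i \<in> S ==> f i = g i; \<And>i. i \<in> S ==> g i \<in> carrier G|] ==> finsum G f S = finsum G g S"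
  by (rule finsum_cong') auto

lemma finsum_swap:
  assumes "finite S" "finite T" "\<And>i j. [|i \<in> S; j \<in> T|] ==> f i j \<in> carrier G"
  shows "(\<Oplus>i\<in>S. \<Oplus>j\<in>T. f i j) = (\<Oplus>j\<in>T. \<Oplus>i\<in>S. f i j)"
  using assms(1,3)
proof (induction S rule: finite_induct)
  case empty
  then show ?case by (simp add: finsum_zero)
next
  case (insert a S)
  have "(\<Oplus>i\<in>insert a S. \<Oplus>j\<in>T. f i j) = (\<Oplus>j\<in>T. f a j) \<oplus> (\<Oplus>i\<in>S. \<Oplus>j\<in>T. f i j)"
    using insert by (intro finsum_insert) (auto intro!: finsum_closed)
  also have "\<dots> = (\<Oplus>j\<in>T. f a j) \<oplus> (\<Oplus>j\<in>T. \<Oplus>i\<in>S. f i j)"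
    using insert by auto
  also have "\<dots> = (\<Oplus>j\<in>T. f a j \<oplus> (\<Oplus>i\<in>S. f i j))"
    using insert by (intro finsum_addf[symmetric]) (auto intro!: finsum_closed)
  also have "\<dots> = (\<Oplus>j\<in>T. \<Oplus>i\<in>insert a S. f i j)"
    using insert by (intro finsum_eqI finsum_insert[symmetric]) (auto intro!: finsum_closed)
  finally show ?case .
qed

lemma finsum_Times:
  assumes "finite S" "finite T" "\<And>i j. [|i \<in> S; j \<in> T|] ==> f i j \<in> carrier G"
  shows "(\<Oplus>i\<in>S. \<Oplus>j\<in>T. f i j) = (\<Oplus>p\<in>S \<times> T. case p of (i, j) => f i j)"
  using assms(1,3)
proof (induction S rule: finite_induct)
  case empty
  then show ?case by (simp add: finsum_zero)
next
  case (insert a S)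
  have "(\<Oplus>p\<in>insert a S \<times> T. case p of (i, j) => f i j)
      = (\<Oplus>p\<in>Pair a ` T \<union> S \<times> T. case p of (i, j) => f i j)"
    by (rule arg_cong[where f = "finsum G _"]) auto
  also have "\<dots> = (\<Oplus>p\<in>Pair a ` T. case p of (i, j) => f i j)
      \<oplus> (\<Oplus>p\<in>S \<times> T. case p of (i, j) => f i j)"
    using insert assms(2) by (intro finsum_Un_disjoint) (auto intro: finite_cartesian_product)
  also have "(\<Oplus>p\<in>Pair a ` T. case p of (i, j) => f i j) = (\<Oplus>j\<in>T. f a j)"
    using insert by (subst finsum_reindex) (auto simp: inj_on_def)
  also have "(\<Oplus>p\<in>S \<times> T. case p of (i, j) => f i j) = (\<Oplus>i\<in>S. \<Oplus>j\<in>T. f i j)"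
    using insert by auto
  finally show ?case
    using insert by (subst finsum_insert) (auto intro!: finsum_closed)
qed

lemma finsum_delta:
  assumes "finite S" "\<And>i. i \<in> S ==> f i \<in> carrier G"
  shows "(\<Oplus>i\<in>S. if i = a then f i else \<zero>) = (if a \<in> S then f a else \<zero>)"
proof (cases "a \<in> S")
  case True
  have "(\<Oplus>i\<in>S. if i = a then f i else \<zero>) = (\<Oplus>i\<in>S. if a = i then f i else \<zero>)"
    by (rule finsum_eqI) (auto simp: assms)
  then show ?thesis using finsum_singleton[of a S f] True assms by auto
next
  case False
  then have "(\<Oplus>i\<in>S. if i = a then f i else \<zero>) = (\<Oplus>i\<in>S. \<zero>)"
    by (intro finsum_eqI) auto
  then show ?thesis using False by (simp add: finsum_zero)
qed

lemma finsum_delta':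
  assumes "finite S" "\<And>i. i \<in> S ==> f i \<in> carrier G"
  shows "(\<Oplus>i\<in>S. if a = i then f i else \<zero>) = (if a \<in> S then f a else \<zero>)"
  using finsum_delta[of S f a] assms by (simp add: eq_commute)

lemma finsum_restrict:
  assumes "finite T" "S \<subseteq> T" "\<And>i. i \<in> T ==> f i \<in> carrier G" "\<And>i. i \<in> T - S ==> f i = \<zero>"
  shows "finsum G f T = finsum G f S"
  using assms by (intro add.finprod_mono_neutral_cong_right) auto

end

subsection \<open>Linear maps\<close>

lemma lin_mapI:
  assumes "\<And>x. x \<in> carrier V ==> h x \<in> carrier W"
    and "\<And>x y. [|x \<in> carrier V; y \<in> carrier V|] ==> h (x \<oplus>\<^sub>V y) = h x \<oplus>\<^sub>W h y"
    and "\<And>c x. x \<in> carrier V ==> h (c \<odot>\<^sub>V x) = c \<odot>\<^sub>W h x"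
  shows "h \<in> lin_map V W"
  using assms unfolding lin_map_def by auto

lemma
  assumes "h \<in> lin_map V W"
  shows lin_map_closed: "x \<in> carrier V ==> h x \<in> carrier W"
    and lin_map_add: "[|x \<in> carrier V; y \<in> carrier V|] ==> h (x \<oplus>\<^sub>V y) = h x \<oplus>\<^sub>W h y"
    and lin_map_smult: "x \<in> carrier V ==> h (c \<odot>\<^sub>V x) = c \<odot>\<^sub>W h x"
  using assms unfolding lin_map_def by auto

lemma lin_map_zero:
  assumes "kspace V" "kspace W" "h \<in> lin_map V W"
  shows "h \<zero>\<^sub>V = \<zero>\<^sub>W"
proof -
  interpret V: kspace V by fact
  interpret W: kspace W by fact
  have "h (0 \<odot>\<^sub>V \<zero>\<^sub>V) = 0 \<odot>\<^sub>W h \<zero>\<^sub>V"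
    by (rule lin_map_smult[OF assms(3)]) simp
  then show ?thesis using lin_map_closed[OF assms(3), of "\<zero>\<^sub>V"] by simp
qed

lemma lin_map_uminus:
  assumes "kspace V" "kspace W" "h \<in> lin_map V W" "x \<in> carrier V"
  shows "h (\<ominus>\<^sub>V x) = \<ominus>\<^sub>W h x"
proof -
  interpret V: kspace V by fact
  interpret W: kspace W by fact
  show ?thesis
    using lin_map_smult[OF assms(3,4), of "-1"] assms
    by (simp add: V.smult_minus_one W.smult_minus_one lin_map_closed[OF assms(3)])
qed

lemma lin_map_minus:
  assumes "kspace V" "kspace W" "h \<in> lin_map V W" "x \<in> carrier V" "y \<in> carrier V"
  shows "h (x \<ominus>\<^sub>V y) = h x \<ominus>\<^sub>W h y"
proof -
  interpret V: kspace V by fact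
  show ?thesis
    using assms by (simp add: a_minus_def lin_map_add[OF assms(3)] lin_map_uminus[OF assms(1-3)])
qed

lemma lin_map_finsum:
  assumes "kspace V" "kspace W" "h \<in> lin_map V W" "\<And>i. i \<in> S ==> f i \<in> carrier V"
  shows "h (\<Oplus>\<^sub>V i\<in>S. f i) = (\<Oplus>\<^sub>W i\<in>S. h (f i))"
proof (cases "finite S")
  case False
  interpret V: kspace V by fact
  interpret W: kspace W by fact
  show ?thesis using False lin_map_zero[OF assms(1-3)] by simp
next
  case True
  interpret V: kspace V by fact
  interpret W: kspace W by fact
  note h = lin_map_closed[OF assms(3)]
  show ?thesis using True assms(4)
  proof (induction S rule: finite_induct)
    case (insert a S)
    then have "f \<in> S \<rightarrow> carrier V" "(\<lambda>i. h (f i)) \<in> S \<rightarrow> carrier W" by (auto intro: h)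
    with insert show ?case by (simp add: lin_map_add[OF assms(3)] h)
  qed (use lin_map_zero[OF assms(1-3)] in simp)
qed

lemma lin_map_comp:
  "[|f \<in> lin_map U V; g \<in> lin_map V W|] ==> (\<lambda>x. g (f x)) \<in> lin_map U W"
  by (rule lin_mapI) (auto simp: lin_map_add lin_map_smult lin_map_closed)

lemma lin_map_sum:
  assumes "kspace W" "finite S" "\<And>i. i \<in> S ==> f i \<in> lin_map V W"
  shows "(\<lambda>x. \<Oplus>\<^sub>W i\<in>S. f i x) \<in> lin_map V W"
proof -
  interpret W: kspace W by fact
  note cl = lin_map_closed[OF assms(3)]
  show ?thesis
  proof (rule lin_mapI)
    fix x assume x: "x \<in> carrier V"
    then show "(\<Oplus>\<^sub>W i\<in>S. f i x) \<in> carrier W" by (auto intro!: W.finsum_closed cl)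
    fix c show "(\<Oplus>\<^sub>W i\<in>S. f i (c \<odot>\<^sub>V x)) = c \<odot>\<^sub>W (\<Oplus>\<^sub>W i\<in>S. f i x)"
      using x assms(2)
      by (subst W.finsum_smult)
        (auto intro!: W.finsum_eqI cl simp: lin_map_smult[OF assms(3)])
    fix y assume y: "y \<in> carrier V"
    show "(\<Oplus>\<^sub>W i\<in>S. f i (x \<oplus>\<^sub>V y)) = (\<Oplus>\<^sub>W i\<in>S. f i x) \<oplus>\<^sub>W (\<Oplus>\<^sub>W i\<in>S. f i y)"
      using x y
      by (subst W.finsum_addf[symmetric])
        (auto intro!: W.finsum_eqI cl simp: lin_map_add[OF assms(3)])
  qed
qed

lemma (in kalg) mult_left_lin: "a \<in> carrier A ==> (\<lambda>x. a \<otimes> x) \<in> lin_map A A"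
  by (rule lin_mapI) (auto simp: r_distr smult_mult_right)

lemma (in kalg) mult_right_lin: "a \<in> carrier A ==> (\<lambda>x. x \<otimes> a) \<in> lin_map A A"
  by (rule lin_mapI) (auto simp: l_distr smult_mult_left)

lemma
  assumes "h \<in> alg_hom A B"
  shows alg_hom_lin: "h \<in> lin_map A B"
    and alg_hom_closed: "x \<in> carrier A ==> h x \<in> carrier B"
    and alg_hom_mult: "[|x \<in> carrier A; y \<in> carrier A|] ==> h (x \<otimes>\<^sub>A y) = h x \<otimes>\<^sub>B h y"
    and alg_hom_one: "h \<one>\<^sub>A = \<one>\<^sub>B"
  using assms unfolding alg_hom_def ring_hom_def lin_map_def by auto

lemma alg_homI:
  assumes "h \<in> lin_map A B"
    and "\<And>x y. [|x \<in> carrier A; y \<in> carrier A|] ==> h (x \<otimes>\<^sub>A y) = h x \<otimes>\<^sub>B h y"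
    and "h \<one>\<^sub>A = \<one>\<^sub>B"
  shows "h \<in> alg_hom A B"
  using assms unfolding alg_hom_def ring_hom_def lin_map_def by auto

subsection \<open>Subspaces, linear hulls and ideals\<close>

lemma subspaceI:
  assumes "kspace V" "U \<subseteq> carrier V" "\<zero>\<^sub>V \<in> U"
    and "\<And>x y. [|x \<in> U; y \<in> U|] ==> x \<oplus>\<^sub>V y \<in> U"
    and "\<And>c x. x \<in> U ==> c \<odot>\<^sub>V x \<in> U"
  shows "submodule U scalars V"
proof -
  interpret V: kspace V by fact
  interpret m: module scalars V using assms(1) by (simp add: kspace_iff)
  show ?thesis
  proof (rule m.submoduleI)
    fix x assume "x \<in> U"
    then show "\<ominus>\<^sub>V x \<in> U" using assms(5)[of x "-1"] assms(2) by (auto simp: V.smult_minus_one)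
  qed (use assms in auto)
qed

lemma
  assumes "submodule U scalars V" "kspace V"
  shows subspace_subset: "U \<subseteq> carrier V"
    and subspace_zero: "\<zero>\<^sub>V \<in> U"
    and subspace_add: "[|x \<in> U; y \<in> U|] ==> x \<oplus>\<^sub>V y \<in> U"
    and subspace_smult: "x \<in> U ==> c \<odot>\<^sub>V x \<in> U"
    and subspace_uminus: "x \<in> U ==> \<ominus>\<^sub>V x \<in> U"
    and subspace_minus: "[|x \<in> U; y \<in> U|] ==> x \<ominus>\<^sub>V y \<in> U"
    and subspace_abelian: "abelian_subgroup U V"
proof -
  interpret V: kspace V by fact
  interpret m: module scalars V using assms(2) by (simp add: kspace_iff)
  note E = m.submoduleE[OF assms(1)]
  show sub: "U \<subseteq> carrier V" using E(1) .
  obtain z where z: "z \<in> U" using E(2) by auto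
  have "0 \<odot>\<^sub>V z \<in> U" using z by (intro E(4)) auto
  then show "\<zero>\<^sub>V \<in> U" using z sub by auto
  show "x \<oplus>\<^sub>V y \<in> U" if "x \<in> U" "y \<in> U" for x y using E(5) that .
  show "c \<odot>\<^sub>V x \<in> U" if "x \<in> U" for c x using E(4)[of c x] that by auto
  show "\<ominus>\<^sub>V x \<in> U" if "x \<in> U" for x using E(3) that .
  then show "x \<ominus>\<^sub>V y \<in> U" if "x \<in> U" "y \<in> U" for x y
    using that E(5) by (auto simp: a_minus_def)
  show "abelian_subgroup U V"
    using assms(1) V.abelian_group_axioms
    by (intro abelian_subgroupI3 additive_subgroup.intro) (auto dest: submodule.axioms)
qed

lemma
  assumes "kspace V" "S \<subseteq> carrier V"
  shows lin_hull_subspace: "submodule (lin_hull V S) scalars V"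
    and lin_hull_superset: "S \<subseteq> lin_hull V S"
proof -
  interpret V: kspace V by fact
  have c: "submodule (carrier V) scalars V" by (rule subspaceI) (auto simp: assms)
  show "S \<subseteq> lin_hull V S" unfolding lin_hull_def by auto
  show "submodule (lin_hull V S) scalars V"
  proof (rule subspaceI[OF assms(1)])
    show "lin_hull V S \<subseteq> carrier V" unfolding lin_hull_def using c assms(2) by auto
  qed (auto simp: lin_hull_def intro: subspace_zero subspace_add subspace_smult assms(1))
qed

lemma lin_hull_minimal: "[|submodule U scalars V; S \<subseteq> U|] ==> lin_hull V S \<subseteq> U"
  unfolding lin_hull_def by auto

lemma preimage_subspace:
  assumes "kspace V" "kspace W" "h \<in> lin_map V W" "submodule U scalars W"
  shows "submodule {x \<in> carrier V. h x \<in> U} scalars V"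
proof -
  interpret V: kspace V by fact
  show ?thesis
    using subspace_zero[OF assms(4,2)] subspace_add[OF assms(4,2)] subspace_smult[OF assms(4,2)]
    by (intro subspaceI[OF assms(1)])
      (auto simp: lin_map_zero[OF assms(1-3)] lin_map_add[OF assms(3)] lin_map_smult[OF assms(3)])
qed

lemma lin_hull_image:
  assumes "kspace V" "kspace W" "h \<in> lin_map V W" "submodule U scalars W"
    and "S \<subseteq> carrier V" "\<And>x. x \<in> S ==> h x \<in> U" "x \<in> lin_hull V S"
  shows "h x \<in> U"
  using lin_hull_minimal[OF preimage_subspace[OF assms(1-4)], of S] assms(5-7) by auto

lemma zero_subspace: "kspace W ==> submodule {\<zero>\<^sub>W} scalars W"
proof -
  assume W: "kspace W"
  then interpret W: kspace W .
  show ?thesis by (rule subspaceI[OF W]) auto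
qed

lemma lin_hull_kill:
  assumes "kspace V" "kspace W" "h \<in> lin_map V W"
    and "S \<subseteq> carrier V" "\<And>x. x \<in> S ==> h x = \<zero>\<^sub>W" "x \<in> lin_hull V S"
  shows "h x = \<zero>\<^sub>W"
  using lin_hull_image[OF assms(1-3) zero_subspace[OF assms(2)] assms(4) _ assms(6)] assms(5) by auto

lemma ideal_subspace:
  assumes "kalg A" "ideal I A" shows "submodule I scalars A"
proof -
  interpret A: kalg A by fact
  interpret I: ideal I A by fact
  show ?thesis
  proof (rule subspaceI)
    fix c x assume x: "x \<in> I"
    then have "c \<odot>\<^sub>A x = (c \<odot>\<^sub>A \<one>\<^sub>A) \<otimes>\<^sub>A x" using I.a_subset by (auto simp: A.smult_mult_left)
    then show "c \<odot>\<^sub>A x \<in> I" using x by (auto intro: I.I_l_closed)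
  qed (use I.a_subset in \<open>auto intro: A.ks\<close>)
qed

lemma genideal_ideal: "[|kalg A; S \<subseteq> carrier A|] ==> ideal (genideal A S) A"
  by (intro ring.genideal_ideal kalg.axioms) auto

text \<open>The kernel of a multiplicative linear map is an ideal, whether or not the map is unital.\<close>

lemma genideal_kill:
  assumes "kalg A" "kalg B" "h \<in> lin_map A B"
    and "\<And>x y. [|x \<in> carrier A; y \<in> carrier A|] ==> h (x \<otimes>\<^sub>A y) = h x \<otimes>\<^sub>B h y"
    and "S \<subseteq> carrier A" "\<And>x. x \<in> S ==> h x = \<zero>\<^sub>B" "x \<in> genideal A S"
  shows "h x = \<zero>\<^sub>B"
proof -
  interpret A: kalg A by fact
  interpret B: kalg B by fact
  note h = lin_map_closed[OF assms(3)] lin_map_add[OF assms(3)]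
    lin_map_uminus[OF A.ks B.ks assms(3)]
    lin_map_zero[OF A.ks B.ks assms(3)]
  have "ideal {x \<in> carrier A. h x = \<zero>\<^sub>B} A"
  proof (rule idealI)
    show "subgroup {x \<in> carrier A. h x = \<zero>\<^sub>B} (add_monoid A)"
      by (rule A.add.subgroupI) (use h in \<open>auto simp flip: a_inv_def\<close>)
  qed (use h assms(4) in \<open>auto intro: A.ring_axioms\<close>)
  then have "genideal A S \<subseteq> {x \<in> carrier A. h x = \<zero>\<^sub>B}"
    using assms(5,6) by (intro A.genideal_minimal) auto
  then show ?thesis using assms(7) by auto
qed

section \<open>Algebras on finitely supported functions\<close>

text \<open>
  Monoid algebras, free algebras and the path algebra all have a basis whose products are
  again combinations of basis elements; \<open>m x y\<close> is the product of the basis elements \<open>x\<close>, \<open>y\<close>.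
\<close>

definition pm_alg ::
    "'s set => ('s => 's => ('s \<Rightarrow>\<^sub>0 'k)) => ('s \<Rightarrow>\<^sub>0 'k) => ('k::field, 's \<Rightarrow>\<^sub>0 'k) module" where
  "pm_alg S m u =
    \<lparr>carrier = {p. keys p \<subseteq> S},
     mult = (\<lambda>p q. \<Sum>x\<in>keys p. \<Sum>y\<in>keys q.
       pm_scale (lookup p x * lookup q y) (m x y)),
     one = u, zero = 0, add = (+), smult = pm_scale\<rparr>"

lemma pm_alg_simps [simp]:
  "carrier (pm_alg S m u) = {p. keys p \<subseteq> S}" "\<one>\<^bsub>pm_alg S m u\<^esub> = u"
  "\<zero>\<^bsub>pm_alg S m u\<^esub> = 0" "p \<oplus>\<^bsub>pm_alg S m u\<^esub> q = p + q" "c \<odot>\<^bsub>pm_alg S m u\<^esub> p = pm_scale c p"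
  by (simp_all add: pm_alg_def)

lemma lookup_pm_scale [simp]: "lookup (pm_scale c p) x = c * lookup p x"
  unfolding pm_scale_def by (transfer) (auto simp: when_def)

lemma pm_scale_simps [simp]:
  "pm_scale c (single x d) = single x (c * d)"
  "pm_scale c 0 = 0" "pm_scale 0 p = 0" "pm_scale 1 p = p"
  "pm_scale c (pm_scale d p) = pm_scale (c * d) p"
  by (rule poly_mapping_eqI; simp add: lookup_single when_def)+

lemma pm_scale_add: "pm_scale c (p + q) = pm_scale c p + pm_scale c q"
  by (rule poly_mapping_eqI) (simp add: lookup_add algebra_simps)

lemma pm_scale_diff: "pm_scale c (p - q) = pm_scale c p - pm_scale c q"
  by (rule poly_mapping_eqI) (simp add: lookup_minus algebra_simps)

lemma pm_scale_add_left: "pm_scale (c + d) p = pm_scale c p + pm_scale d p"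
  by (rule poly_mapping_eqI) (simp add: lookup_add algebra_simps)

lemma pm_scale_sum: "pm_scale c (\<Sum>i\<in>I. f i) = (\<Sum>i\<in>I. pm_scale c (f i))"
  by (induction I rule: infinite_finite_induct) (auto simp: pm_scale_add)

lemma keys_pm_scale: "keys (pm_scale c p) \<subseteq> keys p"
  by (auto simp: in_keys_iff)

lemma keys_add_subset:
  "[|keys p \<subseteq> S; keys q \<subseteq> S|] ==> keys (p + q) \<subseteq> S"
  using Poly_Mapping.keys_add[of p q] by auto

lemma keys_diff_subset:
  fixes p q :: "'a \<Rightarrow>\<^sub>0 'b::ab_group_add"
  shows "[|keys p \<subseteq> S; keys q \<subseteq> S|] ==> keys (p - q) \<subseteq> S"
  using Poly_Mapping.keys_diff[of p q] by auto

lemma keys_sum_subset: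
  "(\<And>i. i \<in> I ==> keys (f i) \<subseteq> S) ==> keys (\<Sum>i\<in>I. f i) \<subseteq> S"
proof (induction I rule: infinite_finite_induct)
  case (insert x F)
  then show ?case by (simp add: keys_add_subset)
qed auto

lemma pm_decompose:
  fixes p :: "'s \<Rightarrow>\<^sub>0 'k::comm_monoid_add"
  shows "p = (\<Sum>x\<in>keys p. single x (lookup p x))"
proof (rule poly_mapping_eqI)
  fix y
  have "lookup
      (\<Sum>x\<in>keys p. single x (lookup p x)) y
      = (\<Sum>x\<in>keys p. if x = y then lookup p x else 0)"
    by (simp add: lookup_sum lookup_single when_def)
  also have "\<dots> = lookup p y" by (simp add: in_keys_iff)
  finally show "lookup p y = lookup
      (\<Sum>x\<in>keys p. single x (lookup p x)) y" ..
qed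

lemma pm_induct [consumes 1, case_names zero add single]:
  fixes p :: "'s \<Rightarrow>\<^sub>0 'k::comm_monoid_add"
  assumes "keys p \<subseteq> S" and "P 0"
    and "\<And>p q. [|keys p \<subseteq> S; keys q \<subseteq> S; P p; P q|] ==> P (p + q)"
    and "\<And>x c. x \<in> S ==> P (single x c)"
  shows "P p"
proof -
  have "P (\<Sum>x\<in>T. single x (lookup p x))" if "finite T" "T \<subseteq> S" for T
    using that
  proof (induction T rule: finite_induct)
    case (insert x T)
    then show ?case using assms(4)[of x]
      by (auto intro!: assms(3) keys_sum_subset split: if_splits simp: subset_iff)
  qed (use assms(2) in auto)
  from this[of "keys p"] show ?thesis
    using assms(1) pm_decompose[of p] by auto
qed

subsection \<open>Linear extension from a basis\<close>

lemma kspace_pm_alg: "kspace (pm_alg S m u)"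
proof unfold_locales
  fix x y z c d
  assume "x \<in> carrier (pm_alg S m u)"
  then show "c \<odot>\<^bsub>pm_alg S m u\<^esub> x \<in> carrier (pm_alg S m u)"
    using keys_pm_scale[of c x] by auto
next
  show "carrier (add_monoid (pm_alg S m u)) \<subseteq> Units (add_monoid (pm_alg S m u))"
  proof
    fix x assume "x \<in> carrier (add_monoid (pm_alg S m u))"
    then show "x \<in> Units (add_monoid (pm_alg S m u))"
      unfolding Units_def by (auto intro!: exI[of _ "- x"])
  qed
qed (auto simp: pm_scale_add pm_scale_add_left algebra_simps
    dest: keys_add_subset[THEN subsetD, rotated 2])

lemma pm_alg_minus [simp]:
  "keys p \<subseteq> S ==> \<ominus>\<^bsub>pm_alg S m u\<^esub> p = - p"
  "[|keys p \<subseteq> S; keys q \<subseteq> S|] ==> q \<ominus>\<^bsub>pm_alg S m u\<^esub> p = q - p"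
proof -
  interpret kspace "pm_alg S m u" by (rule kspace_pm_alg)
  show *: "\<ominus>\<^bsub>pm_alg S m u\<^esub> p = - p" if "keys p \<subseteq> S" for p
    by (rule minus_equality) (use that in \<open>auto simp: in_keys_iff\<close>)
  show "q \<ominus>\<^bsub>pm_alg S m u\<^esub> p = q - p"
    if "keys p \<subseteq> S" "keys q \<subseteq> S"
    using that by (simp add: a_minus_def *)
qed

lemma lin_ext_superset:
  assumes "kspace V" "finite T" "keys p \<subseteq> T" "\<And>x. x \<in> T ==> \<phi> x \<in> carrier V"
  shows "lin_ext V \<phi> p = (\<Oplus>\<^sub>V x\<in>T. lookup p x \<odot>\<^sub>V \<phi> x)"
proof -
  interpret V: kspace V by fact
  show ?thesis unfolding lin_ext_def
    using assms by (intro V.finsum_restrict[symmetric]) (auto simp: in_keys_iff)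
qed

lemma lin_ext_single:
  assumes "kspace V" "\<phi> x \<in> carrier V"
  shows "lin_ext V \<phi> (single x c) = c \<odot>\<^sub>V \<phi> x"
proof -
  interpret V: kspace V by fact
  have "lin_ext V \<phi> (single x c) = (\<Oplus>\<^sub>V y\<in>{x}. (if x = y then c else 0) \<odot>\<^sub>V \<phi> y)"
    using assms by (subst lin_ext_superset[where T = "{x}"])
      (auto simp: lookup_single when_def intro!: V.finsum_eqI)
  also have "\<dots> = c \<odot>\<^sub>V \<phi> x"
    using assms by (subst V.finsum_insert) auto
  finally show ?thesis .
qed

lemma lin_ext_lin:
  assumes "kspace V" "\<And>x. x \<in> S ==> \<phi> x \<in> carrier V"
  shows "lin_ext V \<phi> \<in> lin_map (pm_alg S m u) V"
proof -
  interpret V: kspace V by fact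
  show ?thesis
  proof (rule lin_mapI)
    fix p assume p: "p \<in> carrier (pm_alg S m u)"
    then show "lin_ext V \<phi> p \<in> carrier V"
      unfolding lin_ext_def using assms by (auto intro!: V.finsum_closed)
    fix c
    have "lin_ext V \<phi> (pm_scale c p)
        = (\<Oplus>\<^sub>V x\<in>keys p. c \<odot>\<^sub>V (lookup p x \<odot>\<^sub>V \<phi> x))"
      using p assms(2) keys_pm_scale[of c p]
      by (subst lin_ext_superset[OF assms(1), of "keys p"])
        (auto simp: V.smult_smult intro!: V.finsum_eqI)
    then show "lin_ext V \<phi> (c \<odot>\<^bsub>pm_alg S m u\<^esub> p) = c \<odot>\<^sub>V lin_ext V \<phi> p"
      using p assms(2) by (simp add: lin_ext_def, subst V.finsum_smult) (auto simp: subset_iff)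
    fix q assume q: "q \<in> carrier (pm_alg S m u)"
    let ?T = "keys p \<union> keys q"
    have T: "finite ?T" "keys p \<subseteq> ?T" "keys q \<subseteq> ?T" "keys (p + q) \<subseteq> ?T" "\<And>x. x \<in> ?T ==> \<phi> x \<in> carrier V"
      using p q assms(2) Poly_Mapping.keys_add[of p q] by auto
    show "lin_ext V \<phi> (p \<oplus>\<^bsub>pm_alg S m u\<^esub> q) = lin_ext V \<phi> p \<oplus>\<^sub>V lin_ext V \<phi> q"
    proof -
      have E: "lin_ext V \<phi> p = (\<Oplus>\<^sub>V x\<in>?T. lookup p x \<odot>\<^sub>V \<phi> x)"
        if "keys p \<subseteq> ?T" for p
        by (rule lin_ext_superset[OF assms(1) T(1) that]) (use T(5) in auto)
      have "lin_ext V \<phi> (p + q) = (\<Oplus>\<^sub>V x\<in>?T. lookup p x \<odot>\<^sub>V \<phi> x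
          \<oplus>\<^sub>V lookup q x \<odot>\<^sub>V \<phi> x)"
        unfolding E[OF T(4)] by (rule V.finsum_eqI) (use T(5) in \<open>auto simp: lookup_add V.smult_add_left\<close>)
      also have "\<dots> = (\<Oplus>\<^sub>V x\<in>?T. lookup p x \<odot>\<^sub>V \<phi> x)
          \<oplus>\<^sub>V (\<Oplus>\<^sub>V x\<in>?T. lookup q x \<odot>\<^sub>V \<phi> x)"
        by (rule V.finsum_addf) (auto intro!: T(5) V.smult_closed)
      finally show ?thesis
        by (simp add: E[OF T(2)] E[OF T(3)])
    qed
  qed
qed

lemma pm_map_eqI:
  assumes "kspace V" "h \<in> lin_map (pm_alg S m u) V" "g \<in> lin_map (pm_alg S m u) V"
    and "\<And>x. x \<in> S ==> h (single x 1) = g (single x 1)"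
    and "keys p \<subseteq> S"
  shows "h p = g p"
  using assms(5)
proof (induction rule: pm_induct)
  case zero
  show ?case using lin_map_zero[OF kspace_pm_alg assms(1,2)] lin_map_zero[OF kspace_pm_alg assms(1,3)]
    by simp
next
  case (add p q)
  then show ?case using lin_map_add[OF assms(2), of p q] lin_map_add[OF assms(3), of p q] by simp
next
  case (single x c)
  then show ?case
    using lin_map_smult[OF assms(2), of "single x 1" c]
      lin_map_smult[OF assms(3), of "single x 1" c] assms(4)[of x] by simp
qed

lemma pm_alg_mult:
  assumes "finite T" "keys p \<subseteq> T" "finite T'" "keys q \<subseteq> T'"
  shows "p \<otimes>\<^bsub>pm_alg S m u\<^esub> q = (\<Sum>x\<in>T. \<Sum>y\<in>T'.
       pm_scale (lookup p x * lookup q y) (m x y))"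
proof -
  have "p \<otimes>\<^bsub>pm_alg S m u\<^esub> q = (\<Sum>x\<in>keys p. \<Sum>y\<in>T'.
       pm_scale (lookup p x * lookup q y) (m x y))"
    unfolding pm_alg_def monoid.simps using assms
    by (intro sum.cong refl sum.mono_neutral_left) (auto simp: in_keys_iff)
  also have "\<dots> = (\<Sum>x\<in>T. \<Sum>y\<in>T'.
       pm_scale (lookup p x * lookup q y) (m x y))"
    using assms by (auto intro!: sum.mono_neutral_left simp: in_keys_iff)
  finally show ?thesis .
qed

lemma pm_alg_mult_single:
  "single x c \<otimes>\<^bsub>pm_alg S m u\<^esub> single y d = pm_scale (c * d) (m x y)"
  by (subst pm_alg_mult[of "{x}" _ "{y}"]) auto

lemma pm_alg_mult_lin:
  fixes u :: "'s \<Rightarrow>\<^sub>0 'k::field"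
  assumes "\<And>x y. [|x \<in> S; y \<in> S|] ==> keys (m x y) \<subseteq> S"
  defines "A \<equiv> pm_alg S m u"
  assumes p: "p \<in> carrier A"
  shows "(\<lambda>q. p \<otimes>\<^sub>A q) \<in> lin_map A A" "(\<lambda>q. q \<otimes>\<^sub>A p) \<in> lin_map A A"
proof -
  have cl: "x \<otimes>\<^sub>A y \<in> carrier A" if "x \<in> carrier A" "y \<in> carrier A" for x y
    using that assms(1) unfolding A_def
    by (subst pm_alg_mult[OF _ order.refl _ order.refl])
      (auto intro!: keys_sum_subset order.trans[OF keys_pm_scale] simp del: subset_iff, blast)
  note mult = pm_alg_mult[of _ _ _ _ S m u, folded A_def]
  have A: "x \<oplus>\<^sub>A y = x + y" "c \<odot>\<^sub>A x = pm_scale c x" for x y c unfolding A_def by simp_all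
  show "(\<lambda>q. p \<otimes>\<^sub>A q) \<in> lin_map A A"
  proof (rule lin_mapI)
    fix x y c assume "x \<in> carrier A" "y \<in> carrier A"
    let ?K = "keys p" and ?T = "keys x \<union> keys y"
    show "p \<otimes>\<^sub>A (x \<oplus>\<^sub>A y) = p \<otimes>\<^sub>A x \<oplus>\<^sub>A p \<otimes>\<^sub>A y"
      unfolding A using Poly_Mapping.keys_add[of x y]
      by (simp add: mult[of ?K _ ?T] lookup_add distrib_left pm_scale_add_left sum.distrib)
  next
    fix x c assume "x \<in> carrier A"
    show "p \<otimes>\<^sub>A (c \<odot>\<^sub>A x) = c \<odot>\<^sub>A (p \<otimes>\<^sub>A x)"
      unfolding A using keys_pm_scale[of c x]
      by (simp add: mult[of "keys p" _ "keys x"] pm_scale_sum ac_simps)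
  qed (use p cl in auto)
  show "(\<lambda>q. q \<otimes>\<^sub>A p) \<in> lin_map A A"
  proof (rule lin_mapI)
    fix x y c assume "x \<in> carrier A" "y \<in> carrier A"
    let ?K = "keys p" and ?T = "keys x \<union> keys y"
    show "(x \<oplus>\<^sub>A y) \<otimes>\<^sub>A p = x \<otimes>\<^sub>A p \<oplus>\<^sub>A y \<otimes>\<^sub>A p"
      unfolding A using Poly_Mapping.keys_add[of x y]
      by (simp add: mult[of ?T _ ?K] lookup_add distrib_right pm_scale_add_left sum.distrib)
  next
    fix x c assume "x \<in> carrier A"
    show "(c \<odot>\<^sub>A x) \<otimes>\<^sub>A p = c \<odot>\<^sub>A (x \<otimes>\<^sub>A p)"
      unfolding A using keys_pm_scale[of c x]
      by (simp add: mult[of "keys x" _ "keys p"] pm_scale_sum ac_simps)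
  qed (use p cl in auto)
qed

text \<open>Bilinearity reduces the algebra axioms to basis elements.\<close>

lemma kalg_pm_alg:
  fixes u :: "'s \<Rightarrow>\<^sub>0 'k::field"
  assumes m: "\<And>x y. [|x \<in> S; y \<in> S|] ==> keys (m x y) \<subseteq> S"
    and u: "keys u \<subseteq> S"
  defines "A \<equiv> pm_alg S m u" and "b \<equiv> \<lambda>x. single x 1"
  assumes assoc: "\<And>x y z. [|x \<in> S; y \<in> S; z \<in> S|] ==> m x y \<otimes>\<^sub>A b z = b x \<otimes>\<^sub>A m y z"
    and left: "\<And>x. x \<in> S ==> u \<otimes>\<^sub>A b x = b x"
    and right: "\<And>x. x \<in> S ==> b x \<otimes>\<^sub>A u = b x"
  shows "kalg A"
proof -
  interpret A: kspace A unfolding A_def by (rule kspace_pm_alg)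
  have L: "(\<lambda>q. p \<otimes>\<^sub>A q) \<in> lin_map A A" and R: "(\<lambda>q. q \<otimes>\<^sub>A p) \<in> lin_map A A"
    if "p \<in> carrier A" for p
    using pm_alg_mult_lin[of S m p u] m that unfolding A_def by auto
  note eqI = pm_map_eqI[of A _ S m u, folded A_def, OF A.ks]
  have carr: "p \<in> carrier A \<longleftrightarrow> keys p \<subseteq> S" for p unfolding A_def by simp
  have cl: "x \<otimes>\<^sub>A y \<in> carrier A" if "x \<in> carrier A" "y \<in> carrier A" for x y
    by (rule lin_map_closed[OF L]) (use that in auto)
  have bc: "b x \<in> carrier A" if "x \<in> S" for x using that unfolding carr b_def by simp
  have bb: "b x \<otimes>\<^sub>A b y = m x y" for x y
    unfolding A_def b_def by (simp add: pm_alg_mult_single)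
  have uc: "u \<in> carrier A" using u carr by simp
  have id: "(\<lambda>x. x) \<in> lin_map A A" by (rule lin_mapI) auto
  have lu: "u \<otimes>\<^sub>A p = p" if "p \<in> carrier A" for p
    using eqI[OF L[OF uc] id, of p] left that unfolding carr b_def by auto
  have ru: "p \<otimes>\<^sub>A u = p" if "p \<in> carrier A" for p
    using eqI[OF R[OF uc] id, of p] right that unfolding carr b_def by auto
  have a1: "b x \<otimes>\<^sub>A b y \<otimes>\<^sub>A q = b x \<otimes>\<^sub>A (b y \<otimes>\<^sub>A q)"
    if "x \<in> S" "y \<in> S" "q \<in> carrier A" for x y q
  proof (rule eqI[where p = q and h = "\<lambda>q. b x \<otimes>\<^sub>A b y \<otimes>\<^sub>A q"
        and g = "\<lambda>q. b x \<otimes>\<^sub>A (b y \<otimes>\<^sub>A q)"])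
    show "(\<lambda>q. b x \<otimes>\<^sub>A b y \<otimes>\<^sub>A q) \<in> lin_map A A" using that by (intro L cl bc)
    show "(\<lambda>q. b x \<otimes>\<^sub>A (b y \<otimes>\<^sub>A q)) \<in> lin_map A A"
      using that by (intro lin_map_comp[OF L L] bc)
    fix z assume "z \<in> S"
    then show "b x \<otimes>\<^sub>A b y \<otimes>\<^sub>A single z 1
        = b x \<otimes>\<^sub>A (b y \<otimes>\<^sub>A single z 1)"
      using assoc[of x y z] that bb unfolding b_def by simp
  qed (use that carr in auto)
  have a2: "b x \<otimes>\<^sub>A q \<otimes>\<^sub>A r = b x \<otimes>\<^sub>A (q \<otimes>\<^sub>A r)"
    if "x \<in> S" "q \<in> carrier A" "r \<in> carrier A" for x q r
  proof (rule eqI[where p = q and h = "\<lambda>q. b x \<otimes>\<^sub>A q \<otimes>\<^sub>A r"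
        and g = "\<lambda>q. b x \<otimes>\<^sub>A (q \<otimes>\<^sub>A r)"])
    show "(\<lambda>q. b x \<otimes>\<^sub>A q \<otimes>\<^sub>A r) \<in> lin_map A A"
      using that by (intro lin_map_comp[OF L R] bc)
    show "(\<lambda>q. b x \<otimes>\<^sub>A (q \<otimes>\<^sub>A r)) \<in> lin_map A A"
      using that by (intro lin_map_comp[OF R L] bc)
  qed (use that carr a1 b_def in auto)
  have a3: "p \<otimes>\<^sub>A q \<otimes>\<^sub>A r = p \<otimes>\<^sub>A (q \<otimes>\<^sub>A r)"
    if "p \<in> carrier A" "q \<in> carrier A" "r \<in> carrier A" for p q r
  proof (rule eqI[where p = p and h = "\<lambda>p. p \<otimes>\<^sub>A q \<otimes>\<^sub>A r"
        and g = "\<lambda>p. p \<otimes>\<^sub>A (q \<otimes>\<^sub>A r)"])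
    show "(\<lambda>p. p \<otimes>\<^sub>A q \<otimes>\<^sub>A r) \<in> lin_map A A"
      using that by (intro lin_map_comp[OF R R])
    show "(\<lambda>p. p \<otimes>\<^sub>A (q \<otimes>\<^sub>A r)) \<in> lin_map A A"
      using that by (intro R cl)
  qed (use that carr a2 b_def in auto)
  have one: "\<one>\<^sub>A = u" unfolding A_def by simp
  show ?thesis
  proof unfold_locales
    fix x y z c
    assume x: "x \<in> carrier A" and y: "y \<in> carrier A"
    show "c \<odot>\<^sub>A x \<otimes>\<^sub>A y = c \<odot>\<^sub>A (x \<otimes>\<^sub>A y)" using lin_map_smult[OF R[OF y] x] .
    show "x \<otimes>\<^sub>A (c \<odot>\<^sub>A y) = c \<odot>\<^sub>A (x \<otimes>\<^sub>A y)" using lin_map_smult[OF L[OF x] y] .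
    assume z: "z \<in> carrier A"
    show "(x \<oplus>\<^sub>A y) \<otimes>\<^sub>A z = x \<otimes>\<^sub>A z \<oplus>\<^sub>A y \<otimes>\<^sub>A z" using lin_map_add[OF R[OF z] x y] .
    show "z \<otimes>\<^sub>A (x \<oplus>\<^sub>A y) = z \<otimes>\<^sub>A x \<oplus>\<^sub>A z \<otimes>\<^sub>A y" using lin_map_add[OF L[OF z] x y] .
  qed (use cl a3 lu ru uc one in auto)
qed

text \<open>A linear map is multiplicative as soon as it is so on basis elements.\<close>

lemma pm_alg_map_mult:
  assumes m: "\<And>x y. [|x \<in> S; y \<in> S|] ==> keys (m x y) \<subseteq> S"
    and B: "kalg B" and h: "h \<in> lin_map (pm_alg S m u) B"
    and eq: "\<And>x y. [|x \<in> S; y \<in> S|] ==>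
      h (m x y) = h (single x 1) \<otimes>\<^sub>B h (single y 1)"
    and p: "keys p \<subseteq> S" and q: "keys q \<subseteq> S"
  shows "h (p \<otimes>\<^bsub>pm_alg S m u\<^esub> q) = h p \<otimes>\<^sub>B h q"
proof -
  interpret B: kalg B by fact
  let ?A = "pm_alg S m u"
  have L: "(\<lambda>q. p \<otimes>\<^sub>?A q) \<in> lin_map ?A ?A" and R: "(\<lambda>q. q \<otimes>\<^sub>?A p) \<in> lin_map ?A ?A"
    if "p \<in> carrier ?A" for p
    using pm_alg_mult_lin[of S m p u] m that by auto
  have hB: "h p \<in> carrier B" if "keys p \<subseteq> S" for p
    using lin_map_closed[OF h] that by simp
  show ?thesis
  proof (rule pm_map_eqI[OF B.ks _ _ _ p, where h = "\<lambda>p. h (p \<otimes>\<^bsub>pm_alg S m u\<^esub> q)"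
        and g = "\<lambda>p. h p \<otimes>\<^sub>B h q"])
    show "(\<lambda>p. h (p \<otimes>\<^bsub>pm_alg S m u\<^esub> q)) \<in> lin_map (pm_alg S m u) B"
      using q by (intro lin_map_comp[OF R h]) auto
    show "(\<lambda>p. h p \<otimes>\<^sub>B h q) \<in> lin_map (pm_alg S m u) B"
      using q by (intro lin_map_comp[OF h B.mult_right_lin] hB)
    fix x assume x: "x \<in> S"
    show "h (single x 1 \<otimes>\<^bsub>pm_alg S m u\<^esub> q) = h (single x 1) \<otimes>\<^sub>B h q"
    proof (rule pm_map_eqI[OF B.ks _ _ _ q,
          where h = "\<lambda>q. h (single x 1 \<otimes>\<^bsub>pm_alg S m u\<^esub> q)"
          and g = "\<lambda>q. h (single x 1) \<otimes>\<^sub>B h q"])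
      show "(\<lambda>q. h (single x 1 \<otimes>\<^bsub>pm_alg S m u\<^esub> q)) \<in> lin_map (pm_alg S m u) B"
        using x by (intro lin_map_comp[OF L h]) auto
      show "(\<lambda>q. h (single x 1) \<otimes>\<^sub>B h q) \<in> lin_map (pm_alg S m u) B"
        using x by (intro lin_map_comp[OF h B.mult_left_lin] hB) auto
    qed (use x eq in \<open>simp add: pm_alg_mult_single\<close>)
  qed
qed

lemma monoid_alg_eq:
  "monoid_alg S = pm_alg (carrier S) (\<lambda>x y. single (x \<otimes>\<^sub>S y) 1)
     (single \<one>\<^sub>S 1)"
  unfolding monoid_alg_def pm_alg_def by simp

lemma kalg_monoid_alg:
  assumes "monoid S" shows "kalg (monoid_alg S)"
proof -
  interpret S: monoid S by fact
  show ?thesis unfolding monoid_alg_eq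
    by (rule kalg_pm_alg) (auto simp: pm_alg_mult_single S.m_assoc)
qed

lemma monoid_alg_mult_single [simp]:
  "single x c \<otimes>\<^bsub>monoid_alg S\<^esub> single y d
     = single (x \<otimes>\<^sub>S y) (c * d)"
  unfolding monoid_alg_eq by (simp add: pm_alg_mult_single)

lemma monoid_alg_simps [simp]:
  "carrier (monoid_alg S) = {p. keys p \<subseteq> carrier S}"
  "\<one>\<^bsub>monoid_alg S\<^esub> = single \<one>\<^sub>S 1"
  "\<zero>\<^bsub>monoid_alg S\<^esub> = 0" "p \<oplus>\<^bsub>monoid_alg S\<^esub> q = p + q" "c \<odot>\<^bsub>monoid_alg S\<^esub> p = pm_scale c p"
  by (simp_all add: monoid_alg_def)

lemma monoid_alg_minus [simp]:
  "keys p \<subseteq> carrier S ==> \<ominus>\<^bsub>monoid_alg S\<^esub> p = - p"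
  "[|keys p \<subseteq> carrier S; keys q \<subseteq> carrier S|] ==>
     q \<ominus>\<^bsub>monoid_alg S\<^esub> p = q - p"
  by (simp_all add: monoid_alg_eq)

section \<open>Quotients\<close>

lemma (in abelian_group) minus_zero_right [simp]: "x \<in> carrier G ==> x \<ominus> \<zero> = x"
  using minus_equality[of \<zero> \<zero>] by (simp add: a_minus_def)

lemma (in abelian_group) minus_eq_zero_iff:
  assumes "x \<in> carrier G" "y \<in> carrier G" shows "x \<ominus> y = \<zero> \<longleftrightarrow> x = y"
proof
  assume "x \<ominus> y = \<zero>"
  then have "(x \<oplus> \<ominus> y) \<oplus> y = y" using assms by (simp add: a_minus_def)
  then show "x = y" using assms by (simp add: a_assoc l_neg)
qed (use assms in \<open>simp add: a_minus_def r_neg\<close>)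

lemma (in kspace) smult_lin: "(\<lambda>x. c \<odot> x) \<in> lin_map V V"
  by (rule lin_mapI) (simp_all add: smult_add_right smult_smult[symmetric] mult.commute)

lemma mem_coset:
  assumes "kspace V" "submodule U scalars V" "x \<in> carrier V"
  shows "y \<in> U +>\<^sub>V x \<longleftrightarrow> y \<in> carrier V \<and> y \<ominus>\<^sub>V x \<in> U"
proof -
  interpret V: kspace V by fact
  have sub: "U \<subseteq> carrier V" by (rule subspace_subset[OF assms(2,1)])
  show ?thesis
  proof
    assume "y \<in> U +>\<^sub>V x"
    then obtain u where u: "u \<in> U" "y = u \<oplus>\<^sub>V x" by (auto simp: a_r_coset_def')
    then have "y \<ominus>\<^sub>V x = u" using sub assms(3)
      by (simp add: V.minus_eq V.a_assoc V.r_neg subset_iff)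
    with u sub assms(3) show "y \<in> carrier V \<and> y \<ominus>\<^sub>V x \<in> U" by auto
  next
    assume y: "y \<in> carrier V \<and> y \<ominus>\<^sub>V x \<in> U"
    then have "y = (y \<ominus>\<^sub>V x) \<oplus>\<^sub>V x" using assms(3)
      by (simp add: V.minus_eq V.a_assoc V.l_neg)
    with y show "y \<in> U +>\<^sub>V x" by (auto simp: a_r_coset_def')
  qed
qed

lemma coset_self:
  assumes "kspace V" "submodule U scalars V" "x \<in> carrier V" shows "x \<in> U +>\<^sub>V x"
proof -
  interpret V: kspace V by fact
  show ?thesis using assms subspace_zero[OF assms(2,1)] by (simp add: mem_coset V.minus_eq V.r_neg)
qed

lemma coset_eq_iff:
  assumes "kspace V" "submodule U scalars V" "x \<in> carrier V" "y \<in> carrier V"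
  shows "U +>\<^sub>V x = U +>\<^sub>V y \<longleftrightarrow> x \<ominus>\<^sub>V y \<in> U"
proof -
  interpret V: kspace V by fact
  have sub: "subgroup U (add_monoid V)" using assms(2) by (rule submodule.axioms)
  show ?thesis
    using coset_self[OF assms(1-3)] mem_coset[OF assms(1,2,4), of x] assms(3,4)
      V.a_repr_independence[OF _ assms(4) sub, of x] by auto
qed

lemma coset_zero: "kspace V ==> submodule U scalars V ==> U +>\<^sub>V \<zero>\<^sub>V = U"
proof -
  assume a: "kspace V" "submodule U scalars V"
  then interpret V: kspace V by simp
  show ?thesis using subspace_subset[OF a(2,1)] by (rule V.a_coset_add_zero)
qed

lemma coset_eq_zero_iff:
  assumes "kspace V" "submodule U scalars V" "x \<in> carrier V"
  shows "U +>\<^sub>V x = U \<longleftrightarrow> x \<in> U"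
proof -
  interpret V: kspace V by fact
  show ?thesis using coset_eq_iff[OF assms, of "\<zero>\<^sub>V"] coset_zero[OF assms(1,2)] assms(3)
    by simp
qed

lemma quot_alg_simps:
  "carrier (quot_alg A I) = (\<lambda>x. I +>\<^sub>A x) ` carrier A" "\<zero>\<^bsub>quot_alg A I\<^esub> = I"
  "\<one>\<^bsub>quot_alg A I\<^esub> = I +>\<^sub>A \<one>\<^sub>A"
  by (auto simp: quot_alg_def A_RCOSETS_def')

lemma quot_cases:
  assumes "C \<in> carrier (quot_alg V U)" obtains x where "x \<in> carrier V" "C = U +>\<^sub>V x"
  using assms by (auto simp: quot_alg_simps)

lemma quot_add:
  assumes "kspace V" "submodule U scalars V" "x \<in> carrier V" "y \<in> carrier V"
  shows "(U +>\<^sub>V x) \<oplus>\<^bsub>quot_alg V U\<^esub> (U +>\<^sub>V y) = U +>\<^sub>V (x \<oplus>\<^sub>V y)"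
  using abelian_subgroup.a_rcos_sum[OF subspace_abelian[OF assms(2,1)] assms(3,4)]
  by (simp add: quot_alg_def)

lemma quot_smult:
  assumes "kspace V" "submodule U scalars V" "x \<in> carrier V"
  shows "c \<odot>\<^bsub>quot_alg V U\<^esub> (U +>\<^sub>V x) = U +>\<^sub>V (c \<odot>\<^sub>V x)"
proof -
  interpret V: kspace V by fact
  have "U +>\<^sub>V (c \<odot>\<^sub>V y) = U +>\<^sub>V (c \<odot>\<^sub>V x)" if "y \<in> U +>\<^sub>V x" for y
  proof -
    have y: "y \<in> carrier V" "y \<ominus>\<^sub>V x \<in> U" using that assms by (auto simp: mem_coset)
    have "c \<odot>\<^sub>V (y \<ominus>\<^sub>V x) = c \<odot>\<^sub>V y \<ominus>\<^sub>V c \<odot>\<^sub>V x"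
      by (rule lin_map_minus[OF assms(1,1) V.smult_lin y(1) assms(3)])
    then have "c \<odot>\<^sub>V y \<ominus>\<^sub>V c \<odot>\<^sub>V x \<in> U" using subspace_smult[OF assms(2,1) y(2), of c] by simp
    then show ?thesis using y assms by (simp add: coset_eq_iff)
  qed
  then have "(\<Union>y\<in>U +>\<^sub>V x. U +>\<^sub>V (c \<odot>\<^sub>V y)) = U +>\<^sub>V (c \<odot>\<^sub>V x)"
    using coset_self[OF assms] by (intro SUP_eq_const) blast+
  then show ?thesis by (simp add: quot_alg_def)
qed

lemma kspace_quot:
  assumes "kspace V" "submodule U scalars V"
  shows "kspace (quot_alg V U)"
proof -
  interpret V: kspace V by fact
  note add = quot_add[OF assms] and sm = quot_smult[OF assms]
  show ?thesis
  proof (rule kspace.intro)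
    show "abelian_group (quot_alg V U)"
    proof (rule abelian_groupI)
      show "\<zero>\<^bsub>quot_alg V U\<^esub> \<in> carrier (quot_alg V U)"
        unfolding quot_alg_simps using coset_zero[OF assms] V.zero_closed by force
      fix X assume "X \<in> carrier (quot_alg V U)"
      then obtain x where x: "x \<in> carrier V" "X = U +>\<^sub>V x" by (rule quot_cases)
      show "\<zero>\<^bsub>quot_alg V U\<^esub> \<oplus>\<^bsub>quot_alg V U\<^esub> X = X"
        using add[OF V.zero_closed x(1)] x coset_zero[OF assms] by (simp add: quot_alg_simps)
      have "(U +>\<^sub>V (\<ominus>\<^sub>V x)) \<oplus>\<^bsub>quot_alg V U\<^esub> X = \<zero>\<^bsub>quot_alg V U\<^esub>"
        using add[of "\<ominus>\<^sub>V x" x] x coset_zero[OF assms] by (simp add: quot_alg_simps V.l_neg)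
      then show "\<exists>Y\<in>carrier (quot_alg V U). Y \<oplus>\<^bsub>quot_alg V U\<^esub> X = \<zero>\<^bsub>quot_alg V U\<^esub>"
        using x(1) by (intro bexI[of _ "U +>\<^sub>V (\<ominus>\<^sub>V x)"]) (auto simp: quot_alg_simps)
    qed (auto elim!: quot_cases simp: add quot_alg_simps(1) V.a_ac)
    show "kspace_axioms (quot_alg V U)"
      by unfold_locales (auto elim!: quot_cases simp: add sm quot_alg_simps(1) V.smult_add_left
          V.smult_add_right V.smult_smult)
  qed
qed

lemma proj_lin:
  assumes "kspace V" "submodule U scalars V"
  shows "(\<lambda>x. U +>\<^sub>V x) \<in> lin_map V (quot_alg V U)"
  by (rule lin_mapI) (auto simp: quot_add quot_smult assms quot_alg_simps)

text \<open>
  Every function on the space can be evaluated on a coset at some representative, which is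
  enough when all representatives are known to behave alike for other reasons.
\<close>

lemma induced_representative:
  assumes "kspace V" "submodule U scalars V" "C \<in> carrier (quot_alg V U)"
  obtains x where "x \<in> carrier V" "C = U +>\<^sub>V x" "induced h C = h x"
proof -
  interpret V: kspace V by fact
  obtain y where y: "y \<in> carrier V" "C = U +>\<^sub>V y" using assms(3) by (rule quot_cases)
  let ?x = "SOME x. x \<in> C"
  have "?x \<in> C" using coset_self[OF assms(1,2) y(1)] y(2) by (auto intro: someI)
  then have "?x \<in> carrier V" "?x \<ominus>\<^sub>V y \<in> U" using y mem_coset[OF assms(1,2) y(1)] by auto
  then have "C = U +>\<^sub>V ?x" using y coset_eq_iff[OF assms(1,2), of ?x y] by auto
  then show ?thesis using that[of ?x] \<open>?x \<in> carrier V\<close> by (simp add: induced_def)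
qed

lemma induced_coset:
  assumes "kspace V" "submodule U scalars V" "kspace W" "h \<in> lin_map V W"
    and "\<And>u. u \<in> U ==> h u = \<zero>\<^sub>W" "x \<in> carrier V"
  shows "induced h (U +>\<^sub>V x) = h x"
proof -
  interpret W: kspace W by fact
  have "U +>\<^sub>V x \<in> carrier (quot_alg V U)" using assms(6) by (auto simp: quot_alg_simps)
  then obtain y where y: "y \<in> carrier V" "U +>\<^sub>V x = U +>\<^sub>V y" "induced h (U +>\<^sub>V x) = h y"
    by (rule induced_representative[OF assms(1,2)])
  then have "y \<ominus>\<^sub>V x \<in> U" using coset_eq_iff[OF assms(1,2), of y x] assms(6) by auto
  then have "h y \<ominus>\<^sub>W h x = \<zero>\<^sub>W"
    using assms(5) lin_map_minus[OF assms(1,3,4) y(1) assms(6)] by auto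
  then show ?thesis
    using y(3) lin_map_closed[OF assms(4)] y(1) assms(6) by (simp add: W.minus_eq_zero_iff)
qed

lemma induced_lin:
  assumes "kspace V" "submodule U scalars V" "kspace W" "h \<in> lin_map V W"
    and "\<And>u. u \<in> U ==> h u = \<zero>\<^sub>W"
  shows "induced h \<in> lin_map (quot_alg V U) W"
proof -
  interpret V: kspace V by fact
  note [simp] = induced_coset[OF assms] quot_add[OF assms(1,2)] quot_smult[OF assms(1,2)]
  show ?thesis
    by (rule lin_mapI) (auto elim!: quot_cases
      simp: lin_map_closed[OF assms(4)] lin_map_add[OF assms(4)] lin_map_smult[OF assms(4)])
qed

text \<open>
  The product of two cosets of a right ideal \<open>U\<close> is a coset once left multiplication by a
  representative of the first one preserves \<open>U\<close>.
\<close>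

lemma quot_mult:
  assumes "kalg A" "submodule U scalars A" "x \<in> carrier A" "y \<in> carrier A"
    and r: "\<And>u a. [|u \<in> U; a \<in> carrier A|] ==> u \<otimes>\<^sub>A a \<in> U"
    and l: "\<And>u. u \<in> U ==> x \<otimes>\<^sub>A u \<in> U"
  shows "(U +>\<^sub>A x) \<otimes>\<^bsub>quot_alg A U\<^esub> (U +>\<^sub>A y) = U +>\<^sub>A (x \<otimes>\<^sub>A y)"
proof -
  interpret A: kalg A by fact
  note ks = A.ks
  have "U +>\<^sub>A (x' \<otimes>\<^sub>A y') = U +>\<^sub>A (x \<otimes>\<^sub>A y)" if "x' \<in> U +>\<^sub>A x" "y' \<in> U +>\<^sub>A y" for x' y'
  proof -
    have c: "x' \<in> carrier A" "x' \<ominus>\<^sub>A x \<in> U" "y' \<in> carrier A" "y' \<ominus>\<^sub>A y \<in> U"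
      using that assms by (auto simp: mem_coset[OF ks assms(2)])
    have "x' \<otimes>\<^sub>A y' \<ominus>\<^sub>A x \<otimes>\<^sub>A y = (x' \<ominus>\<^sub>A x) \<otimes>\<^sub>A y' \<oplus>\<^sub>A x \<otimes>\<^sub>A (y' \<ominus>\<^sub>A y)"
    proof -
      have "(x' \<ominus>\<^sub>A x) \<otimes>\<^sub>A y' = x' \<otimes>\<^sub>A y' \<oplus>\<^sub>A \<ominus>\<^sub>A (x \<otimes>\<^sub>A y')"
        "x \<otimes>\<^sub>A (y' \<ominus>\<^sub>A y) = x \<otimes>\<^sub>A y' \<oplus>\<^sub>A \<ominus>\<^sub>A (x \<otimes>\<^sub>A y)"
        using c assms(3,4) by (simp_all add: A.minus_eq A.l_distr A.r_distr A.l_minus A.r_minus)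
      then show ?thesis using c assms(3,4)
        by (simp add: A.minus_eq A.a_assoc A.r_neg1)
    qed
    also have "\<dots> \<in> U" using c by (intro subspace_add[OF assms(2) ks] r l) auto
    finally show ?thesis using c assms(3,4) coset_eq_iff[OF ks assms(2)] by simp
  qed
  then have "(\<Union>x'\<in>U +>\<^sub>A x. \<Union>y'\<in>U +>\<^sub>A y. U +>\<^sub>A (x' \<otimes>\<^sub>A y')) = U +>\<^sub>A (x \<otimes>\<^sub>A y)"
    using coset_self[OF ks assms(2,3)] coset_self[OF ks assms(2,4)]
    by (intro SUP_eq_const) blast+
  then show ?thesis by (simp add: quot_alg_def rcoset_mult_def)
qed

lemma quot_ideal_mult:
  assumes "kalg A" "ideal I A" "x \<in> carrier A" "y \<in> carrier A"
  shows "(I +>\<^sub>A x) \<otimes>\<^bsub>quot_alg A I\<^esub> (I +>\<^sub>A y) = I +>\<^sub>A (x \<otimes>\<^sub>A y)"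
  using assms ideal.I_l_closed[OF assms(2)] ideal.I_r_closed[OF assms(2)]
  by (intro quot_mult ideal_subspace) auto

lemma kalg_quot:
  assumes "kalg A" "ideal I A"
  shows "kalg (quot_alg A I)"
proof -
  interpret A: kalg A by fact
  note sub = ideal_subspace[OF assms]
  interpret Q: kspace "quot_alg A I" by (rule kspace_quot[OF A.ks sub])
  note [simp] = quot_ideal_mult[OF assms] quot_add[OF A.ks sub]
    quot_smult[OF A.ks sub]
  show ?thesis
    by unfold_locales (auto elim!: quot_cases simp: quot_alg_simps A.m_assoc A.l_distr A.r_distr
        A.smult_mult_left A.smult_mult_right)
qed

lemma proj_alg_hom:
  assumes "kalg A" "ideal I A"
  shows "(\<lambda>x. I +>\<^sub>A x) \<in> alg_hom A (quot_alg A I)"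
proof -
  interpret A: kalg A by fact
  show ?thesis
    by (rule alg_homI[OF proj_lin[OF A.ks ideal_subspace[OF assms]]])
      (auto simp: quot_ideal_mult assms quot_alg_simps)
qed

section \<open>Tensor products\<close>

definition bilin ::
    "('k::field, 'a) module => ('k, 'b) module => ('k, 'v) module => ('a => 'b => 'v) => bool" where
  "bilin A B V \<beta> \<longleftrightarrow> (\<forall>a\<in>carrier A. (\<lambda>b. \<beta> a b) \<in> lin_map B V) \<and>
                     (\<forall>b\<in>carrier B. (\<lambda>a. \<beta> a b) \<in> lin_map A V)"

lemma bilinI:
  assumes "\<And>a. a \<in> carrier A ==> (\<lambda>b. \<beta> a b) \<in> lin_map B V"
    and "\<And>b. b \<in> carrier B ==> (\<lambda>a. \<beta> a b) \<in> lin_map A V"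
  shows "bilin A B V \<beta>"
  using assms unfolding bilin_def by auto

lemma
  assumes "bilin A B V \<beta>"
  shows bilin_right: "a \<in> carrier A ==> (\<lambda>b. \<beta> a b) \<in> lin_map B V"
    and bilin_left: "b \<in> carrier B ==> (\<lambda>a. \<beta> a b) \<in> lin_map A V"
    and bilin_closed: "[|a \<in> carrier A; b \<in> carrier B|] ==> \<beta> a b \<in> carrier V"
  using assms unfolding bilin_def by (auto intro: lin_map_closed)

locale two_kalgs = A: kalg A + B: kalg B
  for A :: "('k::field, 'a) module" and B :: "('k, 'b) module"
begin

abbreviation "F \<equiv> monoid_alg (A \<times>\<times> B)"
abbreviation "N \<equiv> tensor_null A B"

sublocale F: kalg F
  by (rule kalg_monoid_alg) (intro DirProd_monoid A.monoid_axioms B.monoid_axioms)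

lemma carrier_F: "carrier F = {p. keys p \<subseteq> carrier A \<times> carrier B}"
  by simp

lemma tensor_rels_cases [consumes 1]:
  assumes "x \<in> tensor_rels A B"
  obtains (add1) a a' b where "a \<in> carrier A" "a' \<in> carrier A" "b \<in> carrier B"
      "x = single (a \<oplus>\<^sub>A a', b) 1 - single (a, b) 1
        - single (a', b) 1"
  | (add2) a b b' where "a \<in> carrier A" "b \<in> carrier B" "b' \<in> carrier B"
      "x = single (a, b \<oplus>\<^sub>B b') 1 - single (a, b) 1
        - single (a, b') 1"
  | (scale1) c a b where "a \<in> carrier A" "b \<in> carrier B"
      "x = single (c \<odot>\<^sub>A a, b) 1 - single (a, b) c"
  | (scale2) c a b where "a \<in> carrier A" "b \<in> carrier B"
      "x = single (a, c \<odot>\<^sub>B b) 1 - single (a, b) c"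
  using assms unfolding tensor_rels_def
  by (elim UnE CollectE exE conjE) (rule that; assumption)+

lemma rels_carrier: "tensor_rels A B \<subseteq> carrier F"
proof
  fix x assume "x \<in> tensor_rels A B"
  then show "x \<in> carrier F" by (cases rule: tensor_rels_cases) (simp_all add: keys_diff_subset)
qed

lemmas N_sub = lin_hull_subspace[OF F.ks rels_carrier, folded tensor_null_def]
lemmas N_sup = lin_hull_superset[OF F.ks rels_carrier, folded tensor_null_def]

lemma N_add: "[|x \<in> N; y \<in> N|] ==> x + y \<in> N"
  using subspace_add[OF N_sub F.ks, of x y] by simp

lemma N_scale: "x \<in> N ==> pm_scale c x \<in> N"
  using subspace_smult[OF N_sub F.ks, of x c] by simp

lemma N_zero: "0 \<in> N" using subspace_zero[OF N_sub F.ks] by simp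

lemma mult_diff:
  assumes "keys p \<subseteq> carrier A \<times> carrier B" "keys q \<subseteq> carrier A \<times> carrier B"
    and "keys r \<subseteq> carrier A \<times> carrier B"
  shows "(p - q) \<otimes>\<^sub>F r = p \<otimes>\<^sub>F r - q \<otimes>\<^sub>F r" "r \<otimes>\<^sub>F (p - q) = r \<otimes>\<^sub>F p - r \<otimes>\<^sub>F q"
proof -
  have c: "p \<in> carrier F" "q \<in> carrier F" "r \<in> carrier F" using assms by auto
  have "(p \<ominus>\<^sub>F q) \<otimes>\<^sub>F r = p \<otimes>\<^sub>F r \<ominus>\<^sub>F q \<otimes>\<^sub>F r" "r \<otimes>\<^sub>F (p \<ominus>\<^sub>F q) = r \<otimes>\<^sub>F p \<ominus>\<^sub>F r \<otimes>\<^sub>F q"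
    using lin_map_minus[OF F.ks F.ks F.mult_right_lin[OF c(3)] c(1,2)]
      lin_map_minus[OF F.ks F.ks F.mult_left_lin[OF c(3)] c(1,2)] by auto
  then show "(p - q) \<otimes>\<^sub>F r = p \<otimes>\<^sub>F r - q \<otimes>\<^sub>F r" "r \<otimes>\<^sub>F (p - q) = r \<otimes>\<^sub>F p - r \<otimes>\<^sub>F q"
    using assms F.m_closed[OF c(1,3)] F.m_closed[OF c(2,3)] F.m_closed[OF c(3,1)]
      F.m_closed[OF c(3,2)] by auto
qed

lemma rel1: "[|a \<in> carrier A; a' \<in> carrier A; b \<in> carrier B|] ==>
    single (a \<oplus>\<^sub>A a', b) 1 - single (a, b) 1
      - single (a', b) 1 \<in> N"
  by (rule N_sup[THEN subsetD], unfold tensor_rels_def, rule UnI1, rule UnI1, rule UnI1,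
    rule CollectI, (rule exI)+, rule conjI, rule refl, (intro conjI)?, assumption+)

lemma rel2: "[|a \<in> carrier A; b \<in> carrier B; b' \<in> carrier B|] ==>
    single (a, b \<oplus>\<^sub>B b') 1 - single (a, b) 1
      - single (a, b') 1 \<in> N"
  by (rule N_sup[THEN subsetD], unfold tensor_rels_def, rule UnI1, rule UnI1, rule UnI2,
    rule CollectI, (rule exI)+, rule conjI, rule refl, (intro conjI)?, assumption+)

lemma rel3: "[|a \<in> carrier A; b \<in> carrier B|] ==>
    single (c \<odot>\<^sub>A a, b) 1 - single (a, b) c \<in> N"
  by (rule N_sup[THEN subsetD], unfold tensor_rels_def, rule UnI1, rule UnI2,
    rule CollectI, (rule exI)+, rule conjI, rule refl, (intro conjI)?, assumption+)

lemma rel4: "[|a \<in> carrier A; b \<in> carrier B|] ==>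
    single (a, c \<odot>\<^sub>B b) 1 - single (a, b) c \<in> N"
  by (rule N_sup[THEN subsetD], unfold tensor_rels_def, rule UnI2,
    rule CollectI, (rule exI)+, rule conjI, rule refl, (intro conjI)?, assumption+)

text \<open>
  Each bilinearity relation times a pure tensor is again such a relation; hence their span is a
  two-sided ideal and the tensor product inherits its multiplication.
\<close>

lemma rels_mult_single:
  assumes "x \<in> tensor_rels A B" "a0 \<in> carrier A" "b0 \<in> carrier B"
  shows "x \<otimes>\<^sub>F single (a0, b0) 1 \<in> N \<and> single (a0, b0) 1 \<otimes>\<^sub>F x \<in> N"
  using assms(1)
proof (cases rule: tensor_rels_cases)
  case (add1 a a' b)
  have "x \<otimes>\<^sub>F single (a0, b0) 1 \<in> N"
    using add1 assms rel1[of "a \<otimes>\<^sub>A a0" "a' \<otimes>\<^sub>A a0" "b \<otimes>\<^sub>B b0"]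
    by (simp add: mult_diff keys_diff_subset A.l_distr)
  moreover have "single (a0, b0) 1 \<otimes>\<^sub>F x \<in> N"
    using add1 assms rel1[of "a0 \<otimes>\<^sub>A a" "a0 \<otimes>\<^sub>A a'" "b0 \<otimes>\<^sub>B b"]
    by (simp add: mult_diff keys_diff_subset A.r_distr)
  ultimately show ?thesis ..
next
  case (add2 a b b')
  have "x \<otimes>\<^sub>F single (a0, b0) 1 \<in> N"
    using add2 assms rel2[of "a \<otimes>\<^sub>A a0" "b \<otimes>\<^sub>B b0" "b' \<otimes>\<^sub>B b0"]
    by (simp add: mult_diff keys_diff_subset B.l_distr)
  moreover have "single (a0, b0) 1 \<otimes>\<^sub>F x \<in> N"
    using add2 assms rel2[of "a0 \<otimes>\<^sub>A a" "b0 \<otimes>\<^sub>B b" "b0 \<otimes>\<^sub>B b'"]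
    by (simp add: mult_diff keys_diff_subset B.r_distr)
  ultimately show ?thesis ..
next
  case (scale1 c a b)
  have "x \<otimes>\<^sub>F single (a0, b0) 1 \<in> N"
    using scale1 assms rel3[of "a \<otimes>\<^sub>A a0" "b \<otimes>\<^sub>B b0" c]
    by (simp add: mult_diff keys_diff_subset A.smult_mult_left)
  moreover have "single (a0, b0) 1 \<otimes>\<^sub>F x \<in> N"
    using scale1 assms rel3[of "a0 \<otimes>\<^sub>A a" "b0 \<otimes>\<^sub>B b" c]
    by (simp add: mult_diff keys_diff_subset A.smult_mult_right)
  ultimately show ?thesis ..
next
  case (scale2 c a b)
  have "x \<otimes>\<^sub>F single (a0, b0) 1 \<in> N"
    using scale2 assms rel4[of "a \<otimes>\<^sub>A a0" "b \<otimes>\<^sub>B b0" c]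
    by (simp add: mult_diff keys_diff_subset B.smult_mult_left)
  moreover have "single (a0, b0) 1 \<otimes>\<^sub>F x \<in> N"
    using scale2 assms rel4[of "a0 \<otimes>\<^sub>A a" "b0 \<otimes>\<^sub>B b" c]
    by (simp add: mult_diff keys_diff_subset B.smult_mult_right)
  ultimately show ?thesis ..
qed

lemma N_mult:
  assumes q: "q \<in> carrier F" and x: "x \<in> N"
  shows "x \<otimes>\<^sub>F q \<in> N" "q \<otimes>\<^sub>F x \<in> N"
proof -
  have xc: "x \<in> carrier F" using x subspace_subset[OF N_sub F.ks] by auto
  have s: "single z 1 \<in> carrier F" if "z \<in> carrier A \<times> carrier B" for z
    using that by auto
  have 1: "x \<otimes>\<^sub>F single z 1 \<in> N" if "z \<in> carrier A \<times> carrier B" for z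
    by (rule lin_hull_image[OF F.ks F.ks F.mult_right_lin[OF s[OF that]]
          N_sub rels_carrier _ x[unfolded tensor_null_def]])
      (use that rels_mult_single in auto)
  have 2: "single z 1 \<otimes>\<^sub>F x \<in> N" if "z \<in> carrier A \<times> carrier B" for z
    by (rule lin_hull_image[OF F.ks F.ks F.mult_left_lin[OF s[OF that]]
          N_sub rels_carrier _ x[unfolded tensor_null_def]])
      (use that rels_mult_single in auto)
  have q': "keys q \<subseteq> carrier A \<times> carrier B" using q by simp
  show "x \<otimes>\<^sub>F q \<in> N" using q'
  proof (induction rule: pm_induct)
    case zero
    then show ?case using F.r_null[OF xc] N_zero by simp
  next
    case (add p q)
    then show ?case using F.r_distr[of p q x] xc N_add by simp
  next
    case (single z c)
    then show ?case
      using F.smult_mult_right[OF xc s[of z], of c] N_scale[OF 1[of z], of c] by simp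
  qed
  show "q \<otimes>\<^sub>F x \<in> N" using q'
  proof (induction rule: pm_induct)
    case zero
    then show ?case using F.l_null[OF xc] N_zero by simp
  next
    case (add p q)
    then show ?case using F.l_distr[of p q x] xc N_add by simp
  next
    case (single z c)
    then show ?case
      using F.smult_mult_left[OF s[of z] xc, of c] N_scale[OF 2[of z], of c] by simp
  qed
qed

lemma N_ideal: "ideal N F"
proof (rule idealI)
  show "subgroup N (add_monoid F)" using N_sub by (rule submodule.axioms)
qed (auto intro: N_mult F.ring_axioms)

sublocale T: kalg "tensor A B"
  unfolding tensor_def by (rule kalg_quot[OF F.kalg_axioms N_ideal])

lemma single_carrier: "[|a \<in> carrier A; b \<in> carrier B|] ==> single (a, b) c \<in> carrier F"
  by auto

lemma tens_closed [simp, intro]: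
  "[|a \<in> carrier A; b \<in> carrier B|] ==> tens A B a b \<in> carrier (tensor A B)"
  unfolding tensor_def tens_def quot_alg_simps using single_carrier by blast

lemma tens_mult:
  "[|a \<in> carrier A; b \<in> carrier B; a' \<in> carrier A; b' \<in> carrier B|] ==>
   tens A B a b \<otimes>\<^bsub>tensor A B\<^esub> tens A B a' b' = tens A B (a \<otimes>\<^sub>A a') (b \<otimes>\<^sub>B b')"
  unfolding tensor_def tens_def
  by (subst quot_ideal_mult[OF F.kalg_axioms N_ideal single_carrier single_carrier]) auto

lemma tens_one: "\<one>\<^bsub>tensor A B\<^esub> = tens A B \<one>\<^sub>A \<one>\<^sub>B"
  unfolding tensor_def tens_def quot_alg_simps by simp

lemma coset_eqI: "[|x \<in> carrier F; y \<in> carrier F; x - y \<in> N|] ==> N +>\<^sub>F x = N +>\<^sub>F y"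
  by (subst coset_eq_iff[OF F.ks N_sub]) auto

lemma
  assumes "a \<in> carrier A" "b \<in> carrier B"
  shows tens_add_left: "a' \<in> carrier A ==>
      tens A B (a \<oplus>\<^sub>A a') b = tens A B a b \<oplus>\<^bsub>tensor A B\<^esub> tens A B a' b"
    and tens_add_right: "b' \<in> carrier B ==>
      tens A B a (b \<oplus>\<^sub>B b') = tens A B a b \<oplus>\<^bsub>tensor A B\<^esub> tens A B a b'"
    and tens_smult_left: "tens A B (c \<odot>\<^sub>A a) b = c \<odot>\<^bsub>tensor A B\<^esub> tens A B a b"
    and tens_smult_right: "tens A B a (c \<odot>\<^sub>B b) = c \<odot>\<^bsub>tensor A B\<^esub> tens A B a b"
proof -
  note q = quot_add[OF F.ks N_sub single_carrier single_carrier]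
    quot_smult[OF F.ks N_sub single_carrier]
  note k = keys_diff_subset keys_add_subset
  show "tens A B (a \<oplus>\<^sub>A a') b = tens A B a b \<oplus>\<^bsub>tensor A B\<^esub> tens A B a' b" if "a' \<in> carrier A"
    unfolding tensor_def tens_def using assms that rel1[of a a' b]
    by (subst q) (simp_all, intro coset_eqI, simp_all add: keys_add_subset diff_diff_eq)
  show "tens A B a (b \<oplus>\<^sub>B b') = tens A B a b \<oplus>\<^bsub>tensor A B\<^esub> tens A B a b'" if "b' \<in> carrier B"
    unfolding tensor_def tens_def using assms that rel2[of a b b']
    by (subst q) (simp_all, intro coset_eqI, simp_all add: keys_add_subset diff_diff_eq)
  show "tens A B (c \<odot>\<^sub>A a) b = c \<odot>\<^bsub>tensor A B\<^esub> tens A B a b"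
    unfolding tensor_def tens_def using assms rel3[of a b c]
    by (subst q) (simp_all, intro coset_eqI, simp_all)
  show "tens A B a (c \<odot>\<^sub>B b) = c \<odot>\<^bsub>tensor A B\<^esub> tens A B a b"
    unfolding tensor_def tens_def using assms rel4[of a b c]
    by (subst q) (simp_all, intro coset_eqI, simp_all)
qed

lemma tens_bilin: "bilin A B (tensor A B) (tens A B)"
  by (intro bilinI lin_mapI)
    (auto simp: tens_add_left tens_add_right tens_smult_left tens_smult_right)

lemma tensor_induct [consumes 1, case_names pure add]:
  assumes t: "t \<in> carrier (tensor A B)"
    and pure: "\<And>a b. [|a \<in> carrier A; b \<in> carrier B|] ==> P (tens A B a b)"
    and add: "\<And>t u. [|t \<in> carrier (tensor A B); u \<in> carrier (tensor A B); P t; P u|] ==>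
      P (t \<oplus>\<^bsub>tensor A B\<^esub> u)"
  shows "P t"
proof -
  obtain p where p: "p \<in> carrier F" "t = N +>\<^sub>F p" using t unfolding tensor_def by (rule quot_cases)
  note pr = proj_lin[OF F.ks N_sub, folded tensor_def]
  have "keys p \<subseteq> carrier A \<times> carrier B" using p by simp
  then have "P (N +>\<^sub>F p)"
  proof (induction rule: pm_induct)
    case zero
    have "tens A B \<zero>\<^sub>A \<zero>\<^sub>B = \<zero>\<^bsub>tensor A B\<^esub>"
      using lin_map_zero[OF A.ks T.ks bilin_left[OF tens_bilin B.zero_closed]] .
    then show ?case
      using pure[of "\<zero>\<^sub>A" "\<zero>\<^sub>B"] lin_map_zero[OF F.ks T.ks pr] by simp
  next
    case (add p q)
    then show ?case
      using lin_map_add[OF pr, of p q] lin_map_closed[OF pr, of p] lin_map_closed[OF pr, of q]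
        assms(3)[of "N +>\<^sub>F p" "N +>\<^sub>F q"] by simp
  next
    case (single z c)
    then obtain a b where z: "z = (a, b)" "a \<in> carrier A" "b \<in> carrier B" by auto
    have "N +>\<^sub>F single z c = tens A B (c \<odot>\<^sub>A a) b"
      using lin_map_smult[OF pr, of "single z 1" c] tens_smult_left[of a b c] z
      by (simp add: tens_def)
    then show ?case using pure[of "c \<odot>\<^sub>A a" b] z by simp
  qed
  then show ?thesis using p by simp
qed

lemma tensor_map_eqI:
  assumes "h \<in> lin_map (tensor A B) V" "g \<in> lin_map (tensor A B) V"
    and "\<And>a b. [|a \<in> carrier A; b \<in> carrier B|] ==> h (tens A B a b) = g (tens A B a b)"
    and "t \<in> carrier (tensor A B)"
  shows "h t = g t"
  using assms(4)
  by (induction rule: tensor_induct)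
    (auto simp: assms(3) lin_map_add[OF assms(1)] lin_map_add[OF assms(2)])

lemma tlift_kill:
  assumes V: "kspace V" and \<beta>: "bilin A B V \<beta>" and x: "x \<in> N"
  shows "lin_ext V (\<lambda>(a, b). \<beta> a b) x = \<zero>\<^sub>V"
proof (rule lin_hull_kill[OF F.ks V _ rels_carrier _ x[unfolded tensor_null_def]])
  interpret V: kspace V by fact
  let ?h = "lin_ext V (\<lambda>(a, b). \<beta> a b)"
  show h: "?h \<in> lin_map F V"
    unfolding monoid_alg_eq by (rule lin_ext_lin[OF V]) (auto simp: bilin_closed[OF \<beta>])
  have s: "?h (single (a, b) c) = c \<odot>\<^sub>V \<beta> a b"
    if "a \<in> carrier A" "b \<in> carrier B" for a b c
    using that by (subst lin_ext_single[OF V]) (auto simp: bilin_closed[OF \<beta>])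
  have d: "?h (p - q) = ?h p \<ominus>\<^sub>V ?h q" if "p \<in> carrier F" "q \<in> carrier F" for p q
    using lin_map_minus[OF F.ks V h that] that by simp
  note \<beta>c = bilin_closed[OF \<beta>]
  note \<beta>a = lin_map_add[OF bilin_left[OF \<beta>]] lin_map_add[OF bilin_right[OF \<beta>]]
  note \<beta>s = lin_map_smult[OF bilin_left[OF \<beta>]] lin_map_smult[OF bilin_right[OF \<beta>]]
  have e: "x \<oplus>\<^sub>V y \<ominus>\<^sub>V x \<ominus>\<^sub>V y = \<zero>\<^sub>V" if "x \<in> carrier V" "y \<in> carrier V" for x y
  proof -
    have "x \<oplus>\<^sub>V y \<ominus>\<^sub>V x = y" using that by (simp add: V.minus_eq V.a_comm[of x y] V.a_assoc V.r_neg)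
    then show ?thesis using that by (simp add: V.minus_eq V.r_neg)
  qed
  fix z assume "z \<in> tensor_rels A B"
  then show "?h z = \<zero>\<^sub>V"
  proof (cases rule: tensor_rels_cases)
    case (add1 a a' b)
    then show ?thesis
      by (simp add: d s \<beta>c \<beta>a e keys_diff_subset)
  next
    case (add2 a b b')
    then show ?thesis
      by (simp add: d s \<beta>c \<beta>a e keys_diff_subset)
  qed (simp_all add: d s \<beta>c \<beta>s V.minus_eq_zero_iff keys_diff_subset)
qed

lemma
  assumes V: "kspace V" and \<beta>: "bilin A B V \<beta>"
  shows tlift_lin: "tlift V \<beta> \<in> lin_map (tensor A B) V"
    and tlift_tens [simp]: "[|a \<in> carrier A; b \<in> carrier B|] ==> tlift V \<beta> (tens A B a b) = \<beta> a b"
proof -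
  interpret V: kspace V by fact
  have h: "lin_ext V (\<lambda>(a, b). \<beta> a b) \<in> lin_map F V"
    unfolding monoid_alg_eq by (rule lin_ext_lin[OF V]) (auto simp: bilin_closed[OF \<beta>])
  show "tlift V \<beta> \<in> lin_map (tensor A B) V"
    unfolding tlift_def tensor_def
    by (rule induced_lin[OF F.ks N_sub V h]) (rule tlift_kill[OF V \<beta>])
  show "tlift V \<beta> (tens A B a b) = \<beta> a b" if "a \<in> carrier A" "b \<in> carrier B"
    unfolding tlift_def tens_def
    by (subst induced_coset[OF F.ks N_sub V h tlift_kill[OF V \<beta>] single_carrier[OF that]])
      (use that in \<open>auto simp: lin_ext_single[OF V] bilin_closed[OF \<beta>]\<close>)
qed

lemma tlift_cong:
  assumes t: "t \<in> carrier (tensor A B)"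
    and eq: "\<And>a b. [|a \<in> carrier A; b \<in> carrier B|] ==> \<beta> a b = \<beta>' a b" and V: "kspace V"
    and cl: "\<And>a b. [|a \<in> carrier A; b \<in> carrier B|] ==> \<beta>' a b \<in> carrier V"
  shows "tlift V \<beta> t = tlift V \<beta>' t"
proof -
  interpret V: kspace V by fact
  have "lin_ext V (\<lambda>(a, b). \<beta> a b) x = lin_ext V (\<lambda>(a, b). \<beta>' a b) x" if "x \<in> carrier F" for x
    unfolding lin_ext_def using that
    by (intro V.finsum_eqI) (auto simp: eq cl)
  moreover have "(SOME x. x \<in> t) \<in> carrier F"
  proof -
    obtain y where y: "y \<in> carrier F" "t = N +>\<^sub>F y"
      using t unfolding tensor_def by (rule quot_cases)
    then have "(SOME x. x \<in> t) \<in> t"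
      using coset_self[OF F.ks N_sub y(1)] by (auto intro: someI)
    then show ?thesis using y mem_coset[OF F.ks N_sub y(1)] by auto
  qed
  ultimately show ?thesis unfolding tlift_def induced_def by simp
qed

lemma tensor_map_mult:
  assumes C: "kalg C" and h: "h \<in> lin_map (tensor A B) C"
    and eq: "\<And>a b a' b'. [|a \<in> carrier A; b \<in> carrier B; a' \<in> carrier A; b' \<in> carrier B|] ==>
      h (tens A B (a \<otimes>\<^sub>A a') (b \<otimes>\<^sub>B b')) = h (tens A B a b) \<otimes>\<^sub>C h (tens A B a' b')"
    and t: "t \<in> carrier (tensor A B)" and u: "u \<in> carrier (tensor A B)"
  shows "h (t \<otimes>\<^bsub>tensor A B\<^esub> u) = h t \<otimes>\<^sub>C h u"
proof -
  interpret C: kalg C by fact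
  note [simp] = lin_map_add[OF h] lin_map_closed[OF h]
  show ?thesis using t
  proof (induction rule: tensor_induct)
    case (pure a b)
    show ?case using u
      by (induction rule: tensor_induct) (use pure in \<open>auto simp: tens_mult eq T.r_distr C.r_distr\<close>)
  next
    case (add t t')
    then show ?case using u by (simp add: T.l_distr C.l_distr)
  qed
qed

end

lemma bilin_comp:
  assumes "bilin A B V \<beta>" "f \<in> lin_map A' A" "g \<in> lin_map B' B"
  shows "bilin A' B' V (\<lambda>x y. \<beta> (f x) (g y))"
  using lin_map_comp[OF assms(2) bilin_left[OF assms(1)]]
    lin_map_comp[OF assms(3) bilin_right[OF assms(1)]]
    lin_map_closed[OF assms(2)] lin_map_closed[OF assms(3)]
  by (intro bilinI) auto

context two_kalgs
begin

lemma tensor_sum_rep: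
  assumes t: "t \<in> carrier (tensor A B)"
  obtains I :: "('a \<times> 'b) set" and f g where "finite I"
    "f \<in> I \<rightarrow> carrier A" "g \<in> I \<rightarrow> carrier B"
    "t = (\<Oplus>\<^bsub>tensor A B\<^esub>i\<in>I. tens A B (f i) (g i))"
proof -
  obtain p where p: "p \<in> carrier F" "t = N +>\<^sub>F p" using t unfolding tensor_def by (rule quot_cases)
  note pr = proj_lin[OF F.ks N_sub, folded tensor_def]
  let ?I = "keys p"
  let ?f = "\<lambda>i. lookup p i \<odot>\<^sub>A fst i"
  have sub: "?I \<subseteq> carrier A \<times> carrier B" using p by simp
  have "p = lin_ext F (\<lambda>z. single z 1) p"
  proof (rule pm_map_eqI[where h = "\<lambda>p. p" and S = "carrier A \<times> carrier B"])
    show "lin_ext F (\<lambda>z. single z 1) \<in> lin_map (pm_alg (carrier A \<times> carrier B)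
        (\<lambda>x y. single (x \<otimes>\<^bsub>A \<times>\<times> B\<^esub> y) 1) (single \<one>\<^bsub>A \<times>\<times> B\<^esub> 1)) F"
      by (rule lin_ext_lin[OF F.ks]) auto
    show "(\<lambda>p. p) \<in> lin_map (pm_alg (carrier A \<times> carrier B)
        (\<lambda>x y. single (x \<otimes>\<^bsub>A \<times>\<times> B\<^esub> y) 1) (single \<one>\<^bsub>A \<times>\<times> B\<^esub> 1)) F"
      by (rule lin_mapI) auto
  qed (use sub F.ks in \<open>auto simp: lin_ext_single[OF F.ks]\<close>)
  then have "t = N +>\<^sub>F (\<Oplus>\<^sub>F z\<in>?I. lookup p z \<odot>\<^sub>F single z 1)"
    using p(2) by (simp add: lin_ext_def)
  also have "\<dots> = (\<Oplus>\<^bsub>tensor A B\<^esub>z\<in>?I.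
      N +>\<^sub>F (lookup p z \<odot>\<^sub>F single z 1))"
    using sub by (intro lin_map_finsum[OF F.ks T.ks pr]) auto
  also have "\<dots> = (\<Oplus>\<^bsub>tensor A B\<^esub>z\<in>?I. tens A B (?f z) (snd z))"
  proof (rule T.finsum_eqI)
    fix z assume "z \<in> ?I"
    then obtain x y where z: "z = (x, y)" "x \<in> carrier A" "y \<in> carrier B" using sub by auto
    then show "N +>\<^sub>F (lookup p z \<odot>\<^sub>F single z 1) = tens A B (?f z) (snd z)"
      by (subst lin_map_smult[OF pr]) (simp_all add: tens_smult_left tens_def[symmetric])
    show "tens A B (?f z) (snd z) \<in> carrier (tensor A B)" using z by auto
  qed
  finally show ?thesis using sub by (intro that[of ?I ?f snd]) auto
qed

lemma tlift_sum:
  assumes "kspace V" "bilin A B V \<beta>"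
    and "\<And>i. i \<in> I ==> f i \<in> carrier A" "\<And>i. i \<in> I ==> g i \<in> carrier B"
  shows "tlift V \<beta> (\<Oplus>\<^bsub>tensor A B\<^esub>i\<in>I. tens A B (f i) (g i)) = (\<Oplus>\<^sub>V i\<in>I. \<beta> (f i) (g i))"
proof -
  interpret V: kspace V by fact
  show ?thesis
    by (subst lin_map_finsum[OF T.ks assms(1) tlift_lin[OF assms(1,2)]])
      (auto intro!: V.finsum_eqI simp: assms bilin_closed[OF assms(2)])
qed

end

section \<open>Free algebras and some standard algebras\<close>

lemma free_alg_pm: "free_alg S = pm_alg (lists S) (\<lambda>x y. word (x @ y)) (word [])"
  unfolding free_alg_def monoid_alg_eq word_def by simp

lemma free_alg_simps [simp]:
  "carrier (free_alg S) = {p. keys p \<subseteq> lists S}" "\<one>\<^bsub>free_alg S\<^esub> = word []"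
  "\<zero>\<^bsub>free_alg S\<^esub> = 0" "p \<oplus>\<^bsub>free_alg S\<^esub> q = p + q" "c \<odot>\<^bsub>free_alg S\<^esub> p = pm_scale c p"
  "word x \<otimes>\<^bsub>free_alg S\<^esub> word y = word (x @ y)"
  by (simp_all add: free_alg_pm, simp add: word_def pm_alg_mult_single)

lemma keys_word [simp]: "keys (word w :: 's list \<Rightarrow>\<^sub>0 'k::field) = {w}"
  by (simp add: word_def)

lemma kalg_free_alg: "kalg (free_alg S)"
  unfolding free_alg_def
  by (intro kalg_monoid_alg monoidI) auto

lemma word_prod_simps [simp]:
  "word_prod A \<phi> [] = \<one>\<^sub>A" "word_prod A \<phi> (x # w) = \<phi> x \<otimes>\<^sub>A word_prod A \<phi> w"
  by (simp_all add: word_prod_def)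

lemma (in kalg) word_prod_closed:
  "[|w \<in> lists S; \<And>x. x \<in> S ==> \<phi> x \<in> carrier A|] ==> word_prod A \<phi> w \<in> carrier A"
  by (induction w) auto

lemma (in kalg) word_prod_append:
  "[|v \<in> lists S; w \<in> lists S; \<And>x. x \<in> S ==> \<phi> x \<in> carrier A|] ==>
     word_prod A \<phi> (v @ w) = word_prod A \<phi> v \<otimes> word_prod A \<phi> w"
proof (induction v)
  case (Cons a v)
  then show ?case
    using word_prod_closed[of v S \<phi>] word_prod_closed[of w S \<phi>] by (simp add: m_assoc)
qed (simp add: word_prod_closed[of w S])

lemma alg_ext_lin:
  assumes "kspace A" "\<And>w. w \<in> lists S ==> word_prod A \<phi> w \<in> carrier A"
  shows "alg_ext A \<phi> \<in> lin_map (free_alg S) A"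
    and "w \<in> lists S ==> alg_ext A \<phi> (word w) = word_prod A \<phi> w"
proof -
  interpret A: kspace A by fact
  show "alg_ext A \<phi> \<in> lin_map (free_alg S) A"
    unfolding alg_ext_def free_alg_pm by (rule lin_ext_lin) (use assms in auto)
  show "alg_ext A \<phi> (word w) = word_prod A \<phi> w" if "w \<in> lists S"
    unfolding alg_ext_def word_def using assms that by (subst lin_ext_single) auto
qed

lemma
  fixes A :: "('k::field, 'a) module" and \<phi> :: "'s => 'a"
  assumes "kalg A" and \<phi>: "\<And>x. x \<in> S ==> \<phi> x \<in> carrier A"
  shows alg_ext_hom: "alg_ext A \<phi> \<in> alg_hom (free_alg S) A"
    and alg_ext_word: "w \<in> lists S ==> alg_ext A \<phi> (word w) = word_prod A \<phi> w"
proof -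
  interpret A: kalg A by fact
  note cl = A.word_prod_closed[of _ S \<phi>]
  have lin: "alg_ext A \<phi> \<in> lin_map (free_alg S) A"
    by (rule alg_ext_lin[OF A.ks]) (use cl \<phi> in auto)
  show *: "alg_ext A \<phi> (word w) = word_prod A \<phi> w" if "w \<in> lists S" for w
    by (rule alg_ext_lin(2)[OF A.ks _ that]) (use cl \<phi> in auto)
  show "alg_ext A \<phi> \<in> alg_hom (free_alg S) A"
  proof (rule alg_homI[OF lin])
    fix x y :: "'s list \<Rightarrow>\<^sub>0 'k"
    assume "x \<in> carrier (free_alg S)" "y \<in> carrier (free_alg S)"
    then show "alg_ext A \<phi> (x \<otimes>\<^bsub>free_alg S\<^esub> y) = alg_ext A \<phi> x \<otimes>\<^sub>A alg_ext A \<phi> y"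
      unfolding free_alg_pm
      by (intro pm_alg_map_mult[OF _ assms(1) lin[unfolded free_alg_pm]])
        (use * \<phi> in \<open>auto simp: word_def[symmetric] A.word_prod_append[of _ S]\<close>)
  qed (simp add: *)
qed

lemma opp_simps [simp]:
  "carrier (opp A) = carrier A" "\<zero>\<^bsub>opp A\<^esub> = \<zero>\<^sub>A" "\<one>\<^bsub>opp A\<^esub> = \<one>\<^sub>A" "x \<otimes>\<^bsub>opp A\<^esub> y = y \<otimes>\<^sub>A x"
  "x \<oplus>\<^bsub>opp A\<^esub> y = x \<oplus>\<^sub>A y" "c \<odot>\<^bsub>opp A\<^esub> x = c \<odot>\<^sub>A x"
  by (simp_all add: opp_def)

lemma lin_map_opp: "lin_map (opp A) V = lin_map A V"
  unfolding lin_map_def by simp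

lemma kalgI:
  assumes "abelian_group A"
    and "\<one>\<^sub>A \<in> carrier A"
    and "\<And>x y. [|x \<in> carrier A; y \<in> carrier A|] ==> x \<otimes>\<^sub>A y \<in> carrier A"
    and "\<And>x y z. [|x \<in> carrier A; y \<in> carrier A; z \<in> carrier A|] ==>
      x \<otimes>\<^sub>A y \<otimes>\<^sub>A z = x \<otimes>\<^sub>A (y \<otimes>\<^sub>A z)"
    and "\<And>x. x \<in> carrier A ==> \<one>\<^sub>A \<otimes>\<^sub>A x = x" "\<And>x. x \<in> carrier A ==> x \<otimes>\<^sub>A \<one>\<^sub>A = x"
    and "\<And>x y z. [|x \<in> carrier A; y \<in> carrier A; z \<in> carrier A|] ==>
      (x \<oplus>\<^sub>A y) \<otimes>\<^sub>A z = x \<otimes>\<^sub>A z \<oplus>\<^sub>A y \<otimes>\<^sub>A z"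
    and "\<And>x y z. [|x \<in> carrier A; y \<in> carrier A; z \<in> carrier A|] ==>
      z \<otimes>\<^sub>A (x \<oplus>\<^sub>A y) = z \<otimes>\<^sub>A x \<oplus>\<^sub>A z \<otimes>\<^sub>A y"
    and "\<And>c x. x \<in> carrier A ==> c \<odot>\<^sub>A x \<in> carrier A"
    and "\<And>c d x. x \<in> carrier A ==> (c + d) \<odot>\<^sub>A x = c \<odot>\<^sub>A x \<oplus>\<^sub>A d \<odot>\<^sub>A x"
    and "\<And>c x y. [|x \<in> carrier A; y \<in> carrier A|] ==>
      c \<odot>\<^sub>A (x \<oplus>\<^sub>A y) = c \<odot>\<^sub>A x \<oplus>\<^sub>A c \<odot>\<^sub>A y"
    and "\<And>c d x. x \<in> carrier A ==> (c * d) \<odot>\<^sub>A x = c \<odot>\<^sub>A (d \<odot>\<^sub>A x)"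
    and "\<And>x. x \<in> carrier A ==> 1 \<odot>\<^sub>A x = x"
    and "\<And>c x y. [|x \<in> carrier A; y \<in> carrier A|] ==> (c \<odot>\<^sub>A x) \<otimes>\<^sub>A y = c \<odot>\<^sub>A (x \<otimes>\<^sub>A y)"
    and "\<And>c x y. [|x \<in> carrier A; y \<in> carrier A|] ==> x \<otimes>\<^sub>A (c \<odot>\<^sub>A y) = c \<odot>\<^sub>A (x \<otimes>\<^sub>A y)"
  shows "kalg A"
  using assms
  by (intro kalg.intro kspace.intro kspace_axioms.intro kalg_axioms.intro ringI monoidI) auto

lemma kalg_opp:
  assumes "kalg A" shows "kalg (opp A)"
proof -
  interpret A: kalg A by fact
  show ?thesis
  proof (rule kalgI)
    show "abelian_group (opp A)"
      by (rule abelian_groupI) (auto simp: A.a_ac intro: A.l_neg)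
  qed (auto simp: A.m_assoc A.l_distr A.r_distr A.smult_mult_left A.smult_mult_right
      A.smult_add_left A.smult_add_right A.smult_smult)
qed

lemma fun_alg_simps [simp]:
  "f \<in> carrier (fun_alg R) \<longleftrightarrow> (\<forall>l. f l \<in> carrier R)"
  "\<zero>\<^bsub>fun_alg R\<^esub> = (\<lambda>l. \<zero>\<^sub>R)" "\<one>\<^bsub>fun_alg R\<^esub> = (\<lambda>l. \<one>\<^sub>R)"
  "f \<otimes>\<^bsub>fun_alg R\<^esub> g = (\<lambda>l. f l \<otimes>\<^sub>R g l)" "f \<oplus>\<^bsub>fun_alg R\<^esub> g = (\<lambda>l. f l \<oplus>\<^sub>R g l)"
  "c \<odot>\<^bsub>fun_alg R\<^esub> f = (\<lambda>l. c \<odot>\<^sub>R f l)"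
  by (simp_all add: fun_alg_def)

lemma kalg_fun_alg:
  assumes "kalg R" shows "kalg (fun_alg R)"
proof -
  interpret R: kalg R by fact
  show ?thesis
  proof (rule kalgI)
    show "abelian_group (fun_alg R)"
    proof (rule abelian_groupI)
      fix f assume "f \<in> carrier (fun_alg R)"
      then show "\<exists>g\<in>carrier (fun_alg R). g \<oplus>\<^bsub>fun_alg R\<^esub> f = \<zero>\<^bsub>fun_alg R\<^esub>"
        by (intro bexI[of _ "\<lambda>l. \<ominus>\<^sub>R f l"]) (auto simp: R.l_neg)
    qed (auto simp: R.a_ac)
  qed (auto simp: R.m_assoc R.l_distr R.r_distr R.smult_mult_left R.smult_mult_right
      R.smult_add_left R.smult_add_right R.smult_smult)
qed

lemma fun_alg_eval_lin: "(\<lambda>f. f l) \<in> lin_map (fun_alg R) R"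
  by (rule lin_mapI) auto

lemma fun_alg_finsum:
  assumes "kalg R" "\<And>i. i \<in> S ==> f i \<in> carrier (fun_alg R)"
  shows "(\<Oplus>\<^bsub>fun_alg R\<^esub>i\<in>S. f i) l = (\<Oplus>\<^sub>R i\<in>S. f i l)"
proof -
  interpret R: kalg R by fact
  interpret F: kalg "fun_alg R" by (rule kalg_fun_alg[OF assms(1)])
  show ?thesis
    by (rule lin_map_finsum[OF F.ks R.ks fun_alg_eval_lin assms(2)])
qed

lemma end_alg_simps:
  "carrier (end_alg V) = lin_map V V \<inter> extensional (carrier V)"
  "g \<otimes>\<^bsub>end_alg V\<^esub> h = (\<lambda>x\<in>carrier V. g (h x))" "\<one>\<^bsub>end_alg V\<^esub> = (\<lambda>x\<in>carrier V. x)"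
  "\<zero>\<^bsub>end_alg V\<^esub> = (\<lambda>x\<in>carrier V. \<zero>\<^sub>V)" "g \<oplus>\<^bsub>end_alg V\<^esub> h = (\<lambda>x\<in>carrier V. g x \<oplus>\<^sub>V h x)"
  "c \<odot>\<^bsub>end_alg V\<^esub> g = (\<lambda>x\<in>carrier V. c \<odot>\<^sub>V g x)"
  by (simp_all add: end_alg_def)

lemma end_alg_carrierI:
  assumes "kspace V" "h \<in> lin_map V V" shows "(\<lambda>x\<in>carrier V. h x) \<in> carrier (end_alg V)"
proof -
  interpret V: kspace V by fact
  show ?thesis unfolding end_alg_simps
    using assms(2) by (auto intro!: lin_mapI simp: lin_map_closed lin_map_add lin_map_smult)
qed

lemma kalg_end_alg:
  assumes "kspace V" shows "kalg (end_alg V)"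
proof -
  interpret V: kspace V by fact
  have c: "h \<in> lin_map V V" "h \<in> extensional (carrier V)" if "h \<in> carrier (end_alg V)" for h
    using that by (simp_all add: end_alg_simps)
  have v: "h x \<in> carrier V" if "h \<in> carrier (end_alg V)" "x \<in> carrier V" for h x
    using lin_map_closed[OF c(1)] that .
  have eqI: "g = h" if "g \<in> extensional (carrier V)" "h \<in> extensional (carrier V)"
    "\<And>x. x \<in> carrier V ==> g x = h x" for g h :: "'a => 'a"
    using that by (rule extensionalityI)
  have addc: "(\<lambda>x\<in>carrier V. g x \<oplus>\<^sub>V h x) \<in> carrier (end_alg V)"
    if "g \<in> carrier (end_alg V)" "h \<in> carrier (end_alg V)" for g h
    using that v by (intro end_alg_carrierI[OF assms] lin_mapI)
      (auto simp: lin_map_add[OF c(1)] lin_map_smult[OF c(1)] V.a_ac V.smult_add_right)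
  have smc: "(\<lambda>x\<in>carrier V. d \<odot>\<^sub>V g x) \<in> carrier (end_alg V)"
    if "g \<in> carrier (end_alg V)" for g d
    using lin_map_comp[OF c(1)[OF that] V.smult_lin] by (intro end_alg_carrierI[OF assms])
  have mulc: "(\<lambda>x\<in>carrier V. g (h x)) \<in> carrier (end_alg V)"
    if "g \<in> carrier (end_alg V)" "h \<in> carrier (end_alg V)" for g h
    using lin_map_comp[OF c(1)[OF that(2)] c(1)[OF that(1)]] by (intro end_alg_carrierI[OF assms])
  have zc: "(\<lambda>x\<in>carrier V. \<zero>\<^sub>V) \<in> carrier (end_alg V)"
    by (intro end_alg_carrierI[OF assms] lin_mapI) auto
  have oc: "(\<lambda>x\<in>carrier V. x) \<in> carrier (end_alg V)"
    by (intro end_alg_carrierI[OF assms] lin_mapI) auto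
  note ops = end_alg_simps(2-6)
  show ?thesis
  proof (rule kalgI)
    show "abelian_group (end_alg V)"
    proof (rule abelian_groupI)
      fix g assume g: "g \<in> carrier (end_alg V)"
      show "\<exists>h\<in>carrier (end_alg V). h \<oplus>\<^bsub>end_alg V\<^esub> g = \<zero>\<^bsub>end_alg V\<^esub>"
        by (rule bexI[OF _ smc[OF g, of "-1"]])
          (auto simp: ops V.smult_minus_one v[OF g] V.l_neg intro!: eqI)
    qed (auto simp: ops addc zc v V.a_ac c intro!: eqI)
  qed (auto simp: ops addc zc oc mulc smc v V.a_ac c lin_map_add[OF c(1)] lin_map_smult[OF c(1)]
      V.smult_add_left V.smult_add_right V.smult_smult intro!: eqI)
qed

lemma end_alg_eval_lin: "x \<in> carrier V ==> (\<lambda>h. h x) \<in> lin_map (end_alg V) V"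
  by (rule lin_mapI) (auto simp: end_alg_simps lin_map_closed)

section \<open>Idempotent Frobenius systems\<close>

text \<open>The element \<open>e\<close> is written as a finite sum of the pure tensors \<open>e1 i \<otimes> e2 i\<close>.\<close>

locale frob = M: kalg M for M :: "('k::field, 'm) module" (structure) +
  fixes \<psi> :: "'m => 'k" and I :: "'i set" and e1 e2 :: "'i => 'm"
  assumes \<psi>_lin: "\<psi> \<in> lin_map M scalars"
    and I_finite [simp]: "finite I"
    and e1_closed [simp]: "i \<in> I ==> e1 i \<in> carrier M"
    and e2_closed [simp]: "i \<in> I ==> e2 i \<in> carrier M"
    and frob_left: "l \<in> carrier M ==> (\<Oplus>i\<in>I. \<psi> (l \<otimes> e1 i) \<odot> e2 i) = l"
    and frob_right: "l \<in> carrier M ==> (\<Oplus>i\<in>I. \<psi> (e2 i \<otimes> l) \<odot> e1 i) = l"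
    and frob_idem: "(\<Oplus>i\<in>I. e1 i \<otimes> e2 i) = \<one>"
begin

text \<open>
  Both sides equal the double sum of \<open>\<psi>(e2 j m e1 i) \<beta>(e1 j, e2 i)\<close>: expand \<open>m e1 i\<close> on the left and
  \<open>e2 j m\<close> on the right by the Frobenius property.
\<close>

lemma casimir:
  assumes V: "kspace V" and \<beta>: "bilin M M V \<beta>" and m: "m \<in> carrier M"
  shows "(\<Oplus>\<^sub>V i\<in>I. \<beta> (m \<otimes> e1 i) (e2 i)) = (\<Oplus>\<^sub>V i\<in>I. \<beta> (e1 i) (e2 i \<otimes> m))"
proof -
  interpret V: kspace V by fact
  note \<beta>c = bilin_closed[OF \<beta>]
  have 1: "\<beta> (m \<otimes> e1 i) (e2 i) = (\<Oplus>\<^sub>V j\<in>I. \<psi> (e2 j \<otimes> (m \<otimes> e1 i)) \<odot>\<^sub>V \<beta> (e1 j) (e2 i))"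
    if i: "i \<in> I" for i
  proof -
    have "\<beta> (m \<otimes> e1 i) (e2 i) = \<beta> (\<Oplus>j\<in>I. \<psi> (e2 j \<otimes> (m \<otimes> e1 i)) \<odot> e1 j) (e2 i)"
      using frob_right[of "m \<otimes> e1 i"] i m by simp
    also have "\<dots> = (\<Oplus>\<^sub>V j\<in>I. \<beta> (\<psi> (e2 j \<otimes> (m \<otimes> e1 i)) \<odot> e1 j) (e2 i))"
      using i by (intro lin_map_finsum[OF M.ks V bilin_left[OF \<beta>]]) auto
    finally show ?thesis
      using i m by (auto intro!: V.finsum_eqI simp: lin_map_smult[OF bilin_left[OF \<beta>]] \<beta>c)
  qed
  have 2: "\<beta> (e1 j) (e2 j \<otimes> m) = (\<Oplus>\<^sub>V i\<in>I. \<psi> (e2 j \<otimes> (m \<otimes> e1 i)) \<odot>\<^sub>V \<beta> (e1 j) (e2 i))"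
    if j: "j \<in> I" for j
  proof -
    have "\<beta> (e1 j) (e2 j \<otimes> m) = \<beta> (e1 j) (\<Oplus>i\<in>I. \<psi> (e2 j \<otimes> m \<otimes> e1 i) \<odot> e2 i)"
      using frob_left[of "e2 j \<otimes> m"] j m by simp
    also have "\<dots> = (\<Oplus>\<^sub>V i\<in>I. \<beta> (e1 j) (\<psi> (e2 j \<otimes> m \<otimes> e1 i) \<odot> e2 i))"
      using j by (intro lin_map_finsum[OF M.ks V bilin_right[OF \<beta>]]) auto
    finally show ?thesis
      using j m
      by (auto intro!: V.finsum_eqI simp: lin_map_smult[OF bilin_right[OF \<beta>]] \<beta>c M.m_assoc)
  qed
  have "(\<Oplus>\<^sub>V i\<in>I. \<beta> (m \<otimes> e1 i) (e2 i))
      = (\<Oplus>\<^sub>V i\<in>I. \<Oplus>\<^sub>V j\<in>I. \<psi> (e2 j \<otimes> (m \<otimes> e1 i)) \<odot>\<^sub>V \<beta> (e1 j) (e2 i))"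
    by (rule V.finsum_eqI) (auto simp: 1 \<beta>c intro!: V.finsum_closed)
  also have "\<dots> = (\<Oplus>\<^sub>V j\<in>I. \<Oplus>\<^sub>V i\<in>I. \<psi> (e2 j \<otimes> (m \<otimes> e1 i)) \<odot>\<^sub>V \<beta> (e1 j) (e2 i))"
    by (rule V.finsum_swap) (auto simp: \<beta>c)
  also have "\<dots> = (\<Oplus>\<^sub>V j\<in>I. \<beta> (e1 j) (e2 j \<otimes> m))"
    using m by (intro V.finsum_eqI) (auto simp: 2 \<beta>c)
  finally show ?thesis .
qed

text \<open>The element \<open>e\<close> is idempotent for the multiplication of \<open>M\<^sup>o\<^sup>p \<otimes> M\<close>.\<close>

lemma e_idempotent:
  assumes V: "kspace V" and \<beta>: "bilin M M V \<beta>"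
  shows "(\<Oplus>\<^sub>V i\<in>I. \<Oplus>\<^sub>V j\<in>I. \<beta> (e1 j \<otimes> e1 i) (e2 i \<otimes> e2 j)) = (\<Oplus>\<^sub>V i\<in>I. \<beta> (e1 i) (e2 i))"
proof -
  interpret V: kspace V by fact
  note \<beta>c = bilin_closed[OF \<beta>]
  have "(\<Oplus>\<^sub>V i\<in>I. \<beta> (e1 j \<otimes> e1 i) (e2 i \<otimes> e2 j)) = (\<Oplus>\<^sub>V i\<in>I. \<beta> (e1 i) (e2 i \<otimes> e1 j \<otimes> e2 j))"
    if j: "j \<in> I" for j
    by (rule casimir[OF V, of "\<lambda>x y. \<beta> x (y \<otimes> e2 j)"])
      (use j in \<open>auto intro!: bilinI lin_map_comp[OF M.mult_right_lin bilin_right[OF \<beta>]]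
        bilin_left[OF \<beta>]\<close>)
  moreover have "(\<Oplus>\<^sub>V i\<in>I. \<beta> (e1 i) (e2 i \<otimes> e1 j \<otimes> e2 j))
      = (\<Oplus>\<^sub>V i\<in>I. \<beta> (e1 i) (e2 i \<otimes> (e1 j \<otimes> e2 j)))" if "j \<in> I" for j
    using that by (intro V.finsum_eqI) (auto simp: \<beta>c M.m_assoc)
  ultimately have eq: "(\<Oplus>\<^sub>V i\<in>I. \<beta> (e1 j \<otimes> e1 i) (e2 i \<otimes> e2 j))
      = (\<Oplus>\<^sub>V i\<in>I. \<beta> (e1 i) (e2 i \<otimes> (e1 j \<otimes> e2 j)))" if "j \<in> I" for j
    using that by simp
  have "(\<Oplus>\<^sub>V j\<in>I. \<Oplus>\<^sub>V i\<in>I. \<beta> (e1 j \<otimes> e1 i) (e2 i \<otimes> e2 j))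
      = (\<Oplus>\<^sub>V j\<in>I. \<Oplus>\<^sub>V i\<in>I. \<beta> (e1 i) (e2 i \<otimes> (e1 j \<otimes> e2 j)))"
    by (rule V.finsum_eqI) (auto simp: \<beta>c eq intro!: V.finsum_closed)
  also have "\<dots> = (\<Oplus>\<^sub>V i\<in>I. \<Oplus>\<^sub>V j\<in>I. \<beta> (e1 i) (e2 i \<otimes> (e1 j \<otimes> e2 j)))"
    by (rule V.finsum_swap) (auto simp: \<beta>c)
  also have "\<dots> = (\<Oplus>\<^sub>V i\<in>I. \<beta> (e1 i) (e2 i))"
  proof (rule V.finsum_eqI)
    fix i assume i: "i \<in> I"
    have "(\<lambda>x. \<beta> (e1 i) (e2 i \<otimes> x)) \<in> lin_map M V"
      using i by (intro lin_map_comp[OF M.mult_left_lin bilin_right[OF \<beta>]]) auto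
    from lin_map_finsum[OF M.ks V this, of I "\<lambda>j. e1 j \<otimes> e2 j"]
    show "(\<Oplus>\<^sub>V j\<in>I. \<beta> (e1 i) (e2 i \<otimes> (e1 j \<otimes> e2 j))) = \<beta> (e1 i) (e2 i)"
      using i by (simp add: frob_idem)
  qed (auto simp: \<beta>c)
  finally show ?thesis
    by (subst V.finsum_swap) (auto simp: \<beta>c)
qed

end

lemma frob_exists:
  assumes "kalg R" "idempotent_frobenius_system R \<psi> e"
  obtains I :: "('r \<times> 'r) set" and e1 e2 where "frob (R :: ('k::field, 'r) module) \<psi> I e1 e2"
    "e = (\<Oplus>\<^bsub>tensor R R\<^esub>i\<in>I. tens R R (e1 i) (e2 i))"
proof -
  interpret R: kalg R by fact
  interpret RR: two_kalgs R R by unfold_locales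
  have e: "e \<in> carrier (tensor R R)" and \<psi>: "\<psi> \<in> lin_map R scalars"
    using assms(2) unfolding idempotent_frobenius_system_def by auto
  obtain I :: "('r \<times> 'r) set" and f g where I: "finite I" "f \<in> I \<rightarrow> carrier R" "g \<in> I \<rightarrow> carrier R"
    "e = (\<Oplus>\<^bsub>tensor R R\<^esub>i\<in>I. tens R R (f i) (g i))"
    by (rule RR.tensor_sum_rep[OF e])
  have sm: "(\<lambda>c. c \<odot>\<^sub>R x) \<in> lin_map scalars R" if "x \<in> carrier R" for x
    using that by (intro lin_mapI) (auto simp: R.smult_add_left R.smult_smult)
  have b1: "bilin R R R (\<lambda>x y. \<psi> (l \<otimes>\<^sub>R x) \<odot>\<^sub>R y)" if "l \<in> carrier R" for l
    using that
    by (intro bilinI R.smult_lin lin_map_comp[OF R.mult_left_lin lin_map_comp[OF \<psi> sm]])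
  have b2: "bilin R R R (\<lambda>x y. \<psi> (y \<otimes>\<^sub>R l) \<odot>\<^sub>R x)" if "l \<in> carrier R" for l
    using that
    by (intro bilinI R.smult_lin lin_map_comp[OF R.mult_right_lin lin_map_comp[OF \<psi> sm]])
  have b3: "bilin R R R (\<lambda>x y. x \<otimes>\<^sub>R y)"
    by (intro bilinI R.mult_left_lin R.mult_right_lin)
  have fg: "f i \<in> carrier R" "g i \<in> carrier R" if "i \<in> I" for i using I that by auto
  have sum: "tlift R \<beta> e = (\<Oplus>\<^sub>R i\<in>I. \<beta> (f i) (g i))" if "bilin R R R \<beta>" for \<beta>
    unfolding I(4) by (rule RR.tlift_sum[OF R.ks that]) (use fg in auto)
  note F = assms(2)[unfolded idempotent_frobenius_system_def]
  have "frob R \<psi> I f g"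
  proof
    fix l assume l: "l \<in> carrier R"
    show "(\<Oplus>\<^sub>R i\<in>I. \<psi> (l \<otimes>\<^sub>R f i) \<odot>\<^sub>R g i) = l"
      "(\<Oplus>\<^sub>R i\<in>I. \<psi> (g i \<otimes>\<^sub>R l) \<odot>\<^sub>R f i) = l"
      using F l sum[OF b1[OF l]] sum[OF b2[OF l]] by auto
  next
    show "(\<Oplus>\<^sub>R i\<in>I. f i \<otimes>\<^sub>R g i) = \<one>\<^sub>R"
      using F sum[OF b3] by auto
  qed (use I(1) fg \<psi> in auto)
  then show ?thesis using I(4) by (rule that)
qed

text \<open>The function with the single value \<open>r\<close> at \<open>l\<close>, which is \<open>r\<^sub>M \<delta>\<^sub>l\<close>.\<close>

definition pt :: "('k, 'r) module => 'l => 'r => 'l => 'r" where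
  "pt R l r = (\<lambda>m. if m = l then r else \<zero>\<^sub>R)"

lemma (in kalg) pt_closed [simp]: "r \<in> carrier A ==> pt A l r \<in> carrier (fun_alg A)"
  by (auto simp: pt_def)

lemma (in kalg) pt_closed' [simp]: "r \<in> carrier A ==> pt A l r m \<in> carrier A"
  by (auto simp: pt_def)

lemma (in kalg) cst_delta: "r \<in> carrier A ==> cst r \<otimes>\<^bsub>fun_alg A\<^esub> delta A l = pt A l r"
  by (auto simp: pt_def cst_def delta_def)

lemma (in kalg) delta_pt: "delta A l = pt A l \<one>"
  by (auto simp: pt_def delta_def)

lemma (in kalg) pt_lin: "pt A l \<in> lin_map A (fun_alg A)"
  by (rule lin_mapI) (auto simp: pt_def)

text \<open>
  The system of \<open>R\<close> is repeated at every point of the finite base; the index set is therefore a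
  product.
\<close>

lemma frob_fun_alg:
  assumes "frob R \<psi> I e1 e2"
  shows "frob (fun_alg R) (frob_form \<psi> :: ('l::finite => 'r) => 'k::field) (UNIV \<times> I)
    (\<lambda>(l, i). pt R l (e1 i)) (\<lambda>(l, i). pt R l (e2 i))"
proof -
  interpret frob R \<psi> I e1 e2 by fact
  let ?M = "fun_alg R :: ('k, 'l => 'r) module"
  interpret FA: kalg ?M by (rule kalg_fun_alg) unfold_locales
  have \<psi>0: "\<psi> \<zero>\<^sub>R = 0"
    using lin_map_zero[OF M.ks kspace_scalars \<psi>_lin] by simp
  have fl: "frob_form \<psi> (f \<otimes>\<^sub>?M pt R l x) = \<psi> (f l \<otimes>\<^sub>R x)"
    "frob_form \<psi> (pt R l x \<otimes>\<^sub>?M f) = \<psi> (x \<otimes>\<^sub>R f l)"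
    if "f \<in> carrier ?M" "x \<in> carrier R" for f l x
  proof -
    have "(\<Sum>m\<in>UNIV. \<psi> (f m \<otimes>\<^sub>R (if m = l then x else \<zero>\<^sub>R)))
        = (\<Sum>m\<in>UNIV. if m = l then \<psi> (f l \<otimes>\<^sub>R x) else 0)"
      "(\<Sum>m\<in>UNIV. \<psi> ((if m = l then x else \<zero>\<^sub>R) \<otimes>\<^sub>R f m))
        = (\<Sum>m\<in>UNIV. if m = l then \<psi> (x \<otimes>\<^sub>R f l) else 0)"
      using that by (intro sum.cong refl; simp add: \<psi>0)+
    then show "frob_form \<psi> (f \<otimes>\<^sub>?M pt R l x) = \<psi> (f l \<otimes>\<^sub>R x)"
      "frob_form \<psi> (pt R l x \<otimes>\<^sub>?M f) = \<psi> (x \<otimes>\<^sub>R f l)"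
      by (simp_all add: frob_form_def pt_def)
  qed
  have point: "(\<Oplus>\<^sub>?M p\<in>UNIV \<times> I. h p) = f"
    if h: "\<And>l i. i \<in> I ==> h (l, i) = pt R l (k l i)"
      and k: "\<And>l i. i \<in> I ==> k l i \<in> carrier R" and s: "\<And>l. (\<Oplus>\<^sub>R i\<in>I. k l i) = f l" for h k f
  proof
    fix m
    have "(\<Oplus>\<^sub>?M p\<in>UNIV \<times> I. h p) m = (\<Oplus>\<^sub>R p\<in>UNIV \<times> I. h p m)"
      by (rule fun_alg_finsum[OF M.kalg_axioms]) (use h k in auto)
    also have "\<dots> = (\<Oplus>\<^sub>R p\<in>UNIV \<times> I. case p of (l, i) => if l = m then k l i else \<zero>\<^sub>R)"
      by (rule M.finsum_eqI) (use k in \<open>auto simp: h pt_def\<close>)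
    also have "\<dots> = (\<Oplus>\<^sub>R l\<in>UNIV. \<Oplus>\<^sub>R i\<in>I. if l = m then k l i else \<zero>\<^sub>R)"
      by (rule M.finsum_Times[symmetric]) (use k in auto)
    also have "\<dots> = (\<Oplus>\<^sub>R l\<in>UNIV. if l = m then \<Oplus>\<^sub>R i\<in>I. k l i else \<zero>\<^sub>R)"
      by (rule M.finsum_eqI) (use k in \<open>auto simp: M.finsum_zero intro!: M.finsum_closed\<close>)
    also have "\<dots> = (\<Oplus>\<^sub>R i\<in>I. k m i)"
      by (subst M.finsum_delta) (use k in \<open>auto intro!: M.finsum_closed\<close>)
    also have "\<dots> = f m" by (rule s)
    finally show "(\<Oplus>\<^sub>?M p\<in>UNIV \<times> I. h p) m = f m" .
  qed
  have ptc: "c \<odot>\<^sub>?M pt R l x = pt R l (c \<odot>\<^sub>R x)" if "x \<in> carrier R" for c l x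
    by (rule lin_map_smult[OF M.pt_lin that, symmetric])
  show ?thesis
  proof
    show "frob_form \<psi> \<in> lin_map ?M scalars"
      by (rule lin_mapI) (auto simp: frob_form_def sum.distrib sum_distrib_left
        lin_map_add[OF \<psi>_lin] lin_map_smult[OF \<psi>_lin])
    fix f assume f: "f \<in> carrier ?M"
    show "(\<Oplus>\<^sub>?M p\<in>UNIV \<times> I. frob_form \<psi> (f \<otimes>\<^sub>?M (case p of (l, i) => pt R l (e1 i)))
        \<odot>\<^sub>?M (case p of (l, i) => pt R l (e2 i))) = f"
      by (rule point[where k = "\<lambda>l i. \<psi> (f l \<otimes>\<^sub>R e1 i) \<odot>\<^sub>R e2 i"])
        (use f in \<open>auto simp: fl ptc frob_left simp del: fun_alg_simps(4,6)\<close>)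
    show "(\<Oplus>\<^sub>?M p\<in>UNIV \<times> I. frob_form \<psi> ((case p of (l, i) => pt R l (e2 i)) \<otimes>\<^sub>?M f)
        \<odot>\<^sub>?M (case p of (l, i) => pt R l (e1 i))) = f"
      by (rule point[where k = "\<lambda>l i. \<psi> (e2 i \<otimes>\<^sub>R f l) \<odot>\<^sub>R e1 i"])
        (use f in \<open>auto simp: fl ptc frob_right simp del: fun_alg_simps(4,6)\<close>)
  next
    show "(\<Oplus>\<^sub>?M p\<in>UNIV \<times> I. (case p of (l, i) => pt R l (e1 i))
        \<otimes>\<^sub>?M (case p of (l, i) => pt R l (e2 i))) = \<one>\<^sub>?M"
      by (rule point[where k = "\<lambda>l i. e1 i \<otimes>\<^sub>R e2 i"]) (auto simp: frob_idem pt_def)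
  qed auto
qed

lemma frob_elt_sum:
  assumes "frob R \<psi> I e1 e2" and e: "e = (\<Oplus>\<^bsub>tensor R R\<^esub>i\<in>I. tens R R (e1 i) (e2 i))"
  defines "M \<equiv> fun_alg R :: ('k::field, 'l::finite => 'r) module"
  shows "(frob_elt R e :: ('k, 'l => 'r, 'l => 'r) tens) = (\<Oplus>\<^bsub>tensor M M\<^esub>p\<in>UNIV \<times> I.
    tens M M (case p of (l, i) => pt R l (e1 i)) (case p of (l, i) => pt R l (e2 i)))"
proof -
  interpret R: frob R \<psi> I e1 e2 by fact
  interpret RR: two_kalgs R R by unfold_locales
  interpret M: kalg M unfolding M_def by (rule kalg_fun_alg) unfold_locales
  interpret MM: two_kalgs M M by unfold_locales
  have b: "bilin R R (tensor M M) (\<lambda>x y. tens M M (pt R l x) (pt R l y))" for l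
    using bilin_comp[OF MM.tens_bilin] R.M.pt_lin[of l] unfolding M_def by blast
  have cd: "cst r \<otimes>\<^sub>M delta R l = pt R l r" if "r \<in> carrier R" for r l
    unfolding M_def by (rule R.M.cst_delta[OF that])
  have ec: "e \<in> carrier (tensor R R)" unfolding e by (auto intro!: RR.T.finsum_closed)
  have "frob_elt R e = (\<Oplus>\<^bsub>tensor M M\<^esub>l\<in>UNIV. tlift (tensor M M)
      (\<lambda>x y. tens M M (pt R l x) (pt R l y)) e)"
    unfolding frob_elt_def M_def[symmetric]
    by (rule MM.T.finsum_eqI, rule RR.tlift_cong[OF ec])
      (simp_all only: cd MM.T.ks lin_map_closed[OF RR.tlift_lin[OF MM.T.ks b] ec]
        bilin_closed[OF b])
  also have "\<dots> = (\<Oplus>\<^bsub>tensor M M\<^esub>l\<in>UNIV. \<Oplus>\<^bsub>tensor M M\<^esub>i\<in>I.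
      tens M M (pt R l (e1 i)) (pt R l (e2 i)))"
    unfolding e by (rule MM.T.finsum_eqI) (auto simp: RR.tlift_sum[OF MM.T.ks b]
      intro!: MM.T.finsum_closed bilin_closed[OF b])
  also have "\<dots> = (\<Oplus>\<^bsub>tensor M M\<^esub>p\<in>UNIV \<times> I.
    case p of (l, i) => tens M M (pt R l (e1 i)) (pt R l (e2 i)))"
    by (rule MM.T.finsum_Times) (auto intro!: bilin_closed[OF b])
  finally show ?thesis by (simp add: case_prod_unfold)
qed

section \<open>The comultiplication of the weak bialgebra of a left bialgebroid\<close>

locale base_maps = A: kalg A + frob M \<psi> I e1 e2
  for A :: "('k::field, 'a) module" (structure) and M :: "('k, 'm) module" and \<psi> I
    and e1 e2 :: "'i => 'm" +
  fixes s t :: "'m => 'a"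
  assumes s_lin: "s \<in> lin_map M A" and t_lin: "t \<in> lin_map M A"
    and s_mult: "[|f \<in> carrier M; g \<in> carrier M|] ==> s (f \<otimes>\<^sub>M g) = s f \<otimes> s g"
    and t_mult: "[|f \<in> carrier M; g \<in> carrier M|] ==> t (f \<otimes>\<^sub>M g) = t g \<otimes> t f"
begin

sublocale AA: two_kalgs A A by unfold_locales

lemmas s_closed [simp] = lin_map_closed[OF s_lin]
lemmas t_closed [simp] = lin_map_closed[OF t_lin]

definition E where "E = (\<Oplus>\<^bsub>tensor A A\<^esub>i\<in>I. tens A A (t (e1 i)) (s (e2 i)))"

lemma E_closed [simp]: "E \<in> carrier (tensor A A)"
  unfolding E_def by (auto intro!: AA.T.finsum_closed)

abbreviation "null \<equiv> tensor_over_null A M s t"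

abbreviation "gens \<equiv> {tens A A (t l \<otimes> a) b \<ominus>\<^bsub>tensor A A\<^esub> tens A A a (s l \<otimes> b) | l a b.
  l \<in> carrier M \<and> a \<in> carrier A \<and> b \<in> carrier A}"

lemma gens_closed: "gens \<subseteq> carrier (tensor A A)"
  by auto

lemma null_sub: "submodule null scalars (tensor A A)"
  unfolding tensor_over_null_def by (rule lin_hull_subspace[OF AA.T.ks gens_closed])

lemma null_carrier: "u \<in> null ==> u \<in> carrier (tensor A A)"
  using subspace_subset[OF null_sub AA.T.ks] by auto

lemma gens_null:
  "[|l \<in> carrier M; a \<in> carrier A; b \<in> carrier A|] ==>
   tens A A (t l \<otimes> a) b \<ominus>\<^bsub>tensor A A\<^esub> tens A A a (s l \<otimes> b) \<in> null"
  unfolding tensor_over_null_def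
  by (rule subsetD[OF lin_hull_superset[OF AA.T.ks gens_closed]]) auto

text \<open>Membership in the null space may be checked on generators.\<close>

lemma null_image:
  assumes h: "h \<in> lin_map (tensor A A) W" and W: "kspace W" and U: "submodule U scalars W"
    and "\<And>l a b. [|l \<in> carrier M; a \<in> carrier A; b \<in> carrier A|] ==>
      h (tens A A (t l \<otimes> a) b) \<ominus>\<^sub>W h (tens A A a (s l \<otimes> b)) \<in> U"
    and "u \<in> null"
  shows "h u \<in> U"
  by (rule lin_hull_image[OF AA.T.ks W h U gens_closed _
        assms(5)[unfolded tensor_over_null_def]])
    (use assms(4) in \<open>auto simp: lin_map_minus[OF AA.T.ks W h]\<close>)

lemma null_right:
  assumes u: "u \<in> null" and x: "x \<in> carrier (tensor A A)"
  shows "u \<otimes>\<^bsub>tensor A A\<^esub> x \<in> null"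
  using x
proof (induction rule: AA.tensor_induct)
  case (pure x y)
  show ?case
    by (rule null_image[OF AA.T.mult_right_lin AA.T.ks null_sub _ u])
      (use pure gens_null in \<open>auto simp: AA.tens_mult A.m_assoc\<close>)
next
  case (add x y)
  then show ?case
    using u subspace_add[OF null_sub AA.T.ks] by (simp add: AA.T.r_distr null_carrier)
qed

lemma E_mult_pure:
  assumes "a \<in> carrier A" "b \<in> carrier A"
  shows "E \<otimes>\<^bsub>tensor A A\<^esub> tens A A a b
    = (\<Oplus>\<^bsub>tensor A A\<^esub>i\<in>I. tens A A (t (e1 i) \<otimes> a) (s (e2 i) \<otimes> b))"
  unfolding E_def using assms
  by (subst AA.T.finsum_ldistr) (auto intro!: AA.T.finsum_eqI simp: AA.tens_mult)

text \<open>The Casimir property of \<open>e\<close> makes left multiplication by \<open>E\<close> balanced over \<open>M\<close>.\<close>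

lemma E_null:
  assumes "u \<in> null" shows "E \<otimes>\<^bsub>tensor A A\<^esub> u = \<zero>\<^bsub>tensor A A\<^esub>"
proof -
  have "E \<otimes>\<^bsub>tensor A A\<^esub> tens A A (t l \<otimes> a) b = E \<otimes>\<^bsub>tensor A A\<^esub> tens A A a (s l \<otimes> b)"
    if "l \<in> carrier M" "a \<in> carrier A" "b \<in> carrier A" for l a b
  proof -
    have *: "bilin M M (tensor A A) (\<lambda>x y. tens A A (t x \<otimes> a) (s y \<otimes> b))"
      using that by (intro bilinI
          lin_map_comp[OF lin_map_comp[OF t_lin A.mult_right_lin] bilin_left[OF AA.tens_bilin]]
          lin_map_comp[OF lin_map_comp[OF s_lin A.mult_right_lin] bilin_right[OF AA.tens_bilin]])
        auto
    have "(\<Oplus>\<^bsub>tensor A A\<^esub>i\<in>I. tens A A (t (e1 i) \<otimes> (t l \<otimes> a)) (s (e2 i) \<otimes> b))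
        = (\<Oplus>\<^bsub>tensor A A\<^esub>i\<in>I. tens A A (t (l \<otimes>\<^sub>M e1 i) \<otimes> a) (s (e2 i) \<otimes> b))"
      using that by (intro AA.T.finsum_eqI) (auto simp: t_mult A.m_assoc)
    also have "\<dots> = (\<Oplus>\<^bsub>tensor A A\<^esub>i\<in>I. tens A A (t (e1 i) \<otimes> a) (s (e2 i \<otimes>\<^sub>M l) \<otimes> b))"
      using casimir[OF AA.T.ks * that(1)] .
    also have "\<dots> = (\<Oplus>\<^bsub>tensor A A\<^esub>i\<in>I. tens A A (t (e1 i) \<otimes> a) (s (e2 i) \<otimes> (s l \<otimes> b)))"
      using that by (intro AA.T.finsum_eqI) (auto simp: s_mult A.m_assoc)
    finally show ?thesis using that by (simp add: E_mult_pure)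
  qed
  then have "E \<otimes>\<^bsub>tensor A A\<^esub> u \<in> {\<zero>\<^bsub>tensor A A\<^esub>}"
    by (intro null_image[OF AA.T.mult_left_lin AA.T.ks
          zero_subspace[OF AA.T.ks] _ assms])
      (auto simp: AA.T.minus_eq_zero_iff)
  then show ?thesis by simp
qed

lemma kspace_over: "kspace (tensor_over A M s t)"
  unfolding tensor_over_def by (rule kspace_quot[OF AA.T.ks null_sub])

lemma over_proj_lin: "(\<lambda>x. null +>\<^bsub>tensor A A\<^esub> x) \<in> lin_map (tensor A A) (tensor_over A M s t)"
  unfolding tensor_over_def by (rule proj_lin[OF AA.T.ks null_sub])

lemma tens_over_closed:
  "[|a \<in> carrier A; b \<in> carrier A|] ==> tens_over A M s t a b \<in> carrier (tensor_over A M s t)"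
  unfolding tens_over_def by (rule lin_map_closed[OF over_proj_lin]) auto

definition W where "W = induced (\<lambda>x. E \<otimes>\<^bsub>tensor A A\<^esub> x)"

lemma W_lin: "W \<in> lin_map (tensor_over A M s t) (tensor A A)"
  unfolding W_def tensor_over_def
  by (rule induced_lin[OF AA.T.ks null_sub AA.T.ks AA.T.mult_left_lin])
    (auto simp: E_null)

lemma W_coset: "x \<in> carrier (tensor A A) ==> W (null +>\<^bsub>tensor A A\<^esub> x) = E \<otimes>\<^bsub>tensor A A\<^esub> x"
  unfolding W_def
  by (rule induced_coset[OF AA.T.ks null_sub AA.T.ks AA.T.mult_left_lin])
    (auto simp: E_null)

lemma wb_comult_eq:
  assumes e: "e = (\<Oplus>\<^bsub>tensor M M\<^esub>i\<in>I. tens M M (e1 i) (e2 i))"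
    and D: "D a \<in> carrier (tensor_over A M s t)"
  shows "wb_comult A s t e D a = W (D a)"
proof -
  interpret MM: two_kalgs M M by unfold_locales
  let ?h = "\<lambda>X. tlift (tensor A A) (\<lambda>e1 e2. tlift (tensor A A)
       (\<lambda>a1 a2. tens A A (t e1 \<otimes> a1) (s e2 \<otimes> a2)) X) e"
  have ec: "e \<in> carrier (tensor M M)" unfolding e by (auto intro!: MM.T.finsum_closed)
  have in_eq: "tlift (tensor A A) (\<lambda>a1 a2. tens A A (t x \<otimes> a1) (s y \<otimes> a2)) X
      = tens A A (t x) (s y) \<otimes>\<^bsub>tensor A A\<^esub> X"
    if "x \<in> carrier M" "y \<in> carrier M" "X \<in> carrier (tensor A A)" for x y X
  proof -
    have b: "bilin A A (tensor A A) (\<lambda>a1 a2. tens A A (t x \<otimes> a1) (s y \<otimes> a2))"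
      using that by (intro bilinI lin_map_comp[OF A.mult_left_lin bilin_left[OF AA.tens_bilin]]
          lin_map_comp[OF A.mult_left_lin bilin_right[OF AA.tens_bilin]]) auto
    show ?thesis
      by (rule AA.tensor_map_eqI[OF AA.tlift_lin[OF AA.T.ks b] AA.T.mult_left_lin])
        (use that in \<open>auto simp: AA.tlift_tens[OF AA.T.ks b] AA.tens_mult\<close>)
  qed
  have h: "?h X = E \<otimes>\<^bsub>tensor A A\<^esub> X" if X: "X \<in> carrier (tensor A A)" for X
  proof -
    have b: "bilin M M (tensor A A) (\<lambda>x y. tens A A (t x) (s y) \<otimes>\<^bsub>tensor A A\<^esub> X)"
      using X by (intro bilinI
          lin_map_comp[OF lin_map_comp[OF t_lin bilin_left[OF AA.tens_bilin]] AA.T.mult_right_lin]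
          lin_map_comp[OF lin_map_comp[OF s_lin bilin_right[OF AA.tens_bilin]] AA.T.mult_right_lin])
        auto
    have "?h X = tlift (tensor A A) (\<lambda>x y. tens A A (t x) (s y) \<otimes>\<^bsub>tensor A A\<^esub> X) e"
      using X by (intro MM.tlift_cong[OF ec _ AA.T.ks]) (auto simp: in_eq)
    also have "\<dots> = E \<otimes>\<^bsub>tensor A A\<^esub> X"
      unfolding e E_def using X
      by (subst MM.tlift_sum[OF AA.T.ks b], simp_all)
        (rule AA.T.finsum_ldistr[symmetric], auto)
    finally show ?thesis .
  qed
  obtain x where x: "x \<in> carrier (tensor A A)" "D a = null +>\<^bsub>tensor A A\<^esub> x" "induced ?h (D a) = ?h x"
    using D unfolding tensor_over_def
    by (rule induced_representative[OF AA.T.ks null_sub])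
  then show ?thesis unfolding wb_comult_def by (simp add: h W_coset)
qed

end

section \<open>Paths and the path algebra\<close>

lemma paths_0: "paths X deg 0 = {(l, []) | l. True}"
  unfolding paths_def by auto

lemma paths_Nil [simp]: "(l, []) \<in> paths X deg n \<longleftrightarrow> n = 0"
  unfolding paths_def by auto

lemma paths_Cons [simp]:
  "(l, q # qs) \<in> paths X deg n \<longleftrightarrow>
     fst q = l \<and> snd q \<in> X \<and> n = Suc (length qs) \<and> (atgt deg q, qs) \<in> paths X deg (length qs)"
proof -
  have "(\<forall>i. Suc i < Suc (length qs) --> atgt deg ((q # qs) ! i) = fst ((q # qs) ! Suc i)) \<longleftrightarrow>
      (qs \<noteq> [] --> atgt deg q = fst (hd qs)) \<and>
      (\<forall>i. Suc i < length qs --> atgt deg (qs ! i) = fst (qs ! Suc i))"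
  proof -
    have split: "(\<forall>i. P i) \<longleftrightarrow> P 0 \<and> (\<forall>i. P (Suc i))" for P :: "nat => bool"
      by (metis not0_implies_Suc)
    show ?thesis by (subst split) (cases qs; auto)
  qed
  then show ?thesis
    unfolding paths_def by (cases q) auto
qed

lemma paths_length: "p \<in> paths X deg n ==> length (snd p) = n"
  unfolding paths_def by auto

lemma ptgt_simps [simp]: "ptgt deg (l, []) = l" "ptgt deg (l, q # qs) = ptgt deg (atgt deg q, qs)"
  by (auto simp: ptgt_def)

lemma psrc_simps [simp]: "psrc (l, qs) = l" "psrc (pconc p p') = psrc p"
  by (auto simp: psrc_def pconc_def)

lemma pconc_simps [simp]:
  "pconc (l, []) p = (l, snd p)" "pconc (l, q # qs) p = (l, q # snd (pconc (atgt deg q, qs) p))"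
  "pconc p (l, []) = p"
  by (auto simp: pconc_def)

lemma pconc_assoc: "pconc (pconc p p') p'' = pconc p (pconc p' p'')"
  by (auto simp: pconc_def)

lemma pconc_paths_iff:
  assumes "length (snd p) = n"
  shows "(p \<in> paths X deg n \<and> p' \<in> paths X deg m \<and> ptgt deg p = psrc p') \<longleftrightarrow>
         (pconc p p' \<in> paths X deg (n + m) \<and> length (snd p') = m \<and> ptgt deg p = psrc p')"
proof -
  obtain l qs where p: "p = (l, qs)" by fastforce
  obtain l' qs' where p': "p' = (l', qs')" by fastforce
  show ?thesis using assms unfolding p p'
  proof (induction qs arbitrary: l n)
    case Nil
    then show ?case by (cases qs') (auto dest: paths_length)
  next
    case (Cons q qs)
    from Cons.IH[of "atgt deg q" "length qs"] Cons.prems show ?case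
      by (auto dest: paths_length simp: pconc_def)
  qed
qed

lemma pconc_paths:
  "[|p \<in> paths X deg n; p' \<in> paths X deg m; ptgt deg p = psrc p'|] ==> pconc p p' \<in> paths X deg (n + m)"
  using pconc_paths_iff[of p n X deg p' m] paths_length[of p X deg n] by auto

lemma ptgt_pconc: "ptgt deg p = psrc p' ==> ptgt deg (pconc p p') = ptgt deg p'"
  by (cases p; cases p') (auto simp: ptgt_def pconc_def psrc_def)

lemma finite_paths:
  assumes "finite X" shows "finite (paths X deg n :: ('l::finite, 'x) path set)"
proof -
  have "paths X deg n \<subseteq> (UNIV :: 'l set) \<times> {qs. set qs \<subseteq> UNIV \<times> X \<and> length qs = n}"
    unfolding paths_def by auto
  moreover have "finite \<dots>" using assms by (intro finite_cartesian_product finite_lists_length_eq) auto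
  ultimately show ?thesis by (rule finite_subset)
qed

text \<open>A path of length \<open>n + m\<close> factors uniquely into paths of lengths \<open>n\<close> and \<open>m\<close>.\<close>

lemma paths_split_bij:
  "bij_betw (\<lambda>(u, u'). pconc u u')
     {(u, u'). u \<in> paths X deg n \<and> u' \<in> paths X deg m \<and> ptgt deg u = psrc u'} (paths X deg (n + m))"
  unfolding bij_betw_def
proof
  show "inj_on (\<lambda>(u, u'). pconc u u')
      {(u, u'). u \<in> paths X deg n \<and> u' \<in> paths X deg m \<and> ptgt deg u = psrc u'}"
  proof (rule inj_onI, clarsimp)
    fix l qs qs' k rs rs'
    assume a: "(l, qs) \<in> paths X deg n" "(k, rs) \<in> paths X deg n"
      "pconc (l, qs) (ptgt deg (l, qs), qs') = pconc (k, rs) (ptgt deg (k, rs), rs')"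
    then show "l = k \<and> qs = rs \<and> ptgt deg (l, qs) = ptgt deg (k, rs) \<and> qs' = rs'"
      using paths_length[OF a(1)] paths_length[OF a(2)] by (auto simp: pconc_def)
  qed
  show "(\<lambda>(u, u'). pconc u u') `
      {(u, u'). u \<in> paths X deg n \<and> u' \<in> paths X deg m \<and> ptgt deg u = psrc u'} = paths X deg (n + m)"
  proof
    show "paths X deg (n + m) \<subseteq> (\<lambda>(u, u'). pconc u u') `
      {(u, u'). u \<in> paths X deg n \<and> u' \<in> paths X deg m \<and> ptgt deg u = psrc u'}"
    proof
      fix v assume v: "v \<in> paths X deg (n + m)"
      obtain l vs where l: "v = (l, vs)" by fastforce
      define u where "u = (l, take n vs)"
      define u' where "u' = (ptgt deg u, drop n vs)"
      have len: "length vs = n + m" using paths_length[OF v] l by simp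
      have "pconc u u' = v" by (simp add: u_def u'_def pconc_def l)
      then have "u \<in> paths X deg n" "u' \<in> paths X deg m" "ptgt deg u = psrc u'"
        using pconc_paths_iff[of u n X deg u' m] v len by (auto simp: u_def u'_def)
      then show "v \<in> (\<lambda>(u, u'). pconc u u') `
        {(u, u'). u \<in> paths X deg n \<and> u' \<in> paths X deg m \<and> ptgt deg u = psrc u'}"
        using \<open>pconc u u' = v\<close> by force
    qed
    show "(\<lambda>(u, u'). pconc u u') `
      {(u, u'). u \<in> paths X deg n \<and> u' \<in> paths X deg m \<and> ptgt deg u = psrc u'} \<subseteq> paths X deg (n + m)"
      by (rule image_subsetI) (auto simp del: psrc_simps intro: pconc_paths)
  qed
qed

lemma (in abelian_monoid) finsum_paths:
  fixes f :: "('l::finite, 'x) path => 'a"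
  assumes "finite X" "\<And>v. v \<in> paths X deg (n + m) ==> f v \<in> carrier G"
  shows "(\<Oplus>u\<in>paths X deg n. \<Oplus>u'\<in>paths X deg m. if ptgt deg u = psrc u' then f (pconc u u') else \<zero>)
    = (\<Oplus>v\<in>paths X deg (n + m). f v)"
proof -
  let ?P = "{(u, u'). u \<in> paths X deg n \<and> u' \<in> paths X deg m \<and> ptgt deg u = psrc u'}"
  note fin = finite_paths[OF assms(1), of deg]
  have c: "f (pconc u u') \<in> carrier G"
    if "u \<in> paths X deg n" "u' \<in> paths X deg m" "ptgt deg u = psrc u'" for u u'
    using assms(2) pconc_paths that by blast
  have "(\<Oplus>u\<in>paths X deg n. \<Oplus>u'\<in>paths X deg m. if ptgt deg u = psrc u' then f (pconc u u') else \<zero>)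
    = (\<Oplus>p\<in>paths X deg n \<times> paths X deg m. case p of (u, u') =>
        if ptgt deg u = psrc u' then f (pconc u u') else \<zero>)"
    by (rule finsum_Times) (use fin c in auto)
  also have "\<dots> = (\<Oplus>p\<in>?P. case p of (u, u') => if ptgt deg u = psrc u' then f (pconc u u') else \<zero>)"
    by (rule finsum_restrict) (use fin c in \<open>auto split: if_splits\<close>)
  also have "\<dots> = (\<Oplus>p\<in>?P. f ((\<lambda>(u, u'). pconc u u') p))"
    by (rule finsum_eqI) (use c in auto)
  also have "\<dots> = (\<Oplus>v\<in>(\<lambda>(u, u'). pconc u u') ` ?P. f v)"
    using paths_split_bij[of X deg n m]
      assms(2) by (intro finsum_reindex[symmetric]) (auto simp: bij_betw_def)
  also have "\<dots> = (\<Oplus>v\<in>paths X deg (n + m). f v)"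
    using paths_split_bij[of X deg n m] by (simp add: bij_betw_def)
  finally show ?thesis .
qed

lemma pm_lin_sum:
  assumes V: "kspace V" and h: "h \<in> lin_map (pm_alg S m u) V" and "finite T"
    and "\<And>i. i \<in> T ==> keys (f i) \<subseteq> S"
  shows "h (\<Sum>i\<in>T. f i) = (\<Oplus>\<^sub>V i\<in>T. h (f i))"
  using assms(3,4)
proof (induction T rule: finite_induct)
  case empty
  interpret V: kspace V by fact
  show ?case using lin_map_zero[OF kspace_pm_alg V h] by simp
next
  case (insert i T)
  interpret V: kspace V by fact
  have c: "h (f j) \<in> carrier V" if "j \<in> insert i T" for j
    using lin_map_closed[OF h] insert.prems that by auto
  have "h (f i + (\<Sum>i\<in>T. f i)) = h (f i) \<oplus>\<^sub>V h (\<Sum>i\<in>T. f i)"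
    using lin_map_add[OF h, of "f i" "\<Sum>i\<in>T. f i"] insert.prems keys_sum_subset[of T f S] by auto
  then show ?case using insert c by (simp add: V.finsum_insert)
qed

lemma pm_alg_finsum:
  assumes "finite T" "\<And>i. i \<in> T ==> keys (f i) \<subseteq> S"
  shows "(\<Oplus>\<^bsub>pm_alg S m u\<^esub>i\<in>T. f i) = (\<Sum>i\<in>T. f i)"
  by (rule pm_lin_sum[OF kspace_pm_alg, symmetric, of "\<lambda>x. x" S m u])
    (use assms in \<open>auto intro!: lin_mapI\<close>)

definition path_pairs :: "'x set => ('x => 'l => 'l) => (('l, 'x) path \<times> ('l, 'x) path) set" where
  "path_pairs X deg = (\<Union>n. paths X deg n \<times> paths X deg n)"

definition path_mult ::
    "('x => 'l => 'l) => ('l, 'x) path \<times> ('l, 'x) path => ('l, 'x) path \<times> ('l, 'x) path =>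
     ('k::field, 'l, 'x) path_pairs" where
  "path_mult deg x y =
     (if ptgt deg (fst x) = psrc (fst y) \<and> ptgt deg (snd x) = psrc (snd y)
      then ebas (pconc (fst x) (fst y)) (pconc (snd x) (snd y)) else 0)"

abbreviation path_one :: "('k::field, 'l::finite, 'x) path_pairs" where
  "path_one \<equiv> \<Sum>l\<in>UNIV. \<Sum>m\<in>UNIV. ebas (l, []) (m, [])"

lemma path_alg_pm: "path_alg X deg = pm_alg (path_pairs X deg) (path_mult deg) path_one"
  unfolding path_alg_def pm_alg_def path_pairs_def
  by (auto simp: case_prod_unfold path_mult_def ebas_def fun_eq_iff intro!: sum.cong)

lemma path_pairsI: "[|p \<in> paths X deg n; q \<in> paths X deg n|] ==> (p, q) \<in> path_pairs X deg"
  unfolding path_pairs_def by auto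

lemma path_pairsE:
  assumes "x \<in> path_pairs X deg"
  obtains n p q where "x = (p, q)" "p \<in> paths X deg n" "q \<in> paths X deg n"
  using assms unfolding path_pairs_def by auto

lemma keys_ebas [simp]: "keys (ebas p q :: ('k::field, 'l, 'x) path_pairs) = {(p, q)}"
  by (simp add: ebas_def)

lemma keys_path_mult:
  "[|x \<in> path_pairs X deg; y \<in> path_pairs X deg|] ==>
   keys (path_mult deg x y :: ('k::field, 'l, 'x) path_pairs) \<subseteq> path_pairs X deg"
  by (auto simp: path_mult_def elim!: path_pairsE
      intro!: path_pairsI[OF pconc_paths pconc_paths])

lemma keys_path_one: "keys (path_one :: ('k::field, 'l::finite, 'x) path_pairs) \<subseteq> path_pairs X deg"
  by (intro keys_sum_subset) (auto intro: path_pairsI[of _ _ _ 0])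

lemma path_mult_ebas:
  "ebas p q \<otimes>\<^bsub>path_alg X deg\<^esub> ebas p' q' = (path_mult deg (p, q) (p', q') :: ('k::field, 'l::finite, 'x) path_pairs)"
  unfolding path_alg_pm by (simp add: ebas_def pm_alg_mult_single)

lemma kalg_path_alg: "kalg (path_alg X deg :: ('k::field, ('k, 'l::finite, 'x) path_pairs) module)"
  unfolding path_alg_pm
proof (rule kalg_pm_alg)
  let ?A = "path_alg X deg :: ('k, ('k, 'l, 'x) path_pairs) module"
  let ?P = "path_pairs X deg"
  have b: "(single x 1 :: ('k, 'l, 'x) path_pairs) = ebas (fst x) (snd x)" for x
    by (simp add: ebas_def)
  have b0: "(0 :: ('k, 'l, 'x) path_pairs) \<otimes>\<^sub>?A p = 0" "p \<otimes>\<^sub>?A 0 = 0" for p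
    by (simp_all add: path_alg_pm pm_alg_def)
  fix x y z :: "('l, 'x) path \<times> ('l, 'x) path"
  assume "x \<in> ?P" "y \<in> ?P" "z \<in> ?P"
  show "path_mult deg x y \<otimes>\<^bsub>pm_alg ?P (path_mult deg) path_one\<^esub> single z (1::'k)
      = single x 1 \<otimes>\<^bsub>pm_alg ?P (path_mult deg) path_one\<^esub> path_mult deg y z"
    unfolding b path_alg_pm[symmetric]
    by (cases x; cases y; cases z)
      (auto simp: path_mult_def b0 path_mult_ebas ptgt_pconc pconc_assoc)
next
  let ?P = "path_pairs X deg"
  let ?A = "pm_alg ?P (path_mult deg) path_one :: ('k, ('k, 'l, 'x) path_pairs) module"
  fix x :: "('l, 'x) path \<times> ('l, 'x) path"
  assume "x \<in> ?P"
  obtain p q where x: "x = (p, q)" by (cases x)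
  let ?b = "single x (1::'k)"
  let ?T = "(\<lambda>(l, m). ((l, []), (m, []))) ` (UNIV :: ('l \<times> 'l) set) :: (('l, 'x) path \<times> ('l, 'x) path) set"
  have inj: "inj (\<lambda>(l::'l, m::'l). ((l, [] :: ('l \<times> 'x) list), (m, [] :: ('l \<times> 'x) list)))"
    by (rule injI) auto
  have one: "(path_one :: ('k, 'l, 'x) path_pairs) = (\<Sum>z\<in>?T. single z 1)"
    unfolding sum.reindex[OF inj]
    by (simp add: sum.cartesian_product ebas_def case_prod_unfold flip: UNIV_Times_UNIV)
  have look: "lookup (path_one :: ('k, 'l, 'x) path_pairs) z = (if z \<in> ?T then 1 else 0)" for z
    unfolding one by (simp add: lookup_sum lookup_single when_def)
  have keys: "keys (path_one :: ('k, 'l, 'x) path_pairs) \<subseteq> ?T"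
    using look by (auto simp: in_keys_iff split: if_splits)
  have "path_one \<otimes>\<^sub>?A ?b = (\<Sum>z\<in>?T. path_mult deg z x)"
    using keys by (subst pm_alg_mult[of ?T _ "{x}"]) (simp_all add: look)
  also have "\<dots> = (\<Sum>z\<in>?T. if z = ((psrc p, []), (psrc q, [])) then ebas p q else 0)"
    by (rule sum.cong) (auto simp: path_mult_def x psrc_def split: if_splits)
  finally show "path_one \<otimes>\<^sub>?A ?b = ?b" by (simp add: x ebas_def image_iff)
  have "?b \<otimes>\<^sub>?A path_one = (\<Sum>z\<in>?T. path_mult deg x z)"
    using keys by (subst pm_alg_mult[of "{x}" _ ?T]) (simp_all add: look)
  also have "\<dots> = (\<Sum>z\<in>?T. if z = ((ptgt deg p, []), (ptgt deg q, [])) then ebas p q else 0)"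
    by (rule sum.cong) (auto simp: path_mult_def x)
  finally show "?b \<otimes>\<^sub>?A path_one = ?b" by (simp add: x ebas_def image_iff)
qed (rule keys_path_mult keys_path_one; assumption)+

lemma lin_map_cong:
  assumes "kspace V" "f \<in> lin_map V W" "\<And>x. x \<in> carrier V ==> g x = f x"
  shows "g \<in> lin_map V W"
proof -
  interpret V: kspace V by fact
  show ?thesis
    by (rule lin_mapI)
      (auto simp: assms(3) lin_map_closed[OF assms(2)] lin_map_add[OF assms(2)] lin_map_smult[OF assms(2)])
qed

lemma lin_map_add_fun:
  assumes "kspace W" "f \<in> lin_map V W" "g \<in> lin_map V W"
  shows "(\<lambda>x. f x \<oplus>\<^sub>W g x) \<in> lin_map V W"
proof -
  interpret W: kspace W by fact
  note [simp] = lin_map_closed[OF assms(2)] lin_map_closed[OF assms(3)]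
  show ?thesis
    by (rule lin_mapI) (auto simp: lin_map_add[OF assms(2)] lin_map_add[OF assms(3)]
      lin_map_smult[OF assms(2)] lin_map_smult[OF assms(3)] W.a_ac W.smult_add_right)
qed

lemma (in kspace) lin_map_zero_fun: "(\<lambda>x. \<zero>) \<in> lin_map U V"
  by (rule lin_mapI) auto

section \<open>The setting\<close>

locale dyb = R: frob R \<psi> I r1 r2
  for R :: "('k::field, 'r) module" and \<psi> and I :: "'i set" and r1 r2 +
  fixes X :: "'x set" and deg :: "'x => 'l::finite => 'l"
    and \<sigma> :: "'x => 'x => 'x => 'x => 'l => 'r"
  assumes X_finite [simp]: "finite X"
    and deg_bij: "x \<in> X ==> bij (deg x)"
    and \<sigma>_center: "[|a \<in> X; b \<in> X; c \<in> X; d \<in> X|] ==> \<sigma> a b c d l \<in> center R"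
    and \<sigma>_zero: "[|a \<in> X; b \<in> X; c \<in> X; d \<in> X; deg b (deg d l) \<noteq> deg a (deg c l)|] ==>
      \<sigma> b d a c l = \<zero>\<^sub>R"
begin

abbreviation M :: "('k, 'l => 'r) module" where "M \<equiv> fun_alg R"
definition J :: "('l \<times> 'i) set" where "J = UNIV \<times> I"
definition f1 :: "'l \<times> 'i => 'l => 'r" where "f1 = (\<lambda>(l, i). pt R l (r1 i))"
definition f2 :: "'l \<times> 'i => 'l => 'r" where "f2 = (\<lambda>(l, i). pt R l (r2 i))"

sublocale M: frob M "frob_form \<psi>" J f1 f2
  unfolding J_def f1_def f2_def by (rule frob_fun_alg) unfold_locales

lemma \<sigma>_closed [simp]: "[|a \<in> X; b \<in> X; c \<in> X; d \<in> X|] ==> \<sigma> a b c d l \<in> carrier R"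
  using \<sigma>_center[of a b c d l] by (simp add: center_def)

lemma \<sigma>_comm: "[|a \<in> X; b \<in> X; c \<in> X; d \<in> X; r \<in> carrier R|] ==>
    \<sigma> a b c d l \<otimes>\<^sub>R r = r \<otimes>\<^sub>R \<sigma> a b c d l"
  using \<sigma>_center[of a b c d l] by (simp add: center_def)

abbreviation G :: "('k, ('k, 'l, 'x) path_pairs) module" where "G \<equiv> path_alg X deg"
abbreviation H :: "('k, ('k, 'r, 'l, 'x) hq) module" where "H \<equiv> hq_alg R X deg"

sublocale G: kalg G by (rule kalg_path_alg)
sublocale Rop: kalg "opp R" by (rule kalg_opp) unfold_locales
sublocale RG: two_kalgs "opp R" G by unfold_locales
sublocale RRG: two_kalgs R "tensor (opp R) G" by unfold_locales
sublocale H: kalg H unfolding hq_alg_def by unfold_locales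

abbreviation hb :: "'r => 'r => ('l, 'x) path => ('l, 'x) path => ('k, 'r, 'l, 'x) hq" where
  "hb r r' p q \<equiv> hq3 R X deg r r' (ebas p q)"

lemma G_carrier: "carrier G = {g. keys g \<subseteq> path_pairs X deg}"
  by (simp add: path_alg_pm)

lemma G_one: "\<one>\<^sub>G = path_one"
  by (simp add: path_alg_pm)

lemma ebas_closed [simp]: "[|p \<in> paths X deg n; q \<in> paths X deg n|] ==> ebas p q \<in> carrier G"
  by (auto simp: G_carrier intro: path_pairsI)

lemma hq3_closed [simp]:
  "[|r \<in> carrier R; r' \<in> carrier R; g \<in> carrier G|] ==> hq3 R X deg r r' g \<in> carrier H"
  unfolding hq3_def hq_alg_def by simp

lemma hb_closed [simp]:
  "[|r \<in> carrier R; r' \<in> carrier R; p \<in> paths X deg n; q \<in> paths X deg n|] ==> hb r r' p q \<in> carrier H"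
  by simp

lemma hq3_lin1: "[|r' \<in> carrier R; g \<in> carrier G|] ==> (\<lambda>r. hq3 R X deg r r' g) \<in> lin_map R H"
  unfolding hq3_def hq_alg_def by (rule bilin_left[OF RRG.tens_bilin]) simp

lemma hq3_lin2: "[|r \<in> carrier R; g \<in> carrier G|] ==> (\<lambda>r'. hq3 R X deg r r' g) \<in> lin_map R H"
  unfolding hq3_def hq_alg_def
  using lin_map_comp[OF bilin_left[OF RG.tens_bilin, of g] bilin_right[OF RRG.tens_bilin, of r]]
  by (simp add: lin_map_opp)

lemma hq3_lin3: "[|r \<in> carrier R; r' \<in> carrier R|] ==> (\<lambda>g. hq3 R X deg r r' g) \<in> lin_map G H"
  unfolding hq3_def hq_alg_def
  using lin_map_comp[OF bilin_right[OF RG.tens_bilin, of r'] bilin_right[OF RRG.tens_bilin, of r]]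
  by simp

lemma hq3_zero [simp]:
  "[|r' \<in> carrier R; g \<in> carrier G|] ==> hq3 R X deg \<zero>\<^sub>R r' g = \<zero>\<^sub>H"
  "[|r \<in> carrier R; g \<in> carrier G|] ==> hq3 R X deg r \<zero>\<^sub>R g = \<zero>\<^sub>H"
  "[|r \<in> carrier R; r' \<in> carrier R|] ==> hq3 R X deg r r' 0 = \<zero>\<^sub>H"
  using lin_map_zero[OF R.M.ks H.ks hq3_lin1[of r' g]]
    lin_map_zero[OF R.M.ks H.ks hq3_lin2[of r g]]
    lin_map_zero[OF G.ks H.ks hq3_lin3[of r r']]
  by (auto simp: path_alg_pm)

lemma hq3_mult:
  "[|r \<in> carrier R; r' \<in> carrier R; g \<in> carrier G; s \<in> carrier R; s' \<in> carrier R; h \<in> carrier G|] ==>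
   hq3 R X deg r r' g \<otimes>\<^sub>H hq3 R X deg s s' h = hq3 R X deg (r \<otimes>\<^sub>R s) (s' \<otimes>\<^sub>R r') (g \<otimes>\<^sub>G h)"
  unfolding hq3_def hq_alg_def by (simp add: RRG.tens_mult RG.tens_mult)

lemma hb_mult:
  assumes "r \<in> carrier R" "r' \<in> carrier R" "s \<in> carrier R" "s' \<in> carrier R"
    and "p \<in> paths X deg n" "q \<in> paths X deg n" "p' \<in> paths X deg m" "q' \<in> paths X deg m"
  shows "hb r r' p q \<otimes>\<^sub>H hb s s' p' q' =
    (if ptgt deg p = psrc p' \<and> ptgt deg q = psrc q'
     then hb (r \<otimes>\<^sub>R s) (s' \<otimes>\<^sub>R r') (pconc p p') (pconc q q') else \<zero>\<^sub>H)"
  using assms by (auto simp: hq3_mult[OF _ _ ebas_closed _ _ ebas_closed] path_mult_ebas path_mult_def)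

lemma triv_paths [simp]: "(l, []) \<in> paths X deg 0" by simp

lemma H_one: "\<one>\<^sub>H = (\<Oplus>\<^sub>H l\<in>UNIV. \<Oplus>\<^sub>H m\<in>UNIV. hb \<one>\<^sub>R \<one>\<^sub>R (l, []) (m, []))"
proof -
  have "\<one>\<^sub>H = hq3 R X deg \<one>\<^sub>R \<one>\<^sub>R path_one"
    unfolding hq_alg_def hq3_def by (simp add: RRG.tens_one RG.tens_one G_one)
  also have "\<dots> = (\<Oplus>\<^sub>H l\<in>UNIV. hq3 R X deg \<one>\<^sub>R \<one>\<^sub>R (\<Sum>m\<in>UNIV. ebas (l, []) (m, [])))"
    by (rule pm_lin_sum[OF H.ks, where S = "path_pairs X deg" and m = "path_mult deg" and u = path_one])
      (auto intro!: keys_sum_subset path_pairsI[of _ _ _ 0] hq3_lin3[unfolded path_alg_pm] simp del: path_alg_pm)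
  also have "\<dots> = (\<Oplus>\<^sub>H l\<in>UNIV. \<Oplus>\<^sub>H m\<in>UNIV. hb \<one>\<^sub>R \<one>\<^sub>R (l, []) (m, []))"
    by (rule H.finsum_eqI, rule pm_lin_sum[OF H.ks, where S = "path_pairs X deg"
          and m = "path_mult deg" and u = path_one])
      (auto intro!: path_pairsI[of _ _ _ 0] hq3_lin3[unfolded path_alg_pm] H.finsum_closed
        hb_closed[of _ _ _ 0])
  finally show ?thesis .
qed

lemma hq_induct [consumes 1, case_names gen add]:
  assumes x: "x \<in> carrier H"
    and gen: "\<And>r r' n p q. [|r \<in> carrier R; r' \<in> carrier R; p \<in> paths X deg n; q \<in> paths X deg n|] ==>
      P (hb r r' p q)"
    and add: "\<And>x y. [|x \<in> carrier H; y \<in> carrier H; P x; P y|] ==> P (x \<oplus>\<^sub>H y)"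
  shows "P x"
proof -
  have pure: "P (tens R (tensor (opp R) G) r t)" if r: "r \<in> carrier R" and t: "t \<in> carrier (tensor (opp R) G)" for r t
    using t
  proof (induction rule: RG.tensor_induct)
    case (pure r' g)
    then have r': "r' \<in> carrier R" by simp
    have "keys g \<subseteq> path_pairs X deg" using pure by (simp add: G_carrier)
    then have "P (hq3 R X deg r r' g)"
    proof (induction rule: pm_induct)
      case zero
      fix l :: 'l
      have "hb \<zero>\<^sub>R r' (l, []) (l, []) = \<zero>\<^sub>H" using r' by simp
      then show ?case using gen[of "\<zero>\<^sub>R" r' "(l, [])" 0 "(l, [])"] r r' by simp
    next
      case (add g h)
      then have "g \<in> carrier G" "h \<in> carrier G" by (auto simp: G_carrier)
      with add lin_map_add[OF hq3_lin3[OF r r'], of g h] show ?case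
        using assms(3)[of "hq3 R X deg r r' g" "hq3 R X deg r r' h"] r r'
        by (simp add: path_alg_pm)
    next
      case (single z c)
      then obtain n p q where z: "z = (p, q)" "p \<in> paths X deg n" "q \<in> paths X deg n"
        by (rule path_pairsE)
      have "hq3 R X deg r r' (single z c) = hb (c \<odot>\<^sub>R r) r' p q"
        using lin_map_smult[OF hq3_lin3[OF r r'], of "ebas p q" c]
          lin_map_smult[OF hq3_lin1[OF r' ebas_closed[OF z(2,3)]] r, of c] z
          path_pairsI[OF z(2,3)] by (simp add: path_alg_pm ebas_def)
      then show ?case using gen[of "c \<odot>\<^sub>R r" r' p n q] z r r' by simp
    qed
    then show ?case by (simp add: hq3_def)
  next
    case (add t u)
    then show ?case
      using assms(3)[of "tens R (tensor (opp R) G) r t" "tens R (tensor (opp R) G) r u"] r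
      by (simp add: hq_alg_def RRG.tens_add_right)
  qed
  show ?thesis
    using x unfolding hq_alg_def
  proof (induction rule: RRG.tensor_induct)
    case (add t u)
    then show ?case using assms(3)[of t u] by (simp add: hq_alg_def)
  qed (rule pure)
qed

lemma hq_map_eqI:
  assumes "h \<in> lin_map H V" "g \<in> lin_map H V"
    and "\<And>r r' n p q. [|r \<in> carrier R; r' \<in> carrier R; p \<in> paths X deg n; q \<in> paths X deg n|] ==>
      h (hb r r' p q) = g (hb r r' p q)"
    and "x \<in> carrier H"
  shows "h x = g x"
  using assms(4)
  by (induction rule: hq_induct) (use assms(3) in \<open>auto simp: lin_map_add[OF assms(1)] lin_map_add[OF assms(2)]\<close>)

lemma hq_map_mult:
  assumes B: "kalg B" and h: "h \<in> lin_map H B"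
    and gen: "\<And>r r' s s' n m p q p' q'. [|r \<in> carrier R; r' \<in> carrier R; s \<in> carrier R; s' \<in> carrier R;
      p \<in> paths X deg n; q \<in> paths X deg n; p' \<in> paths X deg m; q' \<in> paths X deg m|] ==>
      h (hb r r' p q \<otimes>\<^sub>H hb s s' p' q') = h (hb r r' p q) \<otimes>\<^sub>B h (hb s s' p' q')"
    and x: "x \<in> carrier H" and y: "y \<in> carrier H"
  shows "h (x \<otimes>\<^sub>H y) = h x \<otimes>\<^sub>B h y"
proof -
  interpret B: kalg B by fact
  note [simp] = lin_map_add[OF h] lin_map_closed[OF h]
  show ?thesis using x
  proof (induction rule: hq_induct)
    case (gen r r' n p q)
    note g = gen
    show ?case using y
    proof (induction rule: hq_induct)
      case (gen s s' m p' q')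
      then show ?case using assms(3) g by blast
    next
      case (add x y)
      then show ?case using g by (simp add: H.r_distr B.r_distr hb_closed[of r r' p n q])
    qed
  next
    case (add x x')
    then show ?case using y by (simp add: H.l_distr B.l_distr)
  qed
qed

lemma
  assumes V: "kspace V"
    and \<tau>: "\<And>n p q. [|p \<in> paths X deg n; q \<in> paths X deg n|] ==> bilin R R V (\<lambda>r r'. \<tau> r r' p q)"
  shows hq_lift_lin: "hq_lift V \<tau> \<in> lin_map H V"
    and hq_lift_hb: "[|r \<in> carrier R; r' \<in> carrier R; p \<in> paths X deg n; q \<in> paths X deg n|] ==>
      hq_lift V \<tau> (hb r r' p q) = \<tau> r r' p q"
proof -
  interpret V: kspace V by fact
  define \<beta> where "\<beta> r r' = lin_ext V (\<lambda>(p, q). \<tau> r r' p q)" for r r'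
  have \<tau>c: "\<tau> r r' (fst z) (snd z) \<in> carrier V"
    if "r \<in> carrier R" "r' \<in> carrier R" "z \<in> path_pairs X deg" for r r' z
    using that(3) bilin_closed[OF \<tau> that(1,2)] by (auto elim!: path_pairsE)
  have \<beta>2: "\<beta> r r' \<in> lin_map G V" if "r \<in> carrier R" "r' \<in> carrier R" for r r'
    unfolding \<beta>_def path_alg_pm using \<tau>c[OF that]
    by (intro lin_ext_lin[OF V]) (auto simp: case_prod_unfold)
  have \<beta>1: "(\<lambda>r. \<beta> r r' g) \<in> lin_map R V" "(\<lambda>r. \<beta> r' r g) \<in> lin_map R V"
    if r': "r' \<in> carrier R" and g: "g \<in> carrier G" for r' g
    unfolding \<beta>_def lin_ext_def
  proof (atomize(full), intro conjI lin_map_sum[OF V])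
    fix z assume "z \<in> keys g"
    then obtain n p q where z: "z = (p, q)" "p \<in> paths X deg n" "q \<in> paths X deg n"
      using g by (auto simp: G_carrier elim!: path_pairsE dest!: subsetD)
    show "(\<lambda>r. lookup g z \<odot>\<^sub>V (case z of (p, q) => \<tau> r r' p q)) \<in> lin_map R V"
      "(\<lambda>r. lookup g z \<odot>\<^sub>V (case z of (p, q) => \<tau> r' r p q)) \<in> lin_map R V"
      using lin_map_comp[OF bilin_left[OF \<tau>[OF z(2,3)] r'] V.smult_lin]
        lin_map_comp[OF bilin_right[OF \<tau>[OF z(2,3)] r'] V.smult_lin] z(1) by simp_all
  qed simp_all
  have \<beta>b: "bilin (opp R) G V (\<beta> r)" if "r \<in> carrier R" for r
    using that by (intro bilinI) (auto simp: lin_map_opp intro: \<beta>1 \<beta>2)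
  have "(\<lambda>r. tlift V (\<beta> r) t) \<in> lin_map R V" if "t \<in> carrier (tensor (opp R) G)" for t
    using that
  proof (induction rule: RG.tensor_induct)
    case (pure r' g)
    then show ?case
      by (intro lin_map_cong[OF R.M.ks \<beta>1(1)]) (auto simp: RG.tlift_tens[OF V \<beta>b])
  next
    case (add t u)
    show ?case
      by (rule lin_map_cong[OF R.M.ks lin_map_add_fun[OF V add.IH]])
        (use add in \<open>simp add: lin_map_add[OF RG.tlift_lin[OF V \<beta>b]]\<close>)
  qed
  then have outer: "bilin R (tensor (opp R) G) V (\<lambda>r. tlift V (\<beta> r))"
    by (intro bilinI RG.tlift_lin[OF V \<beta>b])
  show "hq_lift V \<tau> \<in> lin_map H V"
    unfolding hq_lift_def hq_alg_def \<beta>_def[symmetric]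
    using RRG.tlift_lin[OF V outer] by (simp add: \<beta>_def[abs_def])
  fix r r' n p q
  assume a: "r \<in> carrier R" "r' \<in> carrier R" "p \<in> paths X deg n" "q \<in> paths X deg n"
  have "hq_lift V \<tau> (hb r r' p q) = tlift V (\<lambda>r. tlift V (\<beta> r)) (hb r r' p q)"
    unfolding hq_lift_def \<beta>_def ..
  also have "\<dots> = \<beta> r r' (ebas p q)"
    unfolding hq3_def using a by (subst RRG.tlift_tens[OF V outer]) (auto simp: RG.tlift_tens[OF V \<beta>b])
  also have "\<dots> = \<tau> r r' p q"
    unfolding \<beta>_def ebas_def using a bilin_closed[OF \<tau>[OF a(3,4)] a(1,2)]
    by (simp add: lin_ext_single[OF V])
  finally show "hq_lift V \<tau> (hb r r' p q) = \<tau> r r' p q" .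
qed

subsection \<open>The relations\<close>

abbreviation arrow :: "'l => 'x => ('l, 'x) path" where "arrow l x \<equiv> (l, [(l, x)])"
abbreviation path2 :: "'l => 'x => 'x => ('l, 'x) path" where
  "path2 l x y \<equiv> (l, [(l, x), (deg x l, y)])"

lemma atgt_simp [simp]: "atgt deg (l, x) = deg x l" by (simp add: atgt_def)

definition rel_left where "rel_left l m a b c d =
  (\<Oplus>\<^sub>H y\<in>X. \<Oplus>\<^sub>H x\<in>X. hb (\<sigma> x y a c l) \<one>\<^sub>R (path2 l y x) (path2 m d b))"

definition rel_right where "rel_right l m a b c d =
  (\<Oplus>\<^sub>H y\<in>X. \<Oplus>\<^sub>H x\<in>X. hb \<one>\<^sub>R (\<sigma> b d x y m) (path2 l c a) (path2 m y x))"

lemma path2_paths [simp]: "[|x \<in> X; y \<in> X|] ==> path2 l x y \<in> paths X deg 2"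
  by (simp add: numeral_2_eq_2)

lemma hb2_closed [simp]:
  "[|r \<in> carrier R; r' \<in> carrier R; x \<in> X; y \<in> X; x' \<in> X; y' \<in> X|] ==>
   hb r r' (path2 l x y) (path2 m x' y') \<in> carrier H"
  by (rule hb_closed[of _ _ _ 2]) auto

lemma (in abelian_monoid) finsum_arrow_pairs:
  fixes deg :: "'x => 'l::finite => 'l"
  assumes "finite X" "\<And>z. z \<in> arrow_pairs X deg ==> f z \<in> carrier G"
    and "\<And>x y. [|(x, y) \<in> arrow_pairs X deg; fst x \<noteq> l|] ==> f (x, y) = \<zero>"
  shows "(\<Oplus>z\<in>arrow_pairs X deg. f z) = (\<Oplus>y\<in>X. \<Oplus>x\<in>X. f ((l, y), (deg y l, x)))"
proof -
  let ?g = "\<lambda>(y, x). ((l, y), (deg y l, x))"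
  have fin: "finite (arrow_pairs X deg)"
    by (rule finite_subset[of _ "(UNIV \<times> X) \<times> (UNIV \<times> X)"]) (auto simp: arrow_pairs_def assms)
  have c: "f ((l, y), (deg y l, x)) \<in> carrier G" if "x \<in> X" "y \<in> X" for x y
    using that by (intro assms(2)) (auto simp: arrow_pairs_def atgt_def)
  have sub: "?g ` (X \<times> X) \<subseteq> arrow_pairs X deg" by (auto simp: arrow_pairs_def atgt_def)
  have "(\<Oplus>z\<in>arrow_pairs X deg. f z) = (\<Oplus>z\<in>?g ` (X \<times> X). f z)"
  proof (rule finsum_restrict[OF fin sub assms(2)])
    fix z assume z: "z \<in> arrow_pairs X deg - ?g ` (X \<times> X)"
    obtain k u m v where kk: "z = ((k, u), (m, v))" by (metis surj_pair)
    have "k \<noteq> l" using z unfolding kk by (force simp: arrow_pairs_def atgt_def)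
    then show "f z = \<zero>" using assms(3)[of "(k, u)" "(m, v)"] z kk by auto
  qed
  also have "\<dots> = (\<Oplus>p\<in>X \<times> X. f (?g p))"
    by (rule finsum_reindex) (use c in \<open>auto simp: inj_on_def\<close>)
  also have "\<dots> = (\<Oplus>p\<in>X \<times> X. case p of (y, x) => f ((l, y), (deg y l, x)))"
    by (rule finsum_eqI) (use c in auto)
  also have "\<dots> = (\<Oplus>y\<in>X. \<Oplus>x\<in>X. f ((l, y), (deg y l, x)))"
    by (rule finsum_Times[symmetric]) (use assms(1) c in auto)
  finally show ?thesis .
qed

lemma ebas_arr_mult:
  assumes "(x, y) \<in> arrow_pairs X deg" "(c, d) \<in> arrow_pairs X deg"
  shows "ebas (arr x) (arr c) \<otimes>\<^sub>G ebas (arr y) (arr d) = ebas (fst x, [x, y]) (fst c, [c, d])"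
  using assms by (cases x; cases y; cases c; cases d)
    (auto simp: path_mult_ebas path_mult_def arr_def arrow_pairs_def atgt_def pconc_def)

lemma pair_paths: "(x, y) \<in> arrow_pairs X deg ==> (fst x, [x, y]) \<in> paths X deg 2"
  by (cases x; cases y) (auto simp: arrow_pairs_def atgt_def numeral_2_eq_2)

lemma wsig_closed:
  "[|(x, y) \<in> arrow_pairs X deg; (c, d) \<in> arrow_pairs X deg|] ==> wsig R \<sigma> x y c d \<in> carrier R"
  by (auto simp: wsig_def arrow_pairs_def)

text \<open>
  The coefficients \<open>wsig\<close> vanish unless the first arrow starts at the prescribed source, which
  leaves a sum over pairs of labels.
\<close>

lemma rel_sums:
  fixes l m :: 'l
  assumes "a \<in> X" "b \<in> X" "c \<in> X" "d \<in> X"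
  defines "a' \<equiv> (l, c)" and "b' \<equiv> (deg c l, a)" and "c' \<equiv> (m, d)" and "d' \<equiv> (deg d m, b)"
  shows "(\<Oplus>\<^sub>H z\<in>arrow_pairs X deg. case z of (x, y) =>
      hq3 R X deg (wsig R \<sigma> x y a' b') \<one>\<^sub>R (ebas (arr x) (arr c') \<otimes>\<^sub>G ebas (arr y) (arr d')))
      = rel_left l m a b c d"
    and "(\<Oplus>\<^sub>H z\<in>arrow_pairs X deg. case z of (x, y) =>
      hq3 R X deg \<one>\<^sub>R (wsig R \<sigma> c' d' x y) (ebas (arr a') (arr x) \<otimes>\<^sub>G ebas (arr b') (arr y)))
      = rel_right l m a b c d"
proof -
  have ab: "(a', b') \<in> arrow_pairs X deg" and cd: "(c', d') \<in> arrow_pairs X deg"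
    using assms by (auto simp: arrow_pairs_def atgt_def)
  have p: "path2 l c a = (fst a', [a', b'])" "path2 m d b = (fst c', [c', d'])"
    by (simp_all add: a'_def b'_def c'_def d'_def)
  note cl = hb_closed[OF _ _ pair_paths pair_paths] wsig_closed
  have "(\<Oplus>\<^sub>H z\<in>arrow_pairs X deg. case z of (x, y) =>
      hq3 R X deg (wsig R \<sigma> x y a' b') \<one>\<^sub>R (ebas (arr x) (arr c') \<otimes>\<^sub>G ebas (arr y) (arr d')))
      = (\<Oplus>\<^sub>H y\<in>X. \<Oplus>\<^sub>H x\<in>X. case ((l, y), (deg y l, x)) of (x, y) =>
      hq3 R X deg (wsig R \<sigma> x y a' b') \<one>\<^sub>R (ebas (arr x) (arr c') \<otimes>\<^sub>G ebas (arr y) (arr d')))"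
  proof (rule H.finsum_arrow_pairs)
    fix z assume z: "z \<in> arrow_pairs X deg"
    then show "(case z of (x, y) => hq3 R X deg (wsig R \<sigma> x y a' b') \<one>\<^sub>R
        (ebas (arr x) (arr c') \<otimes>\<^sub>G ebas (arr y) (arr d'))) \<in> carrier H"
      using ab cd by (cases z) (auto simp: ebas_arr_mult intro!: cl)
  next
    fix x y assume xy: "(x, y) \<in> arrow_pairs X deg" "fst x \<noteq> l"
    then show "(case (x, y) of (x, y) => hq3 R X deg (wsig R \<sigma> x y a' b') \<one>\<^sub>R
        (ebas (arr x) (arr c') \<otimes>\<^sub>G ebas (arr y) (arr d'))) = \<zero>\<^sub>H"
      using cd pair_paths[OF xy(1)] pair_paths[OF cd]
      by (simp add: wsig_def a'_def ebas_arr_mult[OF xy(1) cd] ebas_closed[of _ 2])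
  qed simp
  also have "\<dots> = rel_left l m a b c d"
    unfolding rel_left_def
  proof (intro H.finsum_eqI H.finsum_closed)
    fix x y assume xy: "x \<in> X" "y \<in> X"
    then have "((l, y), (deg y l, x)) \<in> arrow_pairs X deg" by (auto simp: arrow_pairs_def atgt_def)
    from ebas_arr_mult[OF this cd]
    show "(case ((l, y), (deg y l, x)) of (x, y) => hq3 R X deg (wsig R \<sigma> x y a' b') \<one>\<^sub>R
        (ebas (arr x) (arr c') \<otimes>\<^sub>G ebas (arr y) (arr d')))
        = hb (\<sigma> x y a c l) \<one>\<^sub>R (path2 l y x) (path2 m d b)"
      by (simp add: wsig_def a'_def b'_def c'_def d'_def)
  qed (use assms(1-4) in auto)
  finally show "(\<Oplus>\<^sub>H z\<in>arrow_pairs X deg. case z of (x, y) =>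
      hq3 R X deg (wsig R \<sigma> x y a' b') \<one>\<^sub>R (ebas (arr x) (arr c') \<otimes>\<^sub>G ebas (arr y) (arr d')))
      = rel_left l m a b c d" .
  have "(\<Oplus>\<^sub>H z\<in>arrow_pairs X deg. case z of (x, y) =>
      hq3 R X deg \<one>\<^sub>R (wsig R \<sigma> c' d' x y) (ebas (arr a') (arr x) \<otimes>\<^sub>G ebas (arr b') (arr y)))
      = (\<Oplus>\<^sub>H y\<in>X. \<Oplus>\<^sub>H x\<in>X. case ((m, y), (deg y m, x)) of (x, y) =>
      hq3 R X deg \<one>\<^sub>R (wsig R \<sigma> c' d' x y) (ebas (arr a') (arr x) \<otimes>\<^sub>G ebas (arr b') (arr y)))"
  proof (rule H.finsum_arrow_pairs)
    fix z assume z: "z \<in> arrow_pairs X deg"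
    then show "(case z of (x, y) => hq3 R X deg \<one>\<^sub>R (wsig R \<sigma> c' d' x y)
        (ebas (arr a') (arr x) \<otimes>\<^sub>G ebas (arr b') (arr y))) \<in> carrier H"
      using ab cd by (cases z) (auto simp: ebas_arr_mult intro!: cl)
  next
    fix x y assume xy: "(x, y) \<in> arrow_pairs X deg" "fst x \<noteq> m"
    then show "(case (x, y) of (x, y) => hq3 R X deg \<one>\<^sub>R (wsig R \<sigma> c' d' x y)
        (ebas (arr a') (arr x) \<otimes>\<^sub>G ebas (arr b') (arr y))) = \<zero>\<^sub>H"
      using ab pair_paths[OF xy(1)] pair_paths[OF ab]
      by (simp add: wsig_def c'_def ebas_arr_mult[OF ab xy(1)] ebas_closed[of _ 2])
  qed simp
  also have "\<dots> = rel_right l m a b c d"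
    unfolding rel_right_def
  proof (intro H.finsum_eqI H.finsum_closed)
    fix x y assume xy: "x \<in> X" "y \<in> X"
    then have "((m, y), (deg y m, x)) \<in> arrow_pairs X deg" by (auto simp: arrow_pairs_def atgt_def)
    from ebas_arr_mult[OF ab this]
    show "(case ((m, y), (deg y m, x)) of (x, y) => hq3 R X deg \<one>\<^sub>R (wsig R \<sigma> c' d' x y)
        (ebas (arr a') (arr x) \<otimes>\<^sub>G ebas (arr b') (arr y)))
        = hb \<one>\<^sub>R (\<sigma> b d x y m) (path2 l c a) (path2 m y x)"
      by (simp add: wsig_def a'_def b'_def c'_def d'_def)
  qed (use assms(1-4) in auto)
  finally show "(\<Oplus>\<^sub>H z\<in>arrow_pairs X deg. case z of (x, y) =>
      hq3 R X deg \<one>\<^sub>R (wsig R \<sigma> c' d' x y) (ebas (arr a') (arr x) \<otimes>\<^sub>G ebas (arr b') (arr y)))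
      = rel_right l m a b c d" .
qed

lemma aw_rels_eq:
  "aw_rels R X deg \<sigma> = {rel_left l m a b c d \<ominus>\<^sub>H rel_right l m a b c d | l m a b c d.
     a \<in> X \<and> b \<in> X \<and> c \<in> X \<and> d \<in> X}" (is "_ = ?R")
proof
  show "aw_rels R X deg \<sigma> \<subseteq> ?R"
  proof
    fix z assume "z \<in> aw_rels R X deg \<sigma>"
    then obtain a' b' c' d' where *: "(a', b') \<in> arrow_pairs X deg" "(c', d') \<in> arrow_pairs X deg"
      "z = (\<Oplus>\<^sub>H z\<in>arrow_pairs X deg. case z of (x, y) =>
      hq3 R X deg (wsig R \<sigma> x y a' b') \<one>\<^sub>R (ebas (arr x) (arr c') \<otimes>\<^sub>G ebas (arr y) (arr d'))) \<ominus>\<^sub>H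
      (\<Oplus>\<^sub>H z\<in>arrow_pairs X deg. case z of (x, y) =>
      hq3 R X deg \<one>\<^sub>R (wsig R \<sigma> c' d' x y) (ebas (arr a') (arr x) \<otimes>\<^sub>G ebas (arr b') (arr y)))"
      unfolding aw_rels_def Let_def by blast
    from *(1) obtain l c a where ab: "a' = (l, c)" "b' = (deg c l, a)" "a \<in> X" "c \<in> X"
      by (cases a'; cases b') (auto simp: arrow_pairs_def atgt_def)
    from *(2) obtain m d b where cd: "c' = (m, d)" "d' = (deg d m, b)" "b \<in> X" "d \<in> X"
      by (cases c'; cases d') (auto simp: arrow_pairs_def atgt_def)
    have "z = rel_left l m a b c d \<ominus>\<^sub>H rel_right l m a b c d"
      unfolding *(3) ab(1,2) cd(1,2) rel_sums(1)[OF ab(3) cd(3) ab(4) cd(4)]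
        rel_sums(2)[OF ab(3) cd(3) ab(4) cd(4)] ..
    then show "z \<in> ?R" using ab(3,4) cd(3,4) by blast
  qed
  show "?R \<subseteq> aw_rels R X deg \<sigma>"
  proof
    fix z assume "z \<in> ?R"
    then obtain l m a b c d where *: "a \<in> X" "b \<in> X" "c \<in> X" "d \<in> X"
      "z = rel_left l m a b c d \<ominus>\<^sub>H rel_right l m a b c d" by blast
    have "((l, c), (deg c l, a)) \<in> arrow_pairs X deg" "((m, d), (deg d m, b)) \<in> arrow_pairs X deg"
      using * by (auto simp: arrow_pairs_def atgt_def)
    then show "z \<in> aw_rels R X deg \<sigma>"
      unfolding *(5) rel_sums[OF *(1-4), symmetric] aw_rels_def Let_def by blast
  qed
qed

lemma rel_closed:
  assumes "a \<in> X" "b \<in> X" "c \<in> X" "d \<in> X"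
  shows "rel_left l m a b c d \<in> carrier H" "rel_right l m a b c d \<in> carrier H"
  unfolding rel_left_def rel_right_def using assms by (auto intro!: H.finsum_closed)

lemma aw_rels_carrier: "aw_rels R X deg \<sigma> \<subseteq> carrier H"
  unfolding aw_rels_eq by (auto intro!: H.minus_closed rel_closed)

lemma aw_ideal: "ideal (aw_ideal R X deg \<sigma>) H"
  unfolding aw_ideal_def by (rule genideal_ideal[OF H.kalg_axioms aw_rels_carrier])

lemma aw_sub: "submodule (aw_ideal R X deg \<sigma>) scalars H"
  by (rule ideal_subspace[OF H.kalg_axioms aw_ideal])

text \<open>
  A multiplicative linear map is defined on the quotient as soon as it identifies both sides
  of the defining relations.
\<close>

lemma aw_ideal_kill:
  assumes "kalg B" "h \<in> lin_map H B"
    and "\<And>x y. [|x \<in> carrier H; y \<in> carrier H|] ==> h (x \<otimes>\<^sub>H y) = h x \<otimes>\<^sub>B h y"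
    and "\<And>l m a b c d. [|a \<in> X; b \<in> X; c \<in> X; d \<in> X|] ==>
      h (rel_left l m a b c d) = h (rel_right l m a b c d)"
    and "x \<in> aw_ideal R X deg \<sigma>"
  shows "h x = \<zero>\<^sub>B"
proof (rule genideal_kill[OF H.kalg_axioms assms(1,2,3) aw_rels_carrier])
  interpret B: kalg B by fact
  fix z assume "z \<in> aw_rels R X deg \<sigma>"
  then obtain l m a b c d where *: "a \<in> X" "b \<in> X" "c \<in> X" "d \<in> X"
    "z = rel_left l m a b c d \<ominus>\<^sub>H rel_right l m a b c d" unfolding aw_rels_eq by blast
  then show "h z = \<zero>\<^sub>B"
    using rel_closed[OF *(1-4)] assms(4)[OF *(1-4)] lin_map_closed[OF assms(2)]
    by (simp add: lin_map_minus[OF H.ks B.ks assms(2)] B.minus_eq_zero_iff)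
qed (use assms(5) in \<open>simp_all add: aw_ideal_def\<close>)

end

declare fun_alg_simps [simp del]

lemma shift_closed [simp]: "f \<in> carrier (fun_alg R) ==> shift \<alpha> f \<in> carrier (fun_alg R)"
  by (auto simp: fun_alg_simps shift_def)

lemma fun_alg_closed: "f \<in> carrier (fun_alg R) ==> f l \<in> carrier R"
  by (simp add: fun_alg_simps)

context kalg
begin

lemma pt_mult_right: "[|r \<in> carrier A; f \<in> carrier (fun_alg A)|] ==>
    pt A l r \<otimes>\<^bsub>fun_alg A\<^esub> f = pt A l (r \<otimes> f l)"
  by (auto simp: fun_alg_simps pt_def)

lemma pt_mult_left: "[|r \<in> carrier A; f \<in> carrier (fun_alg A)|] ==>
    f \<otimes>\<^bsub>fun_alg A\<^esub> pt A l r = pt A l (f l \<otimes> r)"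
  by (auto simp: fun_alg_simps pt_def)

lemma pt_apply: "pt A l r m = (if m = l then r else \<zero>)"
  by (simp add: pt_def)

lemma pt_sum:
  assumes "f \<in> carrier (fun_alg A)"
  shows "f = (\<Oplus>\<^bsub>fun_alg A\<^esub>l\<in>UNIV. pt A (l::'l::finite) (f l))"
proof
  fix m
  have fc: "f l \<in> carrier A" for l using assms by (rule fun_alg_closed)
  have "(\<Oplus>\<^bsub>fun_alg A\<^esub>l\<in>UNIV. pt A l (f l)) m = (\<Oplus>l\<in>UNIV. pt A l (f l) m)"
    by (rule fun_alg_finsum) (simp_all add: kalg_axioms fc)
  also have "\<dots> = (\<Oplus>l\<in>UNIV. if m = l then f l else \<zero>)"
    by (simp add: pt_apply)
  also have "\<dots> = f m"
    by (subst finsum_delta') (simp_all add: fc)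
  finally show "f m = (\<Oplus>\<^bsub>fun_alg A\<^esub>l\<in>UNIV. pt A l (f l)) m" ..
qed

end

section \<open>Representations of the generators\<close>

text \<open>
  Both bialgebroids contain the images of two copies of \<open>M\<close> and a matrix \<open>el\<close> of elements with
  the same commutation rules and the same quadratic relation.
\<close>

locale quad = dyb R \<psi> I r1 r2 X deg \<sigma> + B: kalg B
  for R :: "('k::field, 'r) module" and \<psi> and I :: "'i set" and r1 r2
    and X :: "'x set" and deg :: "'x => 'l::finite => 'l" and \<sigma>
    and B :: "('k, 'b) module" (structure) +
  fixes S T :: "('l => 'r) => 'b" and el :: "'x => 'x => 'b"
  assumes S_lin: "S \<in> lin_map M B" and T_lin: "T \<in> lin_map M B"
    and S_mult: "[|f \<in> carrier M; g \<in> carrier M|] ==> S (f \<otimes>\<^sub>M g) = S f \<otimes> S g"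
    and T_mult: "[|f \<in> carrier M; g \<in> carrier M|] ==> T (f \<otimes>\<^sub>M g) = T g \<otimes> T f"
    and S_one: "S \<one>\<^sub>M = \<one>" and T_one: "T \<one>\<^sub>M = \<one>"
    and TS: "[|f \<in> carrier M; g \<in> carrier M|] ==> T g \<otimes> S f = S f \<otimes> T g"
    and el_closed [simp]: "[|a \<in> X; b \<in> X|] ==> el a b \<in> carrier B"
    and el_S: "[|a \<in> X; b \<in> X; f \<in> carrier M|] ==> el a b \<otimes> S f = S (shift (deg a) f) \<otimes> el a b"
    and el_T: "[|a \<in> X; b \<in> X; f \<in> carrier M|] ==> el a b \<otimes> T f = T (shift (deg b) f) \<otimes> el a b"
    and quadratic: "[|a \<in> X; b \<in> X; c \<in> X; d \<in> X|] ==>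
      (\<Oplus>y\<in>X. \<Oplus>x\<in>X. S (\<sigma> x y a c) \<otimes> (el y d \<otimes> el x b))
      = (\<Oplus>y\<in>X. \<Oplus>x\<in>X. T (\<sigma> b d x y) \<otimes> (el c y \<otimes> el a x))"
begin

lemmas S_closed [simp] = lin_map_closed[OF S_lin]
lemmas T_closed [simp] = lin_map_closed[OF T_lin]

lemma \<sigma>_closed_M [simp]: "[|a \<in> X; b \<in> X; c \<in> X; d \<in> X|] ==> \<sigma> a b c d \<in> carrier M"
  by (simp add: fun_alg_simps)

lemma S_zero: "S \<zero>\<^sub>M = \<zero>" and T_zero: "T \<zero>\<^sub>M = \<zero>"
  using lin_map_zero[OF M.M.ks B.ks S_lin]
    lin_map_zero[OF M.M.ks B.ks T_lin] by simp_all

fun lprod :: "('l \<times> 'x) list => ('l \<times> 'x) list => 'b" where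
  "lprod (x # xs) (y # ys) = el (snd x) (snd y) \<otimes> lprod xs ys"
| "lprod _ _ = \<one>"

definition theta :: "'r => 'r => ('l, 'x) path => ('l, 'x) path => 'b" where
  "theta r r' p q =
     S (pt R (psrc p) r) \<otimes> T (pt R (psrc q) r') \<otimes> lprod (snd p) (snd q)"

definition shifts :: "('l \<times> 'x) list => ('l => 'r) => 'l => 'r" where
  "shifts xs f = foldr (\<lambda>x. shift (deg (snd x))) xs f"

lemma shifts_closed [simp]: "f \<in> carrier M ==> shifts xs f \<in> carrier M"
  by (induction xs) (auto simp: shifts_def)

lemma lprod_closed: "[|(l, xs) \<in> paths X deg n; (m, ys) \<in> paths X deg n|] ==> lprod xs ys \<in> carrier B"
proof (induction xs ys arbitrary: l m n rule: lprod.induct)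
  case (1 x xs y ys)
  from "1.prems" "1.IH"[of "atgt deg x" "length xs" "atgt deg y"] show ?case by auto
qed auto

lemma lprod_closed' [simp]:
  "[|p \<in> paths X deg n; q \<in> paths X deg n|] ==> lprod (snd p) (snd q) \<in> carrier B"
  using lprod_closed[of "fst p" "snd p" n "fst q" "snd q"] by simp

lemma lprod_S:
  "[|(l, xs) \<in> paths X deg n; (m, ys) \<in> paths X deg n; f \<in> carrier M|] ==>
   lprod xs ys \<otimes> S f = S (shifts xs f) \<otimes> lprod xs ys"
proof (induction xs ys arbitrary: l m n rule: lprod.induct)
  case (1 x xs y ys)
  then have p: "(atgt deg x, xs) \<in> paths X deg (length xs)" "(atgt deg y, ys) \<in> paths X deg (length xs)"
    "snd x \<in> X" "snd y \<in> X" by auto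
  note c = lprod_closed[OF p(1,2)]
  have "lprod (x # xs) (y # ys) \<otimes> S f = el (snd x) (snd y) \<otimes> (S (shifts xs f) \<otimes> lprod xs ys)"
    using p c "1.IH"[OF p(1,2)] "1.prems"(3) by (simp add: B.m_assoc)
  also have "\<dots> = S (shifts (x # xs) f) \<otimes> lprod (x # xs) (y # ys)"
    using p c "1.prems"(3) by (simp add: B.m_assoc[symmetric] el_S) (simp add: shifts_def)
  finally show ?case .
qed (auto simp: shifts_def dest!: paths_length)

lemma lprod_T:
  "[|(l, xs) \<in> paths X deg n; (m, ys) \<in> paths X deg n; f \<in> carrier M|] ==>
   lprod xs ys \<otimes> T f = T (shifts ys f) \<otimes> lprod xs ys"
proof (induction xs ys arbitrary: l m n rule: lprod.induct)
  case (1 x xs y ys)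
  then have p: "(atgt deg x, xs) \<in> paths X deg (length xs)" "(atgt deg y, ys) \<in> paths X deg (length xs)"
    "snd x \<in> X" "snd y \<in> X" by auto
  note c = lprod_closed[OF p(1,2)]
  have "lprod (x # xs) (y # ys) \<otimes> T f = el (snd x) (snd y) \<otimes> (T (shifts ys f) \<otimes> lprod xs ys)"
    using p c "1.IH"[OF p(1,2)] "1.prems"(3) by (simp add: B.m_assoc)
  also have "\<dots> = T (shifts (y # ys) f) \<otimes> lprod (x # xs) (y # ys)"
    using p c "1.prems"(3) by (simp add: B.m_assoc[symmetric] el_T) (simp add: shifts_def)
  finally show ?case .
qed (auto simp: shifts_def dest!: paths_length)

text \<open>
  At the source of a path the accumulated shift evaluates at its target. This is why the product of
  two values of \<open>theta\<close> vanishes unless the paths can be concatenated.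
\<close>

lemma shifts_path: "(l, xs) \<in> paths X deg n ==> shifts xs f l = f (ptgt deg (l, xs))"
  by (induction xs arbitrary: l n) (auto simp: shifts_def shift_def atgt_def)

lemma lprod_append:
  "[|(l, xs) \<in> paths X deg n; (m, ys) \<in> paths X deg n; p' \<in> paths X deg k; q' \<in> paths X deg k|] ==>
   lprod (xs @ snd p') (ys @ snd q') = lprod xs ys \<otimes> lprod (snd p') (snd q')"
proof (induction xs ys arbitrary: l m n rule: lprod.induct)
  case (1 x xs y ys)
  then have p: "(atgt deg x, xs) \<in> paths X deg (length xs)" "(atgt deg y, ys) \<in> paths X deg (length xs)"
    "snd x \<in> X" "snd y \<in> X" by auto
  then show ?case using "1.IH"[OF p(1,2)] "1.prems"(3,4) lprod_closed[OF p(1,2)]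
    by (simp add: B.m_assoc)
qed (auto dest!: paths_length[of "(_, _)"])

lemma theta_bilin:
  assumes "p \<in> paths X deg n" "q \<in> paths X deg n"
  shows "bilin R R B (\<lambda>r r'. theta r r' p q)"
  unfolding theta_def using assms
  by (intro bilinI lin_map_comp[OF lin_map_comp[OF lin_map_comp[OF R.M.pt_lin S_lin] B.mult_right_lin] B.mult_right_lin]
      lin_map_comp[OF lin_map_comp[OF lin_map_comp[OF R.M.pt_lin T_lin] B.mult_left_lin] B.mult_right_lin]) auto

lemmas theta_closed [simp] = bilin_closed[OF theta_bilin]

lemma theta_mult:
  assumes r: "r \<in> carrier R" "r' \<in> carrier R" "s \<in> carrier R" "s' \<in> carrier R"
    and p: "p \<in> paths X deg n" "q \<in> paths X deg n" "p' \<in> paths X deg k" "q' \<in> paths X deg k"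
  shows "theta r r' p q \<otimes> theta s s' p' q' =
    (if ptgt deg p = psrc p' \<and> ptgt deg q = psrc q'
     then theta (r \<otimes>\<^sub>R s) (s' \<otimes>\<^sub>R r') (pconc p p') (pconc q q') else \<zero>)"
proof -
  let ?l = "psrc p" and ?m = "psrc q"
  let ?L = "lprod (snd p) (snd q)" and ?L' = "lprod (snd p') (snd q')"
  let ?f = "pt R (psrc p') s" and ?g = "pt R (psrc q') s'"
  have pp: "(?l, snd p) \<in> paths X deg n" "(?m, snd q) \<in> paths X deg n"
    using p by (simp_all add: psrc_def)
  note c = lprod_closed[OF pp] lprod_closed'[OF p(3,4)]
  have f: "?f \<in> carrier M" "?g \<in> carrier M" using r by auto
  have "theta r r' p q \<otimes> theta s s' p' q'
    = S (pt R ?l r) \<otimes> T (pt R ?m r') \<otimes> (?L \<otimes> S ?f) \<otimes> T ?g \<otimes> ?L'"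
    unfolding theta_def using r f c by (simp add: B.m_assoc)
  also have "\<dots> = S (pt R ?l r) \<otimes> (T (pt R ?m r') \<otimes> S (shifts (snd p) ?f)) \<otimes> (?L \<otimes> T ?g) \<otimes> ?L'"
    unfolding lprod_S[OF pp f(1)] using r f c by (simp add: B.m_assoc)
  also have "\<dots> = (S (pt R ?l r) \<otimes> S (shifts (snd p) ?f)) \<otimes>
      (T (pt R ?m r') \<otimes> T (shifts (snd q) ?g)) \<otimes> (?L \<otimes> ?L')"
    using r f c by (simp add: lprod_T[OF pp f(2)] TS B.m_assoc)
  also have "\<dots> = S (pt R ?l (r \<otimes>\<^sub>R ?f (ptgt deg p))) \<otimes> T (pt R ?m (?g (ptgt deg q) \<otimes>\<^sub>R r'))
      \<otimes> (?L \<otimes> ?L')"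
  proof -
    have "S (pt R ?l r) \<otimes> S (shifts (snd p) ?f) = S (pt R ?l (r \<otimes>\<^sub>R ?f (ptgt deg p)))"
      using r f shifts_path[OF pp(1), of ?f]
      by (simp add: S_mult[symmetric] R.M.pt_mult_right psrc_def)
    moreover have "T (pt R ?m r') \<otimes> T (shifts (snd q) ?g) = T (pt R ?m (?g (ptgt deg q) \<otimes>\<^sub>R r'))"
      using r f shifts_path[OF pp(2), of ?g]
      by (simp add: T_mult[symmetric] R.M.pt_mult_left psrc_def)
    ultimately show ?thesis by simp
  qed
  finally have eq: "theta r r' p q \<otimes> theta s s' p' q' =
      S (pt R ?l (r \<otimes>\<^sub>R ?f (ptgt deg p))) \<otimes> T (pt R ?m (?g (ptgt deg q) \<otimes>\<^sub>R r'))
      \<otimes> (?L \<otimes> ?L')" .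
  have z: "pt R l \<zero>\<^sub>R = \<zero>\<^sub>M" for l by (auto simp: pt_def fun_alg_simps)
  show ?thesis
  proof (cases "ptgt deg p = psrc p' \<and> ptgt deg q = psrc q'")
    case True
    then show ?thesis
      using lprod_append[OF pp p(3,4)] unfolding eq
      by (simp add: R.M.pt_apply theta_def pconc_def psrc_def)
  next
    case False
    then consider "ptgt deg p \<noteq> psrc p'" | "ptgt deg q \<noteq> psrc q'" by auto
    then show ?thesis
      using False r f c unfolding eq by cases (simp_all add: R.M.pt_apply z S_zero T_zero)
  qed
qed

definition Theta where "Theta = hq_lift B theta"

lemma Theta_lin: "Theta \<in> lin_map H B"
  unfolding Theta_def by (rule hq_lift_lin[OF B.ks theta_bilin])

lemma Theta_hb:
  "[|r \<in> carrier R; r' \<in> carrier R; p \<in> paths X deg n; q \<in> paths X deg n|] ==>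
   Theta (hb r r' p q) = theta r r' p q"
  unfolding Theta_def by (rule hq_lift_hb[OF B.ks theta_bilin])

lemma Theta_mult:
  assumes "x \<in> carrier H" "y \<in> carrier H"
  shows "Theta (x \<otimes>\<^sub>H y) = Theta x \<otimes> Theta y"
proof (rule hq_map_mult[OF B.kalg_axioms Theta_lin _ assms])
  fix r r' s s' n k p q p' q'
  assume a: "r \<in> carrier R" "r' \<in> carrier R" "s \<in> carrier R" "s' \<in> carrier R"
    "p \<in> paths X deg n" "q \<in> paths X deg n" "p' \<in> paths X deg k" "q' \<in> paths X deg k"
  show "Theta (hb r r' p q \<otimes>\<^sub>H hb s s' p' q') = Theta (hb r r' p q) \<otimes> Theta (hb s s' p' q')"
    using a pconc_paths[OF a(5,7)] pconc_paths[OF a(6,8)]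
      lin_map_zero[OF H.ks B.ks Theta_lin]
    by (simp add: hb_mult[OF a] theta_mult[OF a] Theta_hb[OF a(1,2,5,6)] Theta_hb[OF a(3,4,7,8)]
        Theta_hb[of _ _ _ "n + k"])
qed

lemma ST_sum:
  assumes "f \<in> carrier M" "g \<in> carrier M"
  shows "(\<Oplus>l\<in>UNIV. \<Oplus>m\<in>UNIV. S (pt R l (f l)) \<otimes> T (pt R m (g m))) = S f \<otimes> T g"
proof -
  have fc: "f l \<in> carrier R" "g l \<in> carrier R" for l
    using fun_alg_closed[OF assms(1)] fun_alg_closed[OF assms(2)] by simp_all
  have "S f = S (\<Oplus>\<^sub>M l\<in>UNIV. pt R l (f l))" using R.M.pt_sum[OF assms(1)] by simp
  also have "\<dots> = (\<Oplus>l\<in>UNIV. S (pt R l (f l)))"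
    by (rule lin_map_finsum[OF M.M.ks B.ks S_lin]) (simp add: fc)
  finally have Sf: "S f = (\<Oplus>l\<in>UNIV. S (pt R l (f l)))" .
  have "T g = T (\<Oplus>\<^sub>M l\<in>UNIV. pt R l (g l))" using R.M.pt_sum[OF assms(2)] by simp
  also have "\<dots> = (\<Oplus>l\<in>UNIV. T (pt R l (g l)))"
    by (rule lin_map_finsum[OF M.M.ks B.ks T_lin]) (simp add: fc)
  finally have Tg: "T g = (\<Oplus>m\<in>UNIV. T (pt R m (g m)))" .
  have "S f \<otimes> T g = (\<Oplus>l\<in>UNIV. S (pt R l (f l)) \<otimes> T g)"
    unfolding Sf using assms fc by (intro B.finsum_ldistr) auto
  also have "\<dots> = (\<Oplus>l\<in>UNIV. \<Oplus>m\<in>UNIV. S (pt R l (f l)) \<otimes> T (pt R m (g m)))"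
    unfolding Tg using assms fc
    by (intro B.finsum_eqI B.finsum_rdistr) (auto intro!: B.finsum_closed)
  finally show ?thesis ..
qed

lemma Theta_one: "Theta \<one>\<^sub>H = \<one>"
proof -
  have "Theta \<one>\<^sub>H = (\<Oplus>l\<in>UNIV. \<Oplus>m\<in>UNIV. theta \<one>\<^sub>R \<one>\<^sub>R (l, []) (m, []))"
    unfolding H_one
    by (subst lin_map_finsum[OF H.ks B.ks Theta_lin])
      (auto simp: lin_map_finsum[OF H.ks B.ks Theta_lin]
        Theta_hb[of _ _ _ 0] hb_closed[of _ _ _ 0]
        intro!: B.finsum_eqI H.finsum_closed B.finsum_closed theta_closed[of _ 0])
  also have "\<dots> = (\<Oplus>l\<in>UNIV. \<Oplus>m\<in>UNIV. S (pt R l (\<one>\<^sub>M l)) \<otimes> T (pt R m (\<one>\<^sub>M m)))"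
    by (auto simp: theta_def fun_alg_simps(3) intro!: B.finsum_eqI B.finsum_closed)
  also have "\<dots> = \<one>" by (subst ST_sum) (auto simp: S_one T_one)
  finally show ?thesis .
qed

text \<open>
  Each relation of the path algebra is the quadratic relation cut down by the idempotents at the two
  sources.
\<close>

lemma Theta_rel:
  assumes "a \<in> X" "b \<in> X" "c \<in> X" "d \<in> X"
  shows "Theta (rel_left l m a b c d) = Theta (rel_right l m a b c d)"
proof -
  let ?u = "S (pt R l \<one>\<^sub>R)" and ?v = "T (pt R m \<one>\<^sub>R)"
  note lf = lin_map_finsum[OF H.ks B.ks Theta_lin]
  have 1: "theta (\<sigma> x y a c l) \<one>\<^sub>R (path2 l y x) (path2 m d b)
      = ?u \<otimes> ?v \<otimes> (S (\<sigma> x y a c) \<otimes> (el y d \<otimes> el x b))" if "x \<in> X" "y \<in> X" for x y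
  proof -
    have "S (pt R l (\<sigma> x y a c l)) = ?u \<otimes> S (\<sigma> x y a c)"
      using that assms by (simp add: S_mult[symmetric] R.M.pt_mult_right)
    moreover have "S (\<sigma> x y a c) \<otimes> ?v = ?v \<otimes> S (\<sigma> x y a c)"
      using that assms by (simp add: TS)
    ultimately have "S (pt R l (\<sigma> x y a c l)) \<otimes> ?v = ?u \<otimes> ?v \<otimes> S (\<sigma> x y a c)"
      using that assms by (simp add: B.m_assoc)
    then show ?thesis unfolding theta_def using that assms by (simp add: B.m_assoc)
  qed
  have 2: "theta \<one>\<^sub>R (\<sigma> b d x y m) (path2 l c a) (path2 m y x)
      = ?u \<otimes> ?v \<otimes> (T (\<sigma> b d x y) \<otimes> (el c y \<otimes> el a x))" if "x \<in> X" "y \<in> X" for x y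
  proof -
    have "T (pt R m (\<sigma> b d x y m)) = ?v \<otimes> T (\<sigma> b d x y)"
      using that assms by (simp add: T_mult[symmetric] R.M.pt_mult_left)
    then show ?thesis unfolding theta_def using that assms by (simp add: B.m_assoc)
  qed
  have "Theta (rel_left l m a b c d) = (\<Oplus>y\<in>X. \<Oplus>x\<in>X.
      ?u \<otimes> ?v \<otimes> (S (\<sigma> x y a c) \<otimes> (el y d \<otimes> el x b)))"
    unfolding rel_left_def using assms
    by (subst lf) (auto simp: lf 1 Theta_hb[of _ _ _ 2]
        intro!: B.finsum_eqI H.finsum_closed B.finsum_closed)
  also have "\<dots> = ?u \<otimes> ?v \<otimes>
      (\<Oplus>y\<in>X. \<Oplus>x\<in>X. S (\<sigma> x y a c) \<otimes> (el y d \<otimes> el x b))"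
    using assms by (subst B.finsum_rdistr)
      (auto simp: B.finsum_rdistr intro!: B.finsum_eqI B.finsum_closed)
  also have "\<dots> = ?u \<otimes> ?v \<otimes>
      (\<Oplus>y\<in>X. \<Oplus>x\<in>X. T (\<sigma> b d x y) \<otimes> (el c y \<otimes> el a x))"
    unfolding quadratic[OF assms] ..
  also have "\<dots> = (\<Oplus>y\<in>X. \<Oplus>x\<in>X.
      ?u \<otimes> ?v \<otimes> (T (\<sigma> b d x y) \<otimes> (el c y \<otimes> el a x)))"
    using assms by (subst B.finsum_rdistr)
      (auto simp: B.finsum_rdistr intro!: B.finsum_eqI B.finsum_closed)
  also have "\<dots> = Theta (rel_right l m a b c d)"
    unfolding rel_right_def using assms
    by (subst lf) (auto simp: lf 2 Theta_hb[of _ _ _ 2]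
        intro!: B.finsum_eqI[symmetric] H.finsum_closed B.finsum_closed)
  finally show ?thesis .
qed

lemma Theta_kill: "x \<in> aw_ideal R X deg \<sigma> ==> Theta x = \<zero>"
  by (rule aw_ideal_kill[OF B.kalg_axioms Theta_lin Theta_mult Theta_rel])

end

context dyb
begin

section \<open>The bialgebroid of the path algebra\<close>

abbreviation AW :: "('k, ('k, 'r, 'l, 'x) aw) module" where "AW \<equiv> Aw R X deg \<sigma>"
abbreviation P :: "('k, 'r, 'l, 'x) hq => ('k, 'r, 'l, 'x) aw" where
  "P x \<equiv> aw_ideal R X deg \<sigma> +>\<^sub>H x"
abbreviation w :: "'r => 'r => ('l, 'x) path => ('l, 'x) path => ('k, 'r, 'l, 'x) aw" where
  "w r r' p q \<equiv> aw3 R X deg \<sigma> r r' (ebas p q)"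

sublocale W: kalg AW
  unfolding Aw_def by (rule kalg_quot[OF H.kalg_axioms aw_ideal])

lemma P_hom: "P \<in> alg_hom H AW"
  unfolding Aw_def by (rule proj_alg_hom[OF H.kalg_axioms aw_ideal])

lemmas P_lin = alg_hom_lin[OF P_hom]
lemmas P_closed [simp] = alg_hom_closed[OF P_hom]

lemma P_hb: "P (hb r r' p q) = w r r' p q"
  unfolding aw3_def ..

lemma w_closed [simp]:
  "[|r \<in> carrier R; r' \<in> carrier R; p \<in> paths X deg n; q \<in> paths X deg n|] ==> w r r' p q \<in> carrier AW"
  unfolding P_hb[symmetric] by simp

lemma w_bilin: "[|p \<in> paths X deg n; q \<in> paths X deg n|] ==> bilin R R AW (\<lambda>r r'. w r r' p q)"
  unfolding P_hb[symmetric]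
  by (intro bilinI lin_map_comp[OF hq3_lin1 P_lin] lin_map_comp[OF hq3_lin2 P_lin]) auto

lemmas w_lin1 = bilin_left[OF w_bilin]
lemmas w_lin2 = bilin_right[OF w_bilin]

lemma w_zero:
  assumes "r \<in> carrier R" "p \<in> paths X deg n" "q \<in> paths X deg n"
  shows "w \<zero>\<^sub>R r p q = \<zero>\<^sub>AW" "w r \<zero>\<^sub>R p q = \<zero>\<^sub>AW"
  using lin_map_zero[OF R.M.ks W.ks w_lin1[OF assms(2,3,1)]]
    lin_map_zero[OF R.M.ks W.ks w_lin2[OF assms(2,3,1)]] by simp_all

lemma w_mult:
  assumes "r \<in> carrier R" "r' \<in> carrier R" "s \<in> carrier R" "s' \<in> carrier R"
    and "p \<in> paths X deg n" "q \<in> paths X deg n" "p' \<in> paths X deg m" "q' \<in> paths X deg m"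
  shows "w r r' p q \<otimes>\<^sub>AW w s s' p' q' =
    (if ptgt deg p = psrc p' \<and> ptgt deg q = psrc q'
     then w (r \<otimes>\<^sub>R s) (s' \<otimes>\<^sub>R r') (pconc p p') (pconc q q') else \<zero>\<^sub>AW)"
proof -
  have "w r r' p q \<otimes>\<^sub>AW w s s' p' q' = P (hb r r' p q \<otimes>\<^sub>H hb s s' p' q')"
    unfolding P_hb[symmetric] using assms hb_closed
    by (intro alg_hom_mult[OF P_hom, symmetric]) blast+
  then show ?thesis
    unfolding hb_mult[OF assms] using lin_map_zero[OF H.ks W.ks P_lin]
    by (simp add: P_hb)
qed

lemma AW_cases:
  assumes "x \<in> carrier AW" obtains y where "y \<in> carrier H" "x = P y"
  using assms unfolding Aw_def by (rule quot_cases)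

lemma aw_induct [consumes 1, case_names gen add]:
  assumes "x \<in> carrier AW"
    and "\<And>r r' n p q. [|r \<in> carrier R; r' \<in> carrier R; p \<in> paths X deg n; q \<in> paths X deg n|] ==>
      Q (w r r' p q)"
    and "\<And>x y. [|x \<in> carrier AW; y \<in> carrier AW; Q x; Q y|] ==> Q (x \<oplus>\<^sub>AW y)"
  shows "Q x"
proof -
  obtain y where y: "y \<in> carrier H" "x = P y" using assms(1) by (rule AW_cases)
  have "Q (P y)" using y(1)
  proof (induction rule: hq_induct)
    case (gen r r' n p q)
    then show ?case using assms(2) P_hb by simp
  next
    case (add x y)
    then show ?case using assms(3)[of "P x" "P y"] by (simp add: lin_map_add[OF P_lin])
  qed
  then show ?thesis using y by simp
qed

lemma P_rel:
  assumes "a \<in> X" "b \<in> X" "c \<in> X" "d \<in> X"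
  shows "P (rel_left l m a b c d) = P (rel_right l m a b c d)"
proof -
  have "rel_left l m a b c d \<ominus>\<^sub>H rel_right l m a b c d \<in> aw_rels R X deg \<sigma>"
    unfolding aw_rels_eq by (intro CollectI exI conjI, rule refl) (rule assms)+
  then have "rel_left l m a b c d \<ominus>\<^sub>H rel_right l m a b c d \<in> aw_ideal R X deg \<sigma>"
    unfolding aw_ideal_def by (rule subsetD[OF H.genideal_self[OF aw_rels_carrier]])
  then show ?thesis
    using coset_eq_iff[OF H.ks aw_sub rel_closed(1)[OF assms] rel_closed(2)[OF assms]]
    by simp
qed

lemma w2_closed [simp]:
  "[|r \<in> carrier R; r' \<in> carrier R; x \<in> X; y \<in> X; x' \<in> X; y' \<in> X|] ==>
   w r r' (path2 l x y) (path2 m x' y') \<in> carrier AW"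
  by (rule w_closed[of _ _ _ 2]) auto

lemma w_rel:
  assumes "a \<in> X" "b \<in> X" "c \<in> X" "d \<in> X"
  shows "(\<Oplus>\<^sub>AW y\<in>X. \<Oplus>\<^sub>AW x\<in>X. w (\<sigma> x y a c l) \<one>\<^sub>R (path2 l y x) (path2 m d b))
    = (\<Oplus>\<^sub>AW y\<in>X. \<Oplus>\<^sub>AW x\<in>X. w \<one>\<^sub>R (\<sigma> b d x y m) (path2 l c a) (path2 m y x))"
proof -
  note lf = lin_map_finsum[OF H.ks W.ks P_lin]
  have "P (rel_left l m a b c d) =
    (\<Oplus>\<^sub>AW y\<in>X. \<Oplus>\<^sub>AW x\<in>X. w (\<sigma> x y a c l) \<one>\<^sub>R (path2 l y x) (path2 m d b))"
    unfolding rel_left_def P_hb[symmetric] using assms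
    by (subst lf, simp add: H.finsum_closed)
      (intro W.finsum_eqI lf W.finsum_closed, auto)
  moreover have "P (rel_right l m a b c d) =
    (\<Oplus>\<^sub>AW y\<in>X. \<Oplus>\<^sub>AW x\<in>X. w \<one>\<^sub>R (\<sigma> b d x y m) (path2 l c a) (path2 m y x))"
    unfolding rel_right_def P_hb[symmetric] using assms
    by (subst lf, simp add: H.finsum_closed)
      (intro W.finsum_eqI lf W.finsum_closed, auto)
  ultimately show ?thesis using P_rel[OF assms] by simp
qed

subsection \<open>Source, target and the matrix \<open>L\<close>\<close>

abbreviation sw where "sw \<equiv> aw_s R X deg \<sigma>"
abbreviation tw where "tw \<equiv> aw_t R X deg \<sigma>"
definition Lw :: "'x => 'x => ('k, 'r, 'l, 'x) aw" where
  "Lw a b = (\<Oplus>\<^sub>AW z\<in>UNIV. w \<one>\<^sub>R \<one>\<^sub>R (arrow (fst z) a) (arrow (snd z) b))"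

text \<open>A general element supported on trivial paths, of which \<open>sw\<close> and \<open>tw\<close> are special cases.\<close>

definition triv :: "('l => 'l => 'r) => ('l => 'l => 'r) => ('k, 'r, 'l, 'x) aw" where
  "triv f g = (\<Oplus>\<^sub>AW z\<in>UNIV. w (f (fst z) (snd z)) (g (fst z) (snd z)) (fst z, []) (snd z, []))"

lemma w0_closed [simp]:
  "[|r \<in> carrier R; r' \<in> carrier R|] ==> w r r' (l, []) (m, []) \<in> carrier AW"
  by (rule w_closed[of _ _ _ 0]) auto

lemma w1_closed [simp]:
  "[|r \<in> carrier R; r' \<in> carrier R; a \<in> X; b \<in> X|] ==> w r r' (arrow l a) (arrow m b) \<in> carrier AW"
  by (rule w_closed[of _ _ _ 1]) auto

lemma arrow_paths [simp]: "a \<in> X ==> arrow l a \<in> paths X deg (Suc 0)"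
  by simp

lemma triv_closed [simp]:
  "[|\<And>l m. f l m \<in> carrier R; \<And>l m. g l m \<in> carrier R|] ==> triv f g \<in> carrier AW"
  unfolding triv_def by (auto intro!: W.finsum_closed)

lemma sw_triv: "sw f = triv (\<lambda>l m. f l) (\<lambda>l m. \<one>\<^sub>R)"
  unfolding aw_s_def triv_def by (simp add: case_prod_unfold)

lemma tw_triv:
  assumes "f \<in> carrier M" shows "tw f = triv (\<lambda>l m. \<one>\<^sub>R) (\<lambda>l m. f m)"
proof -
  have fc: "f l \<in> carrier R" for l using assms by (rule fun_alg_closed)
  have "tw f = (\<Oplus>\<^sub>AW z\<in>prod.swap ` UNIV. w \<one>\<^sub>R (f (fst z)) (snd z, []) (fst z, []))"
    unfolding aw_t_def by (simp add: case_prod_unfold)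
  also have "\<dots> = triv (\<lambda>l m. \<one>\<^sub>R) (\<lambda>l m. f m)"
    unfolding triv_def by (subst W.finsum_reindex) (auto simp: fc)
  finally show ?thesis .
qed

lemma triv_w:
  assumes fg: "\<And>l m. f l m \<in> carrier R" "\<And>l m. g l m \<in> carrier R"
    and r: "r \<in> carrier R" "r' \<in> carrier R" and p: "p \<in> paths X deg n" "q \<in> paths X deg n"
  shows "triv f g \<otimes>\<^sub>AW w r r' p q
    = w (f (psrc p) (psrc q) \<otimes>\<^sub>R r) (r' \<otimes>\<^sub>R g (psrc p) (psrc q)) p q"
proof -
  let ?v = "w (f (psrc p) (psrc q) \<otimes>\<^sub>R r) (r' \<otimes>\<^sub>R g (psrc p) (psrc q)) p q"
  have v: "?v \<in> carrier AW" using fg r p by (intro w_closed) auto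
  have "triv f g \<otimes>\<^sub>AW w r r' p q = (\<Oplus>\<^sub>AW z\<in>UNIV.
      w (f (fst z) (snd z)) (g (fst z) (snd z)) (fst z, []) (snd z, []) \<otimes>\<^sub>AW w r r' p q)"
    unfolding triv_def using fg r p by (intro W.finsum_ldistr) auto
  also have "\<dots> = (\<Oplus>\<^sub>AW z\<in>UNIV. if z = (psrc p, psrc q) then ?v else \<zero>\<^sub>AW)"
    by (rule W.finsum_eqI, subst w_mult[OF fg r triv_paths triv_paths p])
      (use v in \<open>auto simp: psrc_def\<close>)
  also have "\<dots> = ?v" by (subst W.finsum_delta) (use v in auto)
  finally show ?thesis .
qed

lemma w_triv:
  assumes fg: "\<And>l m. f l m \<in> carrier R" "\<And>l m. g l m \<in> carrier R"
    and r: "r \<in> carrier R" "r' \<in> carrier R" and p: "p \<in> paths X deg n" "q \<in> paths X deg n"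
  shows "w r r' p q \<otimes>\<^sub>AW triv f g
    = w (r \<otimes>\<^sub>R f (ptgt deg p) (ptgt deg q)) (g (ptgt deg p) (ptgt deg q) \<otimes>\<^sub>R r') p q"
proof -
  let ?v = "w (r \<otimes>\<^sub>R f (ptgt deg p) (ptgt deg q)) (g (ptgt deg p) (ptgt deg q) \<otimes>\<^sub>R r') p q"
  have v: "?v \<in> carrier AW" using fg r p by (intro w_closed) auto
  have "w r r' p q \<otimes>\<^sub>AW triv f g = (\<Oplus>\<^sub>AW z\<in>UNIV.
      w r r' p q \<otimes>\<^sub>AW w (f (fst z) (snd z)) (g (fst z) (snd z)) (fst z, []) (snd z, []))"
    unfolding triv_def using fg r p by (intro W.finsum_rdistr) auto
  also have "\<dots> = (\<Oplus>\<^sub>AW z\<in>UNIV. if z = (ptgt deg p, ptgt deg q) then ?v else \<zero>\<^sub>AW)"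
    by (rule W.finsum_eqI, subst w_mult[OF r fg p triv_paths triv_paths]) (use v in auto)
  also have "\<dots> = ?v" by (subst W.finsum_delta) (use v in auto)
  finally show ?thesis .
qed

lemma triv_triv:
  assumes "\<And>l m. f l m \<in> carrier R" "\<And>l m. g l m \<in> carrier R"
    "\<And>l m. f' l m \<in> carrier R" "\<And>l m. g' l m \<in> carrier R"
  shows "triv f g \<otimes>\<^sub>AW triv f' g' = triv (\<lambda>l m. f l m \<otimes>\<^sub>R f' l m) (\<lambda>l m. g' l m \<otimes>\<^sub>R g l m)"
proof -
  have "triv f g \<otimes>\<^sub>AW triv f' g' = (\<Oplus>\<^sub>AW z\<in>UNIV.
      triv f g \<otimes>\<^sub>AW w (f' (fst z) (snd z)) (g' (fst z) (snd z)) (fst z, []) (snd z, []))"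
    unfolding triv_def[of f' g'] using assms by (intro W.finsum_rdistr) auto
  also have "\<dots> = triv (\<lambda>l m. f l m \<otimes>\<^sub>R f' l m) (\<lambda>l m. g' l m \<otimes>\<^sub>R g l m)"
    unfolding triv_def[of "\<lambda>l m. f l m \<otimes>\<^sub>R f' l m"]
    by (rule W.finsum_eqI, subst triv_w[OF assms triv_paths triv_paths]) (use assms in auto)
  finally show ?thesis .
qed

lemma triv_one: "triv (\<lambda>l m. \<one>\<^sub>R) (\<lambda>l m. \<one>\<^sub>R) = \<one>\<^sub>AW"
proof -
  note lf = lin_map_finsum[OF H.ks W.ks P_lin]
  have "\<one>\<^sub>AW = P \<one>\<^sub>H" using alg_hom_one[OF P_hom] by simp
  also have "\<dots> = (\<Oplus>\<^sub>AW l\<in>UNIV. \<Oplus>\<^sub>AW m\<in>UNIV. w \<one>\<^sub>R \<one>\<^sub>R (l, []) (m, []))"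
    unfolding H_one P_hb[symmetric]
    by (subst lf) (auto simp: lf hb_closed[of _ _ _ 0] intro!: W.finsum_eqI H.finsum_closed W.finsum_closed)
  also have "\<dots> = (\<Oplus>\<^sub>AW z\<in>UNIV \<times> UNIV. case z of (l, m) => w \<one>\<^sub>R \<one>\<^sub>R (l, []) (m, []))"
    by (rule W.finsum_Times) auto
  finally show ?thesis by (simp add: triv_def case_prod_unfold)
qed

lemma Lw_closed [simp]: "[|a \<in> X; b \<in> X|] ==> Lw a b \<in> carrier AW"
  unfolding Lw_def by (auto intro!: W.finsum_closed)

lemma triv_L:
  assumes fg: "\<And>l m. f l m \<in> carrier R" "\<And>l m. g l m \<in> carrier R" and ab: "a \<in> X" "b \<in> X"
  shows "triv f g \<otimes>\<^sub>AW Lw a b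
      = (\<Oplus>\<^sub>AW z\<in>UNIV. w (f (fst z) (snd z)) (g (fst z) (snd z)) (arrow (fst z) a) (arrow (snd z) b))"
    and "Lw a b \<otimes>\<^sub>AW triv f g = (\<Oplus>\<^sub>AW z\<in>UNIV. w (f (deg a (fst z)) (deg b (snd z)))
        (g (deg a (fst z)) (deg b (snd z))) (arrow (fst z) a) (arrow (snd z) b))"
proof -
  have "triv f g \<otimes>\<^sub>AW Lw a b
      = (\<Oplus>\<^sub>AW z\<in>UNIV. triv f g \<otimes>\<^sub>AW w \<one>\<^sub>R \<one>\<^sub>R (arrow (fst z) a) (arrow (snd z) b))"
    unfolding Lw_def using assms by (intro W.finsum_rdistr) auto
  also have "\<dots> = (\<Oplus>\<^sub>AW z\<in>UNIV. w (f (fst z) (snd z)) (g (fst z) (snd z)) (arrow (fst z) a) (arrow (snd z) b))"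
    by (rule W.finsum_eqI, subst triv_w[OF fg, of _ _ _ 1]) (use assms in auto)
  finally show "triv f g \<otimes>\<^sub>AW Lw a b
      = (\<Oplus>\<^sub>AW z\<in>UNIV. w (f (fst z) (snd z)) (g (fst z) (snd z)) (arrow (fst z) a) (arrow (snd z) b))" .
  have "Lw a b \<otimes>\<^sub>AW triv f g
      = (\<Oplus>\<^sub>AW z\<in>UNIV. w \<one>\<^sub>R \<one>\<^sub>R (arrow (fst z) a) (arrow (snd z) b) \<otimes>\<^sub>AW triv f g)"
    unfolding Lw_def using assms by (intro W.finsum_ldistr) auto
  also have "\<dots> = (\<Oplus>\<^sub>AW z\<in>UNIV. w (f (deg a (fst z)) (deg b (snd z)))
        (g (deg a (fst z)) (deg b (snd z))) (arrow (fst z) a) (arrow (snd z) b))"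
    by (rule W.finsum_eqI, subst w_triv[OF fg, of _ _ _ 1]) (use assms in auto)
  finally show "Lw a b \<otimes>\<^sub>AW triv f g = (\<Oplus>\<^sub>AW z\<in>UNIV. w (f (deg a (fst z)) (deg b (snd z)))
        (g (deg a (fst z)) (deg b (snd z))) (arrow (fst z) a) (arrow (snd z) b))" .
qed

lemma triv_L_L:
  assumes fg: "\<And>l m. f l m \<in> carrier R" "\<And>l m. g l m \<in> carrier R"
    and X: "y \<in> X" "d \<in> X" "x \<in> X" "b \<in> X"
  shows "triv f g \<otimes>\<^sub>AW (Lw y d \<otimes>\<^sub>AW Lw x b)
    = (\<Oplus>\<^sub>AW z\<in>UNIV. w (f (fst z) (snd z)) (g (fst z) (snd z)) (path2 (fst z) y x) (path2 (snd z) d b))"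
proof -
  have 1: "w r r' (arrow l y) (arrow m d) \<otimes>\<^sub>AW Lw x b = w r r' (path2 l y x) (path2 m d b)"
    if r: "r \<in> carrier R" "r' \<in> carrier R" for r r' l m
  proof -
    let ?v = "w r r' (path2 l y x) (path2 m d b)"
    have v: "?v \<in> carrier AW" using r X by simp
    have "w r r' (arrow l y) (arrow m d) \<otimes>\<^sub>AW Lw x b = (\<Oplus>\<^sub>AW z\<in>UNIV.
        w r r' (arrow l y) (arrow m d) \<otimes>\<^sub>AW w \<one>\<^sub>R \<one>\<^sub>R (arrow (fst z) x) (arrow (snd z) b))"
      unfolding Lw_def using r X by (intro W.finsum_rdistr) auto
    also have "\<dots> = (\<Oplus>\<^sub>AW z\<in>UNIV. if z = (deg y l, deg d m) then ?v else \<zero>\<^sub>AW)"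
      by (rule W.finsum_eqI, subst w_mult[OF r R.M.one_closed R.M.one_closed, of _ 1 _ _ 1])
        (use v r X in \<open>auto simp: pconc_def\<close>)
    also have "\<dots> = ?v" by (subst W.finsum_delta) (use v in auto)
    finally show ?thesis .
  qed
  have "triv f g \<otimes>\<^sub>AW (Lw y d \<otimes>\<^sub>AW Lw x b) = (triv f g \<otimes>\<^sub>AW Lw y d) \<otimes>\<^sub>AW Lw x b"
    using assms by (simp add: W.m_assoc)
  also have "\<dots> = (\<Oplus>\<^sub>AW z\<in>UNIV.
      w (f (fst z) (snd z)) (g (fst z) (snd z)) (arrow (fst z) y) (arrow (snd z) d) \<otimes>\<^sub>AW Lw x b)"
    unfolding triv_L(1)[OF fg X(1,2)] using assms by (intro W.finsum_ldistr) auto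
  also have "\<dots> = (\<Oplus>\<^sub>AW z\<in>UNIV.
      w (f (fst z) (snd z)) (g (fst z) (snd z)) (path2 (fst z) y x) (path2 (snd z) d b))"
    by (rule W.finsum_eqI) (use assms in \<open>auto simp: 1\<close>)
  finally show ?thesis .
qed

lemma sw_closed: "f \<in> carrier M ==> sw f \<in> carrier AW"
  unfolding sw_triv using fun_alg_closed[of f R] by (intro triv_closed) auto

lemma eval_lin: "(\<lambda>f. f l) \<in> lin_map M R"
  by (rule fun_alg_eval_lin)

lemma sw_lin: "sw \<in> lin_map M AW"
proof -
  have "(\<lambda>f. \<Oplus>\<^sub>AW z\<in>UNIV. w (f (fst z)) \<one>\<^sub>R (fst z, []) (snd z, [])) \<in> lin_map M AW"
    by (rule lin_map_sum[OF W.ks])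
      (auto intro: lin_map_comp[OF eval_lin w_lin1[of _ 0]])
  then show ?thesis by (simp add: sw_triv[abs_def] triv_def)
qed

lemma tw_lin: "tw \<in> lin_map M AW"
proof -
  have "(\<lambda>f. \<Oplus>\<^sub>AW z\<in>UNIV. w \<one>\<^sub>R (f (snd z)) (fst z, []) (snd z, [])) \<in> lin_map M AW"
    by (rule lin_map_sum[OF W.ks])
      (auto intro: lin_map_comp[OF eval_lin w_lin2[of _ 0]])
  then show ?thesis
    by (rule lin_map_cong[OF M.M.ks]) (simp add: tw_triv triv_def)
qed

sublocale Wq: quad R \<psi> I r1 r2 X deg \<sigma> AW sw tw Lw
proof
  have fc: "f l \<in> carrier R" if "f \<in> carrier M" for f l using fun_alg_closed[OF that] .
  show "sw \<in> lin_map M AW" "tw \<in> lin_map M AW" by (rule sw_lin tw_lin)+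
  show "sw \<one>\<^sub>M = \<one>\<^sub>AW"
    using triv_one by (simp add: sw_triv fun_alg_simps)
  show "tw \<one>\<^sub>M = \<one>\<^sub>AW"
    using triv_one by (simp add: tw_triv) (simp add: fun_alg_simps)
  fix f g assume f: "f \<in> carrier M" and g: "g \<in> carrier M"
  note c = fc[OF f] fc[OF g]
  show "sw (f \<otimes>\<^sub>M g) = sw f \<otimes>\<^sub>AW sw g"
    unfolding sw_triv by (subst triv_triv) (auto simp: c fun_alg_simps)
  show "tw (f \<otimes>\<^sub>M g) = tw g \<otimes>\<^sub>AW tw f"
    unfolding tw_triv[OF f] tw_triv[OF g] tw_triv[OF M.M.m_closed[OF f g]]
    by (subst triv_triv) (auto simp: c fun_alg_simps)
  show "tw g \<otimes>\<^sub>AW sw f = sw f \<otimes>\<^sub>AW tw g"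
    unfolding sw_triv tw_triv[OF g] by (subst triv_triv, simp_all add: c)+
next
  have fc: "f l \<in> carrier R" if "f \<in> carrier M" for f l using fun_alg_closed[OF that] .
  fix a b f assume a: "a \<in> X" "b \<in> X" and f: "f \<in> carrier M"
  then have s: "shift \<alpha> f \<in> carrier M" for \<alpha> by simp
  note c = fc[OF f] fc[OF s]
  show "Lw a b \<otimes>\<^sub>AW sw f = sw (shift (deg a) f) \<otimes>\<^sub>AW Lw a b"
    unfolding sw_triv using a c by (simp add: triv_L shift_def)
  show "Lw a b \<otimes>\<^sub>AW tw f = tw (shift (deg b) f) \<otimes>\<^sub>AW Lw a b"
    unfolding tw_triv[OF f] tw_triv[OF s] using a c by (simp add: triv_L shift_def)
next
  fix a b c d assume X: "a \<in> X" "b \<in> X" "c \<in> X" "d \<in> X"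
  have \<sigma>M: "\<sigma> a b c d \<in> carrier M" if "a \<in> X" "b \<in> X" "c \<in> X" "d \<in> X" for a b c d
    using that by (simp add: fun_alg_simps)
  have "(\<Oplus>\<^sub>AW y\<in>X. \<Oplus>\<^sub>AW x\<in>X. sw (\<sigma> x y a c) \<otimes>\<^sub>AW (Lw y d \<otimes>\<^sub>AW Lw x b))
      = (\<Oplus>\<^sub>AW y\<in>X. \<Oplus>\<^sub>AW x\<in>X. \<Oplus>\<^sub>AW z\<in>UNIV.
          w (\<sigma> x y a c (fst z)) \<one>\<^sub>R (path2 (fst z) y x) (path2 (snd z) d b))"
    using X by (intro W.finsum_eqI W.finsum_closed) (auto simp: sw_triv triv_L_L intro!: W.finsum_closed)
  also have "\<dots> = (\<Oplus>\<^sub>AW y\<in>X. \<Oplus>\<^sub>AW z\<in>UNIV. \<Oplus>\<^sub>AW x\<in>X.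
          w (\<sigma> x y a c (fst z)) \<one>\<^sub>R (path2 (fst z) y x) (path2 (snd z) d b))"
    using X by (intro W.finsum_eqI W.finsum_swap) (auto intro!: W.finsum_closed)
  also have "\<dots> = (\<Oplus>\<^sub>AW z\<in>UNIV. \<Oplus>\<^sub>AW y\<in>X. \<Oplus>\<^sub>AW x\<in>X.
          w (\<sigma> x y a c (fst z)) \<one>\<^sub>R (path2 (fst z) y x) (path2 (snd z) d b))"
    using X by (intro W.finsum_swap) (auto intro!: W.finsum_closed)
  also have "\<dots> = (\<Oplus>\<^sub>AW z\<in>UNIV. \<Oplus>\<^sub>AW y\<in>X. \<Oplus>\<^sub>AW x\<in>X.
          w \<one>\<^sub>R (\<sigma> b d x y (snd z)) (path2 (fst z) c a) (path2 (snd z) y x))"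
    by (rule W.finsum_eqI) (use X in \<open>auto simp: w_rel[OF X] intro!: W.finsum_closed\<close>)
  also have "\<dots> = (\<Oplus>\<^sub>AW y\<in>X. \<Oplus>\<^sub>AW z\<in>UNIV. \<Oplus>\<^sub>AW x\<in>X.
          w \<one>\<^sub>R (\<sigma> b d x y (snd z)) (path2 (fst z) c a) (path2 (snd z) y x))"
    using X by (intro W.finsum_swap) (auto intro!: W.finsum_closed)
  also have "\<dots> = (\<Oplus>\<^sub>AW y\<in>X. \<Oplus>\<^sub>AW x\<in>X. \<Oplus>\<^sub>AW z\<in>UNIV.
          w \<one>\<^sub>R (\<sigma> b d x y (snd z)) (path2 (fst z) c a) (path2 (snd z) y x))"
    using X by (intro W.finsum_eqI W.finsum_swap) (auto intro!: W.finsum_closed)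
  also have "\<dots> = (\<Oplus>\<^sub>AW y\<in>X. \<Oplus>\<^sub>AW x\<in>X. tw (\<sigma> b d x y) \<otimes>\<^sub>AW (Lw c y \<otimes>\<^sub>AW Lw a x))"
    using X by (intro W.finsum_eqI W.finsum_closed)
      (auto simp: tw_triv[OF \<sigma>M] triv_L_L intro!: W.finsum_closed)
  finally show "(\<Oplus>\<^sub>AW y\<in>X. \<Oplus>\<^sub>AW x\<in>X. sw (\<sigma> x y a c) \<otimes>\<^sub>AW (Lw y d \<otimes>\<^sub>AW Lw x b))
      = (\<Oplus>\<^sub>AW y\<in>X. \<Oplus>\<^sub>AW x\<in>X. tw (\<sigma> b d x y) \<otimes>\<^sub>AW (Lw c y \<otimes>\<^sub>AW Lw a x))" .
qed (rule Lw_closed)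

subsection \<open>Generation by source, target and \<open>L\<close>\<close>

lemma stw: "[|f \<in> carrier M; g \<in> carrier M|] ==>
    sw f \<otimes>\<^sub>AW tw g = triv (\<lambda>l m. f l) (\<lambda>l m. g m)"
  unfolding sw_triv using fun_alg_closed[of f R] fun_alg_closed[of g R]
  by (simp add: tw_triv, subst triv_triv) auto

lemma w_theta_0:
  assumes r: "r \<in> carrier R" "r' \<in> carrier R"
  shows "w r r' (l, []) (m, []) = Wq.theta r r' (l, []) (m, [])"
proof -
  have "sw (pt R l r) \<otimes>\<^sub>AW tw (pt R m r')
      = (\<Oplus>\<^sub>AW z\<in>UNIV. w (pt R l r (fst z)) (pt R m r' (snd z)) (fst z, []) (snd z, []))"
    using r by (simp add: stw triv_def)
  also have "\<dots> = (\<Oplus>\<^sub>AW z\<in>UNIV. if z = (l, m) then w r r' (fst z, []) (snd z, []) else \<zero>\<^sub>AW)"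
    by (rule W.finsum_eqI) (use r in \<open>auto simp: R.M.pt_apply w_zero[of _ _ 0]\<close>)
  also have "\<dots> = w r r' (l, []) (m, [])"
    by (subst W.finsum_delta) (use r in auto)
  finally show ?thesis using r by (simp add: Wq.theta_def)
qed

lemma w_theta_1:
  assumes r: "r \<in> carrier R" "r' \<in> carrier R" and X: "x \<in> X" "y \<in> X"
  shows "w r r' (arrow l x) (arrow m y) = Wq.theta r r' (arrow l x) (arrow m y)"
proof -
  have "sw (pt R l r) \<otimes>\<^sub>AW tw (pt R m r') \<otimes>\<^sub>AW Lw x y
      = (\<Oplus>\<^sub>AW z\<in>UNIV. w (pt R l r (fst z)) (pt R m r' (snd z)) (arrow (fst z) x) (arrow (snd z) y))"
    using r X by (simp add: stw triv_L)
  also have "\<dots> = (\<Oplus>\<^sub>AW z\<in>UNIV. if z = (l, m) then w r r' (arrow (fst z) x) (arrow (snd z) y) else \<zero>\<^sub>AW)"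
    by (rule W.finsum_eqI) (use r X in \<open>auto simp: R.M.pt_apply w_zero[of _ _ 1]\<close>)
  also have "\<dots> = w r r' (arrow l x) (arrow m y)"
    by (subst W.finsum_delta) (use r X in auto)
  finally show ?thesis using r X by (simp add: Wq.theta_def)
qed

text \<open>
  Every basis element is the product of its arrows, so it has the form prescribed by \<open>theta\<close>.
\<close>

lemma w_theta:
  "[|r \<in> carrier R; r' \<in> carrier R; (l, xs) \<in> paths X deg n; (m, ys) \<in> paths X deg n|] ==>
   w r r' (l, xs) (m, ys) = Wq.theta r r' (l, xs) (m, ys)"
proof (induction xs arbitrary: r r' l m n ys)
  case Nil
  then have "n = 0" by simp
  then have "ys = []" using paths_length[OF Nil.prems(4)] by simp
  then show ?case using Nil.prems by (simp add: w_theta_0)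
next
  case (Cons x xs)
  then obtain y ys' where ys: "ys = y # ys'" by (cases ys) auto
  let ?p = "(atgt deg x, xs)" and ?q = "(atgt deg y, ys')"
  have pq: "?p \<in> paths X deg (length xs)" "?q \<in> paths X deg (length xs)"
    and x: "fst x = l" "snd x \<in> X" "fst y = m" "snd y \<in> X" using Cons.prems ys by auto
  have a: "arrow l (snd x) \<in> paths X deg 1" "arrow m (snd y) \<in> paths X deg 1" using x by auto
  have c: "pconc (arrow l (snd x)) ?p = (l, x # xs)" "pconc (arrow m (snd y)) ?q = (m, y # ys')"
    using x by (auto simp: pconc_def)
  have t: "ptgt deg (arrow l (snd x)) = psrc ?p" "ptgt deg (arrow m (snd y)) = psrc ?q"
    using x by (auto simp: atgt_def)
  have "w r r' (l, x # xs) (m, ys)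
      = w r r' (arrow l (snd x)) (arrow m (snd y)) \<otimes>\<^sub>AW w \<one>\<^sub>R \<one>\<^sub>R ?p ?q"
    using Cons.prems x by (subst w_mult[OF _ _ _ _ a pq]) (simp_all only: t c ys, simp_all)
  also have "\<dots> = Wq.theta r r' (arrow l (snd x)) (arrow m (snd y)) \<otimes>\<^sub>AW Wq.theta \<one>\<^sub>R \<one>\<^sub>R ?p ?q"
    using Cons.prems x Cons.IH[OF _ _ pq] by (simp add: w_theta_1)
  also have "\<dots> = Wq.theta r r' (l, x # xs) (m, ys)"
    using Cons.prems x by (subst Wq.theta_mult[OF _ _ _ _ a pq]) (simp_all only: t c ys, simp_all)
  finally show ?case .
qed

text \<open>Hence algebra homomorphisms on \<open>AW\<close> are determined by their values on these elements.\<close>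

lemma AW_hom_eqI:
  assumes g: "g \<in> alg_hom AW B" and h: "h \<in> alg_hom AW B" and B: "kalg B"
    and s: "\<And>f. f \<in> carrier M ==> g (sw f) = h (sw f)"
    and t: "\<And>f. f \<in> carrier M ==> g (tw f) = h (tw f)"
    and L: "\<And>a b. [|a \<in> X; b \<in> X|] ==> g (Lw a b) = h (Lw a b)"
    and x: "x \<in> carrier AW"
  shows "g x = h x"
  using x
proof (induction rule: aw_induct)
  case (gen r r' n p q)
  have l: "g (Wq.lprod xs ys) = h (Wq.lprod xs ys)"
    if "(l, xs) \<in> paths X deg k" "(m, ys) \<in> paths X deg k" for l m k xs ys
    using that
  proof (induction xs ys arbitrary: l m k rule: Wq.lprod.induct)
    case (1 x xs y ys)
    then have p: "(atgt deg x, xs) \<in> paths X deg (length xs)" "(atgt deg y, ys) \<in> paths X deg (length xs)"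
      "snd x \<in> X" "snd y \<in> X" by auto
    then show ?case
      using "1.IH"[OF p(1,2)] Wq.lprod_closed[OF p(1,2)]
      by (simp add: alg_hom_mult[OF g] alg_hom_mult[OF h] L)
  qed (auto simp: alg_hom_one[OF g] alg_hom_one[OF h])
  have "w r r' p q = Wq.theta r r' p q"
    using w_theta[of r r' "fst p" "snd p" n "fst q" "snd q"] gen by simp
  then show ?case
    using gen l[of "fst p" "snd p" n "fst q" "snd q"]
    by (simp add: Wq.theta_def alg_hom_mult[OF g] alg_hom_mult[OF h] s t)
next
  case (add x y)
  then show ?case by (simp add: lin_map_add[OF alg_hom_lin[OF g]] lin_map_add[OF alg_hom_lin[OF h]])
qed

end

lemma (in ring) finsum_mult:
  assumes "finite U" "finite V" "\<And>u. u \<in> U ==> f u \<in> carrier R" "\<And>v. v \<in> V ==> g v \<in> carrier R"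
  shows "(\<Oplus>u\<in>U. f u) \<otimes> (\<Oplus>v\<in>V. g v) = (\<Oplus>u\<in>U. \<Oplus>v\<in>V. f u \<otimes> g v)"
proof -
  have "(\<Oplus>u\<in>U. f u) \<otimes> (\<Oplus>v\<in>V. g v) = (\<Oplus>u\<in>U. f u \<otimes> (\<Oplus>v\<in>V. g v))"
    by (rule finsum_ldistr) (use assms in \<open>auto intro!: finsum_closed\<close>)
  also have "\<dots> = (\<Oplus>u\<in>U. \<Oplus>v\<in>V. f u \<otimes> g v)"
    by (intro finsum_eqI finsum_rdistr finsum_closed) (use assms in auto)
  finally show ?thesis .
qed

context two_kalgs
begin

lemma tens_zero [simp]:
  "b \<in> carrier B ==> tens A B \<zero>\<^sub>A b = \<zero>\<^bsub>tensor A B\<^esub>"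
  "a \<in> carrier A ==> tens A B a \<zero>\<^sub>B = \<zero>\<^bsub>tensor A B\<^esub>"
  using lin_map_zero[OF A.ks T.ks bilin_left[OF tens_bilin]]
    lin_map_zero[OF B.ks T.ks bilin_right[OF tens_bilin]] by simp_all

lemma tens_sum_left:
  "[|\<And>i. i \<in> S ==> f i \<in> carrier A; b \<in> carrier B|] ==>
   tens A B (\<Oplus>\<^sub>A i\<in>S. f i) b = (\<Oplus>\<^bsub>tensor A B\<^esub>i\<in>S. tens A B (f i) b)"
  by (rule lin_map_finsum[OF A.ks T.ks bilin_left[OF tens_bilin]])

lemma tens_sum_right:
  "[|\<And>i. i \<in> S ==> g i \<in> carrier B; a \<in> carrier A|] ==>
   tens A B a (\<Oplus>\<^sub>B i\<in>S. g i) = (\<Oplus>\<^bsub>tensor A B\<^esub>i\<in>S. tens A B a (g i))"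
  by (rule lin_map_finsum[OF B.ks T.ks bilin_right[OF tens_bilin]])

end

sublocale quad \<subseteq> Bb: base_maps B M "frob_form \<psi>" J f1 f2 S T
  by unfold_locales (auto intro: S_lin T_lin S_mult T_mult)

context dyb
begin

section \<open>The weak bialgebra structure\<close>

abbreviation WW where "WW \<equiv> tensor AW AW"
abbreviation tt where "tt \<equiv> tens AW AW"
abbreviation EW where "EW \<equiv> Wq.Bb.E"

lemmas WW_kspace = Wq.Bb.AA.T.ks
lemmas tt_closed = Wq.Bb.AA.tens_closed
lemmas tt_bilin = Wq.Bb.AA.tens_bilin

lemma paths_fin [simp]: "finite (paths X deg n)"
  by (rule finite_paths) simp

lemma sw_w: "[|f \<in> carrier M; r \<in> carrier R; r' \<in> carrier R; p \<in> paths X deg n; q \<in> paths X deg n|] ==>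
    sw f \<otimes>\<^sub>AW w r r' p q = w (f (psrc p) \<otimes>\<^sub>R r) r' p q"
  unfolding sw_triv using fun_alg_closed[of f R] by (subst triv_w) auto

lemma tw_w: "[|f \<in> carrier M; r \<in> carrier R; r' \<in> carrier R; p \<in> paths X deg n; q \<in> paths X deg n|] ==>
    tw f \<otimes>\<^sub>AW w r r' p q = w r (r' \<otimes>\<^sub>R f (psrc q)) p q"
  using fun_alg_closed[of f R] by (simp add: tw_triv, subst triv_w) auto

text \<open>The value of the comultiplication at \<open>r \<otimes> r' \<otimes> e p q\<close>.\<close>

definition dl where "dl r r' p q = (\<Oplus>\<^sub>WW u\<in>paths X deg (length (snd p)). \<Oplus>\<^sub>WW i\<in>I.
    tt (w r (r1 i) p u) (w (r2 i) r' u q))"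

lemma tt_w_closed [simp]:
  "[|r \<in> carrier R; r' \<in> carrier R; s \<in> carrier R; s' \<in> carrier R; p \<in> paths X deg n; q \<in> paths X deg n;
    p' \<in> paths X deg m; q' \<in> paths X deg m|] ==> tt (w r r' p q) (w s s' p' q') \<in> carrier WW"
  by (intro tt_closed w_closed)

lemma tt_w_bilin:
  assumes "r \<in> carrier R" "r' \<in> carrier R" "p \<in> paths X deg n" "u \<in> paths X deg n"
    "u' \<in> paths X deg m" "q \<in> paths X deg m"
  shows "bilin R R WW (\<lambda>x y. tt (w r x p u) (w y r' u' q))"
  by (rule bilin_comp[OF tt_bilin w_lin2 w_lin1]) (use assms in auto)

lemma dl_eq: "p \<in> paths X deg n ==> dl r r' p q =
    (\<Oplus>\<^sub>WW u\<in>paths X deg n. \<Oplus>\<^sub>WW i\<in>I. tt (w r (r1 i) p u) (w (r2 i) r' u q))"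
  by (simp add: dl_def paths_length)

lemma dl_bilin:
  assumes "p \<in> paths X deg n" "q \<in> paths X deg n"
  shows "bilin R R WW (\<lambda>r r'. dl r r' p q)"
  unfolding dl_eq[OF assms(1)]
  by (intro bilinI lin_map_sum[OF WW_kspace] lin_map_comp[OF w_lin1 bilin_left[OF tt_bilin]]
      lin_map_comp[OF w_lin2 bilin_right[OF tt_bilin]])
    (use assms in \<open>auto intro: w_closed\<close>)

lemmas dl_closed [simp] = bilin_closed[OF dl_bilin]

definition Dw where "Dw = hq_lift WW dl"

lemma Dw_lin: "Dw \<in> lin_map H WW"
  unfolding Dw_def by (rule hq_lift_lin[OF WW_kspace dl_bilin])

lemma Dw_hb:
  "[|r \<in> carrier R; r' \<in> carrier R; p \<in> paths X deg n; q \<in> paths X deg n|] ==> Dw (hb r r' p q) = dl r r' p q"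
  unfolding Dw_def by (rule hq_lift_hb[OF WW_kspace dl_bilin])

lemma dl_mult:
  assumes r: "r \<in> carrier R" "r' \<in> carrier R" "s \<in> carrier R" "s' \<in> carrier R"
    and p: "p \<in> paths X deg n" "q \<in> paths X deg n" "p' \<in> paths X deg k" "q' \<in> paths X deg k"
  shows "dl r r' p q \<otimes>\<^sub>WW dl s s' p' q' =
    (if ptgt deg p = psrc p' \<and> ptgt deg q = psrc q'
     then dl (r \<otimes>\<^sub>R s) (s' \<otimes>\<^sub>R r') (pconc p p') (pconc q q') else \<zero>\<^sub>WW)"
proof -
  let ?c = "ptgt deg p = psrc p' \<and> ptgt deg q = psrc q'"
  let ?a = "\<lambda>u i. tt (w r (r1 i) p u) (w (r2 i) r' u q)"
  let ?b = "\<lambda>u j. tt (w s (r1 j) p' u) (w (r2 j) s' u q')"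
  let ?\<beta> = "\<lambda>v x y. tt (w (r \<otimes>\<^sub>R s) x (pconc p p') v) (w y (s' \<otimes>\<^sub>R r') v (pconc q q'))"
  have ac: "?a u i \<in> carrier WW" if "u \<in> paths X deg n" "i \<in> I" for u i using that r p by simp
  have bc: "?b u i \<in> carrier WW" if "u \<in> paths X deg k" "i \<in> I" for u i using that r p by simp
  have "dl r r' p q \<otimes>\<^sub>WW dl s s' p' q' = (\<Oplus>\<^sub>WW u\<in>paths X deg n. \<Oplus>\<^sub>WW u'\<in>paths X deg k.
      (\<Oplus>\<^sub>WW i\<in>I. ?a u i) \<otimes>\<^sub>WW (\<Oplus>\<^sub>WW j\<in>I. ?b u' j))"
    unfolding dl_eq[OF p(1)] dl_eq[OF p(3)]
    by (rule Wq.Bb.AA.T.finsum_mult) (auto intro!: Wq.Bb.AA.T.finsum_closed ac bc)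
  also have "\<dots> = (\<Oplus>\<^sub>WW u\<in>paths X deg n. \<Oplus>\<^sub>WW u'\<in>paths X deg k.
      if ptgt deg u = psrc u' then (if ?c then \<Oplus>\<^sub>WW i\<in>I. ?\<beta> (pconc u u') (r1 i) (r2 i) else \<zero>\<^sub>WW)
      else \<zero>\<^sub>WW)"
  proof (intro Wq.Bb.AA.T.finsum_eqI)
    fix u u' assume u: "u \<in> paths X deg n" "u' \<in> paths X deg k"
    have t: "?a u i \<otimes>\<^sub>WW ?b u' j = (if ptgt deg u = psrc u' then
        (if ?c then ?\<beta> (pconc u u') (r1 j \<otimes>\<^sub>R r1 i) (r2 i \<otimes>\<^sub>R r2 j) else \<zero>\<^sub>WW) else \<zero>\<^sub>WW)"
      if i: "i \<in> I" "j \<in> I" for i j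
    proof -
      have "?a u i \<otimes>\<^sub>WW ?b u' j = tt (w r (r1 i) p u \<otimes>\<^sub>AW w s (r1 j) p' u')
          (w (r2 i) r' u q \<otimes>\<^sub>AW w (r2 j) s' u' q')"
        using u r p i by (intro Wq.Bb.AA.tens_mult w_closed) auto
      moreover have "w x y (pconc p p') (pconc u u') \<in> carrier AW"
        if "x \<in> carrier R" "y \<in> carrier R" "ptgt deg p = psrc p'" "ptgt deg u = psrc u'" for x y
        using that pconc_paths[OF p(1,3)] pconc_paths[OF u] by (intro w_closed) auto
      moreover have "w x y (pconc u u') (pconc q q') \<in> carrier AW"
        if "x \<in> carrier R" "y \<in> carrier R" "ptgt deg q = psrc q'" "ptgt deg u = psrc u'" for x y
        using that pconc_paths[OF p(2,4)] pconc_paths[OF u] by (intro w_closed) auto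
      ultimately show ?thesis
        using i r w_mult[OF r(1) R.e1_closed[OF i(1)] r(3) R.e1_closed[OF i(2)] p(1) u(1) p(3) u(2)]
          w_mult[OF R.e2_closed[OF i(1)] r(2) R.e2_closed[OF i(2)] r(4) u(1) p(2) u(2) p(4)]
        by simp
    qed
    have "(\<Oplus>\<^sub>WW i\<in>I. ?a u i) \<otimes>\<^sub>WW (\<Oplus>\<^sub>WW j\<in>I. ?b u' j) = (\<Oplus>\<^sub>WW i\<in>I. \<Oplus>\<^sub>WW j\<in>I. ?a u i \<otimes>\<^sub>WW ?b u' j)"
      by (rule Wq.Bb.AA.T.finsum_mult) (auto intro!: ac bc u)
    also have "\<dots> = (if ptgt deg u = psrc u' then (if ?c then \<Oplus>\<^sub>WW i\<in>I. ?\<beta> (pconc u u') (r1 i) (r2 i) else \<zero>\<^sub>WW)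
      else \<zero>\<^sub>WW)"
    proof (cases "ptgt deg u = psrc u' \<and> ?c")
      case True
      have \<beta>: "bilin R R WW (?\<beta> (pconc u u'))"
        by (rule tt_w_bilin[of _ _ _ "n + k" _ _ "n + k"])
          (use True r pconc_paths[OF p(1,3)] pconc_paths[OF p(2,4)] pconc_paths[OF u] in auto)
      have "(\<Oplus>\<^sub>WW i\<in>I. \<Oplus>\<^sub>WW j\<in>I. ?a u i \<otimes>\<^sub>WW ?b u' j)
          = (\<Oplus>\<^sub>WW i\<in>I. \<Oplus>\<^sub>WW j\<in>I. ?\<beta> (pconc u u') (r1 j \<otimes>\<^sub>R r1 i) (r2 i \<otimes>\<^sub>R r2 j))"
        by (intro Wq.Bb.AA.T.finsum_eqI Wq.Bb.AA.T.finsum_closed)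
          (use True bilin_closed[OF \<beta>] in \<open>simp_all add: t\<close>)
      also have "\<dots> = (\<Oplus>\<^sub>WW i\<in>I. ?\<beta> (pconc u u') (r1 i) (r2 i))"
        by (rule R.e_idempotent[OF WW_kspace \<beta>])
      finally show ?thesis using True by simp
    next
      case False
      have "(\<Oplus>\<^sub>WW i\<in>I. \<Oplus>\<^sub>WW j\<in>I. ?a u i \<otimes>\<^sub>WW ?b u' j) = (\<Oplus>\<^sub>WW i\<in>I. \<Oplus>\<^sub>WW j\<in>I. \<zero>\<^sub>WW)"
        by (intro Wq.Bb.AA.T.finsum_eqI Wq.Bb.AA.T.finsum_closed) (use False in \<open>auto simp: t\<close>)
      then show ?thesis using False by (auto simp: Wq.Bb.AA.T.finsum_zero)
    qed
    finally show "(\<Oplus>\<^sub>WW i\<in>I. ?a u i) \<otimes>\<^sub>WW (\<Oplus>\<^sub>WW j\<in>I. ?b u' j)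
      = (if ptgt deg u = psrc u' then (if ?c then \<Oplus>\<^sub>WW i\<in>I. ?\<beta> (pconc u u') (r1 i) (r2 i) else \<zero>\<^sub>WW)
      else \<zero>\<^sub>WW)" .
  next
    fix u u' assume u: "u \<in> paths X deg n" "u' \<in> paths X deg k"
    show "(if ptgt deg u = psrc u' then (if ?c then \<Oplus>\<^sub>WW i\<in>I. ?\<beta> (pconc u u') (r1 i) (r2 i) else \<zero>\<^sub>WW)
      else \<zero>\<^sub>WW) \<in> carrier WW"
      using r pconc_paths[OF p(1,3)] pconc_paths[OF p(2,4)] pconc_paths[OF u]
      by (auto intro!: Wq.Bb.AA.T.finsum_closed tt_w_closed[of _ _ _ _ _ "n + k" _ _ "n + k"])
  qed (auto intro!: Wq.Bb.AA.T.finsum_closed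
      tt_w_closed[of _ _ _ _ _ "n + k" _ _ "n + k"] pconc_paths p r)
  also have "\<dots> = (\<Oplus>\<^sub>WW v\<in>paths X deg (n + k).
      if ?c then \<Oplus>\<^sub>WW i\<in>I. ?\<beta> v (r1 i) (r2 i) else \<zero>\<^sub>WW)"
    by (rule Wq.Bb.AA.T.finsum_paths) (use r pconc_paths[OF p(1,3)] pconc_paths[OF p(2,4)] in
        \<open>auto intro!: Wq.Bb.AA.T.finsum_closed tt_w_closed[of _ _ _ _ _ "n + k" _ _ "n + k"]\<close>)
  also have "\<dots> = (if ?c then dl (r \<otimes>\<^sub>R s) (s' \<otimes>\<^sub>R r') (pconc p p') (pconc q q') else \<zero>\<^sub>WW)"
    using pconc_paths[OF p(1,3)] by (auto simp: dl_eq[of _ "n + k"] Wq.Bb.AA.T.finsum_zero)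
  finally show ?thesis .
qed

lemma Dw_mult:
  assumes "x \<in> carrier H" "y \<in> carrier H"
  shows "Dw (x \<otimes>\<^sub>H y) = Dw x \<otimes>\<^sub>WW Dw y"
proof (rule hq_map_mult[OF Wq.Bb.AA.T.kalg_axioms Dw_lin _ assms])
  fix r r' s s' n k p q p' q'
  assume a: "r \<in> carrier R" "r' \<in> carrier R" "s \<in> carrier R" "s' \<in> carrier R"
    "p \<in> paths X deg n" "q \<in> paths X deg n" "p' \<in> paths X deg k" "q' \<in> paths X deg k"
  show "Dw (hb r r' p q \<otimes>\<^sub>H hb s s' p' q') = Dw (hb r r' p q) \<otimes>\<^sub>WW Dw (hb s s' p' q')"
    using a pconc_paths[OF a(5,7)] pconc_paths[OF a(6,8)]
      lin_map_zero[OF H.ks WW_kspace Dw_lin]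
    by (simp add: hb_mult[OF a] dl_mult[OF a] Dw_hb[OF a(1,2,5,6)] Dw_hb[OF a(3,4,7,8)]
        Dw_hb[of _ _ _ "n + k"])
qed

end

lemma (in abelian_monoid) finsum_cond:
  "(\<Oplus>i\<in>S. if c then f i else \<zero>) = (if c then (\<Oplus>i\<in>S. f i) else \<zero>)"
  by (simp add: finsum_zero)

context dyb
begin

lemma (in -) paths_2: "paths X deg 2 = (\<lambda>(k, y, x). (k, [(k, y), (deg y k, x)])) ` (UNIV \<times> X \<times> X)"
proof
  show "paths X deg 2 \<subseteq> (\<lambda>(k, y, x). (k, [(k, y), (deg y k, x)])) ` (UNIV \<times> X \<times> X)"
  proof
    fix p assume p: "p \<in> paths X deg 2"
    obtain k xs where k: "p = (k, xs)" by fastforce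
    obtain a b where "xs = [a, b]" using paths_length[OF p] k
      by (metis length_0_conv length_Suc_conv numeral_2_eq_2 snd_conv)
    with p k show "p \<in> (\<lambda>(k, y, x). (k, [(k, y), (deg y k, x)])) ` (UNIV \<times> X \<times> X)"
      by (cases a; cases b) (auto simp: atgt_def image_iff)
  qed
qed (auto simp: atgt_def numeral_2_eq_2)

lemma (in abelian_monoid) finsum_paths_2:
  fixes f :: "('l::finite, 'x) path => 'a"
  assumes "finite X" "\<And>u. u \<in> paths X deg 2 ==> f u \<in> carrier G"
  shows "(\<Oplus>u\<in>paths X deg 2. f u) = (\<Oplus>k\<in>UNIV. \<Oplus>v\<in>X \<times> X. f (k, [(k, fst v), (deg (fst v) k, snd v)]))"
proof -
  let ?h = "\<lambda>(k::'l, y::'x, x::'x). (k, [(k, y), (deg y k, x)])"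
  have c: "f (k, [(k, y), (deg y k, x)]) \<in> carrier G" if "y \<in> X" "x \<in> X" for k y x
    by (rule assms(2)) (use that in \<open>auto simp: atgt_def numeral_2_eq_2\<close>)
  have "(\<Oplus>u\<in>paths X deg 2. f u) = (\<Oplus>z\<in>UNIV \<times> X \<times> X. f (?h z))"
    unfolding paths_2 by (rule finsum_reindex) (use c in \<open>auto simp: inj_on_def\<close>)
  also have "\<dots> = (\<Oplus>z\<in>UNIV \<times> (X \<times> X). case z of (k, v) => f (k, [(k, fst v), (deg (fst v) k, snd v)]))"
    by (rule finsum_eqI) (use c in auto)
  also have "\<dots> = (\<Oplus>k\<in>UNIV. \<Oplus>v\<in>X \<times> X. f (k, [(k, fst v), (deg (fst v) k, snd v)]))"
    by (rule finsum_Times[symmetric]) (use assms(1) c in auto)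
  finally show ?thesis .
qed

abbreviation pth :: "'l => 'x \<times> 'x => ('l, 'x) path" where
  "pth k v \<equiv> path2 k (fst v) (snd v)"

lemma pth_paths [simp]: "v \<in> X \<times> X ==> pth k v \<in> paths X deg 2"
  by (cases v) simp

text \<open>The defining relation, multiplied by elements of \<open>R\<close>.\<close>

lemma w_rel_right:
  assumes X: "a \<in> X" "c \<in> X" "v \<in> X \<times> X" and r: "\<rho> \<in> carrier R"
  shows "(\<Oplus>\<^sub>AW y\<in>X \<times> X. w (\<sigma> (snd y) (fst y) a c l) \<rho> (pth l y) (pth k v))
    = (\<Oplus>\<^sub>AW y\<in>X \<times> X. w \<one>\<^sub>R (\<sigma> (snd v) (fst v) (snd y) (fst y) k \<otimes>\<^sub>R \<rho>) (path2 l c a) (pth k y))"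
proof -
  have v: "fst v \<in> X" "snd v \<in> X" using X by auto
  have tc: "tw (pt R k \<rho>) \<in> carrier AW" using r by simp
  have T1: "(\<Oplus>\<^sub>AW y\<in>X. \<Oplus>\<^sub>AW x\<in>X. w (\<sigma> x y a c l) \<one>\<^sub>R (path2 l y x) (pth k v))
    = (\<Oplus>\<^sub>AW y\<in>X \<times> X. w (\<sigma> (snd y) (fst y) a c l) \<one>\<^sub>R (pth l y) (pth k v))"
    using X v by (subst W.finsum_Times) (auto simp: case_prod_unfold)
  have T2: "(\<Oplus>\<^sub>AW y\<in>X. \<Oplus>\<^sub>AW x\<in>X. w \<one>\<^sub>R (\<sigma> (snd v) (fst v) x y k) (path2 l c a) (path2 k y x))
    = (\<Oplus>\<^sub>AW y\<in>X \<times> X. w \<one>\<^sub>R (\<sigma> (snd v) (fst v) (snd y) (fst y) k) (path2 l c a) (pth k y))"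
    using X v by (subst W.finsum_Times) (auto simp: case_prod_unfold)
  have "(\<Oplus>\<^sub>AW y\<in>X \<times> X. w (\<sigma> (snd y) (fst y) a c l) \<rho> (pth l y) (pth k v))
    = tw (pt R k \<rho>) \<otimes>\<^sub>AW (\<Oplus>\<^sub>AW y\<in>X \<times> X. w (\<sigma> (snd y) (fst y) a c l) \<one>\<^sub>R (pth l y) (pth k v))"
    using X v r tc by (subst W.finsum_rdistr)
      (auto simp: tw_w[of _ _ _ _ 2] R.M.pt_apply psrc_def intro!: W.finsum_eqI w_closed[of _ _ _ 2])
  also have "\<dots> = tw (pt R k \<rho>) \<otimes>\<^sub>AW
    (\<Oplus>\<^sub>AW y\<in>X \<times> X. w \<one>\<^sub>R (\<sigma> (snd v) (fst v) (snd y) (fst y) k) (path2 l c a) (pth k y))"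
    using w_rel[OF X(1) v(2) X(2) v(1), of l k] T1 T2 by simp
  also have "\<dots> = (\<Oplus>\<^sub>AW y\<in>X \<times> X. w \<one>\<^sub>R (\<sigma> (snd v) (fst v) (snd y) (fst y) k \<otimes>\<^sub>R \<rho>) (path2 l c a) (pth k y))"
    using X v r tc by (subst W.finsum_rdistr)
      (auto simp: tw_w[of _ _ _ _ 2] R.M.pt_apply psrc_def intro!: W.finsum_eqI w_closed[of _ _ _ 2])
  finally show ?thesis .
qed

lemma w_rel_left:
  assumes X: "b \<in> X" "d \<in> X" "y \<in> X \<times> X" and r: "\<rho> \<in> carrier R"
  shows "(\<Oplus>\<^sub>AW v\<in>X \<times> X. w (\<rho> \<otimes>\<^sub>R \<sigma> (snd v) (fst v) (snd y) (fst y) k) \<one>\<^sub>R (pth k v) (path2 m d b))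
    = (\<Oplus>\<^sub>AW v\<in>X \<times> X. w \<rho> (\<sigma> b d (snd v) (fst v) m) (pth k y) (pth m v))"
proof -
  have y: "fst y \<in> X" "snd y \<in> X" using X by auto
  have sc: "sw (pt R k \<rho>) \<in> carrier AW" using r by simp
  have T1: "(\<Oplus>\<^sub>AW u\<in>X. \<Oplus>\<^sub>AW x\<in>X. w (\<sigma> x u (snd y) (fst y) k) \<one>\<^sub>R (path2 k u x) (path2 m d b))
    = (\<Oplus>\<^sub>AW v\<in>X \<times> X. w (\<sigma> (snd v) (fst v) (snd y) (fst y) k) \<one>\<^sub>R (pth k v) (path2 m d b))"
    using X y by (subst W.finsum_Times) (auto simp: case_prod_unfold)
  have T2: "(\<Oplus>\<^sub>AW u\<in>X. \<Oplus>\<^sub>AW x\<in>X. w \<one>\<^sub>R (\<sigma> b d x u m) (pth k y) (path2 m u x))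
    = (\<Oplus>\<^sub>AW v\<in>X \<times> X. w \<one>\<^sub>R (\<sigma> b d (snd v) (fst v) m) (pth k y) (pth m v))"
    using X y by (subst W.finsum_Times) (auto simp: case_prod_unfold)
  have "(\<Oplus>\<^sub>AW v\<in>X \<times> X. w (\<rho> \<otimes>\<^sub>R \<sigma> (snd v) (fst v) (snd y) (fst y) k) \<one>\<^sub>R (pth k v) (path2 m d b))
    = sw (pt R k \<rho>) \<otimes>\<^sub>AW
      (\<Oplus>\<^sub>AW v\<in>X \<times> X. w (\<sigma> (snd v) (fst v) (snd y) (fst y) k) \<one>\<^sub>R (pth k v) (path2 m d b))"
    using X y r sc by (subst W.finsum_rdistr)
      (auto simp: sw_w[of _ _ _ _ 2] R.M.pt_apply psrc_def intro!: W.finsum_eqI w_closed[of _ _ _ 2])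
  also have "\<dots> = sw (pt R k \<rho>) \<otimes>\<^sub>AW
    (\<Oplus>\<^sub>AW v\<in>X \<times> X. w \<one>\<^sub>R (\<sigma> b d (snd v) (fst v) m) (pth k y) (pth m v))"
    using w_rel[OF y(2) X(1) y(1) X(2), of k m] T1 T2 by simp
  also have "\<dots> = (\<Oplus>\<^sub>AW v\<in>X \<times> X. w \<rho> (\<sigma> b d (snd v) (fst v) m) (pth k y) (pth m v))"
    using X y r sc by (subst W.finsum_rdistr)
      (auto simp: sw_w[of _ _ _ _ 2] R.M.pt_apply psrc_def intro!: W.finsum_eqI w_closed[of _ _ _ 2])
  finally show ?thesis .
qed

text \<open>
  The comultiplication respects the quadratic relation: the relation is applied in the first
  tensor factor, the coefficient is carried over by the Casimir element, and the relation is
  applied again in the second factor.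
\<close>

lemma Dw_rel:
  assumes X: "a \<in> X" "b \<in> X" "c \<in> X" "d \<in> X"
  shows "Dw (rel_left l m a b c d) = Dw (rel_right l m a b c d)"
proof -
  let ?Y = "X \<times> X"
  let ?p = "path2 l c a" and ?q = "path2 m d b"
  note WT = Wq.Bb.AA.T.ks
  note lf = lin_map_finsum[OF H.ks WW_kspace Dw_lin]
  note fe = Wq.Bb.AA.T.finsum_eqI and fc = Wq.Bb.AA.T.finsum_closed and fs = Wq.Bb.AA.T.finsum_swap
  have XX: "fst v \<in> X" "snd v \<in> X" if "v \<in> ?Y" for v using that by auto
  have pq: "?p \<in> paths X deg 2" "?q \<in> paths X deg 2" using X by auto
  have tc: "tt (w r r' p u) (w s s' u' q) \<in> carrier WW"
    if "r \<in> carrier R" "r' \<in> carrier R" "s \<in> carrier R" "s' \<in> carrier R"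
      "p \<in> paths X deg 2" "u \<in> paths X deg 2" "u' \<in> paths X deg 2" "q \<in> paths X deg 2"
    for r r' s s' p u u' q using that by (intro tt_w_closed)
  have HL: "rel_left l m a b c d = (\<Oplus>\<^sub>H y\<in>?Y. hb (\<sigma> (snd y) (fst y) a c l) \<one>\<^sub>R (pth l y) ?q)"
    unfolding rel_left_def using X by (subst H.finsum_Times) (auto simp: case_prod_unfold)
  have HR: "rel_right l m a b c d = (\<Oplus>\<^sub>H v\<in>?Y. hb \<one>\<^sub>R (\<sigma> b d (snd v) (fst v) m) ?p (pth m v))"
    unfolding rel_right_def using X by (subst H.finsum_Times) (auto simp: case_prod_unfold)
  have "Dw (rel_left l m a b c d) = (\<Oplus>\<^sub>WW y\<in>?Y. \<Oplus>\<^sub>WW k\<in>UNIV. \<Oplus>\<^sub>WW v\<in>?Y. \<Oplus>\<^sub>WW i\<in>I.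
      tt (w (\<sigma> (snd y) (fst y) a c l) (r1 i) (pth l y) (pth k v)) (w (r2 i) \<one>\<^sub>R (pth k v) ?q))"
    unfolding HL
  proof (subst lf)
    show "(\<Oplus>\<^sub>WW y\<in>?Y. Dw (hb (\<sigma> (snd y) (fst y) a c l) \<one>\<^sub>R (pth l y) ?q)) =
      (\<Oplus>\<^sub>WW y\<in>?Y. \<Oplus>\<^sub>WW k\<in>UNIV. \<Oplus>\<^sub>WW v\<in>?Y. \<Oplus>\<^sub>WW i\<in>I.
      tt (w (\<sigma> (snd y) (fst y) a c l) (r1 i) (pth l y) (pth k v)) (w (r2 i) \<one>\<^sub>R (pth k v) ?q))"
    proof (rule fe)
      fix y assume y: "y \<in> ?Y"
      show "Dw (hb (\<sigma> (snd y) (fst y) a c l) \<one>\<^sub>R (pth l y) ?q) = (\<Oplus>\<^sub>WW k\<in>UNIV. \<Oplus>\<^sub>WW v\<in>?Y. \<Oplus>\<^sub>WW i\<in>I.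
        tt (w (\<sigma> (snd y) (fst y) a c l) (r1 i) (pth l y) (pth k v)) (w (r2 i) \<one>\<^sub>R (pth k v) ?q))"
        using y XX[OF y] X pq
        by (simp add: Dw_hb[of _ _ _ 2] dl_eq[of _ 2])
          (rule Wq.Bb.AA.T.finsum_paths_2, simp, intro fc, auto intro!: tc)
    qed (use X XX pq in \<open>auto intro!: fc tc\<close>)
  qed (use X XX pq in \<open>auto intro!: hb_closed[of _ _ _ 2]\<close>)
  also have "\<dots> = (\<Oplus>\<^sub>WW k\<in>UNIV. \<Oplus>\<^sub>WW y\<in>?Y. \<Oplus>\<^sub>WW v\<in>?Y. \<Oplus>\<^sub>WW i\<in>I.
      tt (w (\<sigma> (snd y) (fst y) a c l) (r1 i) (pth l y) (pth k v)) (w (r2 i) \<one>\<^sub>R (pth k v) ?q))"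
    by (rule fs) (use X XX pq in \<open>auto intro!: fc tc\<close>)
  also have "\<dots> = (\<Oplus>\<^sub>WW k\<in>UNIV. \<Oplus>\<^sub>WW y\<in>?Y. \<Oplus>\<^sub>WW v\<in>?Y. \<Oplus>\<^sub>WW i\<in>I.
      tt (w \<one>\<^sub>R (r1 i) ?p (pth k y)) (w (r2 i) (\<sigma> b d (snd v) (fst v) m) (pth k y) (pth m v)))"
  proof (rule fe)
    fix k
    let ?A = "\<lambda>y v i. tt (w (\<sigma> (snd y) (fst y) a c l) (r1 i) (pth l y) (pth k v)) (w (r2 i) \<one>\<^sub>R (pth k v) ?q)"
    let ?B = "\<lambda>y v i. tt (w \<one>\<^sub>R (\<sigma> (snd v) (fst v) (snd y) (fst y) k \<otimes>\<^sub>R r1 i) ?p (pth k y)) (w (r2 i) \<one>\<^sub>R (pth k v) ?q)"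
    let ?C = "\<lambda>y v i. tt (w \<one>\<^sub>R (r1 i) ?p (pth k y)) (w (r2 i \<otimes>\<^sub>R \<sigma> (snd v) (fst v) (snd y) (fst y) k) \<one>\<^sub>R (pth k v) ?q)"
    let ?D = "\<lambda>y v i. tt (w \<one>\<^sub>R (r1 i) ?p (pth k y)) (w (r2 i) (\<sigma> b d (snd v) (fst v) m) (pth k y) (pth m v))"
    have cl: "?A y v i \<in> carrier WW" "?B y v i \<in> carrier WW" "?C y v i \<in> carrier WW" "?D y v i \<in> carrier WW"
      if "y \<in> ?Y" "v \<in> ?Y" "i \<in> I" for y v i
      using that X XX[OF that(1)] XX[OF that(2)] pq by (intro tc, auto)+
    have AB: "(\<Oplus>\<^sub>WW y\<in>?Y. ?A y v i) = (\<Oplus>\<^sub>WW y\<in>?Y. ?B y v i)" if v: "v \<in> ?Y" and i: "i \<in> I" for v i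
    proof -
      have "(\<Oplus>\<^sub>WW y\<in>?Y. ?A y v i) = tt (\<Oplus>\<^sub>AW y\<in>?Y. w (\<sigma> (snd y) (fst y) a c l) (r1 i) (pth l y) (pth k v))
          (w (r2 i) \<one>\<^sub>R (pth k v) ?q)"
        by (rule Wq.Bb.AA.tens_sum_left[symmetric])
          (use i v X XX pq in \<open>auto intro!: w_closed[of _ _ _ 2]\<close>)
      also have "\<dots> = (\<Oplus>\<^sub>WW y\<in>?Y. ?B y v i)"
        unfolding w_rel_right[OF X(1,3) v R.e1_closed[OF i]]
        by (rule Wq.Bb.AA.tens_sum_left)
          (use i v X XX pq in \<open>auto intro!: w_closed[of _ _ _ 2]\<close>)
      finally show ?thesis .
    qed
    have BC: "(\<Oplus>\<^sub>WW i\<in>I. ?B y v i) = (\<Oplus>\<^sub>WW i\<in>I. ?C y v i)" if y: "y \<in> ?Y" and v: "v \<in> ?Y" for y v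
      by (rule R.casimir[OF WW_kspace tt_w_bilin[of _ _ _ 2 _ _ 2]])
        (use y v X XX[OF y] XX[OF v] pq in auto)
    have CD: "(\<Oplus>\<^sub>WW v\<in>?Y. ?C y v i) = (\<Oplus>\<^sub>WW v\<in>?Y. ?D y v i)" if y: "y \<in> ?Y" and i: "i \<in> I" for y i
    proof -
      have "(\<Oplus>\<^sub>WW v\<in>?Y. ?C y v i) = tt (w \<one>\<^sub>R (r1 i) ?p (pth k y))
          (\<Oplus>\<^sub>AW v\<in>?Y. w (r2 i \<otimes>\<^sub>R \<sigma> (snd v) (fst v) (snd y) (fst y) k) \<one>\<^sub>R (pth k v) ?q)"
        by (rule Wq.Bb.AA.tens_sum_right[symmetric])
          (use i y X XX pq in \<open>auto intro!: w_closed[of _ _ _ 2]\<close>)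
      also have "\<dots> = (\<Oplus>\<^sub>WW v\<in>?Y. ?D y v i)"
        unfolding w_rel_left[OF X(2,4) y R.e2_closed[OF i]]
        by (rule Wq.Bb.AA.tens_sum_right)
          (use i y X XX pq in \<open>auto intro!: w_closed[of _ _ _ 2]\<close>)
      finally show ?thesis .
    qed
    have "(\<Oplus>\<^sub>WW y\<in>?Y. \<Oplus>\<^sub>WW v\<in>?Y. \<Oplus>\<^sub>WW i\<in>I. ?A y v i) = (\<Oplus>\<^sub>WW v\<in>?Y. \<Oplus>\<^sub>WW y\<in>?Y. \<Oplus>\<^sub>WW i\<in>I. ?A y v i)"
      by (rule fs) (simp_all add: cl Pi_I fc)
    also have "\<dots> = (\<Oplus>\<^sub>WW v\<in>?Y. \<Oplus>\<^sub>WW i\<in>I. \<Oplus>\<^sub>WW y\<in>?Y. ?A y v i)"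
      by (intro fe fs fc) (simp_all add: cl Pi_I fc)
    also have "\<dots> = (\<Oplus>\<^sub>WW v\<in>?Y. \<Oplus>\<^sub>WW i\<in>I. \<Oplus>\<^sub>WW y\<in>?Y. ?B y v i)"
      by (rule fe, rule fe, rule AB) (simp_all add: cl Pi_I fc)
    also have "\<dots> = (\<Oplus>\<^sub>WW v\<in>?Y. \<Oplus>\<^sub>WW y\<in>?Y. \<Oplus>\<^sub>WW i\<in>I. ?B y v i)"
      by (intro fe fs fc) (simp_all add: cl Pi_I fc)
    also have "\<dots> = (\<Oplus>\<^sub>WW y\<in>?Y. \<Oplus>\<^sub>WW v\<in>?Y. \<Oplus>\<^sub>WW i\<in>I. ?B y v i)"
      by (rule fs) (simp_all add: cl Pi_I fc)
    also have "\<dots> = (\<Oplus>\<^sub>WW y\<in>?Y. \<Oplus>\<^sub>WW v\<in>?Y. \<Oplus>\<^sub>WW i\<in>I. ?C y v i)"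
      by (rule fe, rule fe, rule BC) (simp_all add: cl Pi_I fc)
    also have "\<dots> = (\<Oplus>\<^sub>WW y\<in>?Y. \<Oplus>\<^sub>WW i\<in>I. \<Oplus>\<^sub>WW v\<in>?Y. ?C y v i)"
      by (intro fe fs fc) (simp_all add: cl Pi_I fc)
    also have "\<dots> = (\<Oplus>\<^sub>WW y\<in>?Y. \<Oplus>\<^sub>WW i\<in>I. \<Oplus>\<^sub>WW v\<in>?Y. ?D y v i)"
      by (rule fe, rule fe, rule CD) (simp_all add: cl Pi_I fc)
    also have "\<dots> = (\<Oplus>\<^sub>WW y\<in>?Y. \<Oplus>\<^sub>WW v\<in>?Y. \<Oplus>\<^sub>WW i\<in>I. ?D y v i)"
      by (intro fe fs fc) (simp_all add: cl Pi_I fc)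
    finally show "(\<Oplus>\<^sub>WW y\<in>?Y. \<Oplus>\<^sub>WW v\<in>?Y. \<Oplus>\<^sub>WW i\<in>I. ?A y v i) = (\<Oplus>\<^sub>WW y\<in>?Y. \<Oplus>\<^sub>WW v\<in>?Y. \<Oplus>\<^sub>WW i\<in>I. ?D y v i)" .
    show "(\<Oplus>\<^sub>WW y\<in>?Y. \<Oplus>\<^sub>WW v\<in>?Y. \<Oplus>\<^sub>WW i\<in>I. ?D y v i) \<in> carrier WW" by (auto intro!: fc cl)
  qed
  also have "\<dots> = (\<Oplus>\<^sub>WW v\<in>?Y. \<Oplus>\<^sub>WW k\<in>UNIV. \<Oplus>\<^sub>WW y\<in>?Y. \<Oplus>\<^sub>WW i\<in>I.
      tt (w \<one>\<^sub>R (r1 i) ?p (pth k y)) (w (r2 i) (\<sigma> b d (snd v) (fst v) m) (pth k y) (pth m v)))"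
    (is "(\<Oplus>\<^sub>WW k\<in>UNIV. \<Oplus>\<^sub>WW y\<in>?Y. \<Oplus>\<^sub>WW v\<in>?Y. ?G k y v) = _")
  proof -
    have G: "?G k y v \<in> carrier WW" if "y \<in> ?Y" "v \<in> ?Y" for k y v
      using that X XX[OF that(1)] XX[OF that(2)] pq by (auto intro!: fc tc)
    have "(\<Oplus>\<^sub>WW k\<in>UNIV. \<Oplus>\<^sub>WW y\<in>?Y. \<Oplus>\<^sub>WW v\<in>?Y. ?G k y v)
        = (\<Oplus>\<^sub>WW k\<in>UNIV. \<Oplus>\<^sub>WW v\<in>?Y. \<Oplus>\<^sub>WW y\<in>?Y. ?G k y v)"
      by (rule fe, rule fs) (simp_all add: G Pi_I fc)
    also have "\<dots> = (\<Oplus>\<^sub>WW v\<in>?Y. \<Oplus>\<^sub>WW k\<in>UNIV. \<Oplus>\<^sub>WW y\<in>?Y. ?G k y v)"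
      by (rule fs) (simp_all add: G Pi_I fc)
    finally show ?thesis .
  qed
  also have "\<dots> = Dw (rel_right l m a b c d)"
    unfolding HR
  proof (subst lf)
    show "(\<Oplus>\<^sub>WW v\<in>?Y. \<Oplus>\<^sub>WW k\<in>UNIV. \<Oplus>\<^sub>WW y\<in>?Y. \<Oplus>\<^sub>WW i\<in>I.
      tt (w \<one>\<^sub>R (r1 i) ?p (pth k y)) (w (r2 i) (\<sigma> b d (snd v) (fst v) m) (pth k y) (pth m v)))
      = (\<Oplus>\<^sub>WW v\<in>?Y. Dw (hb \<one>\<^sub>R (\<sigma> b d (snd v) (fst v) m) ?p (pth m v)))"
    proof (rule fe)
      fix v assume v: "v \<in> ?Y"
      show "(\<Oplus>\<^sub>WW k\<in>UNIV. \<Oplus>\<^sub>WW y\<in>?Y. \<Oplus>\<^sub>WW i\<in>I.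
        tt (w \<one>\<^sub>R (r1 i) ?p (pth k y)) (w (r2 i) (\<sigma> b d (snd v) (fst v) m) (pth k y) (pth m v)))
        = Dw (hb \<one>\<^sub>R (\<sigma> b d (snd v) (fst v) m) ?p (pth m v))"
        using v XX[OF v] X pq
        by (simp add: Dw_hb[of _ _ _ 2] dl_eq[of _ 2])
          (rule Wq.Bb.AA.T.finsum_paths_2[symmetric], simp, intro fc, auto intro!: tc)
      show "Dw (hb \<one>\<^sub>R (\<sigma> b d (snd v) (fst v) m) ?p (pth m v)) \<in> carrier WW"
        using v XX[OF v] X pq by (intro lin_map_closed[OF Dw_lin] hb_closed[of _ _ _ 2]) auto
    qed
  qed (use X XX pq in \<open>auto intro!: hb_closed[of _ _ _ 2]\<close>)
  finally show ?thesis .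
qed

lemma Dw_kill: "x \<in> aw_ideal R X deg \<sigma> ==> Dw x = \<zero>\<^sub>WW"
  by (rule aw_ideal_kill[OF Wq.Bb.AA.T.kalg_axioms Dw_lin Dw_mult Dw_rel])

end

context dyb
begin

abbreviation TW where "TW \<equiv> tensor_over AW M sw tw"
abbreviation tto where "tto \<equiv> tens_over AW M sw tw"

definition dlo where "dlo r r' p q = (\<Oplus>\<^sub>TW u\<in>paths X deg (length (snd p)).
    tto (w r \<one>\<^sub>R p u) (w \<one>\<^sub>R r' u q))"

lemma aw_comultL_eq: "aw_comultL R X deg \<sigma> = induced (hq_lift TW dlo)"
  unfolding aw_comultL_def Let_def dlo_def ..

lemma tto_eq: "tto a b = Wq.Bb.null +>\<^sub>WW tt a b"
  by (simp add: tens_over_def)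

lemma tto_bilin: "bilin AW AW TW tto"
  unfolding tto_eq
  by (intro bilinI lin_map_comp[OF bilin_left[OF tt_bilin] Wq.Bb.over_proj_lin]
      lin_map_comp[OF bilin_right[OF tt_bilin] Wq.Bb.over_proj_lin])

lemma TW_kspace: "kspace TW" by (rule Wq.Bb.kspace_over)

lemma dlo_bilin:
  assumes "p \<in> paths X deg n" "q \<in> paths X deg n"
  shows "bilin R R TW (\<lambda>r r'. dlo r r' p q)"
  unfolding dlo_def paths_length[OF assms(1)]
  by (intro bilinI lin_map_sum[OF TW_kspace] lin_map_comp[OF w_lin1 bilin_left[OF tto_bilin]]
      lin_map_comp[OF w_lin2 bilin_right[OF tto_bilin]])
    (use assms in \<open>auto intro: w_closed\<close>)

text \<open>Multiplication by \<open>EW\<close> glues two paths only if their middle ends agree.\<close>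

lemma EW_tt:
  assumes r: "r \<in> carrier R" "r' \<in> carrier R"
    and p: "p \<in> paths X deg n" "u \<in> paths X deg n" "u' \<in> paths X deg n" "q \<in> paths X deg n"
  shows "EW \<otimes>\<^sub>WW tt (w r \<one>\<^sub>R p u) (w \<one>\<^sub>R r' u' q)
    = (if psrc u = psrc u' then \<Oplus>\<^sub>WW i\<in>I. tt (w r (r1 i) p u) (w (r2 i) r' u' q) else \<zero>\<^sub>WW)"
proof -
  let ?g = "\<lambda>i. tt (w r (r1 i) p u) (w (r2 i) r' u' q)"
  have gc: "?g i \<in> carrier WW" if "i \<in> I" for i using that r p by (intro tt_w_closed) auto
  have "EW \<otimes>\<^sub>WW tt (w r \<one>\<^sub>R p u) (w \<one>\<^sub>R r' u' q) = (\<Oplus>\<^sub>WW j\<in>J.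
      tt (tw (f1 j) \<otimes>\<^sub>AW w r \<one>\<^sub>R p u) (sw (f2 j) \<otimes>\<^sub>AW w \<one>\<^sub>R r' u' q))"
    using r p by (intro Wq.Bb.E_mult_pure w_closed) auto
  also have "\<dots> = (\<Oplus>\<^sub>WW j\<in>J. case j of (l, i) =>
      if l = psrc u then (if psrc u = psrc u' then ?g i else \<zero>\<^sub>WW) else \<zero>\<^sub>WW)"
  proof (rule Wq.Bb.AA.T.finsum_eqI)
    fix j assume "j \<in> J"
    then obtain l i where j: "j = (l, i)" "i \<in> I" by (auto simp: J_def)
    have "tw (f1 j) \<otimes>\<^sub>AW w r \<one>\<^sub>R p u = (if l = psrc u then w r (r1 i) p u else \<zero>\<^sub>AW)"
      using j r p by (simp add: f1_def tw_w[of _ _ _ _ n] R.M.pt_apply w_zero[of _ _ n])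
    moreover have "sw (f2 j) \<otimes>\<^sub>AW w \<one>\<^sub>R r' u' q = (if l = psrc u' then w (r2 i) r' u' q else \<zero>\<^sub>AW)"
      using j r p by (simp add: f2_def sw_w[of _ _ _ _ n] R.M.pt_apply w_zero[of _ _ n])
    moreover have "w r (r1 i) p u \<in> carrier AW" "w (r2 i) r' u' q \<in> carrier AW"
      using j r p by (auto intro!: w_closed)
    ultimately show "tt (tw (f1 j) \<otimes>\<^sub>AW w r \<one>\<^sub>R p u) (sw (f2 j) \<otimes>\<^sub>AW w \<one>\<^sub>R r' u' q)
      = (case j of (l, i) => if l = psrc u then (if psrc u = psrc u' then ?g i else \<zero>\<^sub>WW) else \<zero>\<^sub>WW)"
      using j by simp
  qed (auto simp: J_def gc)
  also have "\<dots> = (\<Oplus>\<^sub>WW l\<in>UNIV. \<Oplus>\<^sub>WW i\<in>I.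
      if l = psrc u then (if psrc u = psrc u' then ?g i else \<zero>\<^sub>WW) else \<zero>\<^sub>WW)"
    unfolding J_def by (rule Wq.Bb.AA.T.finsum_Times[symmetric]) (auto simp: gc)
  also have "\<dots> = (if psrc u = psrc u' then \<Oplus>\<^sub>WW i\<in>I. ?g i else \<zero>\<^sub>WW)"
    unfolding Wq.Bb.AA.T.finsum_cond
    by (subst Wq.Bb.AA.T.finsum_delta) (auto intro!: Wq.Bb.AA.T.finsum_closed gc)
  finally show ?thesis .
qed

lemma W_dlo:
  assumes "r \<in> carrier R" "r' \<in> carrier R" "p \<in> paths X deg n" "q \<in> paths X deg n"
  shows "Wq.Bb.W (dlo r r' p q) = dl r r' p q"
proof -
  have c: "tt (w r \<one>\<^sub>R p u) (w \<one>\<^sub>R r' u q) \<in> carrier WW" if "u \<in> paths X deg n" for u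
    using assms that by (intro tt_w_closed) auto
  have "Wq.Bb.W (dlo r r' p q) = (\<Oplus>\<^sub>WW u\<in>paths X deg n. Wq.Bb.W (tto (w r \<one>\<^sub>R p u) (w \<one>\<^sub>R r' u q)))"
    unfolding dlo_def paths_length[OF assms(3)]
    by (rule lin_map_finsum[OF TW_kspace WW_kspace Wq.Bb.W_lin])
      (use assms in \<open>auto intro!: bilin_closed[OF tto_bilin] w_closed\<close>)
  also have "\<dots> = dl r r' p q"
    unfolding dl_eq[OF assms(3)]
    by (intro Wq.Bb.AA.T.finsum_eqI Wq.Bb.AA.T.finsum_closed)
      (use assms c in \<open>auto simp: tto_eq Wq.Bb.W_coset EW_tt[of _ _ _ n] intro!: tt_w_closed\<close>)
  finally show ?thesis .
qed

lemma hq_lift_dlo: "hq_lift TW dlo \<in> lin_map H TW"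
  by (rule hq_lift_lin[OF TW_kspace dlo_bilin])

lemma W_hq_lift: "x \<in> carrier H ==> Wq.Bb.W (hq_lift TW dlo x) = Dw x"
  by (rule hq_map_eqI[OF lin_map_comp[OF hq_lift_dlo Wq.Bb.W_lin] Dw_lin])
    (auto simp: hq_lift_hb[OF TW_kspace dlo_bilin] W_dlo Dw_hb)

definition eR :: "('k, 'r, 'r) tens" where
  "eR = (\<Oplus>\<^bsub>tensor R R\<^esub>i\<in>I. tens R R (r1 i) (r2 i))"

lemma frob_elt_eR: "frob_elt R eR = (\<Oplus>\<^bsub>tensor M M\<^esub>j\<in>J. tens M M (f1 j) (f2 j))"
  unfolding J_def f1_def f2_def by (rule frob_elt_sum[OF _ eR_def]) unfold_locales

abbreviation cw where "cw \<equiv> aw_comult R eR X deg \<sigma>"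

lemma cw_P:
  assumes x: "x \<in> carrier H" shows "cw (P x) = Dw x"
proof -
  have "P x \<in> carrier (quot_alg H (aw_ideal R X deg \<sigma>))" using P_closed[OF x] by (simp add: Aw_def)
  then obtain y where y: "y \<in> carrier H" "P x = P y" "aw_comultL R X deg \<sigma> (P x) = hq_lift TW dlo y"
    unfolding aw_comultL_eq by (rule induced_representative[OF H.ks aw_sub])
  have "cw (P x) = Wq.Bb.W (aw_comultL R X deg \<sigma> (P x))"
    unfolding aw_comult_def
    by (rule Wq.Bb.wb_comult_eq[OF frob_elt_eR]) (simp add: y(3) lin_map_closed[OF hq_lift_dlo y(1)])
  also have "\<dots> = Dw y" by (simp add: y(3) W_hq_lift[OF y(1)])
  also have "\<dots> = induced Dw (P y)"
    by (rule induced_coset[OF H.ks aw_sub WW_kspace Dw_lin Dw_kill y(1), symmetric])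
  also have "\<dots> = induced Dw (P x)" by (simp add: y(2))
  also have "\<dots> = Dw x"
    by (rule induced_coset[OF H.ks aw_sub WW_kspace Dw_lin Dw_kill x])
  finally show ?thesis .
qed

lemma cw_lin: "cw \<in> lin_map AW WW"
proof -
  have "induced Dw \<in> lin_map AW WW"
    using induced_lin[OF H.ks aw_sub WW_kspace Dw_lin Dw_kill]
    by (simp add: Aw_def[symmetric])
  then show ?thesis
  proof (rule lin_map_cong[OF W.ks])
    fix x assume "x \<in> carrier AW"
    then obtain y where y: "y \<in> carrier H" "x = P y" by (rule AW_cases)
    then show "cw x = induced Dw x"
      by (simp add: cw_P induced_coset[OF H.ks aw_sub WW_kspace Dw_lin Dw_kill])
  qed
qed

lemma cw_w:
  "[|r \<in> carrier R; r' \<in> carrier R; p \<in> paths X deg n; q \<in> paths X deg n|] ==> cw (w r r' p q) = dl r r' p q"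
  unfolding P_hb[symmetric] by (simp add: cw_P Dw_hb hb_closed[of _ _ _ n])

text \<open>
  The comultiplication on elements summed over all sources. Here \<open>pu k c\<close>, for \<open>c \<in> C\<close>, enumerates
  the paths of length \<open>n\<close> with source \<open>k\<close>.
\<close>

lemma cw_family:
  assumes f: "f \<in> carrier M" and g: "g \<in> carrier M" and C: "finite C"
    and pa: "\<And>l. pa l \<in> paths X deg n" and pq: "\<And>m. pq m \<in> paths X deg n"
    and pu: "\<And>k c. c \<in> C ==> pu k c \<in> paths X deg n" "\<And>k c. psrc (pu k c) = k"
    and sum: "\<And>h. (\<And>u. u \<in> paths X deg n ==> h u \<in> carrier WW) ==>
      (\<Oplus>\<^sub>WW u\<in>paths X deg n. h u) = (\<Oplus>\<^sub>WW c\<in>C. \<Oplus>\<^sub>WW k\<in>UNIV. h (pu k c))"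
  shows "cw (\<Oplus>\<^sub>AW z\<in>UNIV. w (f (fst z)) (g (snd z)) (pa (fst z)) (pq (snd z)))
    = EW \<otimes>\<^sub>WW (\<Oplus>\<^sub>WW c\<in>C. tt (\<Oplus>\<^sub>AW z\<in>UNIV. w (f (fst z)) \<one>\<^sub>R (pa (fst z)) (pu (snd z) c))
        (\<Oplus>\<^sub>AW z\<in>UNIV. w \<one>\<^sub>R (g (snd z)) (pu (fst z) c) (pq (snd z))))"
proof -
  have fc: "f l \<in> carrier R" "g l \<in> carrier R" for l
    using fun_alg_closed[OF f] fun_alg_closed[OF g] by simp_all
  let ?G = "\<lambda>c l k m. \<Oplus>\<^sub>WW i\<in>I. tt (w (f l) (r1 i) (pa l) (pu k c)) (w (r2 i) (g m) (pu k c) (pq m))"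
  have G: "?G c l k m \<in> carrier WW" if "c \<in> C" for c l k m
    using that pa pq pu(1)[OF that] fc by (auto intro!: Wq.Bb.AA.T.finsum_closed tt_w_closed)
  note wc = w_closed[of _ _ _ n]
  have "cw (\<Oplus>\<^sub>AW z\<in>UNIV. w (f (fst z)) (g (snd z)) (pa (fst z)) (pq (snd z)))
    = (\<Oplus>\<^sub>WW z\<in>UNIV. dl (f (fst z)) (g (snd z)) (pa (fst z)) (pq (snd z)))"
    by (subst lin_map_finsum[OF W.ks WW_kspace cw_lin])
      (simp_all add: cw_w[of _ _ _ n] fc pa pq wc)
  also have "\<dots> = (\<Oplus>\<^sub>WW z\<in>UNIV. \<Oplus>\<^sub>WW c\<in>C. \<Oplus>\<^sub>WW k\<in>UNIV. ?G c (fst z) k (snd z))"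
  proof (rule Wq.Bb.AA.T.finsum_eqI)
    fix z :: "'l \<times> 'l"
    show "dl (f (fst z)) (g (snd z)) (pa (fst z)) (pq (snd z)) = (\<Oplus>\<^sub>WW c\<in>C. \<Oplus>\<^sub>WW k\<in>UNIV. ?G c (fst z) k (snd z))"
      unfolding dl_eq[OF pa] by (rule sum)
        (use pa pq fc in \<open>auto intro!: Wq.Bb.AA.T.finsum_closed tt_w_closed\<close>)
  qed (auto intro!: Wq.Bb.AA.T.finsum_closed G)
  also have "\<dots> = (\<Oplus>\<^sub>WW c\<in>C. \<Oplus>\<^sub>WW z\<in>UNIV. \<Oplus>\<^sub>WW k\<in>UNIV. ?G c (fst z) k (snd z))"
    by (rule Wq.Bb.AA.T.finsum_swap) (auto intro!: Wq.Bb.AA.T.finsum_closed G C)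
  also have "\<dots> = (\<Oplus>\<^sub>WW c\<in>C. \<Oplus>\<^sub>WW z\<in>UNIV. \<Oplus>\<^sub>WW z'\<in>UNIV.
      if snd z = fst z' then ?G c (fst z) (fst z') (snd z') else \<zero>\<^sub>WW)"
  proof (rule Wq.Bb.AA.T.finsum_eqI)
    fix c assume c: "c \<in> C"
    have U: "(\<Oplus>\<^sub>WW z\<in>UNIV. h (fst z) (snd z)) = (\<Oplus>\<^sub>WW l\<in>UNIV. \<Oplus>\<^sub>WW m\<in>UNIV. h l m)"
      if "\<And>l m. h l m \<in> carrier WW" for h :: "'l => 'l => _"
      using Wq.Bb.AA.T.finsum_Times[of UNIV UNIV h] that by (simp add: case_prod_unfold)
    have "(\<Oplus>\<^sub>WW z\<in>UNIV. \<Oplus>\<^sub>WW k\<in>UNIV. ?G c (fst z) k (snd z))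
        = (\<Oplus>\<^sub>WW l\<in>UNIV. \<Oplus>\<^sub>WW m\<in>UNIV. \<Oplus>\<^sub>WW k\<in>UNIV. ?G c l k m)"
      by (rule U) (auto intro!: Wq.Bb.AA.T.finsum_closed G c)
    also have "\<dots> = (\<Oplus>\<^sub>WW l\<in>UNIV. \<Oplus>\<^sub>WW k\<in>UNIV. \<Oplus>\<^sub>WW m\<in>UNIV. ?G c l k m)"
      by (rule Wq.Bb.AA.T.finsum_eqI, rule Wq.Bb.AA.T.finsum_swap)
        (auto intro!: Wq.Bb.AA.T.finsum_closed G c)
    also have "\<dots> = (\<Oplus>\<^sub>WW l\<in>UNIV. \<Oplus>\<^sub>WW k'\<in>UNIV. \<Oplus>\<^sub>WW k\<in>UNIV. \<Oplus>\<^sub>WW m\<in>UNIV.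
        if k' = k then ?G c l k m else \<zero>\<^sub>WW)"
      unfolding Wq.Bb.AA.T.finsum_cond
      by (rule Wq.Bb.AA.T.finsum_eqI, rule Wq.Bb.AA.T.finsum_eqI, subst Wq.Bb.AA.T.finsum_delta')
        (auto intro!: Wq.Bb.AA.T.finsum_closed G c)
    also have "\<dots> = (\<Oplus>\<^sub>WW l\<in>UNIV. \<Oplus>\<^sub>WW k'\<in>UNIV. \<Oplus>\<^sub>WW z'\<in>UNIV.
        if k' = fst z' then ?G c l (fst z') (snd z') else \<zero>\<^sub>WW)"
      by (rule Wq.Bb.AA.T.finsum_eqI, rule Wq.Bb.AA.T.finsum_eqI, rule U[symmetric])
        (auto intro!: Wq.Bb.AA.T.finsum_closed G c)
    also have "\<dots> = (\<Oplus>\<^sub>WW z\<in>UNIV. \<Oplus>\<^sub>WW z'\<in>UNIV.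
        if snd z = fst z' then ?G c (fst z) (fst z') (snd z') else \<zero>\<^sub>WW)"
      by (rule U[symmetric]) (auto intro!: Wq.Bb.AA.T.finsum_closed G c)
    finally show "(\<Oplus>\<^sub>WW z\<in>UNIV. \<Oplus>\<^sub>WW k\<in>UNIV. ?G c (fst z) k (snd z)) = (\<Oplus>\<^sub>WW z\<in>UNIV. \<Oplus>\<^sub>WW z'\<in>UNIV.
        if snd z = fst z' then ?G c (fst z) (fst z') (snd z') else \<zero>\<^sub>WW)" .
  qed (auto intro!: Wq.Bb.AA.T.finsum_closed G)
  also have "\<dots> = (\<Oplus>\<^sub>WW c\<in>C. EW \<otimes>\<^sub>WW
      tt (\<Oplus>\<^sub>AW z\<in>UNIV. w (f (fst z)) \<one>\<^sub>R (pa (fst z)) (pu (snd z) c))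
        (\<Oplus>\<^sub>AW z\<in>UNIV. w \<one>\<^sub>R (g (snd z)) (pu (fst z) c) (pq (snd z))))"
  proof (rule Wq.Bb.AA.T.finsum_eqI)
    fix c assume c: "c \<in> C"
    let ?a = "\<lambda>z. w (f (fst z)) \<one>\<^sub>R (pa (fst z)) (pu (snd z) c)"
    let ?b = "\<lambda>z. w \<one>\<^sub>R (g (snd z)) (pu (fst z) c) (pq (snd z))"
    have ab: "?a z \<in> carrier AW" "?b z \<in> carrier AW" for z
      using pa pq pu(1)[OF c] fc by (auto intro!: wc)
    have "tt (\<Oplus>\<^sub>AW z\<in>UNIV. ?a z) (\<Oplus>\<^sub>AW z\<in>UNIV. ?b z) = (\<Oplus>\<^sub>WW z\<in>UNIV. \<Oplus>\<^sub>WW z'\<in>UNIV. tt (?a z) (?b z'))"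
      using ab by (subst Wq.Bb.AA.tens_sum_left) (simp_all add: Wq.Bb.AA.tens_sum_right W.finsum_closed)
    then have "EW \<otimes>\<^sub>WW tt (\<Oplus>\<^sub>AW z\<in>UNIV. ?a z) (\<Oplus>\<^sub>AW z\<in>UNIV. ?b z)
        = (\<Oplus>\<^sub>WW z\<in>UNIV. \<Oplus>\<^sub>WW z'\<in>UNIV. EW \<otimes>\<^sub>WW tt (?a z) (?b z'))"
      using ab by (simp add: Wq.Bb.AA.T.finsum_rdistr Wq.Bb.AA.T.finsum_closed Pi_I)
    also have "\<dots> = (\<Oplus>\<^sub>WW z\<in>UNIV. \<Oplus>\<^sub>WW z'\<in>UNIV.
        if snd z = fst z' then ?G c (fst z) (fst z') (snd z') else \<zero>\<^sub>WW)"
    proof (rule Wq.Bb.AA.T.finsum_eqI, rule Wq.Bb.AA.T.finsum_eqI)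
      fix z z' :: "'l \<times> 'l"
      show "EW \<otimes>\<^sub>WW tt (?a z) (?b z') = (if snd z = fst z' then ?G c (fst z) (fst z') (snd z') else \<zero>\<^sub>WW)"
        using EW_tt[of "f (fst z)" "g (snd z')" "pa (fst z)" n "pu (snd z) c" "pu (fst z') c" "pq (snd z')"]
          fc pa pq pu(1)[OF c] by (simp add: pu(2))
    qed (auto intro!: Wq.Bb.AA.T.finsum_closed G c)
    finally show "(\<Oplus>\<^sub>WW z\<in>UNIV. \<Oplus>\<^sub>WW z'\<in>UNIV.
        if snd z = fst z' then ?G c (fst z) (fst z') (snd z') else \<zero>\<^sub>WW)
        = EW \<otimes>\<^sub>WW tt (\<Oplus>\<^sub>AW z\<in>UNIV. ?a z) (\<Oplus>\<^sub>AW z\<in>UNIV. ?b z)" ..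
    show "EW \<otimes>\<^sub>WW tt (\<Oplus>\<^sub>AW z\<in>UNIV. ?a z) (\<Oplus>\<^sub>AW z\<in>UNIV. ?b z) \<in> carrier WW"
      using ab by (auto intro!: Wq.Bb.AA.T.m_closed tt_closed W.finsum_closed)
  qed
  also have "\<dots> = EW \<otimes>\<^sub>WW (\<Oplus>\<^sub>WW c\<in>C. tt (\<Oplus>\<^sub>AW z\<in>UNIV. w (f (fst z)) \<one>\<^sub>R (pa (fst z)) (pu (snd z) c))
        (\<Oplus>\<^sub>AW z\<in>UNIV. w \<one>\<^sub>R (g (snd z)) (pu (fst z) c) (pq (snd z))))"
    by (rule Wq.Bb.AA.T.finsum_rdistr[symmetric])
      (use pa pq pu(1) fc C in \<open>auto intro!: tt_closed W.finsum_closed wc\<close>)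
  finally show ?thesis .
qed

lemma stw_sum: "[|f \<in> carrier M; g \<in> carrier M|] ==> sw f \<otimes>\<^sub>AW tw g
    = (\<Oplus>\<^sub>AW z\<in>UNIV. w (f (fst z)) (g (snd z)) (fst z, []) (snd z, []))"
  by (simp add: stw triv_def)

lemma stLw_sum: "[|f \<in> carrier M; g \<in> carrier M; a \<in> X; b \<in> X|] ==> sw f \<otimes>\<^sub>AW tw g \<otimes>\<^sub>AW Lw a b
    = (\<Oplus>\<^sub>AW z\<in>UNIV. w (f (fst z)) (g (snd z)) (arrow (fst z) a) (arrow (snd z) b))"
  using fun_alg_closed[of f R] fun_alg_closed[of g R] by (simp add: stw triv_L)

lemma cw_st:
  assumes f: "f \<in> carrier M" and g: "g \<in> carrier M"
  shows "cw (sw f \<otimes>\<^sub>AW tw g) = EW \<otimes>\<^sub>WW tt (sw f) (tw g)"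
proof -
  have p0: "paths X deg 0 = (\<lambda>k. (k, [])) ` UNIV" unfolding paths_0 by auto
  have s: "sw f = (\<Oplus>\<^sub>AW z\<in>UNIV. w (f (fst z)) \<one>\<^sub>R (fst z, []) (snd z, []))"
    by (simp add: sw_triv triv_def)
  have t: "tw g = (\<Oplus>\<^sub>AW z\<in>UNIV. w \<one>\<^sub>R (g (snd z)) (fst z, []) (snd z, []))"
    by (simp add: tw_triv[OF g] triv_def)
  have c: "tt (sw f) (tw g) \<in> carrier WW" using f g by (intro tt_closed) auto
  have "cw (sw f \<otimes>\<^sub>AW tw g) = EW \<otimes>\<^sub>WW (\<Oplus>\<^sub>WW c\<in>{()}. tt (sw f) (tw g))"
    unfolding stw_sum[OF f g] unfolding s t
  proof (rule cw_family[OF f g, where n = 0 and pu = "\<lambda>k c. (k, [])"])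
    fix h :: "('l, 'x) path => _" assume h: "\<And>u. u \<in> paths X deg 0 ==> h u \<in> carrier WW"
    have "(\<Oplus>\<^sub>WW u\<in>paths X deg 0. h u) = (\<Oplus>\<^sub>WW k\<in>UNIV. h (k, []))"
      unfolding p0 by (rule Wq.Bb.AA.T.finsum_reindex) (use h in \<open>auto simp: inj_on_def\<close>)
    then show "(\<Oplus>\<^sub>WW u\<in>paths X deg 0. h u) = (\<Oplus>\<^sub>WW c\<in>{()}. \<Oplus>\<^sub>WW k\<in>UNIV. h (k, []))"
      using h by (subst Wq.Bb.AA.T.finsum_insert) (auto intro!: Wq.Bb.AA.T.finsum_closed)
  qed auto
  then show ?thesis using c by (subst (asm) Wq.Bb.AA.T.finsum_insert) auto
qed

lemma cw_stL:
  assumes f: "f \<in> carrier M" and g: "g \<in> carrier M" and ab: "a \<in> X" "b \<in> X"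
  shows "cw (sw f \<otimes>\<^sub>AW tw g \<otimes>\<^sub>AW Lw a b)
    = EW \<otimes>\<^sub>WW (\<Oplus>\<^sub>WW c\<in>X. tt (sw f \<otimes>\<^sub>AW Lw a c) (tw g \<otimes>\<^sub>AW Lw c b))"
proof -
  have fc: "f l \<in> carrier R" "g l \<in> carrier R" for l
    using fun_alg_closed[OF f] fun_alg_closed[OF g] by simp_all
  have p1: "paths X deg 1 = (\<lambda>(c, k). arrow k c) ` (X \<times> UNIV)"
  proof
    show "paths X deg 1 \<subseteq> (\<lambda>(c, k). arrow k c) ` (X \<times> UNIV)"
    proof
      fix p assume p: "p \<in> paths X deg 1"
      obtain k xs where k: "p = (k, xs)" by fastforce
      obtain a where "xs = [a]" using paths_length[OF p] k by (auto simp: length_Suc_conv)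
      with p k show "p \<in> (\<lambda>(c, k). arrow k c) ` (X \<times> UNIV)" by (cases a) auto
    qed
  qed auto
  have s: "sw f \<otimes>\<^sub>AW Lw a c = (\<Oplus>\<^sub>AW z\<in>UNIV. w (f (fst z)) \<one>\<^sub>R (arrow (fst z) a) (arrow (snd z) c))"
    if "c \<in> X" for c using that ab fc by (simp add: sw_triv triv_L)
  have t: "tw g \<otimes>\<^sub>AW Lw c b = (\<Oplus>\<^sub>AW z\<in>UNIV. w \<one>\<^sub>R (g (snd z)) (arrow (fst z) c) (arrow (snd z) b))"
    if "c \<in> X" for c using that ab fc by (simp add: tw_triv[OF g] triv_L)
  have "cw (sw f \<otimes>\<^sub>AW tw g \<otimes>\<^sub>AW Lw a b) = EW \<otimes>\<^sub>WW (\<Oplus>\<^sub>WW c\<in>X.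
      tt (\<Oplus>\<^sub>AW z\<in>UNIV. w (f (fst z)) \<one>\<^sub>R (arrow (fst z) a) (arrow (snd z) c))
      (\<Oplus>\<^sub>AW z\<in>UNIV. w \<one>\<^sub>R (g (snd z)) (arrow (fst z) c) (arrow (snd z) b)))"
    unfolding stLw_sum[OF f g ab]
  proof (rule cw_family[OF f g, where n = 1 and pu = arrow])
    fix h :: "('l, 'x) path => _" assume h: "\<And>u. u \<in> paths X deg 1 ==> h u \<in> carrier WW"
    have hc: "h (arrow k c) \<in> carrier WW" if "c \<in> X" for k c using that by (intro h) auto
    have "(\<Oplus>\<^sub>WW u\<in>paths X deg 1. h u) = (\<Oplus>\<^sub>WW z\<in>X \<times> UNIV. h ((\<lambda>(c, k). arrow k c) z))"
      unfolding p1 by (rule Wq.Bb.AA.T.finsum_reindex) (use hc in \<open>auto simp: inj_on_def\<close>)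
    also have "\<dots> = (\<Oplus>\<^sub>WW z\<in>X \<times> UNIV. case z of (c, k) => h (arrow k c))"
      by (rule Wq.Bb.AA.T.finsum_eqI) (use hc in auto)
    also have "\<dots> = (\<Oplus>\<^sub>WW c\<in>X. \<Oplus>\<^sub>WW k\<in>UNIV. h (arrow k c))"
      by (rule Wq.Bb.AA.T.finsum_Times[symmetric]) (use hc in auto)
    finally show "(\<Oplus>\<^sub>WW u\<in>paths X deg 1. h u) = (\<Oplus>\<^sub>WW c\<in>X. \<Oplus>\<^sub>WW k\<in>UNIV. h (arrow k c))" .
  qed (use ab in auto)
  also have "(\<Oplus>\<^sub>WW c\<in>X.
      tt (\<Oplus>\<^sub>AW z\<in>UNIV. w (f (fst z)) \<one>\<^sub>R (arrow (fst z) a) (arrow (snd z) c))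
      (\<Oplus>\<^sub>AW z\<in>UNIV. w \<one>\<^sub>R (g (snd z)) (arrow (fst z) c) (arrow (snd z) b)))
      = (\<Oplus>\<^sub>WW c\<in>X. tt (sw f \<otimes>\<^sub>AW Lw a c) (tw g \<otimes>\<^sub>AW Lw c b))"
    by (rule Wq.Bb.AA.T.finsum_eqI) (use f g ab in \<open>simp_all add: s[symmetric] t[symmetric] tt_closed\<close>)
  finally show ?thesis .
qed

end

context quad
begin

definition out :: "('k, 'r, 'l, 'x) aw => 'b" where "out = induced Theta"

lemma out_P: "x \<in> carrier H ==> out (P x) = Theta x"
  unfolding out_def
  by (rule induced_coset[OF H.ks aw_sub B.ks Theta_lin Theta_kill])

lemma out_lin: "out \<in> lin_map AW B"
  unfolding out_def Aw_def
  by (rule induced_lin[OF H.ks aw_sub B.ks Theta_lin Theta_kill])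

lemma out_hom: "out \<in> alg_hom AW B"
proof (rule alg_homI[OF out_lin])
  show "out \<one>\<^sub>AW = \<one>"
    using out_P[OF H.one_closed] unfolding alg_hom_one[OF P_hom] Theta_one .
  fix x y assume "x \<in> carrier AW" "y \<in> carrier AW"
  then obtain x' y' where x: "x' \<in> carrier H" "x = P x'" and y: "y' \<in> carrier H" "y = P y'"
    by (elim AW_cases)
  have "out (x \<otimes>\<^sub>AW y) = out (P (x' \<otimes>\<^sub>H y'))"
    unfolding x(2) y(2) alg_hom_mult[OF P_hom x(1) y(1)] ..
  also have "\<dots> = out x \<otimes> out y"
    unfolding x(2) y(2) out_P[OF H.m_closed[OF x(1) y(1)]] out_P[OF x(1)] out_P[OF y(1)]
    by (rule Theta_mult[OF x(1) y(1)])
  finally show "out (x \<otimes>\<^sub>AW y) = out x \<otimes> out y" .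
qed

lemma out_w: "[|r \<in> carrier R; r' \<in> carrier R; p \<in> paths X deg n; q \<in> paths X deg n|] ==>
    out (w r r' p q) = theta r r' p q"
  unfolding P_hb[symmetric] by (simp add: out_P Theta_hb hb_closed[of _ _ _ n])

lemma out_st:
  assumes f: "f \<in> carrier M" and g: "g \<in> carrier M"
  shows "out (sw f \<otimes>\<^sub>AW tw g) = S f \<otimes> T g"
proof -
  note fc = fun_alg_closed[OF f] fun_alg_closed[OF g]
  have "out (sw f \<otimes>\<^sub>AW tw g)
      = (\<Oplus>z\<in>UNIV \<times> UNIV. case z of (l, m) => S (pt R l (f l)) \<otimes> T (pt R m (g m)))"
    unfolding stw_sum[OF f g] UNIV_Times_UNIV
    by (subst lin_map_finsum[OF W.ks B.ks out_lin])
      (auto simp: fc out_w[of _ _ _ 0] theta_def intro!: B.finsum_eqI)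
  also have "\<dots> = (\<Oplus>l\<in>UNIV. \<Oplus>m\<in>UNIV. S (pt R l (f l)) \<otimes> T (pt R m (g m)))"
    by (rule B.finsum_Times[symmetric]) (auto simp: fc)
  finally show ?thesis using ST_sum[OF f g] by simp
qed

lemma out_s: "f \<in> carrier M ==> out (sw f) = S f"
  using out_st[of f "\<one>\<^sub>M"] by (simp add: Wq.T_one T_one)

lemma out_t: "f \<in> carrier M ==> out (tw f) = T f"
  using out_st[of "\<one>\<^sub>M" f] by (simp add: Wq.S_one S_one)

lemma out_L:
  assumes X: "a \<in> X" "b \<in> X" shows "out (Lw a b) = el a b"
proof -
  note o = M.M.one_closed
  have fc: "\<one>\<^sub>M l = \<one>\<^sub>R" for l by (simp add: fun_alg_simps)
  have "out (Lw a b) = out (sw \<one>\<^sub>M \<otimes>\<^sub>AW tw \<one>\<^sub>M \<otimes>\<^sub>AW Lw a b)"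
    using X by (simp add: Wq.S_one Wq.T_one)
  also have "\<dots> = (\<Oplus>z\<in>UNIV \<times> UNIV. case z of (l, m) =>
      S (pt R l (\<one>\<^sub>M l)) \<otimes> T (pt R m (\<one>\<^sub>M m)) \<otimes> el a b)"
    unfolding stLw_sum[OF o o X] UNIV_Times_UNIV
    by (subst lin_map_finsum[OF W.ks B.ks out_lin])
      (use X in \<open>auto simp: fc out_w[of _ _ _ 1] theta_def intro!: B.finsum_eqI\<close>)
  also have "\<dots> = (\<Oplus>l\<in>UNIV. \<Oplus>m\<in>UNIV. S (pt R l (\<one>\<^sub>M l)) \<otimes> T (pt R m (\<one>\<^sub>M m)) \<otimes> el a b)"
    by (rule B.finsum_Times[symmetric]) (use X in \<open>auto simp: fc\<close>)
  also have "\<dots> = (\<Oplus>l\<in>UNIV. \<Oplus>m\<in>UNIV. S (pt R l (\<one>\<^sub>M l)) \<otimes> T (pt R m (\<one>\<^sub>M m))) \<otimes> el a b"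
    using X by (subst B.finsum_ldistr)
      (auto simp: fc intro!: B.finsum_eqI B.finsum_closed B.finsum_ldistr[symmetric])
  finally show ?thesis using X by (simp add: ST_sum S_one T_one)
qed

end

context dyb
begin

abbreviation sh where "sh a \<equiv> shift (deg a)"
abbreviation shi where "shi a \<equiv> shift (inv_into UNIV (deg a))"

lemma shift_mult: "shift \<alpha> (f \<otimes>\<^sub>M g) = shift \<alpha> f \<otimes>\<^sub>M shift \<alpha> g"
  by (simp add: fun_alg_simps shift_def)

lemma shift_one [simp]: "shift \<alpha> \<one>\<^sub>M = \<one>\<^sub>M"
  by (simp add: fun_alg_simps shift_def)

lemma shift_inv [simp]:
  assumes "a \<in> X" shows "sh a (shi a f) = f" "shi a (sh a f) = f"
  using deg_bij[OF assms] by (auto simp: shift_def bij_def inv_f_f surj_f_inv_f fun_eq_iff)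

lemma shift_lin: "shift \<alpha> \<in> lin_map M M"
  by (rule lin_mapI, simp) (simp_all add: fun_alg_simps shift_def)

section \<open>The counit\<close>

abbreviation EM where "EM \<equiv> end_alg M"

sublocale EM: kalg EM by (rule kalg_end_alg[OF M.M.ks])

lemma EM_eqI:
  "[|g \<in> carrier EM; h \<in> carrier EM; \<And>x. x \<in> carrier M ==> g x = h x|] ==> g = h"
  by (auto simp: end_alg_simps intro: extensionalityI)

definition lm :: "('l => 'r) => ('l => 'r) => 'l => 'r" where "lm f = (\<lambda>h\<in>carrier M. f \<otimes>\<^sub>M h)"
definition rm :: "('l => 'r) => ('l => 'r) => 'l => 'r" where "rm g = (\<lambda>h\<in>carrier M. h \<otimes>\<^sub>M g)"
definition lsh :: "'x => 'x => ('l => 'r) => 'l => 'r" where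
  "lsh a b = (if a = b then (\<lambda>h\<in>carrier M. sh a h) else \<zero>\<^sub>EM)"

lemma EM_apply:
  assumes "h \<in> carrier M"
  shows "(u \<otimes>\<^sub>EM v) h = u (v h)" "\<zero>\<^sub>EM h = \<zero>\<^sub>M" "\<one>\<^sub>EM h = h"
    "lm f h = f \<otimes>\<^sub>M h" "rm f h = h \<otimes>\<^sub>M f" "lsh a b h = (if a = b then sh a h else \<zero>\<^sub>M)"
  using assms by (simp_all add: end_alg_simps lm_def rm_def lsh_def)

lemma shift_zero [simp]: "shift \<alpha> \<zero>\<^sub>M = \<zero>\<^sub>M"
  by (simp add: fun_alg_simps shift_def)

lemma EM_ops_closed: "f \<in> carrier M ==> lm f \<in> carrier EM" "f \<in> carrier M ==> rm f \<in> carrier EM"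
  "lsh a b \<in> carrier EM"
  unfolding lm_def rm_def lsh_def
  by (auto intro!: end_alg_carrierI[OF M.M.ks] M.M.mult_left_lin M.M.mult_right_lin shift_lin)

text \<open>
  Multiplications and shifts of \<open>M\<close> satisfy the relations; in the quadratic one a single term
  survives on each side, and these agree because \<open>\<sigma>\<close> is central and vanishes off the diagonal of
  degrees.
\<close>

sublocale Mq: quad R \<psi> I r1 r2 X deg \<sigma> EM lm rm lsh
proof
  note c = EM_ops_closed
  have ad: "(u \<oplus>\<^sub>EM v) h = u h \<oplus>\<^sub>M v h" "(k \<odot>\<^sub>EM u) h = k \<odot>\<^sub>M u h" if "h \<in> carrier M" for u v h k
    using that by (simp_all add: end_alg_simps)
  note e = EM_apply ad
  show "lm \<in> lin_map M EM" "rm \<in> lin_map M EM"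
    by (auto intro!: lin_mapI EM_eqI simp: c e M.M.l_distr M.M.r_distr M.M.smult_mult_left M.M.smult_mult_right)
  show "lm \<one>\<^sub>M = \<one>\<^sub>EM" "rm \<one>\<^sub>M = \<one>\<^sub>EM"
    by (auto intro!: EM_eqI simp: c e)
  fix f g assume "f \<in> carrier M" "g \<in> carrier M"
  then show "lm (f \<otimes>\<^sub>M g) = lm f \<otimes>\<^sub>EM lm g" "rm (f \<otimes>\<^sub>M g) = rm g \<otimes>\<^sub>EM rm f"
    "rm g \<otimes>\<^sub>EM lm f = lm f \<otimes>\<^sub>EM rm g"
    by (auto intro!: EM_eqI simp: c e M.M.m_assoc)
next
  note c = EM_ops_closed and e = EM_apply
  show "lsh a b \<in> carrier EM" for a b by (rule EM_ops_closed)
  show "lsh a b \<otimes>\<^sub>EM lm f = lm (sh a f) \<otimes>\<^sub>EM lsh a b" "lsh a b \<otimes>\<^sub>EM rm f = rm (sh b f) \<otimes>\<^sub>EM lsh a b"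
    if "f \<in> carrier M" for a b f
    using that by (auto intro!: EM_eqI simp: c e shift_mult)
  fix a b c' d assume X: "a \<in> X" "b \<in> X" "c' \<in> X" "d \<in> X"
  have s: "\<sigma> x y z u \<in> carrier M" if "x \<in> X" "y \<in> X" "z \<in> X" "u \<in> X" for x y z u
    using that by (simp add: fun_alg_simps)
  have ev: "(\<Oplus>\<^sub>EM y\<in>X. \<Oplus>\<^sub>EM x\<in>X. g y x) h = (\<Oplus>\<^sub>M y\<in>X. \<Oplus>\<^sub>M x\<in>X. g y x h)"
    if h: "h \<in> carrier M" and g: "\<And>y x. [|y \<in> X; x \<in> X|] ==> g y x \<in> carrier EM" for g h
  proof -
    note ev1 = lin_map_finsum[OF EM.ks M.M.ks end_alg_eval_lin[OF h]]
    have gc: "g y x h \<in> carrier M" if "y \<in> X" "x \<in> X" for y x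
      by (rule lin_map_closed[OF end_alg_eval_lin[OF h] g[OF that]])
    show ?thesis
      by (subst ev1, use g in \<open>simp add: EM.finsum_closed Pi_I\<close>, rule M.M.finsum_eqI, rule ev1)
        (use g gc in \<open>simp_all add: M.M.finsum_closed Pi_I\<close>)
  qed
  show "(\<Oplus>\<^sub>EM y\<in>X. \<Oplus>\<^sub>EM x\<in>X. lm (\<sigma> x y a c') \<otimes>\<^sub>EM (lsh y d \<otimes>\<^sub>EM lsh x b))
      = (\<Oplus>\<^sub>EM y\<in>X. \<Oplus>\<^sub>EM x\<in>X. rm (\<sigma> b d x y) \<otimes>\<^sub>EM (lsh c' y \<otimes>\<^sub>EM lsh a x))"
  proof (rule EM_eqI)
    fix h assume h: "h \<in> carrier M"
    have "(\<Oplus>\<^sub>EM y\<in>X. \<Oplus>\<^sub>EM x\<in>X. lm (\<sigma> x y a c') \<otimes>\<^sub>EM (lsh y d \<otimes>\<^sub>EM lsh x b)) h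
        = (\<Oplus>\<^sub>M y\<in>X. \<Oplus>\<^sub>M x\<in>X. (lm (\<sigma> x y a c') \<otimes>\<^sub>EM (lsh y d \<otimes>\<^sub>EM lsh x b)) h)"
      by (rule ev[OF h]) (use X in \<open>simp add: c s\<close>)
    also have "\<dots> = (\<Oplus>\<^sub>M y\<in>X. if y = d then \<Oplus>\<^sub>M x\<in>X. (if x = b then \<sigma> x y a c' \<otimes>\<^sub>M sh y (sh x h) else \<zero>\<^sub>M) else \<zero>\<^sub>M)"
      by (rule M.M.finsum_eqI) (use X h in \<open>auto simp: e s intro!: M.M.finsum_eqI M.M.finsum_closed M.M.add.finprod_one_eqI\<close>)
    also have "\<dots> = \<sigma> b d a c' \<otimes>\<^sub>M sh d (sh b h)"
      using X h by (simp add: M.M.finsum_delta s M.M.finsum_closed Pi_I)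
    finally have 1: "(\<Oplus>\<^sub>EM y\<in>X. \<Oplus>\<^sub>EM x\<in>X. lm (\<sigma> x y a c') \<otimes>\<^sub>EM (lsh y d \<otimes>\<^sub>EM lsh x b)) h
        = \<sigma> b d a c' \<otimes>\<^sub>M sh d (sh b h)" .
    have "(\<Oplus>\<^sub>EM y\<in>X. \<Oplus>\<^sub>EM x\<in>X. rm (\<sigma> b d x y) \<otimes>\<^sub>EM (lsh c' y \<otimes>\<^sub>EM lsh a x)) h
        = (\<Oplus>\<^sub>M y\<in>X. \<Oplus>\<^sub>M x\<in>X. (rm (\<sigma> b d x y) \<otimes>\<^sub>EM (lsh c' y \<otimes>\<^sub>EM lsh a x)) h)"
      by (rule ev[OF h]) (use X in \<open>simp add: c s\<close>)
    also have "\<dots> = (\<Oplus>\<^sub>M y\<in>X. if c' = y then \<Oplus>\<^sub>M x\<in>X. (if a = x then sh c' (sh a h) \<otimes>\<^sub>M \<sigma> b d x y else \<zero>\<^sub>M) else \<zero>\<^sub>M)"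
      by (rule M.M.finsum_eqI) (use X h in \<open>auto simp: e s intro!: M.M.finsum_eqI M.M.finsum_closed M.M.add.finprod_one_eqI\<close>)
    also have "\<dots> = sh c' (sh a h) \<otimes>\<^sub>M \<sigma> b d a c'"
      using X h by (simp add: M.M.finsum_delta' s M.M.finsum_closed Pi_I)
    also have "\<dots> = \<sigma> b d a c' \<otimes>\<^sub>M sh d (sh b h)"
    proof
      fix l
      have hc: "h m \<in> carrier R" for m using h by (rule fun_alg_closed)
      show "(sh c' (sh a h) \<otimes>\<^sub>M \<sigma> b d a c') l = (\<sigma> b d a c' \<otimes>\<^sub>M sh d (sh b h)) l"
        using X hc \<sigma>_comm[of b d a c' "h (deg a (deg c' l))" l] \<sigma>_zero[of a b c' d l]
        by (cases "deg b (deg d l) = deg a (deg c' l)") (simp_all add: fun_alg_simps shift_def)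
    qed
    finally show "(\<Oplus>\<^sub>EM y\<in>X. \<Oplus>\<^sub>EM x\<in>X. lm (\<sigma> x y a c') \<otimes>\<^sub>EM (lsh y d \<otimes>\<^sub>EM lsh x b)) h
        = (\<Oplus>\<^sub>EM y\<in>X. \<Oplus>\<^sub>EM x\<in>X. rm (\<sigma> b d x y) \<otimes>\<^sub>EM (lsh c' y \<otimes>\<^sub>EM lsh a x)) h"
      using 1 by simp
  qed (use X in \<open>auto simp: c s intro!: EM.finsum_closed EM.m_closed\<close>)
qed

lemma path_eq_iff:
  "[|(l, xs) \<in> paths X deg n; (m, ys) \<in> paths X deg n|] ==>
   (l, xs) = (m, ys) \<longleftrightarrow> l = m \<and> map snd xs = map snd ys"
proof (induction xs arbitrary: l m n ys)
  case (Cons x xs)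
  then obtain y ys' where ys: "ys = y # ys'" by (cases ys) auto
  have p: "(atgt deg x, xs) \<in> paths X deg (length xs)" "(atgt deg y, ys') \<in> paths X deg (length xs)"
    "fst x = l" "fst y = m" using Cons.prems ys by auto
  then show ?case
    using Cons.IH[OF p(1,2)] ys by (auto simp: atgt_def prod_eq_iff)
qed (auto dest!: paths_length)

lemma lprod_one:
  "[|(l, xs) \<in> paths X deg n; (m, ys) \<in> paths X deg n|] ==>
   Mq.lprod xs ys \<one>\<^sub>M = (if map snd xs = map snd ys then \<one>\<^sub>M else \<zero>\<^sub>M)"
proof (induction xs ys arbitrary: l m n rule: Mq.lprod.induct)
  case (1 x xs y ys)
  then have p: "(atgt deg x, xs) \<in> paths X deg (length xs)" "(atgt deg y, ys) \<in> paths X deg (length xs)" by auto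
  then show ?case using "1.IH"[OF p] by (auto simp: EM_apply)
qed (auto simp: EM_apply dest!: paths_length)

abbreviation pw where "pw \<equiv> aw_pi R :: ('k, 'r, 'l, 'x) aw => 'l => 'r"

definition pb where "pb r r' p q = (if p = q then cst (r \<otimes>\<^sub>R r') \<otimes>\<^sub>M delta R (psrc q) else \<zero>\<^sub>M)"

lemma pb_theta:
  assumes r: "r \<in> carrier R" "r' \<in> carrier R" and p: "p \<in> paths X deg n" "q \<in> paths X deg n"
  shows "pb r r' p q = Mq.theta r r' p q \<one>\<^sub>M"
proof -
  let ?c = "if map snd (snd p) = map snd (snd q) then \<one>\<^sub>M else \<zero>\<^sub>M"
  have z: "pt R l \<zero>\<^sub>R = \<zero>\<^sub>M" for l by (auto simp: pt_def fun_alg_simps)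
  have "Mq.theta r r' p q \<one>\<^sub>M = pt R (psrc p) r \<otimes>\<^sub>M (?c \<otimes>\<^sub>M pt R (psrc q) r')"
    using r lprod_one[of "fst p" "snd p" n "fst q" "snd q"] p by (simp add: Mq.theta_def EM_apply)
  also have "\<dots> = (if map snd (snd p) = map snd (snd q) then pt R (psrc p) r \<otimes>\<^sub>M pt R (psrc q) r' else \<zero>\<^sub>M)"
    using r by simp
  also have "\<dots> = pb r r' p q"
    using r path_eq_iff[of "fst p" "snd p" n "fst q" "snd q"] p
    by (simp add: pb_def psrc_def R.M.cst_delta R.M.pt_mult_right R.M.pt_apply z)
  finally show ?thesis ..
qed

lemma pw_out:
  assumes "x \<in> carrier AW" shows "pw x = Mq.out x \<one>\<^sub>M"
proof -
  note ev = end_alg_eval_lin[OF M.M.one_closed]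
  have b: "bilin R R M (\<lambda>r r'. pb r r' p q)" if p: "p \<in> paths X deg n" "q \<in> paths X deg n" for p q n
  proof (rule bilinI)
    note th = Mq.theta_bilin[OF p]
    show "(\<lambda>r'. pb r r' p q) \<in> lin_map R M" if "r \<in> carrier R" for r
      by (rule lin_map_cong[OF R.M.ks lin_map_comp[OF bilin_right[OF th that] ev]])
        (rule pb_theta[OF that _ p])
    show "(\<lambda>r. pb r r' p q) \<in> lin_map R M" if "r' \<in> carrier R" for r'
      by (rule lin_map_cong[OF R.M.ks lin_map_comp[OF bilin_left[OF th that] ev]])
        (rule pb_theta[OF _ that p])
  qed
  have "hq_lift M pb y = Mq.Theta y \<one>\<^sub>M" if "y \<in> carrier H" for y
    by (rule hq_map_eqI[OF hq_lift_lin[OF M.M.ks b] lin_map_comp[OF Mq.Theta_lin ev] _ that])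
      (auto simp: hq_lift_hb[OF M.M.ks b] Mq.Theta_hb pb_theta)
  moreover have "pw = induced (hq_lift M pb)"
    unfolding aw_pi_def pb_def ..
  moreover obtain y where y: "y \<in> carrier H" "x = P y" "induced (hq_lift M pb) x = hq_lift M pb y"
    using assms unfolding Aw_def by (rule induced_representative[OF H.ks aw_sub])
  ultimately show ?thesis by (simp add: Mq.out_P)
qed

lemma pw_lin: "pw \<in> lin_map AW M"
  by (rule lin_map_cong[OF W.ks lin_map_comp[OF Mq.out_lin end_alg_eval_lin[OF M.M.one_closed]] pw_out])

lemma pw_st: "[|f \<in> carrier M; g \<in> carrier M|] ==> pw (sw f \<otimes>\<^sub>AW tw g) = f \<otimes>\<^sub>M g"
  by (simp add: pw_out Mq.out_st EM_apply)

lemma pw_stL: "[|f \<in> carrier M; g \<in> carrier M; a \<in> X; b \<in> X|] ==>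
    pw (sw f \<otimes>\<^sub>AW tw g \<otimes>\<^sub>AW Lw a b) = (if a = b then f \<otimes>\<^sub>M g else \<zero>\<^sub>M)"
  by (simp add: pw_out alg_hom_mult[OF Mq.out_hom] Mq.out_s Mq.out_t Mq.out_L EM_apply)

end

section \<open>From the antipode to an inverse matrix\<close>

text \<open>
  Associativity of a product of a row, a matrix and a column, all indexed by pairs.
\<close>

lemma (in ring) finsum_mult_assoc:
  assumes fin: "finite U" "finite V"
    and x: "\<And>c i. [|c \<in> U; i \<in> V|] ==> x c i \<in> carrier R"
    and Y: "\<And>c i d j. [|c \<in> U; i \<in> V; d \<in> U; j \<in> V|] ==> Y c i d j \<in> carrier R"
    and z: "\<And>c i. [|c \<in> U; i \<in> V|] ==> z c i \<in> carrier R"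
  shows "(\<Oplus>c\<in>U. \<Oplus>i\<in>V. x c i \<otimes> (\<Oplus>d\<in>U. \<Oplus>j\<in>V. Y c i d j \<otimes> z d j))
    = (\<Oplus>d\<in>U. \<Oplus>j\<in>V. (\<Oplus>c\<in>U. \<Oplus>i\<in>V. x c i \<otimes> Y c i d j) \<otimes> z d j)"
proof -
  let ?P = "U \<times> V"
  have T: "(\<Oplus>c\<in>U. \<Oplus>i\<in>V. h c i) = (\<Oplus>p\<in>?P. h (fst p) (snd p))"
    if "\<And>c i. [|c \<in> U; i \<in> V|] ==> h c i \<in> carrier R" for h
    using finsum_Times[OF fin that] by (simp add: case_prod_unfold)
  have x': "x (fst p) (snd p) \<in> carrier R" "z (fst p) (snd p) \<in> carrier R" if "p \<in> ?P" for p
    using that x z by auto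
  have Y': "Y (fst p) (snd p) (fst q) (snd q) \<in> carrier R" if "p \<in> ?P" "q \<in> ?P" for p q
    using that Y by auto
  note cl = x' Y'
  have "(\<Oplus>c\<in>U. \<Oplus>i\<in>V. x c i \<otimes> (\<Oplus>d\<in>U. \<Oplus>j\<in>V. Y c i d j \<otimes> z d j))
    = (\<Oplus>p\<in>?P. x (fst p) (snd p) \<otimes> (\<Oplus>d\<in>U. \<Oplus>j\<in>V. Y (fst p) (snd p) d j \<otimes> z d j))"
    by (rule T) (use x Y z in \<open>auto intro!: finsum_closed\<close>)
  also have "\<dots> = (\<Oplus>p\<in>?P. \<Oplus>q\<in>?P. x (fst p) (snd p) \<otimes> (Y (fst p) (snd p) (fst q) (snd q) \<otimes> z (fst q) (snd q)))"
  proof (rule finsum_eqI)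
    fix p assume p: "p \<in> ?P"
    have "(\<Oplus>d\<in>U. \<Oplus>j\<in>V. Y (fst p) (snd p) d j \<otimes> z d j)
        = (\<Oplus>q\<in>?P. Y (fst p) (snd p) (fst q) (snd q) \<otimes> z (fst q) (snd q))"
      by (rule T) (use p Y z in auto)
    then show "x (fst p) (snd p) \<otimes> (\<Oplus>d\<in>U. \<Oplus>j\<in>V. Y (fst p) (snd p) d j \<otimes> z d j)
        = (\<Oplus>q\<in>?P. x (fst p) (snd p) \<otimes> (Y (fst p) (snd p) (fst q) (snd q) \<otimes> z (fst q) (snd q)))"
      using p fin by (simp add: finsum_rdistr Pi_I cl)
  qed (simp add: finsum_closed Pi_I cl)
  also have "\<dots> = (\<Oplus>q\<in>?P. \<Oplus>p\<in>?P. x (fst p) (snd p) \<otimes> (Y (fst p) (snd p) (fst q) (snd q) \<otimes> z (fst q) (snd q)))"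
    by (rule finsum_swap) (use fin in \<open>simp_all add: cl\<close>)
  also have "\<dots> = (\<Oplus>q\<in>?P. (\<Oplus>c\<in>U. \<Oplus>i\<in>V. x c i \<otimes> Y c i (fst q) (snd q)) \<otimes> z (fst q) (snd q))"
  proof (rule finsum_eqI)
    fix q assume q: "q \<in> ?P"
    have "(\<Oplus>c\<in>U. \<Oplus>i\<in>V. x c i \<otimes> Y c i (fst q) (snd q))
        = (\<Oplus>p\<in>?P. x (fst p) (snd p) \<otimes> Y (fst p) (snd p) (fst q) (snd q))"
      by (rule T) (use q x Y in auto)
    then show "(\<Oplus>p\<in>?P. x (fst p) (snd p) \<otimes> (Y (fst p) (snd p) (fst q) (snd q) \<otimes> z (fst q) (snd q)))
        = (\<Oplus>c\<in>U. \<Oplus>i\<in>V. x c i \<otimes> Y c i (fst q) (snd q)) \<otimes> z (fst q) (snd q)"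
      using q fin by (simp add: finsum_ldistr Pi_I cl, intro finsum_eqI) (simp_all add: m_assoc cl)
    show "(\<Oplus>c\<in>U. \<Oplus>i\<in>V. x c i \<otimes> Y c i (fst q) (snd q)) \<otimes> z (fst q) (snd q) \<in> carrier R"
      using q x Y z by (auto intro!: finsum_closed)
  qed
  also have "\<dots> = (\<Oplus>d\<in>U. \<Oplus>j\<in>V. (\<Oplus>c\<in>U. \<Oplus>i\<in>V. x c i \<otimes> Y c i d j) \<otimes> z d j)"
    by (rule T[symmetric]) (use x Y z in \<open>auto intro!: finsum_closed\<close>)
  finally show ?thesis .
qed

context dyb
begin

text \<open>
  The degrees act by permutations of the base, so the Frobenius form is invariant under shifts.
\<close>

lemma frob_form_shift:
  assumes "a \<in> X" "f \<in> carrier M" "g \<in> carrier M"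
  shows "frob_form \<psi> (sh a f \<otimes>\<^sub>M g) = frob_form \<psi> (f \<otimes>\<^sub>M shi a g)"
proof -
  have "frob_form \<psi> (sh a h) = frob_form \<psi> h" for h
    unfolding frob_form_def shift_def using sum.reindex_bij_betw[OF deg_bij[OF assms(1)], of "\<lambda>l. \<psi> (h l)"]
    by simp
  from this[of "f \<otimes>\<^sub>M shi a g"] show ?thesis
    using assms by (simp add: shift_mult)
qed

end

text \<open>
  The identities satisfied by \<open>m a b f g = f\<^sup>-(s(f) t(g) L\<^sub>a\<^sub>b)\<close>: the axioms for \<open>f\<^sup>- \<star> f\<^sup>+\<close>,
  \<open>f\<^sup>+ \<star> f\<^sup>-\<close> and \<open>f\<^sup>- \<star> f\<^sup>+ \<star> f\<^sup>-\<close> with the comultiplication, counit, source and target maps written out.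
\<close>

locale quad_antipode = quad R \<psi> I r1 r2 X deg \<sigma> B S T el
  for R :: "('k::field, 'r) module" and \<psi> and I :: "'i set" and r1 r2
    and X :: "'x set" and deg :: "'x => 'l::finite => 'l" and \<sigma>
    and B :: "('k, 'b) module" (structure) and S T el +
  fixes m :: "'x => 'x => ('l => 'r) => ('l => 'r) => 'b"
  assumes m_closed [simp]: "[|a \<in> X; b \<in> X; f \<in> carrier M; g \<in> carrier M|] ==> m a b f g \<in> carrier B"
    and minus_plus: "[|a \<in> X; b \<in> X; g \<in> carrier M|] ==>
      (\<Oplus>c\<in>X. \<Oplus>i\<in>J. m a c \<one>\<^sub>M (f1 i) \<otimes> (S (f2 i) \<otimes> T g \<otimes> el c b))
      = (if a = b then T (shi a g) else \<zero>)"
    and plus_minus: "[|a \<in> X; b \<in> X; f \<in> carrier M; g \<in> carrier M|] ==>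
      (\<Oplus>c\<in>X. \<Oplus>i\<in>J. (S f \<otimes> T (f1 i) \<otimes> el a c) \<otimes> m c b (f2 i) g)
      = (if a = b then S (f \<otimes>\<^sub>M g) else \<zero>)"
    and minus_plus_minus: "[|a \<in> X; b \<in> X; g \<in> carrier M|] ==>
      (\<Oplus>i\<in>J. T (shi a (f1 i)) \<otimes> m a b (f2 i) g) = m a b \<one>\<^sub>M g"
begin

lemma delta_row:
  assumes "a \<in> X" "\<And>c i. [|c \<in> X; i \<in> J|] ==> h c i \<in> carrier B"
  shows "(\<Oplus>c\<in>X. \<Oplus>i\<in>J. if a = c then h c i else \<zero>) = (\<Oplus>i\<in>J. h a i)"
  unfolding B.finsum_cond using assms
  by (subst B.finsum_delta') (auto intro!: B.finsum_closed)

text \<open>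
  Expanding \<open>m\<close> by the last axiom and regrouping the resulting double sum moves \<open>S h\<close> from the
  left of \<open>m\<close> to its right.
\<close>

lemma S_m:
  assumes X: "a \<in> X" "b \<in> X" and h: "h \<in> carrier M" and g: "g \<in> carrier M"
  shows "S h \<otimes> m a b \<one>\<^sub>M g = (\<Oplus>i\<in>J. m a b \<one>\<^sub>M (f1 i) \<otimes> S (f2 i \<otimes>\<^sub>M (sh b h \<otimes>\<^sub>M g)))"
proof -
  have "S h \<otimes> m a b \<one>\<^sub>M g = (\<Oplus>j\<in>J. S h \<otimes> (T (shi a (f1 j)) \<otimes> m a b (f2 j) g))"
    unfolding minus_plus_minus[OF X g, symmetric] using X h g by (intro B.finsum_rdistr) auto
  also have "\<dots> = (\<Oplus>j\<in>J. T (shi a (f1 j)) \<otimes> (S h \<otimes> m a b (f2 j) g))"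
    using X h g by (intro B.finsum_eqI) (simp_all add: B.m_assoc[symmetric] TS)
  also have "\<dots> = (\<Oplus>d\<in>X. \<Oplus>j\<in>J. if a = d then T (shi a (f1 j)) \<otimes> (S h \<otimes> m d b (f2 j) g) else \<zero>)"
    by (rule delta_row[symmetric]) (use X h g in auto)
  also have "\<dots> = (\<Oplus>d\<in>X. \<Oplus>j\<in>J.
      (\<Oplus>c\<in>X. \<Oplus>i\<in>J. m a c \<one>\<^sub>M (f1 i) \<otimes> (S (f2 i) \<otimes> T (f1 j) \<otimes> el c d))
      \<otimes> (S h \<otimes> m d b (f2 j) g))"
    by (rule B.finsum_eqI, rule B.finsum_eqI)
      (use X h g in \<open>auto simp: minus_plus intro!: B.finsum_closed B.m_closed\<close>)
  also have "\<dots> = (\<Oplus>c\<in>X. \<Oplus>i\<in>J. m a c \<one>\<^sub>M (f1 i) \<otimes>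
      (\<Oplus>d\<in>X. \<Oplus>j\<in>J. (S (f2 i) \<otimes> T (f1 j) \<otimes> el c d) \<otimes> (S h \<otimes> m d b (f2 j) g)))"
    by (rule B.finsum_mult_assoc[symmetric]) (use X h g in auto)
  also have "\<dots> = (\<Oplus>c\<in>X. \<Oplus>i\<in>J.
      if b = c then m a c \<one>\<^sub>M (f1 i) \<otimes> S (f2 i \<otimes>\<^sub>M (sh b h \<otimes>\<^sub>M g)) else \<zero>)"
  proof (rule B.finsum_eqI, rule B.finsum_eqI)
    fix c i assume c: "c \<in> X" and i: "i \<in> J"
    have "(\<Oplus>d\<in>X. \<Oplus>j\<in>J. (S (f2 i) \<otimes> T (f1 j) \<otimes> el c d) \<otimes> (S h \<otimes> m d b (f2 j) g))
      = (\<Oplus>d\<in>X. \<Oplus>j\<in>J. (S (f2 i \<otimes>\<^sub>M sh c h) \<otimes> T (f1 j) \<otimes> el c d) \<otimes> m d b (f2 j) g)"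
    proof (rule B.finsum_eqI, rule B.finsum_eqI)
      fix d j assume d: "d \<in> X" and j: "j \<in> J"
      have "S (f2 i) \<otimes> T (f1 j) \<otimes> el c d \<otimes> (S h \<otimes> m d b (f2 j) g)
          = S (f2 i) \<otimes> (T (f1 j) \<otimes> (el c d \<otimes> S h)) \<otimes> m d b (f2 j) g"
        using c d i j h g X by (simp add: B.m_assoc)
      also have "\<dots> = S (f2 i) \<otimes> (T (f1 j) \<otimes> S (sh c h)) \<otimes> el c d \<otimes> m d b (f2 j) g"
        using c d i j h g X by (simp add: B.m_assoc el_S)
      also have "\<dots> = S (f2 i \<otimes>\<^sub>M sh c h) \<otimes> T (f1 j) \<otimes> el c d \<otimes> m d b (f2 j) g"
        using c d i j h g X by (simp add: TS S_mult B.m_assoc)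
      finally show "S (f2 i) \<otimes> T (f1 j) \<otimes> el c d \<otimes> (S h \<otimes> m d b (f2 j) g)
        = S (f2 i \<otimes>\<^sub>M sh c h) \<otimes> T (f1 j) \<otimes> el c d \<otimes> m d b (f2 j) g" .
    qed (use c i h g X in \<open>auto intro!: B.finsum_closed\<close>)
    also have "\<dots> = (if b = c then S (f2 i \<otimes>\<^sub>M (sh b h \<otimes>\<^sub>M g)) else \<zero>)"
      using c i h g X by (subst plus_minus) (auto simp: M.M.m_assoc)
    finally show "m a c \<one>\<^sub>M (f1 i) \<otimes>
      (\<Oplus>d\<in>X. \<Oplus>j\<in>J. (S (f2 i) \<otimes> T (f1 j) \<otimes> el c d) \<otimes> (S h \<otimes> m d b (f2 j) g))
      = (if b = c then m a c \<one>\<^sub>M (f1 i) \<otimes> S (f2 i \<otimes>\<^sub>M (sh b h \<otimes>\<^sub>M g)) else \<zero>)"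
      using c i h g X by auto
  qed (use X h g in \<open>auto intro!: B.finsum_closed\<close>)
  also have "\<dots> = (\<Oplus>i\<in>J. m a b \<one>\<^sub>M (f1 i) \<otimes> S (f2 i \<otimes>\<^sub>M (sh b h \<otimes>\<^sub>M g)))"
    by (rule delta_row) (use X h g in auto)
  finally show ?thesis .
qed

lemma m_expand:
  assumes X: "a \<in> X" "b \<in> X" and g: "g \<in> carrier M"
  shows "m a b \<one>\<^sub>M g = (\<Oplus>i\<in>J. m a b \<one>\<^sub>M (f1 i) \<otimes> S (f2 i \<otimes>\<^sub>M g))"
  using S_m[OF X M.M.one_closed g] X g by (simp add: S_one)

definition km where "km a b = m a b \<one>\<^sub>M \<one>\<^sub>M"

lemma km_closed [simp]: "[|a \<in> X; b \<in> X|] ==> km a b \<in> carrier B"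
  by (simp add: km_def)

lemma m_km:
  assumes X: "a \<in> X" "b \<in> X" and g: "g \<in> carrier M"
  shows "m a b \<one>\<^sub>M g = km a b \<otimes> S g"
proof -
  have "km a b \<otimes> S g = (\<Oplus>i\<in>J. m a b \<one>\<^sub>M (f1 i) \<otimes> S (f2 i \<otimes>\<^sub>M \<one>\<^sub>M)) \<otimes> S g"
    unfolding km_def by (simp only: m_expand[OF X M.M.one_closed, symmetric])
  also have "\<dots> = (\<Oplus>i\<in>J. m a b \<one>\<^sub>M (f1 i) \<otimes> S (f2 i \<otimes>\<^sub>M \<one>\<^sub>M) \<otimes> S g)"
    using X g by (intro B.finsum_ldistr) auto
  also have "\<dots> = m a b \<one>\<^sub>M g"
    unfolding m_expand[OF X g] using X g by (intro B.finsum_eqI) (auto simp: S_mult B.m_assoc)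
  finally show ?thesis ..
qed

lemma S_km:
  assumes X: "a \<in> X" "b \<in> X" and h: "h \<in> carrier M"
  shows "S h \<otimes> km a b = km a b \<otimes> S (sh b h)"
  using S_m[OF X h M.M.one_closed] m_expand[OF X, of "sh b h"] m_km[OF X, of "sh b h"] X h
  by (simp add: km_def)

text \<open>The same regrouping, with \<open>T h\<close> inserted on the other side.\<close>

lemma km_T:
  assumes X: "a \<in> X" "b \<in> X" and h: "h \<in> carrier M"
  shows "km a b \<otimes> T h = T (shi a h) \<otimes> km a b"
proof -
  let ?z = "\<lambda>d j. m d b (f2 j) \<one>\<^sub>M"
  have "km a b \<otimes> T h = (\<Oplus>i\<in>J. m a b \<one>\<^sub>M (f1 i) \<otimes> S (f2 i \<otimes>\<^sub>M \<one>\<^sub>M)) \<otimes> T h"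
    unfolding km_def by (simp only: m_expand[OF X M.M.one_closed, symmetric])
  also have "\<dots> = (\<Oplus>i\<in>J. m a b \<one>\<^sub>M (f1 i) \<otimes> S (f2 i \<otimes>\<^sub>M \<one>\<^sub>M) \<otimes> T h)"
    using X h by (intro B.finsum_ldistr) auto
  also have "\<dots> = (\<Oplus>i\<in>J. m a b \<one>\<^sub>M (f1 i) \<otimes> (T h \<otimes> S (f2 i \<otimes>\<^sub>M \<one>\<^sub>M)))"
    using X h by (intro B.finsum_eqI) (simp_all add: B.m_assoc TS)
  also have "\<dots> = (\<Oplus>c\<in>X. \<Oplus>i\<in>J.
      if b = c then m a c \<one>\<^sub>M (f1 i) \<otimes> (T h \<otimes> S (f2 i \<otimes>\<^sub>M \<one>\<^sub>M)) else \<zero>)"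
    by (rule delta_row[symmetric]) (use X h in auto)
  also have "\<dots> = (\<Oplus>c\<in>X. \<Oplus>i\<in>J. m a c \<one>\<^sub>M (f1 i) \<otimes>
      (\<Oplus>d\<in>X. \<Oplus>j\<in>J. (S (f2 i) \<otimes> T (f1 j \<otimes>\<^sub>M h) \<otimes> el c d) \<otimes> ?z d j))"
  proof (rule B.finsum_eqI, rule B.finsum_eqI)
    fix c i assume c: "c \<in> X" and i: "i \<in> J"
    have pm: "(\<Oplus>d\<in>X. \<Oplus>j\<in>J. (S (f2 i) \<otimes> T (f1 j) \<otimes> el c d) \<otimes> ?z d j)
        = (if c = b then S (f2 i \<otimes>\<^sub>M \<one>\<^sub>M) else \<zero>)"
      by (rule plus_minus) (use c i X in auto)
    have "(\<Oplus>d\<in>X. \<Oplus>j\<in>J. (S (f2 i) \<otimes> T (f1 j \<otimes>\<^sub>M h) \<otimes> el c d) \<otimes> ?z d j)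
      = (\<Oplus>d\<in>X. \<Oplus>j\<in>J. T h \<otimes> ((S (f2 i) \<otimes> T (f1 j) \<otimes> el c d) \<otimes> ?z d j))"
    proof (rule B.finsum_eqI, rule B.finsum_eqI)
      fix d j assume d: "d \<in> X" and j: "j \<in> J"
      have "S (f2 i) \<otimes> T (f1 j \<otimes>\<^sub>M h) = T h \<otimes> S (f2 i) \<otimes> T (f1 j)"
        using i j h by (simp add: TS T_mult B.m_assoc)
      then show "S (f2 i) \<otimes> T (f1 j \<otimes>\<^sub>M h) \<otimes> el c d \<otimes> ?z d j
        = T h \<otimes> ((S (f2 i) \<otimes> T (f1 j) \<otimes> el c d) \<otimes> ?z d j)"
        using c d i j h X by (simp add: B.m_assoc)
    qed (use c i h X in \<open>auto intro!: B.finsum_closed\<close>)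
    also have "\<dots> = T h \<otimes> (\<Oplus>d\<in>X. \<Oplus>j\<in>J. (S (f2 i) \<otimes> T (f1 j) \<otimes> el c d) \<otimes> ?z d j)"
      using c i h X by (subst B.finsum_rdistr)
        (auto intro!: B.finsum_eqI B.finsum_rdistr[symmetric] B.finsum_closed)
    finally show "(if b = c then m a c \<one>\<^sub>M (f1 i) \<otimes> (T h \<otimes> S (f2 i \<otimes>\<^sub>M \<one>\<^sub>M)) else \<zero>)
      = m a c \<one>\<^sub>M (f1 i) \<otimes>
      (\<Oplus>d\<in>X. \<Oplus>j\<in>J. (S (f2 i) \<otimes> T (f1 j \<otimes>\<^sub>M h) \<otimes> el c d) \<otimes> ?z d j)"
      unfolding pm using c i h X by auto
  qed (use X h in \<open>auto intro!: B.finsum_closed\<close>)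
  also have "\<dots> = (\<Oplus>d\<in>X. \<Oplus>j\<in>J.
      (\<Oplus>c\<in>X. \<Oplus>i\<in>J. m a c \<one>\<^sub>M (f1 i) \<otimes> (S (f2 i) \<otimes> T (f1 j \<otimes>\<^sub>M h) \<otimes> el c d)) \<otimes> ?z d j)"
    by (rule B.finsum_mult_assoc) (use X h in auto)
  also have "\<dots> = (\<Oplus>d\<in>X. \<Oplus>j\<in>J.
      if a = d then T (shi a h) \<otimes> (T (shi a (f1 j)) \<otimes> ?z d j) else \<zero>)"
  proof (rule B.finsum_eqI, rule B.finsum_eqI)
    fix d j assume d: "d \<in> X" and j: "j \<in> J"
    have "(\<Oplus>c\<in>X. \<Oplus>i\<in>J. m a c \<one>\<^sub>M (f1 i) \<otimes> (S (f2 i) \<otimes> T (f1 j \<otimes>\<^sub>M h) \<otimes> el c d))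
      = (if a = d then T (shi a (f1 j \<otimes>\<^sub>M h)) else \<zero>)"
      by (rule minus_plus) (use X d j h in auto)
    also have "\<dots> = (if a = d then T (shi a h) \<otimes> T (shi a (f1 j)) else \<zero>)"
      using X j h by (simp add: shift_mult T_mult)
    finally show "(\<Oplus>c\<in>X. \<Oplus>i\<in>J. m a c \<one>\<^sub>M (f1 i) \<otimes> (S (f2 i) \<otimes> T (f1 j \<otimes>\<^sub>M h) \<otimes> el c d)) \<otimes> ?z d j
      = (if a = d then T (shi a h) \<otimes> (T (shi a (f1 j)) \<otimes> ?z d j) else \<zero>)"
      using X d j h by (simp add: B.m_assoc)
  qed (use X h in \<open>auto intro!: B.finsum_closed\<close>)
  also have "\<dots> = (\<Oplus>j\<in>J. T (shi a h) \<otimes> (T (shi a (f1 j)) \<otimes> ?z a j))"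
    by (rule delta_row) (use X h in auto)
  also have "\<dots> = T (shi a h) \<otimes> (\<Oplus>j\<in>J. T (shi a (f1 j)) \<otimes> ?z a j)"
    using X h by (intro B.finsum_rdistr[symmetric]) auto
  also have "\<dots> = T (shi a h) \<otimes> km a b"
    using X by (simp add: minus_plus_minus km_def)
  finally show ?thesis .
qed

lemma T_km:
  assumes X: "a \<in> X" "b \<in> X" and h: "h \<in> carrier M"
  shows "T h \<otimes> km a b = km a b \<otimes> T (sh a h)"
  using km_T[OF X, of "sh a h"] X h by simp

lemma km_el:
  assumes X: "a \<in> X" "b \<in> X"
  shows "(\<Oplus>c\<in>X. km a c \<otimes> el c b) = (if a = b then \<one> else \<zero>)"
proof -
  have "(\<Oplus>i\<in>J. m a c \<one>\<^sub>M (f1 i) \<otimes> (S (f2 i) \<otimes> T \<one>\<^sub>M \<otimes> el c b)) = km a c \<otimes> el c b"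
    if c: "c \<in> X" for c
  proof -
    have "(\<Oplus>i\<in>J. m a c \<one>\<^sub>M (f1 i) \<otimes> (S (f2 i) \<otimes> T \<one>\<^sub>M \<otimes> el c b))
        = (\<Oplus>i\<in>J. km a c \<otimes> S (f1 i \<otimes>\<^sub>M f2 i) \<otimes> el c b)"
      using X c by (intro B.finsum_eqI) (simp_all add: m_km S_mult T_one B.m_assoc)
    also have "\<dots> = (\<Oplus>i\<in>J. km a c \<otimes> S (f1 i \<otimes>\<^sub>M f2 i)) \<otimes> el c b"
      using X c by (intro B.finsum_ldistr[symmetric]) auto
    also have "\<dots> = km a c \<otimes> (\<Oplus>i\<in>J. S (f1 i \<otimes>\<^sub>M f2 i)) \<otimes> el c b"
      using X c by (subst B.finsum_rdistr) auto
    also have "(\<Oplus>i\<in>J. S (f1 i \<otimes>\<^sub>M f2 i)) = \<one>"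
      using lin_map_finsum[OF M.M.ks B.ks S_lin, of J "\<lambda>i. f1 i \<otimes>\<^sub>M f2 i"]
      by (simp add: M.frob_idem S_one)
    finally show ?thesis using X c by simp
  qed
  then have "(\<Oplus>c\<in>X. km a c \<otimes> el c b) = (\<Oplus>c\<in>X. \<Oplus>i\<in>J.
      m a c \<one>\<^sub>M (f1 i) \<otimes> (S (f2 i) \<otimes> T \<one>\<^sub>M \<otimes> el c b))"
    using X by (intro B.finsum_eqI) auto
  also have "\<dots> = (if a = b then T (shi a \<one>\<^sub>M) else \<zero>)"
    by (rule minus_plus) (use X in auto)
  finally show ?thesis by (simp add: T_one)
qed

lemma el_km:
  assumes X: "a \<in> X" "b \<in> X"
  shows "(\<Oplus>c\<in>X. el a c \<otimes> km c b) = (if a = b then \<one> else \<zero>)"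
proof -
  have "el a c \<otimes> km c b = (\<Oplus>i\<in>J. (S \<one>\<^sub>M \<otimes> T (f1 i) \<otimes> el a c) \<otimes> m c b (f2 i) \<one>\<^sub>M)"
    if c: "c \<in> X" for c
  proof -
    have "el a c \<otimes> km c b = el a c \<otimes> (\<Oplus>i\<in>J. T (shi c (f1 i)) \<otimes> m c b (f2 i) \<one>\<^sub>M)"
      using X c by (simp add: minus_plus_minus km_def)
    also have "\<dots> = (\<Oplus>i\<in>J. el a c \<otimes> (T (shi c (f1 i)) \<otimes> m c b (f2 i) \<one>\<^sub>M))"
      using X c by (intro B.finsum_rdistr) auto
    also have "\<dots> = (\<Oplus>i\<in>J. (S \<one>\<^sub>M \<otimes> T (f1 i) \<otimes> el a c) \<otimes> m c b (f2 i) \<one>\<^sub>M)"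
      using X c by (intro B.finsum_eqI) (simp_all add: B.m_assoc[symmetric] el_T S_one)
    finally show ?thesis .
  qed
  then have "(\<Oplus>c\<in>X. el a c \<otimes> km c b) = (\<Oplus>c\<in>X. \<Oplus>i\<in>J.
      (S \<one>\<^sub>M \<otimes> T (f1 i) \<otimes> el a c) \<otimes> m c b (f2 i) \<one>\<^sub>M)"
    using X by (intro B.finsum_eqI) (auto intro!: B.finsum_closed)
  also have "\<dots> = (if a = b then S (\<one>\<^sub>M \<otimes>\<^sub>M \<one>\<^sub>M) else \<zero>)"
    by (rule plus_minus) (use X in auto)
  finally show ?thesis by (simp add: S_one)
qed

end

locale antipode_data = dyb R \<psi> I r1 r2 X deg \<sigma> + A: kalg A
  for R :: "('k::field, 'r) module" and \<psi> and I :: "'i set" and r1 r2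
    and X :: "'x set" and deg :: "'x => 'l::finite => 'l" and \<sigma>
    and A :: "('k, 'a) module" (structure) +
  fixes fp fm :: "('k, 'r, 'l, 'x) aw => 'a"
  assumes fp_hom: "fp \<in> alg_hom AW A"
    and antipode: "antipode_of AW cw (aw_counit R \<psi>) A fp fm"
begin

lemmas fp_lin = alg_hom_lin[OF fp_hom]
lemmas fp_mult = alg_hom_mult[OF fp_hom]
lemmas fp_closed [simp] = lin_map_closed[OF fp_lin]

lemma fm_lin: "fm \<in> lin_map AW A"
  using antipode by (simp add: antipode_of_def)

lemmas fm_closed [simp] = lin_map_closed[OF fm_lin]

definition "Sp = (\<lambda>f. fp (sw f))"
definition "Tp = (\<lambda>f. fp (tw f))"
definition "lp = (\<lambda>a b. fp (Lw a b))"
definition "stL f g a b = sw f \<otimes>\<^sub>AW tw g \<otimes>\<^sub>AW Lw a b"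
definition "mm a b f g = fm (stL f g a b)"

lemma stL_closed [simp]: "[|f \<in> carrier M; g \<in> carrier M; a \<in> X; b \<in> X|] ==> stL f g a b \<in> carrier AW"
  by (simp add: stL_def)

lemma fp_stL: "[|f \<in> carrier M; g \<in> carrier M; a \<in> X; b \<in> X|] ==>
    fp (stL f g a b) = Sp f \<otimes> Tp g \<otimes> lp a b"
  by (simp add: stL_def fp_mult Sp_def Tp_def lp_def)

sublocale Aq: quad R \<psi> I r1 r2 X deg \<sigma> A Sp Tp lp
proof
  show "Sp \<in> lin_map M A" unfolding Sp_def by (rule lin_map_comp[OF sw_lin fp_lin])
  show "Tp \<in> lin_map M A" unfolding Tp_def by (rule lin_map_comp[OF tw_lin fp_lin])
  show "Sp \<one>\<^sub>M = \<one>" "Tp \<one>\<^sub>M = \<one>"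
    by (simp_all add: Sp_def Tp_def Wq.S_one Wq.T_one alg_hom_one[OF fp_hom])
  fix f g assume fg: "f \<in> carrier M" "g \<in> carrier M"
  show "Sp (f \<otimes>\<^sub>M g) = Sp f \<otimes> Sp g" "Tp (f \<otimes>\<^sub>M g) = Tp g \<otimes> Tp f"
    "Tp g \<otimes> Sp f = Sp f \<otimes> Tp g"
    using fg by (simp_all add: Sp_def Tp_def Wq.S_mult Wq.T_mult fp_mult Wq.TS fp_mult[symmetric] del: fp_mult)
next
  fix a b f assume x: "a \<in> X" "b \<in> X" "f \<in> carrier M"
  show "lp a b \<otimes> Sp f = Sp (sh a f) \<otimes> lp a b" "lp a b \<otimes> Tp f = Tp (sh b f) \<otimes> lp a b"
    using x by (simp_all add: Sp_def Tp_def lp_def fp_mult[symmetric] Wq.el_S Wq.el_T)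
next
  fix a b assume "a \<in> X" "b \<in> X" then show "lp a b \<in> carrier A" by (simp add: lp_def)
next
  fix a b c d assume x: "a \<in> X" "b \<in> X" "c \<in> X" "d \<in> X"
  note lf = lin_map_finsum[OF W.ks A.ks fp_lin]
  have "fp (\<Oplus>\<^sub>AW y\<in>X. \<Oplus>\<^sub>AW x\<in>X. sw (\<sigma> x y a c) \<otimes>\<^sub>AW (Lw y d \<otimes>\<^sub>AW Lw x b))
    = (\<Oplus>y\<in>X. \<Oplus>x\<in>X. Sp (\<sigma> x y a c) \<otimes> (lp y d \<otimes> lp x b))"
    using x by (subst lf) (auto simp: lf Sp_def lp_def fp_mult intro!: A.finsum_eqI W.finsum_closed)
  moreover have "fp (\<Oplus>\<^sub>AW y\<in>X. \<Oplus>\<^sub>AW x\<in>X. tw (\<sigma> b d x y) \<otimes>\<^sub>AW (Lw c y \<otimes>\<^sub>AW Lw a x))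
    = (\<Oplus>y\<in>X. \<Oplus>x\<in>X. Tp (\<sigma> b d x y) \<otimes> (lp c y \<otimes> lp a x))"
    using x by (subst lf) (auto simp: lf Tp_def lp_def fp_mult intro!: A.finsum_eqI W.finsum_closed)
  ultimately show "(\<Oplus>y\<in>X. \<Oplus>x\<in>X. Sp (\<sigma> x y a c) \<otimes> (lp y d \<otimes> lp x b))
    = (\<Oplus>y\<in>X. \<Oplus>x\<in>X. Tp (\<sigma> b d x y) \<otimes> (lp c y \<otimes> lp a x))"
    using Wq.quadratic[OF x] by simp
qed

end

context dyb
begin

text \<open>
  Multiplication by \<open>EW = \<Delta>(1)\<close> inserts the Frobenius element of \<open>M\<close> between the tensor factors.
\<close>

lemma tlift_EW:
  assumes V: "kspace V" and \<beta>: "bilin AW AW V \<beta>"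
    and x: "\<And>c. c \<in> C ==> x c \<in> carrier AW" and y: "\<And>c. c \<in> C ==> y c \<in> carrier AW"
  shows "tlift V \<beta> (EW \<otimes>\<^sub>WW (\<Oplus>\<^sub>WW c\<in>C. tt (x c) (y c)))
    = (\<Oplus>\<^sub>V c\<in>C. \<Oplus>\<^sub>V j\<in>J. \<beta> (tw (f1 j) \<otimes>\<^sub>AW x c) (sw (f2 j) \<otimes>\<^sub>AW y c))"
proof -
  interpret V: kspace V by fact
  note b = bilin_closed[OF \<beta>]
  note l = Wq.Bb.AA.tlift_lin[OF V \<beta>]
  have "tlift V \<beta> (EW \<otimes>\<^sub>WW (\<Oplus>\<^sub>WW c\<in>C. tt (x c) (y c)))
      = (\<Oplus>\<^sub>V c\<in>C. tlift V \<beta> (EW \<otimes>\<^sub>WW tt (x c) (y c)))"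
    using x y by (intro lin_map_finsum[OF WW_kspace V
          lin_map_comp[OF Wq.Bb.AA.T.mult_left_lin l]]) auto
  also have "\<dots> = (\<Oplus>\<^sub>V c\<in>C. \<Oplus>\<^sub>V j\<in>J. \<beta> (tw (f1 j) \<otimes>\<^sub>AW x c) (sw (f2 j) \<otimes>\<^sub>AW y c))"
  proof (rule V.finsum_eqI)
    fix c assume c: "c \<in> C"
    show "tlift V \<beta> (EW \<otimes>\<^sub>WW tt (x c) (y c))
      = (\<Oplus>\<^sub>V j\<in>J. \<beta> (tw (f1 j) \<otimes>\<^sub>AW x c) (sw (f2 j) \<otimes>\<^sub>AW y c))"
      unfolding Wq.Bb.E_mult_pure[OF x[OF c] y[OF c]]
      by (rule Wq.Bb.AA.tlift_sum[OF V \<beta>]) (use x[OF c] y[OF c] in auto)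
    show "(\<Oplus>\<^sub>V j\<in>J. \<beta> (tw (f1 j) \<otimes>\<^sub>AW x c) (sw (f2 j) \<otimes>\<^sub>AW y c)) \<in> carrier V"
      using x[OF c] y[OF c] by (intro V.finsum_closed) (auto intro!: b)
  qed
  finally show ?thesis .
qed

lemma cw_one: "cw \<one>\<^sub>AW = EW"
  using cw_st[of "\<one>\<^sub>M" "\<one>\<^sub>M"] Wq.Bb.AA.T.r_one[of EW]
  by (simp add: Wq.S_one Wq.T_one Wq.Bb.AA.tens_one)

lemma counit_lin: "aw_counit R \<psi> \<in> lin_map AW scalars"
  unfolding aw_counit_def wb_counit_def by (rule lin_map_comp[OF pw_lin M.\<psi>_lin])

end

context antipode_data
begin

lemma prod_bilin:
  assumes "Fa \<in> lin_map AW A" "Fb \<in> lin_map AW A"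
  shows "bilin AW AW A (\<lambda>x y. Fa x \<otimes> Fb y)"
  by (intro bilinI lin_map_comp[OF assms(1) A.mult_right_lin] lin_map_comp[OF assms(2) A.mult_left_lin]
      lin_map_closed[OF assms(1)] lin_map_closed[OF assms(2)])

lemma conv_lin:
  assumes "Fa \<in> lin_map AW A" "Fb \<in> lin_map AW A" shows "conv cw A Fa Fb \<in> lin_map AW A"
  unfolding conv_def
  by (rule lin_map_comp[OF cw_lin Wq.Bb.AA.tlift_lin[OF A.ks prod_bilin[OF assms]]])

lemma conv_stL:
  assumes FG: "Fa \<in> lin_map AW A" "Fb \<in> lin_map AW A" and f: "f \<in> carrier M" "g \<in> carrier M"
    and X: "a \<in> X" "b \<in> X"
  shows "conv cw A Fa Fb (stL f g a b)
    = (\<Oplus>c\<in>X. \<Oplus>j\<in>J. Fa (stL f (f1 j) a c) \<otimes> Fb (stL (f2 j) g c b))"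
proof -
  have "conv cw A Fa Fb (stL f g a b) = (\<Oplus>c\<in>X. \<Oplus>j\<in>J.
      Fa (tw (f1 j) \<otimes>\<^sub>AW (sw f \<otimes>\<^sub>AW Lw a c)) \<otimes> Fb (sw (f2 j) \<otimes>\<^sub>AW (tw g \<otimes>\<^sub>AW Lw c b)))"
    unfolding conv_def stL_def cw_stL[OF f X]
    by (rule tlift_EW[OF A.ks prod_bilin[OF FG]]) (use f X in auto)
  also have "\<dots> = (\<Oplus>c\<in>X. \<Oplus>j\<in>J. Fa (stL f (f1 j) a c) \<otimes> Fb (stL (f2 j) g c b))"
  proof (rule A.finsum_eqI, rule A.finsum_eqI)
    fix c j assume c: "c \<in> X" and j: "j \<in> J"
    have "tw (f1 j) \<otimes>\<^sub>AW (sw f \<otimes>\<^sub>AW Lw a c) = stL f (f1 j) a c"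
      "sw (f2 j) \<otimes>\<^sub>AW (tw g \<otimes>\<^sub>AW Lw c b) = stL (f2 j) g c b"
      using c j f X by (simp_all add: stL_def W.m_assoc[symmetric] Wq.TS)
    then show "Fa (tw (f1 j) \<otimes>\<^sub>AW (sw f \<otimes>\<^sub>AW Lw a c)) \<otimes> Fb (sw (f2 j) \<otimes>\<^sub>AW (tw g \<otimes>\<^sub>AW Lw c b))
      = Fa (stL f (f1 j) a c) \<otimes> Fb (stL (f2 j) g c b)" by simp
  qed (use f X in \<open>auto intro!: A.finsum_closed lin_map_closed[OF FG(1)] lin_map_closed[OF FG(2)]\<close>)
  finally show ?thesis .
qed

lemma counit_stL:
  "[|f \<in> carrier M; g \<in> carrier M; a \<in> X; b \<in> X|] ==>
   aw_counit R \<psi> (stL f g a b) = (if a = b then frob_form \<psi> (f \<otimes>\<^sub>M g) else 0)"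
  using lin_map_zero[OF M.M.ks kspace_scalars M.\<psi>_lin]
  by (simp add: aw_counit_def wb_counit_def stL_def pw_stL)

lemma eps_eq:
  assumes h: "h \<in> carrier AW"
  shows "eps_s AW cw (aw_counit R \<psi>) h
      = (\<Oplus>\<^sub>AW j\<in>J. aw_counit R \<psi> (h \<otimes>\<^sub>AW sw (f2 j)) \<odot>\<^sub>AW tw (f1 j))"
    and "eps_t AW cw (aw_counit R \<psi>) h
      = (\<Oplus>\<^sub>AW j\<in>J. aw_counit R \<psi> (tw (f1 j) \<otimes>\<^sub>AW h) \<odot>\<^sub>AW sw (f2 j))"
proof -
  have sl: "(\<lambda>c. c \<odot>\<^sub>AW x) \<in> lin_map scalars AW" if "x \<in> carrier AW" for x
    by (rule lin_mapI) (use that in \<open>auto simp: W.smult_add_left W.smult_smult\<close>)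
  have 1: "bilin AW AW AW (\<lambda>x y. aw_counit R \<psi> (h \<otimes>\<^sub>AW y) \<odot>\<^sub>AW x)"
    by (intro bilinI W.smult_lin lin_map_comp[OF lin_map_comp[OF W.mult_left_lin counit_lin] sl] h)
  have 2: "bilin AW AW AW (\<lambda>x y. aw_counit R \<psi> (x \<otimes>\<^sub>AW h) \<odot>\<^sub>AW y)"
    by (intro bilinI W.smult_lin lin_map_comp[OF lin_map_comp[OF W.mult_right_lin counit_lin] sl] h)
  show "eps_s AW cw (aw_counit R \<psi>) h
      = (\<Oplus>\<^sub>AW j\<in>J. aw_counit R \<psi> (h \<otimes>\<^sub>AW sw (f2 j)) \<odot>\<^sub>AW tw (f1 j))"
    unfolding eps_s_def cw_one Wq.Bb.E_def by (rule Wq.Bb.AA.tlift_sum[OF W.ks 1]) auto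
  show "eps_t AW cw (aw_counit R \<psi>) h
      = (\<Oplus>\<^sub>AW j\<in>J. aw_counit R \<psi> (tw (f1 j) \<otimes>\<^sub>AW h) \<odot>\<^sub>AW sw (f2 j))"
    unfolding eps_t_def cw_one Wq.Bb.E_def by (rule Wq.Bb.AA.tlift_sum[OF W.ks 2]) auto
qed

text \<open>
  The Frobenius property contracts the sum over the dual bases. In \<open>eps_s\<close> the second factor has to
  pass \<open>L\<close> first, which produces the inverse shift.
\<close>

lemma eps_s_stL:
  assumes X: "a \<in> X" "b \<in> X" and g: "g \<in> carrier M"
  shows "eps_s AW cw (aw_counit R \<psi>) (stL \<one>\<^sub>M g a b) = (if a = b then tw (shi a g) else \<zero>\<^sub>AW)"
proof -
  have "aw_counit R \<psi> (stL \<one>\<^sub>M g a b \<otimes>\<^sub>AW sw (f2 j))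
      = (if a = b then frob_form \<psi> (f2 j \<otimes>\<^sub>M shi a g) else 0)" if j: "j \<in> J" for j
  proof -
    have "stL \<one>\<^sub>M g a b \<otimes>\<^sub>AW sw (f2 j) = tw g \<otimes>\<^sub>AW sw (sh a (f2 j)) \<otimes>\<^sub>AW Lw a b"
      using X g j by (simp add: stL_def Wq.S_one W.m_assoc Wq.el_S)
    also have "\<dots> = stL (sh a (f2 j)) g a b" using X g j by (simp add: stL_def Wq.TS)
    finally show ?thesis using X g j by (simp add: counit_stL frob_form_shift)
  qed
  then have "eps_s AW cw (aw_counit R \<psi>) (stL \<one>\<^sub>M g a b)
      = (\<Oplus>\<^sub>AW j\<in>J. (if a = b then frob_form \<psi> (f2 j \<otimes>\<^sub>M shi a g) else 0) \<odot>\<^sub>AW tw (f1 j))"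
    using X g by (subst eps_eq) (auto intro!: W.finsum_eqI)
  also have "\<dots> = (if a = b then tw (\<Oplus>\<^sub>M j\<in>J. frob_form \<psi> (f2 j \<otimes>\<^sub>M shi a g) \<odot>\<^sub>M f1 j) else \<zero>\<^sub>AW)"
    by (auto simp: lin_map_finsum[OF M.M.ks W.ks tw_lin]
        lin_map_smult[OF tw_lin] intro!: W.finsum_eqI W.add.finprod_one_eqI)
  finally show ?thesis using g by (simp add: M.frob_right)
qed

lemma eps_t_stL:
  assumes X: "a \<in> X" "b \<in> X" and f: "f \<in> carrier M" and g: "g \<in> carrier M"
  shows "eps_t AW cw (aw_counit R \<psi>) (stL f g a b) = (if a = b then sw (f \<otimes>\<^sub>M g) else \<zero>\<^sub>AW)"
proof -
  have "aw_counit R \<psi> (tw (f1 j) \<otimes>\<^sub>AW stL f g a b)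
      = (if a = b then frob_form \<psi> (f \<otimes>\<^sub>M g \<otimes>\<^sub>M f1 j) else 0)" if j: "j \<in> J" for j
  proof -
    have "tw (f1 j) \<otimes>\<^sub>AW stL f g a b = (tw (f1 j) \<otimes>\<^sub>AW sw f) \<otimes>\<^sub>AW tw g \<otimes>\<^sub>AW Lw a b"
      using X f g j by (simp add: stL_def W.m_assoc)
    also have "\<dots> = stL f (g \<otimes>\<^sub>M f1 j) a b"
      using X f g j by (simp add: stL_def Wq.TS Wq.T_mult W.m_assoc)
    finally show ?thesis using X f g j by (simp add: counit_stL M.M.m_assoc)
  qed
  then have "eps_t AW cw (aw_counit R \<psi>) (stL f g a b)
      = (\<Oplus>\<^sub>AW j\<in>J. (if a = b then frob_form \<psi> (f \<otimes>\<^sub>M g \<otimes>\<^sub>M f1 j) else 0) \<odot>\<^sub>AW sw (f2 j))"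
    using X f g by (subst eps_eq) (auto intro!: W.finsum_eqI)
  also have "\<dots> = (if a = b then sw (\<Oplus>\<^sub>M j\<in>J. frob_form \<psi> (f \<otimes>\<^sub>M g \<otimes>\<^sub>M f1 j) \<odot>\<^sub>M f2 j) else \<zero>\<^sub>AW)"
    by (auto simp: lin_map_finsum[OF M.M.ks W.ks sw_lin]
        lin_map_smult[OF sw_lin] intro!: W.finsum_eqI W.add.finprod_one_eqI)
  finally show ?thesis using f g by (simp add: M.frob_left)
qed

lemma antipode_eqs:
  assumes "h \<in> carrier AW"
  shows "conv cw A fm fp h = fp (eps_s AW cw (aw_counit R \<psi>) h)"
    and "conv cw A fp fm h = fp (eps_t AW cw (aw_counit R \<psi>) h)"
    and "conv cw A (conv cw A fm fp) fm h = fm h"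
  using antipode assms by (auto simp: antipode_of_def)

sublocale Ak: quad_antipode R \<psi> I r1 r2 X deg \<sigma> A Sp Tp lp mm
proof
  note fz = lin_map_zero[OF W.ks A.ks fp_lin]
  have mp: "conv cw A fm fp (stL \<one>\<^sub>M g a b) = (if a = b then Tp (shi a g) else \<zero>)"
    if "a \<in> X" "b \<in> X" "g \<in> carrier M" for a b g
    using that by (simp add: antipode_eqs eps_s_stL fz Tp_def)
  fix a b assume X: "a \<in> X" "b \<in> X"
  fix g assume g: "g \<in> carrier M"
  show "(\<Oplus>c\<in>X. \<Oplus>i\<in>J. mm a c \<one>\<^sub>M (f1 i) \<otimes> (Sp (f2 i) \<otimes> Tp g \<otimes> lp c b))
      = (if a = b then Tp (shi a g) else \<zero>)"
    unfolding mp[OF X g, symmetric] conv_stL[OF fm_lin fp_lin M.M.one_closed g X]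
    by (rule A.finsum_eqI, rule A.finsum_eqI)
      (use X g in \<open>auto simp: fp_stL mm_def intro!: A.finsum_closed\<close>)
  show "(\<Oplus>i\<in>J. Tp (shi a (f1 i)) \<otimes> mm a b (f2 i) g) = mm a b \<one>\<^sub>M g"
  proof -
    have "mm a b \<one>\<^sub>M g = conv cw A (conv cw A fm fp) fm (stL \<one>\<^sub>M g a b)"
      using X g by (simp add: mm_def antipode_eqs)
    also have "\<dots> = (\<Oplus>c\<in>X. \<Oplus>j\<in>J. conv cw A fm fp (stL \<one>\<^sub>M (f1 j) a c) \<otimes> fm (stL (f2 j) g c b))"
      by (rule conv_stL[OF conv_lin[OF fm_lin fp_lin] fm_lin M.M.one_closed g X])
    also have "\<dots> = (\<Oplus>c\<in>X. \<Oplus>j\<in>J. if a = c then Tp (shi a (f1 j)) \<otimes> mm c b (f2 j) g else \<zero>)"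
      by (rule A.finsum_eqI, rule A.finsum_eqI)
        (use X g in \<open>auto simp: mp mm_def intro!: A.finsum_closed\<close>)
    also have "\<dots> = (\<Oplus>i\<in>J. Tp (shi a (f1 i)) \<otimes> mm a b (f2 i) g)"
      unfolding A.finsum_cond using X g
      by (subst A.finsum_delta') (auto simp: mm_def intro!: A.finsum_closed)
    finally show ?thesis ..
  qed
next
  note fz = lin_map_zero[OF W.ks A.ks fp_lin]
  fix a b f g assume X: "a \<in> X" "b \<in> X" and f: "f \<in> carrier M" and g: "g \<in> carrier M"
  show "mm a b f g \<in> carrier A" using X f g by (simp add: mm_def)
  have pm: "conv cw A fp fm (stL f g a b) = (if a = b then Sp (f \<otimes>\<^sub>M g) else \<zero>)"
    using X f g by (simp add: antipode_eqs eps_t_stL fz Sp_def)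
  show "(\<Oplus>c\<in>X. \<Oplus>i\<in>J. (Sp f \<otimes> Tp (f1 i) \<otimes> lp a c) \<otimes> mm c b (f2 i) g)
      = (if a = b then Sp (f \<otimes>\<^sub>M g) else \<zero>)"
    unfolding pm[symmetric] conv_stL[OF fp_lin fm_lin f g X]
    by (rule A.finsum_eqI, rule A.finsum_eqI)
      (use X f g in \<open>auto simp: fp_stL mm_def intro!: A.finsum_closed\<close>)
qed

end

section \<open>The algebra with generators and relations\<close>

locale quad_inv = quad R \<psi> I r1 r2 X deg \<sigma> B S T el
  for R :: "('k::field, 'r) module" and \<psi> and I :: "'i set" and r1 r2
    and X :: "'x set" and deg :: "'x => 'l::finite => 'l" and \<sigma>
    and B :: "('k, 'b) module" (structure) and S T el +
  fixes N :: "'x => 'x => 'b"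
  assumes N_closed [simp]: "[|a \<in> X; b \<in> X|] ==> N a b \<in> carrier B"
    and el_N: "[|a \<in> X; b \<in> X|] ==> (\<Oplus>c\<in>X. el a c \<otimes> N c b) = (if a = b then \<one> else \<zero>)"
    and N_el: "[|a \<in> X; b \<in> X|] ==> (\<Oplus>c\<in>X. N a c \<otimes> el c b) = (if a = b then \<one> else \<zero>)"
    and S_N: "[|a \<in> X; b \<in> X; f \<in> carrier M|] ==> S f \<otimes> N a b = N a b \<otimes> S (sh b f)"
    and T_N: "[|a \<in> X; b \<in> X; f \<in> carrier M|] ==> T f \<otimes> N a b = N a b \<otimes> T (sh a f)"

sublocale antipode_data \<subseteq> Ai: quad_inv R \<psi> I r1 r2 X deg \<sigma> A Sp Tp lp Ak.km
  by unfold_locales (simp_all add: Ak.km_el Ak.el_km Ak.S_km Ak.T_km)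

lemma ball_Collects:
  "(\<forall>r\<in>{t u |u. P1 u}. Q r) \<longleftrightarrow> (\<forall>u. P1 u --> Q (t u))"
  "(\<forall>r\<in>{t2 u v |u v. P2 u v}. Q r) \<longleftrightarrow> (\<forall>u v. P2 u v --> Q (t2 u v))"
  "(\<forall>r\<in>{t3 u v w |u v w. P3 u v w}. Q r) \<longleftrightarrow> (\<forall>u v w. P3 u v w --> Q (t3 u v w))"
  "(\<forall>r\<in>{t4 u v w x |u v w x. P4 u v w x}. Q r) \<longleftrightarrow> (\<forall>u v w x. P4 u v w x --> Q (t4 u v w x))"
  by blast+

context dyb
begin

abbreviation U :: "('k, ('k, 'r, 'l) base_env) module" where "U \<equiv> base_env R"
abbreviation LS :: "('k, 'r, 'l, 'x) lett set" where "LS \<equiv> letters R X"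
abbreviation FA :: "('k, ('k, 'r, 'l, 'x) lett list \<Rightarrow>\<^sub>0 'k) module" where "FA \<equiv> free_alg LS"
abbreviation AS :: "('k, ('k, 'r, 'l, 'x) asig) module" where "AS \<equiv> Asig R X deg \<sigma>"
abbreviation Pa where "Pa x \<equiv> asig_ideal R X deg \<sigma> +>\<^sub>FA x"
abbreviation aw where "aw \<equiv> aword R X deg \<sigma>"

sublocale Mop: kalg "opp M" by (rule kalg_opp[OF M.M.kalg_axioms])
sublocale MO: two_kalgs M "opp M" by unfold_locales
sublocale U: kalg U unfolding base_env_def by unfold_locales
sublocale FA: kalg FA by (rule kalg_free_alg)

lemma bt_closed [simp]: "[|f \<in> carrier M; g \<in> carrier M|] ==> bt R f g \<in> carrier U"
  unfolding bt_def base_env_def by (rule MO.tens_closed) simp_all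

lemma bt_mult: "[|f \<in> carrier M; g \<in> carrier M; f' \<in> carrier M; g' \<in> carrier M|] ==>
    bt R f g \<otimes>\<^sub>U bt R f' g' = bt R (f \<otimes>\<^sub>M f') (g' \<otimes>\<^sub>M g)"
  unfolding bt_def base_env_def by (subst MO.tens_mult) simp_all

lemma bt_one: "bt R \<one>\<^sub>M \<one>\<^sub>M = \<one>\<^sub>U"
  unfolding bt_def base_env_def MO.tens_one by simp

lemma bt_bilin: "bilin M M U (bt R)"
  using MO.tens_bilin unfolding bt_def base_env_def bilin_def lin_map_opp by simp

lemma LS_simps [simp]:
  "Scal u \<in> LS \<longleftrightarrow> u \<in> carrier U" "L a b \<in> LS \<longleftrightarrow> a \<in> X \<and> b \<in> X" "Linv a b \<in> LS \<longleftrightarrow> a \<in> X \<and> b \<in> X"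
  by (auto simp: letters_def)

lemma \<sigma>_M [simp]: "[|a \<in> X; b \<in> X; c \<in> X; d \<in> X|] ==> \<sigma> a b c d \<in> carrier M"
  by (simp add: fun_alg_simps)

text \<open>
  The values \<open>\<phi>\<close> of the letters satisfy the defining relations of \<open>A\<^sub>\<sigma>\<close>.
\<close>

definition asig_rep :: "('k, 'b) module => (('k, 'r, 'l, 'x) lett => 'b) => bool" where
  "asig_rep B \<phi> \<longleftrightarrow>
     (\<lambda>u. \<phi> (Scal u)) \<in> alg_hom U B \<and>
     (\<forall>a\<in>X. \<forall>b\<in>X. \<phi> (L a b) \<in> carrier B \<and> \<phi> (Linv a b) \<in> carrier B \<and>
       (\<Oplus>\<^sub>B c\<in>X. \<phi> (L a c) \<otimes>\<^sub>B \<phi> (Linv c b)) = (if a = b then \<one>\<^sub>B else \<zero>\<^sub>B) \<and>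
       (\<Oplus>\<^sub>B c\<in>X. \<phi> (Linv a c) \<otimes>\<^sub>B \<phi> (L c b)) = (if a = b then \<one>\<^sub>B else \<zero>\<^sub>B) \<and>
       (\<forall>f\<in>carrier M.
         \<phi> (Scal (bt R (sh a f) \<one>\<^sub>M)) \<otimes>\<^sub>B \<phi> (L a b) = \<phi> (L a b) \<otimes>\<^sub>B \<phi> (Scal (bt R f \<one>\<^sub>M)) \<and>
         \<phi> (Scal (bt R \<one>\<^sub>M (sh b f))) \<otimes>\<^sub>B \<phi> (L a b) = \<phi> (L a b) \<otimes>\<^sub>B \<phi> (Scal (bt R \<one>\<^sub>M f)) \<and>
         \<phi> (Scal (bt R f \<one>\<^sub>M)) \<otimes>\<^sub>B \<phi> (Linv a b) = \<phi> (Linv a b) \<otimes>\<^sub>B \<phi> (Scal (bt R (sh b f) \<one>\<^sub>M)) \<and>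
         \<phi> (Scal (bt R \<one>\<^sub>M f)) \<otimes>\<^sub>B \<phi> (Linv a b) = \<phi> (Linv a b) \<otimes>\<^sub>B \<phi> (Scal (bt R \<one>\<^sub>M (sh a f))))) \<and>
     (\<forall>a\<in>X. \<forall>b\<in>X. \<forall>c\<in>X. \<forall>d\<in>X.
       (\<Oplus>\<^sub>B x\<in>X. \<Oplus>\<^sub>B y\<in>X. \<phi> (Scal (bt R (\<sigma> x y a c) \<one>\<^sub>M)) \<otimes>\<^sub>B (\<phi> (L y d) \<otimes>\<^sub>B \<phi> (L x b)))
       = (\<Oplus>\<^sub>B x\<in>X. \<Oplus>\<^sub>B y\<in>X. \<phi> (Scal (bt R \<one>\<^sub>M (\<sigma> b d x y))) \<otimes>\<^sub>B (\<phi> (L c y) \<otimes>\<^sub>B \<phi> (L a x))))"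

text \<open>
  Read from left to right this yields the relations that hold in the quotient, read from right to left
  it defines homomorphisms on the quotient.
\<close>

lemma asig_rep_iff:
  assumes B: "kalg B" and h: "h \<in> alg_hom FA B"
  shows "(\<forall>r\<in>asig_rels R X deg \<sigma>. h r = \<zero>\<^sub>B) \<longleftrightarrow> asig_rep B (\<lambda>z. h (word [z]))"
proof -
  interpret B: kalg B by fact
  note hl = alg_hom_lin[OF h]
  let ?K = "\<lambda>x :: ('k, 'r, 'l, 'x) lett list \<Rightarrow>\<^sub>0 'k. keys x \<subseteq> lists LS"
  have K: "?K (x + y)" "?K (x - y)" if "?K x" "?K y" for x y :: "('k, 'r, 'l, 'x) lett list \<Rightarrow>\<^sub>0 'k"
    using that by (rule keys_add_subset keys_diff_subset)+
  have c1: "h x \<in> carrier B" if "?K x" for x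
    using lin_map_closed[OF hl] that by simp
  have wd: "?K (word w)" if "w \<in> lists LS" for w using that by simp
  have c2 [simp]: "h (word [z]) \<in> carrier B" if "z \<in> LS" for z using that by (intro c1) simp
  have hadd: "h (x + y) = h x \<oplus>\<^sub>B h y" if "?K x" "?K y" for x y
    using lin_map_add[OF hl] that by simp
  have hsc: "h (pm_scale c x) = c \<odot>\<^sub>B h x" if "?K x" for c x
    using lin_map_smult[OF hl] that by simp
  have hd: "h (x - y) = \<zero>\<^sub>B \<longleftrightarrow> h x = h y" if "?K x" "?K y" for x y
  proof -
    have "h x = h (x - y) \<oplus>\<^sub>B h y" using hadd[OF K(2)[OF that] that(2)] by simp
    then show ?thesis using c1[OF K(2)[OF that]] c1[OF that(1)] c1[OF that(2)] by auto
  qed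
  have hsum: "h (\<Sum>c\<in>X. x c) = (\<Oplus>\<^sub>B c\<in>X. h (x c))" if "\<And>c. c \<in> X ==> ?K (x c)" for x
    using hl that unfolding free_alg_pm by (intro pm_lin_sum[OF B.ks]) auto
  have Ksum: "?K (\<Sum>c\<in>X. x c)" if "\<And>c. c \<in> X ==> ?K (x c)" for x :: "'x => ('k, 'r, 'l, 'x) lett list \<Rightarrow>\<^sub>0 'k"
    by (rule keys_sum_subset) (rule that)
  have hw: "h (word (z # w)) = h (word [z]) \<otimes>\<^sub>B h (word w)" if "z \<in> LS" "w \<in> lists LS" for z w
    using alg_hom_mult[OF h, of "word [z]" "word w"] that by simp
  have h0: "h (word []) = \<one>\<^sub>B" using alg_hom_one[OF h] by simp
  have w2: "h (word [z, z']) = h (word [z]) \<otimes>\<^sub>B h (word [z'])" if "z \<in> LS" "z' \<in> LS" for z z'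
    using hw[of z "[z']"] that by simp
  have w3: "h (word [z, z', z'']) = h (word [z]) \<otimes>\<^sub>B (h (word [z']) \<otimes>\<^sub>B h (word [z'']))"
    if "z \<in> LS" "z' \<in> LS" "z'' \<in> LS" for z z' z''
    using hw[of z "[z', z'']"] w2[of z' z''] that by simp
  have hif: "h (if p then word [] else 0) = (if p then \<one>\<^sub>B else \<zero>\<^sub>B)" for p
    using h0 lin_map_zero[OF FA.ks B.ks hl] by simp
  have Kif: "?K (if p then word [] else 0 :: ('k, 'r, 'l, 'x) lett list \<Rightarrow>\<^sub>0 'k)" for p by simp
  let ?f = "\<lambda>z. h (word [z])"
  have U1: "bt R f \<one>\<^sub>M \<in> carrier U" "bt R \<one>\<^sub>M f \<in> carrier U" if "f \<in> carrier M" for f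
    using that by simp_all
  have hom: "(\<lambda>u. ?f (Scal u)) \<in> alg_hom U B \<longleftrightarrow>
    (\<forall>u v. u \<in> carrier U \<and> v \<in> carrier U --> ?f (Scal u) \<oplus>\<^sub>B ?f (Scal v) = ?f (Scal (u \<oplus>\<^sub>U v))) \<and>
    (\<forall>c u. u \<in> carrier U --> c \<odot>\<^sub>B ?f (Scal u) = ?f (Scal (c \<odot>\<^sub>U u))) \<and>
    (\<forall>u v. u \<in> carrier U \<and> v \<in> carrier U --> ?f (Scal u) \<otimes>\<^sub>B ?f (Scal v) = ?f (Scal (u \<otimes>\<^sub>U v))) \<and>
    \<one>\<^sub>B = ?f (Scal (bt R \<one>\<^sub>M \<one>\<^sub>M))" (is "?l \<longleftrightarrow> ?r")
  proof
    assume l: ?l then show ?r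
      by (simp add: alg_hom_mult[OF l] alg_hom_one[OF l] bt_one
          lin_map_add[OF alg_hom_lin[OF l]] lin_map_smult[OF alg_hom_lin[OF l]])
  next
    assume ?r then show ?l
      by (intro alg_homI lin_mapI) (simp_all add: bt_one)
  qed
  have e1: "h (word [Scal u] + word [Scal v] - word [Scal (u \<oplus>\<^sub>U v)]) = \<zero>\<^sub>B
      \<longleftrightarrow> ?f (Scal u) \<oplus>\<^sub>B ?f (Scal v) = ?f (Scal (u \<oplus>\<^sub>U v))"
    if "u \<in> carrier U" "v \<in> carrier U" for u v
    using that hd[OF K(1)[OF wd[of "[Scal u]"] wd[of "[Scal v]"]] wd[of "[Scal (u \<oplus>\<^sub>U v)]"]]
      hadd[OF wd[of "[Scal u]"] wd[of "[Scal v]"]] by simp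
  have e2: "h (pm_scale c (word [Scal u]) - word [Scal (c \<odot>\<^sub>U u)]) = \<zero>\<^sub>B
      \<longleftrightarrow> c \<odot>\<^sub>B ?f (Scal u) = ?f (Scal (c \<odot>\<^sub>U u))" if "u \<in> carrier U" for c u
    using that hd[OF subset_trans[OF keys_pm_scale wd[of "[Scal u]"]] wd[of "[Scal (c \<odot>\<^sub>U u)]"]]
      hsc[OF wd[of "[Scal u]"]] by simp
  have e3: "h (word [u, v] - word [z]) = \<zero>\<^sub>B \<longleftrightarrow> ?f u \<otimes>\<^sub>B ?f v = ?f z"
    if "u \<in> LS" "v \<in> LS" "z \<in> LS" for u v z
    using that hd[OF wd[of "[u, v]"] wd[of "[z]"]] by (simp add: w2)
  have e4: "h (word [u, v] - word [u', v']) = \<zero>\<^sub>B \<longleftrightarrow> ?f u \<otimes>\<^sub>B ?f v = ?f u' \<otimes>\<^sub>B ?f v'"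
    if "u \<in> LS" "v \<in> LS" "u' \<in> LS" "v' \<in> LS" for u v u' v'
    using that hd[OF wd[of "[u, v]"] wd[of "[u', v']"]] by (simp add: w2)
  have e5: "h ((\<Sum>c\<in>X. word [u c, v c]) - (if p then word [] else 0)) = \<zero>\<^sub>B
      \<longleftrightarrow> (\<Oplus>\<^sub>B c\<in>X. ?f (u c) \<otimes>\<^sub>B ?f (v c)) = (if p then \<one>\<^sub>B else \<zero>\<^sub>B)"
    if "\<And>c. c \<in> X ==> u c \<in> LS" "\<And>c. c \<in> X ==> v c \<in> LS" for u v p
  proof -
    have wc: "?K (word [u c, v c])" if "c \<in> X" for c using that \<open>\<And>c. c \<in> X ==> u c \<in> LS\<close>
      \<open>\<And>c. c \<in> X ==> v c \<in> LS\<close> by (intro wd) simp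
    have "h (\<Sum>c\<in>X. word [u c, v c]) = (\<Oplus>\<^sub>B c\<in>X. ?f (u c) \<otimes>\<^sub>B ?f (v c))"
      using that by (subst hsum[OF wc]) (auto simp: w2 intro!: B.finsum_eqI)
    then show ?thesis by (simp only: hd[OF Ksum[OF wc] Kif] hif)
  qed
  have e6: "h ((\<Sum>x\<in>X. \<Sum>y\<in>X. word [u x y, v x y, w x y]) - (\<Sum>x\<in>X. \<Sum>y\<in>X. word [u' x y, v' x y, w' x y])) = \<zero>\<^sub>B
      \<longleftrightarrow> (\<Oplus>\<^sub>B x\<in>X. \<Oplus>\<^sub>B y\<in>X. ?f (u x y) \<otimes>\<^sub>B (?f (v x y) \<otimes>\<^sub>B ?f (w x y)))
        = (\<Oplus>\<^sub>B x\<in>X. \<Oplus>\<^sub>B y\<in>X. ?f (u' x y) \<otimes>\<^sub>B (?f (v' x y) \<otimes>\<^sub>B ?f (w' x y)))"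
    if "\<And>x y. [|x \<in> X; y \<in> X|] ==> u x y \<in> LS \<and> v x y \<in> LS \<and> w x y \<in> LS"
      "\<And>x y. [|x \<in> X; y \<in> X|] ==> u' x y \<in> LS \<and> v' x y \<in> LS \<and> w' x y \<in> LS" for u v w u' v' w'
  proof -
    have k: "?K (\<Sum>x\<in>X. \<Sum>y\<in>X. word [u x y, v x y, w x y])
        \<and> h (\<Sum>x\<in>X. \<Sum>y\<in>X. word [u x y, v x y, w x y])
        = (\<Oplus>\<^sub>B x\<in>X. \<Oplus>\<^sub>B y\<in>X. ?f (u x y) \<otimes>\<^sub>B (?f (v x y) \<otimes>\<^sub>B ?f (w x y)))"
      if l: "\<And>x y. [|x \<in> X; y \<in> X|] ==> u x y \<in> LS \<and> v x y \<in> LS \<and> w x y \<in> LS" for u v w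
    proof -
      have wc: "?K (word [u x y, v x y, w x y])" if "x \<in> X" "y \<in> X" for x y
        using l[OF that] by (intro wd) simp
      have wc': "?K (\<Sum>y\<in>X. word [u x y, v x y, w x y])" if "x \<in> X" for x
        by (rule Ksum) (rule wc[OF that])
      have "h (\<Sum>y\<in>X. word [u x y, v x y, w x y])
          = (\<Oplus>\<^sub>B y\<in>X. ?f (u x y) \<otimes>\<^sub>B (?f (v x y) \<otimes>\<^sub>B ?f (w x y)))" if x: "x \<in> X" for x
        using l[OF x] by (subst hsum[OF wc[OF x]]) (auto simp: w3 intro!: B.finsum_eqI)
      then show ?thesis
        using Ksum[OF wc'] l by (subst hsum[OF wc']) (auto intro!: B.finsum_eqI B.finsum_closed)
    qed
    show ?thesis
      using k[of u v w, OF that(1)] k[of u' v' w', OF that(2)] by (simp only: hd)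
  qed
  have e7: "h (word [] - word [z]) = \<zero>\<^sub>B \<longleftrightarrow> \<one>\<^sub>B = ?f z" if "z \<in> LS" for z
    using that hd[OF wd[of "[]"] wd[of "[z]"]] by (simp add: h0)
  have "(\<forall>r\<in>asig_rels R X deg \<sigma>. h r = \<zero>\<^sub>B) \<longleftrightarrow>
    (\<forall>u v. u \<in> carrier U \<and> v \<in> carrier U --> ?f (Scal u) \<oplus>\<^sub>B ?f (Scal v) = ?f (Scal (u \<oplus>\<^sub>U v))) \<and>
    (\<forall>c u. u \<in> carrier U --> c \<odot>\<^sub>B ?f (Scal u) = ?f (Scal (c \<odot>\<^sub>U u))) \<and>
    (\<forall>u v. u \<in> carrier U \<and> v \<in> carrier U --> ?f (Scal u) \<otimes>\<^sub>B ?f (Scal v) = ?f (Scal (u \<otimes>\<^sub>U v))) \<and>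
    (\<forall>a b. a \<in> X \<and> b \<in> X -->
       (\<Oplus>\<^sub>B c\<in>X. ?f (L a c) \<otimes>\<^sub>B ?f (Linv c b)) = (if a = b then \<one>\<^sub>B else \<zero>\<^sub>B)) \<and>
    (\<forall>a b. a \<in> X \<and> b \<in> X -->
       (\<Oplus>\<^sub>B c\<in>X. ?f (Linv a c) \<otimes>\<^sub>B ?f (L c b)) = (if a = b then \<one>\<^sub>B else \<zero>\<^sub>B)) \<and>
    (\<forall>a b f. a \<in> X \<and> b \<in> X \<and> f \<in> carrier M -->
       ?f (Scal (bt R (sh a f) \<one>\<^sub>M)) \<otimes>\<^sub>B ?f (L a b) = ?f (L a b) \<otimes>\<^sub>B ?f (Scal (bt R f \<one>\<^sub>M))) \<and>
    (\<forall>a b f. a \<in> X \<and> b \<in> X \<and> f \<in> carrier M -->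
       ?f (Scal (bt R \<one>\<^sub>M (sh b f))) \<otimes>\<^sub>B ?f (L a b) = ?f (L a b) \<otimes>\<^sub>B ?f (Scal (bt R \<one>\<^sub>M f))) \<and>
    (\<forall>a b f. a \<in> X \<and> b \<in> X \<and> f \<in> carrier M -->
       ?f (Scal (bt R f \<one>\<^sub>M)) \<otimes>\<^sub>B ?f (Linv a b) = ?f (Linv a b) \<otimes>\<^sub>B ?f (Scal (bt R (sh b f) \<one>\<^sub>M))) \<and>
    (\<forall>a b f. a \<in> X \<and> b \<in> X \<and> f \<in> carrier M -->
       ?f (Scal (bt R \<one>\<^sub>M f)) \<otimes>\<^sub>B ?f (Linv a b) = ?f (Linv a b) \<otimes>\<^sub>B ?f (Scal (bt R \<one>\<^sub>M (sh a f)))) \<and>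
    (\<forall>a b c d. a \<in> X \<and> b \<in> X \<and> c \<in> X \<and> d \<in> X -->
       (\<Oplus>\<^sub>B x\<in>X. \<Oplus>\<^sub>B y\<in>X. ?f (Scal (bt R (\<sigma> x y a c) \<one>\<^sub>M)) \<otimes>\<^sub>B (?f (L y d) \<otimes>\<^sub>B ?f (L x b)))
       = (\<Oplus>\<^sub>B x\<in>X. \<Oplus>\<^sub>B y\<in>X. ?f (Scal (bt R \<one>\<^sub>M (\<sigma> b d x y))) \<otimes>\<^sub>B (?f (L c y) \<otimes>\<^sub>B ?f (L a x)))) \<and>
    \<one>\<^sub>B = ?f (Scal (bt R \<one>\<^sub>M \<one>\<^sub>M))"
    unfolding asig_rels_def ball_Un ball_Collects conj_assoc
  proof (intro arg_cong2[of _ _ _ _ "(\<and>)"])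
    show "(\<forall>u v. u \<in> carrier U \<and> v \<in> carrier U -->
        h (word [Scal u] + word [Scal v] - word [Scal (u \<oplus>\<^sub>U v)]) = \<zero>\<^sub>B)
      = (\<forall>u v. u \<in> carrier U \<and> v \<in> carrier U --> ?f (Scal u) \<oplus>\<^sub>B ?f (Scal v) = ?f (Scal (u \<oplus>\<^sub>U v)))"
      by (simp add: e1 cong: imp_cong)
    show "(\<forall>c u. u \<in> carrier U --> h (pm_scale c (word [Scal u]) - word [Scal (c \<odot>\<^sub>U u)]) = \<zero>\<^sub>B)
      = (\<forall>c u. u \<in> carrier U --> c \<odot>\<^sub>B ?f (Scal u) = ?f (Scal (c \<odot>\<^sub>U u)))"
      by (simp add: e2 cong: imp_cong)
  qed (simp_all add: e3 e4 e5 e6 e7 cong: imp_cong)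
  also have "\<dots> \<longleftrightarrow> asig_rep B ?f"
    unfolding asig_rep_def hom Ball_def
    by (simp add: all_conj_distrib imp_conjR conj_ac split del: if_split cong: conj_cong) (auto split del: if_split)
  finally show ?thesis .
qed

end

lemma alg_hom_cong:
  assumes "kalg A" "h \<in> alg_hom A B" "\<And>x. x \<in> carrier A ==> g x = h x" shows "g \<in> alg_hom A B"
proof -
  interpret A: kalg A by fact
  show ?thesis
    by (rule alg_homI[OF lin_map_cong[OF A.ks alg_hom_lin[OF assms(2)] assms(3)]])
      (simp_all add: assms(3) alg_hom_mult[OF assms(2)] alg_hom_one[OF assms(2)])
qed

lemma free_alg_lin_eqI:
  assumes "kspace V" "g \<in> lin_map (free_alg S) V" "h \<in> lin_map (free_alg S) V"
    and "\<And>ws. ws \<in> lists S ==> g (word ws) = h (word ws)" and "x \<in> carrier (free_alg S)"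
  shows "g x = h x"
  by (rule pm_map_eqI[OF assms(1-3)[unfolded free_alg_pm]])
    (use assms(4,5) in \<open>auto simp: word_def\<close>)

context dyb
begin

lemma asig_rels_carrier: "asig_rels R X deg \<sigma> \<subseteq> carrier FA"
proof -
  let ?C = "carrier FA :: (('k, 'r, 'l, 'x) lett list \<Rightarrow>\<^sub>0 'k) set"
  have K: "x + y \<in> ?C" "x - y \<in> ?C" if "x \<in> ?C" "y \<in> ?C" for x y
    using that by (simp_all add: keys_add_subset keys_diff_subset)
  have sc: "pm_scale c x \<in> ?C" if "x \<in> ?C" for c x using FA.smult_closed[of x c] that by simp
  have sm: "(\<Sum>c\<in>X. x c) \<in> ?C" if "\<And>c. c \<in> X ==> x c \<in> ?C" for x
    using that by (simp add: keys_sum_subset)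
  have wd: "word ws \<in> ?C" if "set ws \<subseteq> LS" for ws using that by (simp add: in_listsI subset_iff)
  have z: "0 \<in> ?C" by simp
  have "\<forall>r\<in>asig_rels R X deg \<sigma>. r \<in> ?C"
    unfolding asig_rels_def ball_Un ball_Collects
    by (intro conjI allI impI ballI; (elim insertE emptyE)?; (simp only:)?;
      intro K sc sm wd; (simp split: if_split add: wd z)?)
  then show ?thesis by blast
qed

lemma asig_ideal: "ideal (asig_ideal R X deg \<sigma>) FA"
  unfolding asig_ideal_def by (rule genideal_ideal[OF FA.kalg_axioms asig_rels_carrier])

lemmas asig_sub = ideal_subspace[OF FA.kalg_axioms asig_ideal]

sublocale As: kalg AS
  unfolding Asig_def by (rule kalg_quot[OF FA.kalg_axioms asig_ideal])

lemma Pa_hom: "Pa \<in> alg_hom FA AS"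
  unfolding Asig_def by (rule proj_alg_hom[OF FA.kalg_axioms asig_ideal])

lemmas Pa_lin = alg_hom_lin[OF Pa_hom]

lemma Pa_word: "Pa (word ws) = aw ws"
  by (simp add: aword_def)

lemma aw_closed [simp]: "ws \<in> lists LS ==> aw ws \<in> carrier AS"
  unfolding Pa_word[symmetric] by (rule lin_map_closed[OF Pa_lin]) simp

lemma aw_Nil: "aw [] = \<one>\<^sub>AS"
  using alg_hom_one[OF Pa_hom] by (simp add: Pa_word)

lemma aw_append: "[|v \<in> lists LS; ws \<in> lists LS|] ==> aw (v @ ws) = aw v \<otimes>\<^sub>AS aw ws"
  using alg_hom_mult[OF Pa_hom, of "word v" "word ws"] by (simp add: Pa_word)

lemma aw_Cons: "[|z \<in> LS; ws \<in> lists LS|] ==> aw (z # ws) = aw [z] \<otimes>\<^sub>AS aw ws"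
  using aw_append[of "[z]" ws] by simp

lemma asig_rep_AS: "asig_rep AS (\<lambda>z. aw [z])"
proof -
  have "\<forall>r\<in>asig_rels R X deg \<sigma>. Pa r = \<zero>\<^sub>AS"
  proof
    fix r assume r: "r \<in> asig_rels R X deg \<sigma>"
    then have rc: "r \<in> carrier FA" using asig_rels_carrier by (rule rev_subsetD)
    have "r \<in> asig_ideal R X deg \<sigma>"
      unfolding asig_ideal_def using FA.genideal_self[OF asig_rels_carrier] r by (rule subsetD)
    then have "Pa r = asig_ideal R X deg \<sigma>"
      using coset_eq_zero_iff[OF FA.ks asig_sub rc] by (rule iffD2[rotated])
    then show "Pa r = \<zero>\<^sub>AS" by (simp add: Asig_def quot_alg_simps)
  qed
  then show ?thesis
    unfolding asig_rep_iff[OF As.kalg_axioms Pa_hom] Pa_word .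
qed

lemma asig_rep_closed:
  assumes "asig_rep B \<phi>" "z \<in> LS" shows "\<phi> z \<in> carrier B"
proof (cases z)
  case (Scal u)
  have "(\<lambda>u. \<phi> (Scal u)) \<in> alg_hom U B" using assms(1) by (simp add: asig_rep_def)
  then show ?thesis using Scal assms(2) lin_map_closed[OF alg_hom_lin, of "\<lambda>u. \<phi> (Scal u)"] by simp
qed (use assms in \<open>simp_all add: asig_rep_def\<close>)

definition asig_ext :: "('k, 'b) module => (('k, 'r, 'l, 'x) lett => 'b) => ('k, 'r, 'l, 'x) asig => 'b" where
  "asig_ext B \<phi> = induced (alg_ext B \<phi>)"

lemma
  assumes B: "kalg B" and rep: "asig_rep B \<phi>"
  shows asig_ext_hom: "asig_ext B \<phi> \<in> alg_hom AS B"
    and asig_ext_letter: "z \<in> LS ==> asig_ext B \<phi> (aw [z]) = \<phi> z"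
proof -
  interpret B: kalg B by fact
  let ?e = "alg_ext B \<phi>"
  note c = asig_rep_closed[OF rep]
  have hom: "?e \<in> alg_hom FA B" by (rule alg_ext_hom[OF B c])
  note lin = alg_hom_lin[OF hom]
  have wd: "?e (word [z]) = \<phi> z" if "z \<in> LS" for z
    using alg_ext_word[OF B, of LS \<phi> "[z]"] that c by simp
  have "asig_rep B (\<lambda>z. ?e (word [z]))"
  proof -
    have "(\<lambda>u. \<phi> (Scal u)) \<in> alg_hom U B" using rep by (simp add: asig_rep_def)
    then have "(\<lambda>u. ?e (word [Scal u])) \<in> alg_hom U B"
      by (rule alg_hom_cong[OF U.kalg_axioms]) (simp add: wd)
    moreover have eq: "(\<Oplus>\<^sub>B x\<in>X. \<Oplus>\<^sub>B y\<in>X. ?e (word [p x y]) \<otimes>\<^sub>B (?e (word [q x y]) \<otimes>\<^sub>B ?e (word [r x y])))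
        = (\<Oplus>\<^sub>B x\<in>X. \<Oplus>\<^sub>B y\<in>X. \<phi> (p x y) \<otimes>\<^sub>B (\<phi> (q x y) \<otimes>\<^sub>B \<phi> (r x y)))"
      if "\<And>x y. [|x \<in> X; y \<in> X|] ==> p x y \<in> LS \<and> q x y \<in> LS \<and> r x y \<in> LS" for p q r
      by (rule B.finsum_eqI, rule B.finsum_eqI) (use that in \<open>auto simp: wd c intro!: B.finsum_closed\<close>)
    moreover have "(\<Oplus>\<^sub>B x\<in>X. ?e (word [p x]) \<otimes>\<^sub>B ?e (word [q x])) = (\<Oplus>\<^sub>B x\<in>X. \<phi> (p x) \<otimes>\<^sub>B \<phi> (q x))"
      if "\<And>x. x \<in> X ==> p x \<in> LS \<and> q x \<in> LS" for p q
      by (rule B.finsum_eqI) (use that in \<open>auto simp: wd c\<close>)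
    ultimately show ?thesis using rep unfolding asig_rep_def by (simp add: wd)
  qed
  then have krel: "?e r = \<zero>\<^sub>B" if "r \<in> asig_rels R X deg \<sigma>" for r
    using that unfolding asig_rep_iff[OF B hom, symmetric] by (rule bspec)
  have kill: "?e x = \<zero>\<^sub>B" if "x \<in> asig_ideal R X deg \<sigma>" for x
    by (rule genideal_kill[OF FA.kalg_axioms B lin alg_hom_mult[OF hom] asig_rels_carrier krel
          that[unfolded asig_ideal_def]])
  have ev: "asig_ext B \<phi> (Pa x) = ?e x" if "x \<in> carrier FA" for x
    unfolding asig_ext_def
    by (rule induced_coset[OF FA.ks asig_sub B.ks lin kill that])
  show "asig_ext B \<phi> \<in> alg_hom AS B"
  proof (rule alg_homI)
    show "asig_ext B \<phi> \<in> lin_map AS B"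
      unfolding asig_ext_def Asig_def
      by (rule induced_lin[OF FA.ks asig_sub B.ks lin kill])
    show "asig_ext B \<phi> \<one>\<^sub>AS = \<one>\<^sub>B"
      using ev[OF FA.one_closed] unfolding alg_hom_one[OF Pa_hom] alg_hom_one[OF hom] .
  next
    fix x y assume "x \<in> carrier AS" "y \<in> carrier AS"
    then obtain x' y' where x: "x' \<in> carrier FA" "x = Pa x'" and y: "y' \<in> carrier FA" "y = Pa y'"
      unfolding Asig_def by (elim quot_cases)
    have "asig_ext B \<phi> (x \<otimes>\<^sub>AS y) = asig_ext B \<phi> (Pa (x' \<otimes>\<^sub>FA y'))"
      unfolding x(2) y(2) alg_hom_mult[OF Pa_hom x(1) y(1)] ..
    also have "\<dots> = asig_ext B \<phi> x \<otimes>\<^sub>B asig_ext B \<phi> y"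
      unfolding x(2) y(2) ev[OF FA.m_closed[OF x(1) y(1)]] ev[OF x(1)] ev[OF y(1)]
      by (rule alg_hom_mult[OF hom x(1) y(1)])
    finally show "asig_ext B \<phi> (x \<otimes>\<^sub>AS y) = asig_ext B \<phi> x \<otimes>\<^sub>B asig_ext B \<phi> y" .
  qed
  show "asig_ext B \<phi> (aw [z]) = \<phi> z" if "z \<in> LS"
    using ev[of "word [z]"] wd[OF that] that by (simp add: Pa_word)
qed

lemma AS_lin_eqI:
  assumes V: "kspace V" and g: "g \<in> lin_map AS V" and h: "h \<in> lin_map AS V"
    and ws: "\<And>ws. ws \<in> lists LS ==> g (aw ws) = h (aw ws)" and x: "x \<in> carrier AS"
  shows "g x = h x"
proof -
  obtain y where y: "y \<in> carrier FA" "x = Pa y" using x unfolding Asig_def by (rule quot_cases)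
  have "g (Pa y) = h (Pa y)"
    by (rule free_alg_lin_eqI[OF V lin_map_comp[OF Pa_lin g] lin_map_comp[OF Pa_lin h] _ y(1)])
      (simp add: Pa_word ws)
  then show ?thesis using y by simp
qed

lemma AS_hom_eqI:
  assumes B: "kalg B" and g: "g \<in> alg_hom AS B" and h: "h \<in> alg_hom AS B"
    and z: "\<And>z. z \<in> LS ==> g (aw [z]) = h (aw [z])" and x: "x \<in> carrier AS"
  shows "g x = h x"
proof (rule AS_lin_eqI[OF _ alg_hom_lin[OF g] alg_hom_lin[OF h] _ x])
  interpret B: kalg B by fact
  show "kspace B" by (rule B.ks)
  fix ws :: "('k, 'r, 'l, 'x) lett list" assume "ws \<in> lists LS"
  then show "g (aw ws) = h (aw ws)"
  proof (induction ws)
    case Nil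
    then show ?case by (simp add: aw_Nil alg_hom_one[OF g] alg_hom_one[OF h])
  next
    case (Cons y ws)
    then show ?case by (simp add: aw_Cons[of y ws] alg_hom_mult[OF g] alg_hom_mult[OF h] z)
  qed
qed

lemma rep_comp:
  assumes B: "kalg B" and F: "F \<in> alg_hom AS B"
  shows "asig_rep B (\<lambda>z. F (aw [z]))"
proof -
  have h: "(\<lambda>x. F (Pa x)) \<in> alg_hom FA B"
    by (intro alg_homI lin_map_comp[OF Pa_lin alg_hom_lin[OF F]])
      (simp_all add: alg_hom_mult[OF Pa_hom] alg_hom_mult[OF F] alg_hom_one[OF Pa_hom, simplified] alg_hom_one[OF F]
        lin_map_closed[OF Pa_lin])
  interpret B: kalg B by fact
  have "F (Pa r) = \<zero>\<^sub>B" if "r \<in> asig_rels R X deg \<sigma>" for r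
  proof -
    have "Pa r = \<zero>\<^sub>AS"
      using asig_rep_iff[OF As.kalg_axioms Pa_hom] asig_rep_AS that unfolding Pa_word by blast
    then show ?thesis
      using lin_map_zero[OF As.ks B.ks alg_hom_lin[OF F]] by simp
  qed
  then show ?thesis using asig_rep_iff[OF B h] by (simp add: Pa_word)
qed

abbreviation sa where "sa \<equiv> asig_s R X deg \<sigma>"
abbreviation ta where "ta \<equiv> asig_t R X deg \<sigma>"

text \<open>
  Evaluating a representation of the letters at \<open>f \<otimes> 1\<close> and \<open>1 \<otimes> f\<close> splits it into source and target
  parts; the lemma \<open>gen_rep\<close> below goes back.
\<close>

lemma rep_quad_inv:
  assumes B: "kalg B" and rep: "asig_rep B \<phi>"
  shows "quad_inv R \<psi> I r1 r2 X deg \<sigma> B (\<lambda>f. \<phi> (Scal (bt R f \<one>\<^sub>M))) (\<lambda>f. \<phi> (Scal (bt R \<one>\<^sub>M f)))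
    (\<lambda>a b. \<phi> (L a b)) (\<lambda>a b. \<phi> (Linv a b))"
proof -
  interpret B: kalg B by fact
  have hom: "(\<lambda>u. \<phi> (Scal u)) \<in> alg_hom U B" using rep by (simp add: asig_rep_def)
  note hc = lin_map_closed[OF alg_hom_lin[OF hom]]
  show ?thesis
  proof
    show "(\<lambda>f. \<phi> (Scal (bt R f \<one>\<^sub>M))) \<in> lin_map M B" "(\<lambda>f. \<phi> (Scal (bt R \<one>\<^sub>M f))) \<in> lin_map M B"
      by (rule lin_map_comp[OF bilin_left[OF bt_bilin] alg_hom_lin[OF hom]]
          lin_map_comp[OF bilin_right[OF bt_bilin] alg_hom_lin[OF hom]], simp)+
    show "\<phi> (Scal (bt R \<one>\<^sub>M \<one>\<^sub>M)) = \<one>\<^sub>B"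
      by (simp add: bt_one alg_hom_one[OF hom])
  next
    fix a b c d assume X: "a \<in> X" "b \<in> X" "c \<in> X" "d \<in> X"
    have eq: "(\<Oplus>\<^sub>B x\<in>X. \<Oplus>\<^sub>B y\<in>X. \<phi> (Scal (bt R (\<sigma> x y a c) \<one>\<^sub>M)) \<otimes>\<^sub>B (\<phi> (L y d) \<otimes>\<^sub>B \<phi> (L x b)))
       = (\<Oplus>\<^sub>B x\<in>X. \<Oplus>\<^sub>B y\<in>X. \<phi> (Scal (bt R \<one>\<^sub>M (\<sigma> b d x y))) \<otimes>\<^sub>B (\<phi> (L c y) \<otimes>\<^sub>B \<phi> (L a x)))"
      using rep X by (simp add: asig_rep_def)
    show "(\<Oplus>\<^sub>B y\<in>X. \<Oplus>\<^sub>B x\<in>X. \<phi> (Scal (bt R (\<sigma> x y a c) \<one>\<^sub>M)) \<otimes>\<^sub>B (\<phi> (L y d) \<otimes>\<^sub>B \<phi> (L x b)))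
       = (\<Oplus>\<^sub>B y\<in>X. \<Oplus>\<^sub>B x\<in>X. \<phi> (Scal (bt R \<one>\<^sub>M (\<sigma> b d x y))) \<otimes>\<^sub>B (\<phi> (L c y) \<otimes>\<^sub>B \<phi> (L a x)))"
      by (rule trans[OF B.finsum_swap trans[OF eq B.finsum_swap]])
        (use X in \<open>simp_all add: asig_rep_closed[OF rep]\<close>)
  qed (use rep in \<open>simp_all add: asig_rep_def alg_hom_mult[OF hom, symmetric] bt_mult\<close>)
qed

sublocale Sq: quad_inv R \<psi> I r1 r2 X deg \<sigma> AS sa ta "\<lambda>a b. aw [L a b]" "\<lambda>a b. aw [Linv a b]"
  using rep_quad_inv[OF As.kalg_axioms asig_rep_AS] unfolding asig_s_def asig_t_def .

end

context quad_inv
begin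

definition gen :: "('k, 'r, 'l, 'x) lett => 'b" where
  "gen z = (case z of Scal u => tlift B (\<lambda>f g. S f \<otimes> T g) u | L a b => el a b | Linv a b => N a b)"

lemma ST_bilin: "bilin M (opp M) B (\<lambda>f g. S f \<otimes> T g)"
  unfolding bilin_def lin_map_opp
  by (auto intro: lin_map_comp[OF T_lin B.mult_left_lin] lin_map_comp[OF S_lin B.mult_right_lin])

lemma gen_Scal: "[|f \<in> carrier M; g \<in> carrier M|] ==> gen (Scal (bt R f g)) = S f \<otimes> T g"
  by (simp add: gen_def bt_def MO.tlift_tens[OF B.ks ST_bilin])

lemma gen_hom: "(\<lambda>u. gen (Scal u)) \<in> alg_hom U B"
proof -
  have lin: "(\<lambda>u. gen (Scal u)) \<in> lin_map (tensor M (opp M)) B"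
    unfolding gen_def using MO.tlift_lin[OF B.ks ST_bilin] by simp
  have m: "gen (Scal (t \<otimes>\<^bsub>tensor M (opp M)\<^esub> u)) = gen (Scal t) \<otimes> gen (Scal u)"
    if "t \<in> carrier (tensor M (opp M))" "u \<in> carrier (tensor M (opp M))" for t u
  proof (rule MO.tensor_map_mult[OF B.kalg_axioms lin _ that])
    fix f g f' g' assume c: "f \<in> carrier M" "g \<in> carrier (opp M)" "f' \<in> carrier M" "g' \<in> carrier (opp M)"
    then have c': "g \<in> carrier M" "g' \<in> carrier M" by simp_all
    have "S (f \<otimes>\<^sub>M f') \<otimes> T (g' \<otimes>\<^sub>M g) = S f \<otimes> (S f' \<otimes> T g) \<otimes> T g'"
      using c c' by (simp add: S_mult T_mult B.m_assoc)
    also have "\<dots> = (S f \<otimes> T g) \<otimes> (S f' \<otimes> T g')"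
      unfolding TS[OF c(3) c'(1), symmetric] using c c' by (simp add: B.m_assoc)
    finally show "gen (Scal (tens M (opp M) (f \<otimes>\<^sub>M f') (g \<otimes>\<^bsub>opp M\<^esub> g')))
      = gen (Scal (tens M (opp M) f g)) \<otimes> gen (Scal (tens M (opp M) f' g'))"
      using c c' gen_Scal[of "f \<otimes>\<^sub>M f'" "g' \<otimes>\<^sub>M g"] gen_Scal[of f g] gen_Scal[of f' g']
      by (simp add: bt_def base_env_def)
  qed
  show ?thesis
    by (rule alg_homI) (use lin m gen_Scal[of "\<one>\<^sub>M" "\<one>\<^sub>M"] in
      \<open>simp_all add: base_env_def bt_def MO.tens_one S_one T_one\<close>)
qed

lemma gen_rep: "asig_rep B gen"
proof -
  have gs: "gen (Scal (bt R f \<one>\<^sub>M)) = S f" "gen (Scal (bt R \<one>\<^sub>M f)) = T f" if "f \<in> carrier M" for f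
    using that by (simp_all add: gen_Scal S_one T_one)
  have gl: "gen (L a b) = el a b" "gen (Linv a b) = N a b" for a b by (simp_all add: gen_def)
  have q: "(\<Oplus>x\<in>X. \<Oplus>y\<in>X. S (\<sigma> x y a c) \<otimes> (el y d \<otimes> el x b))
      = (\<Oplus>x\<in>X. \<Oplus>y\<in>X. T (\<sigma> b d x y) \<otimes> (el c y \<otimes> el a x))"
    if X: "a \<in> X" "b \<in> X" "c \<in> X" "d \<in> X" for a b c d
    by (rule trans[OF B.finsum_swap trans[OF quadratic[OF X] B.finsum_swap]]) (use X in simp_all)
  have q': "(\<Oplus>x\<in>X. \<Oplus>y\<in>X. gen (Scal (bt R (\<sigma> x y a c) \<one>\<^sub>M)) \<otimes> (el y d \<otimes> el x b))
      = (\<Oplus>x\<in>X. \<Oplus>y\<in>X. gen (Scal (bt R \<one>\<^sub>M (\<sigma> b d x y))) \<otimes> (el c y \<otimes> el a x))"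
    if X: "a \<in> X" "b \<in> X" "c \<in> X" "d \<in> X" for a b c d
  proof -
    have "(\<Oplus>x\<in>X. \<Oplus>y\<in>X. gen (Scal (bt R (\<sigma> x y a c) \<one>\<^sub>M)) \<otimes> (el y d \<otimes> el x b))
      = (\<Oplus>x\<in>X. \<Oplus>y\<in>X. S (\<sigma> x y a c) \<otimes> (el y d \<otimes> el x b))"
      by (rule B.finsum_eqI, rule B.finsum_eqI) (use X in \<open>auto simp: gs intro!: B.finsum_closed\<close>)
    also have "\<dots> = (\<Oplus>x\<in>X. \<Oplus>y\<in>X. T (\<sigma> b d x y) \<otimes> (el c y \<otimes> el a x))"
      by (rule q[OF X])
    also have "\<dots> = (\<Oplus>x\<in>X. \<Oplus>y\<in>X. gen (Scal (bt R \<one>\<^sub>M (\<sigma> b d x y))) \<otimes> (el c y \<otimes> el a x))"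
      by (rule B.finsum_eqI, rule B.finsum_eqI) (use X in \<open>auto simp: gs intro!: B.finsum_closed\<close>)
    finally show ?thesis .
  qed
  show ?thesis
    unfolding asig_rep_def gl
    using gen_hom q' by (simp add: gs el_N N_el el_S el_T S_N T_N)
qed

end

lemma alg_hom_comp:
  assumes f: "f \<in> alg_hom A B" and g: "g \<in> alg_hom B C"
  shows "(\<lambda>x. g (f x)) \<in> alg_hom A C"
  by (rule alg_homI[OF lin_map_comp[OF alg_hom_lin[OF f] alg_hom_lin[OF g]]])
    (simp_all add: alg_hom_mult[OF f] alg_hom_mult[OF g] alg_hom_one[OF f] alg_hom_one[OF g]
      lin_map_closed[OF alg_hom_lin[OF f]])

section \<open>The universal property\<close>

text \<open>
  Left and right inverse of a matrix agree; \<open>u\<close> plays the role of the unit, so that the lemma also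
  applies to matrices over a corner.
\<close>

lemma (in ring) inverse_matrix_unique:
  assumes fin: "finite X"
    and cl: "\<And>a b. [|a \<in> X; b \<in> X|] ==> n a b \<in> carrier R \<and> e a b \<in> carrier R \<and> n' a b \<in> carrier R"
    and u: "u \<in> carrier R" "\<And>a b. [|a \<in> X; b \<in> X|] ==> n a b \<otimes> u = n a b \<and> u \<otimes> n' a b = n' a b"
    and ne: "\<And>a b. [|a \<in> X; b \<in> X|] ==> (\<Oplus>c\<in>X. n a c \<otimes> e c b) = (if a = b then u else \<zero>)"
    and en: "\<And>a b. [|a \<in> X; b \<in> X|] ==> (\<Oplus>c\<in>X. e a c \<otimes> n' c b) = (if a = b then u else \<zero>)"
    and X: "a \<in> X" "b \<in> X"
  shows "n a b = n' a b"
proof -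
  have "n a b = (\<Oplus>c\<in>X. if b = c then n a c else \<zero>)"
    using X cl fin by (subst finsum_delta') auto
  also have "\<dots> = (\<Oplus>c\<in>X. n a c \<otimes> (\<Oplus>d\<in>X. e c d \<otimes> n' d b))"
    by (rule finsum_eqI) (use X cl u en in auto)
  also have "\<dots> = (\<Oplus>c\<in>X. \<Oplus>d\<in>X. n a c \<otimes> e c d \<otimes> n' d b)"
    by (rule finsum_eqI) (use X cl fin in \<open>auto simp: finsum_rdistr m_assoc intro!: finsum_eqI finsum_closed\<close>)
  also have "\<dots> = (\<Oplus>d\<in>X. \<Oplus>c\<in>X. n a c \<otimes> e c d \<otimes> n' d b)"
    by (rule finsum_swap) (use X cl fin in auto)
  also have "\<dots> = (\<Oplus>d\<in>X. (\<Oplus>c\<in>X. n a c \<otimes> e c d) \<otimes> n' d b)"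
    by (rule finsum_eqI) (use X cl fin in \<open>simp_all add: finsum_ldistr Pi_I finsum_closed\<close>)
  also have "\<dots> = (\<Oplus>d\<in>X. if a = d then n' d b else \<zero>)"
    by (rule finsum_eqI) (use X cl u ne in auto)
  also have "\<dots> = n' a b" using X cl fin by (subst finsum_delta') auto
  finally show ?thesis .
qed

context dyb
begin

lemma aw_Scal_bt:
  assumes "f \<in> carrier M" "g \<in> carrier M"
  shows "aw [Scal (bt R f g)] = sa f \<otimes>\<^sub>AS ta g"
proof -
  have "(\<lambda>u. aw [Scal u]) \<in> alg_hom U AS" using asig_rep_AS by (simp add: asig_rep_def)
  from alg_hom_mult[OF this, of "bt R f \<one>\<^sub>M" "bt R \<one>\<^sub>M g"] show ?thesis
    using assms by (simp add: bt_mult asig_s_def asig_t_def)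
qed

lemma aw_path_word:
  "[|(l, xs) \<in> paths X deg n; (m, ys) \<in> paths X deg n|] ==>
   map2 (\<lambda>x y. L (snd x) (snd y)) xs ys \<in> lists LS \<and>
   aw (map2 (\<lambda>x y. L (snd x) (snd y)) xs ys) = Sq.lprod xs ys"
proof (induction xs ys arbitrary: l m n rule: Sq.lprod.induct)
  case (1 x xs y ys)
  then have p: "(atgt deg x, xs) \<in> paths X deg (length xs)" "(atgt deg y, ys) \<in> paths X deg (length xs)"
    "snd x \<in> X" "snd y \<in> X" by auto
  then show ?case
    using "1.IH"[OF p(1,2)] aw_Cons[of "L (snd x) (snd y)" "map2 (\<lambda>x y. L (snd x) (snd y)) xs ys"]
    by simp
qed (auto simp: aw_Nil dest!: paths_length)

definition phi0 where "phi0 r r' p q = aw (Scal (bt R (cst r) (cst r') \<otimes>\<^sub>U bt R (delta R (psrc p)) (delta R (psrc q)))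
        # map2 (\<lambda>x y. L (snd x) (snd y)) (snd p) (snd q))"

lemma phi0_theta:
  assumes r: "r \<in> carrier R" "r' \<in> carrier R" and p: "p \<in> paths X deg n" "q \<in> paths X deg n"
  shows "phi0 r r' p q = Sq.theta r r' p q"
proof -
  have c: "cst s \<in> carrier M" if "s \<in> carrier R" for s
    using that by (simp add: fun_alg_simps cst_def)
  have d: "delta R l \<in> carrier M" for l by (simp add: R.M.delta_pt)
  have "bt R (cst r) (cst r') \<otimes>\<^sub>U bt R (delta R (psrc p)) (delta R (psrc q))
      = bt R (pt R (psrc p) r) (pt R (psrc q) r')"
    using r c[OF r(1)] c[OF r(2)] d R.M.pt_mult_right[of "\<one>\<^sub>R" "cst r'" "psrc q"]
    by (simp add: bt_mult R.M.cst_delta) (simp add: R.M.delta_pt cst_def)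
  moreover have "map2 (\<lambda>x y. L (snd x) (snd y)) (snd p) (snd q) \<in> lists LS \<and>
      aw (map2 (\<lambda>x y. L (snd x) (snd y)) (snd p) (snd q)) = Sq.lprod (snd p) (snd q)"
    by (rule aw_path_word[of "fst p" _ n "fst q"]) (use p in simp_all)
  ultimately show ?thesis
    using r unfolding phi0_def Sq.theta_def by (subst aw_Cons) (simp_all add: aw_Scal_bt)
qed

lemma Phi_eq:
  assumes "x \<in> carrier AW" shows "Phi R X deg \<sigma> x = Sq.out x"
proof -
  have b: "bilin R R AS (\<lambda>r r'. phi0 r r' p q)" if "p \<in> paths X deg n" "q \<in> paths X deg n" for p q n
  proof (rule bilinI)
    note th = Sq.theta_bilin[OF that]
    show "(\<lambda>r'. phi0 r r' p q) \<in> lin_map R AS" if "r \<in> carrier R" for r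
      by (rule lin_map_cong[OF R.M.ks bilin_right[OF th that]]) (rule phi0_theta[OF that _ \<open>p \<in> _\<close> \<open>q \<in> _\<close>])
    show "(\<lambda>r. phi0 r r' p q) \<in> lin_map R AS" if "r' \<in> carrier R" for r'
      by (rule lin_map_cong[OF R.M.ks bilin_left[OF th that]]) (rule phi0_theta[OF _ that \<open>p \<in> _\<close> \<open>q \<in> _\<close>])
  qed
  have "hq_lift AS phi0 y = Sq.Theta y" if "y \<in> carrier H" for y
    by (rule hq_map_eqI[OF hq_lift_lin[OF As.ks b] Sq.Theta_lin _ that])
      (auto simp: hq_lift_hb[OF As.ks b] Sq.Theta_hb phi0_theta)
  moreover have "Phi R X deg \<sigma> = induced (hq_lift AS phi0)"
    unfolding Phi_def phi0_def ..
  moreover obtain y where y: "y \<in> carrier H" "x = P y" "induced (hq_lift AS phi0) x = hq_lift AS phi0 y"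
    using assms unfolding Aw_def by (rule induced_representative[OF H.ks aw_sub])
  ultimately show ?thesis by (simp add: Sq.out_P)
qed

end

text \<open>
  A homomorphism out of the presented algebra is determined by its values on \<open>s\<close>, \<open>t\<close> and \<open>L\<close>, since
  an inverse matrix is unique.
\<close>

context quad_inv
begin

abbreviation "ext \<equiv> asig_ext B gen"

lemma ext_hom: "ext \<in> alg_hom AS B"
  by (rule asig_ext_hom[OF B.kalg_axioms gen_rep])

lemmas ext_letter = asig_ext_letter[OF B.kalg_axioms gen_rep]

lemma ext_s: "f \<in> carrier M ==> ext (sa f) = S f"
  unfolding asig_s_def by (subst ext_letter) (simp_all add: gen_Scal T_one)

lemma ext_t: "f \<in> carrier M ==> ext (ta f) = T f"
  unfolding asig_t_def by (subst ext_letter) (simp_all add: gen_Scal S_one)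

lemma ext_L: "[|a \<in> X; b \<in> X|] ==> ext (aw [L a b]) = el a b"
  by (subst ext_letter) (simp_all add: gen_def)

lemma AS_hom_letter:
  assumes F: "F \<in> alg_hom AS B" and s: "\<And>f. f \<in> carrier M ==> F (sa f) = S f"
    and t: "\<And>f. f \<in> carrier M ==> F (ta f) = T f"
    and l: "\<And>a b. [|a \<in> X; b \<in> X|] ==> F (aw [L a b]) = el a b" and z: "z \<in> LS"
  shows "F (aw [z]) = gen z"
proof (cases z)
  case (Scal u)
  have h: "(\<lambda>u. F (aw [Scal u])) \<in> lin_map (tensor M (opp M)) B"
    using rep_comp[OF B.kalg_axioms F] by (simp add: asig_rep_def alg_hom_lin base_env_def)
  have g: "(\<lambda>u. gen (Scal u)) \<in> lin_map (tensor M (opp M)) B"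
    using alg_hom_lin[OF gen_hom] by (simp add: base_env_def)
  have "F (aw [Scal u]) = gen (Scal u)"
  proof (rule MO.tensor_map_eqI[OF h g])
    show "u \<in> carrier (tensor M (opp M))" using z Scal by (simp add: base_env_def)
    fix f g assume "f \<in> carrier M" "g \<in> carrier (opp M)"
    then show "F (aw [Scal (tens M (opp M) f g)]) = gen (Scal (tens M (opp M) f g))"
      using gen_Scal[of f g] aw_Scal_bt[of f g] by (simp add: bt_def alg_hom_mult[OF F] s t)
  qed
  then show ?thesis using Scal by simp
next
  case (L a b)
  then show ?thesis using z l by (simp add: gen_def)
next
  case (Linv a b)
  interpret Fi: quad_inv R \<psi> I r1 r2 X deg \<sigma> B "\<lambda>f. F (aw [Scal (bt R f \<one>\<^sub>M)])"
    "\<lambda>f. F (aw [Scal (bt R \<one>\<^sub>M f)])" "\<lambda>a b. F (aw [L a b])" "\<lambda>a b. F (aw [Linv a b])"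
    by (rule rep_quad_inv[OF B.kalg_axioms rep_comp[OF B.kalg_axioms F]])
  have "F (aw [Linv a b]) = N a b"
  proof (rule B.inverse_matrix_unique[where X = X and u = "\<one>" and e = el])
    show "(\<Oplus>c\<in>X. F (aw [Linv a c]) \<otimes> el c b) = (if a = b then \<one> else \<zero>)"
      if "a \<in> X" "b \<in> X" for a b
      unfolding Fi.N_el[OF that, symmetric] by (rule B.finsum_eqI) (use that in \<open>simp_all add: l\<close>)
  qed (use z Linv el_N Fi.N_closed in auto)
  then show ?thesis using Linv by (simp add: gen_def)
qed

lemma AS_hom_unique:
  assumes "F \<in> alg_hom AS B" "\<And>f. f \<in> carrier M ==> F (sa f) = S f"
    and "\<And>f. f \<in> carrier M ==> F (ta f) = T f"
    and "\<And>a b. [|a \<in> X; b \<in> X|] ==> F (aw [L a b]) = el a b" and "x \<in> carrier AS"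
  shows "F x = ext x"
  by (rule AS_hom_eqI[OF B.kalg_axioms assms(1) ext_hom _ assms(5)])
    (simp only: ext_letter AS_hom_letter[OF assms(1-4)])

end

context antipode_data
begin

lemma ext_Phi:
  assumes x: "x \<in> carrier AW" shows "Ai.ext (Phi R X deg \<sigma> x) = fp x"
proof -
  have c: "(\<lambda>x. Ai.ext (Sq.out x)) \<in> alg_hom AW A"
    by (rule alg_hom_comp[OF Sq.out_hom Ai.ext_hom])
  have "Ai.ext (Sq.out x) = fp x"
  proof (rule AW_hom_eqI[OF c fp_hom A.kalg_axioms _ _ _ x])
    fix f assume f: "f \<in> carrier M"
    show "Ai.ext (Sq.out (sw f)) = fp (sw f)"
      unfolding Sq.out_s[OF f] unfolding Ai.ext_s[OF f] unfolding Sp_def ..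
    show "Ai.ext (Sq.out (tw f)) = fp (tw f)"
      unfolding Sq.out_t[OF f] unfolding Ai.ext_t[OF f] unfolding Tp_def ..
  next
    fix a b assume X: "a \<in> X" "b \<in> X"
    show "Ai.ext (Sq.out (Lw a b)) = fp (Lw a b)"
      unfolding Sq.out_L[OF X] unfolding Ai.ext_L[OF X] unfolding lp_def ..
  qed
  then show ?thesis unfolding Phi_eq[OF x] .
qed

lemma Phi_hom_values:
  assumes F: "\<forall>x\<in>carrier AW. F (Phi R X deg \<sigma> x) = fp x"
  shows "f \<in> carrier M ==> F (sa f) = Sp f" "f \<in> carrier M ==> F (ta f) = Tp f"
    "[|a \<in> X; b \<in> X|] ==> F (aw [L a b]) = lp a b"
proof -
  show "F (sa f) = Sp f" if f: "f \<in> carrier M"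
    using bspec[OF F sw_closed[OF f]] unfolding Phi_eq[OF sw_closed[OF f]] Sq.out_s[OF f] Sp_def .
  show "F (ta f) = Tp f" if f: "f \<in> carrier M"
    using bspec[OF F Wq.T_closed[OF f]] unfolding Phi_eq[OF Wq.T_closed[OF f]] Sq.out_t[OF f] Tp_def .
  show "F (aw [L a b]) = lp a b" if X: "a \<in> X" "b \<in> X"
    using bspec[OF F Lw_closed[OF X]] unfolding Phi_eq[OF Lw_closed[OF X]] Sq.out_L[OF X] lp_def .
qed

theorem universal_property:
  "\<exists>!F. F \<in> extensional (carrier AS) \<and> F \<in> alg_hom AS A \<and> (\<forall>x\<in>carrier AW. F (Phi R X deg \<sigma> x) = fp x)"
proof (rule ex1I)
  let ?F = "restrict Ai.ext (carrier AS)"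
  have h: "?F \<in> alg_hom AS A"
    by (rule alg_hom_cong[OF As.kalg_axioms Ai.ext_hom]) simp
  have "?F (Phi R X deg \<sigma> x) = fp x" if "x \<in> carrier AW" for x
    using ext_Phi[OF that] lin_map_closed[OF Sq.out_lin that]
    unfolding Phi_eq[OF that] by (simp only: restrict_apply if_True)
  then show "?F \<in> extensional (carrier AS) \<and> ?F \<in> alg_hom AS A \<and> (\<forall>x\<in>carrier AW. ?F (Phi R X deg \<sigma> x) = fp x)"
    using h by (simp only: restrict_extensional) blast
  fix F assume F: "F \<in> extensional (carrier AS) \<and> F \<in> alg_hom AS A \<and> (\<forall>x\<in>carrier AW. F (Phi R X deg \<sigma> x) = fp x)"
  then have F': "F \<in> alg_hom AS A" "\<forall>x\<in>carrier AW. F (Phi R X deg \<sigma> x) = fp x" by auto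
  have "F x = ?F x" if "x \<in> carrier AS" for x
    using Ai.AS_hom_unique[OF F'(1) Phi_hom_values[OF F'(2)] that] that
    by (simp only: restrict_apply if_True)
  then show "F = ?F" using F by (intro extensionalityI[of F "carrier AS"]) simp_all
qed

end

section \<open>Compatibility with comultiplications\<close>

definition tmap :: "('k::field, 'a) module => ('b => 'a) => ('k, 'b, 'b) tens => ('k, 'a, 'a) tens" where
  "tmap A g = tlift (tensor A A) (\<lambda>x y. tens A A (g x) (g y))"

lemma
  fixes A :: "('k::field, 'a) module" and B :: "('k, 'b) module"
  assumes A: "kalg A" and B: "kalg B" and g: "g \<in> alg_hom B A"
  shows tmap_hom: "tmap A g \<in> alg_hom (tensor B B) (tensor A A)"
    and tmap_tens: "[|x \<in> carrier B; y \<in> carrier B|] ==> tmap A g (tens B B x y) = tens A A (g x) (g y)"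
proof -
  interpret A: kalg A by fact
  interpret B: kalg B by fact
  interpret AA: two_kalgs A A by unfold_locales
  interpret BB: two_kalgs B B by unfold_locales
  note gl = alg_hom_lin[OF g]
  note gc = lin_map_closed[OF gl]
  have b: "bilin B B (tensor A A) (\<lambda>x y. tens A A (g x) (g y))"
    by (rule bilin_comp[OF AA.tens_bilin gl gl])
  have lin: "tmap A g \<in> lin_map (tensor B B) (tensor A A)"
    unfolding tmap_def by (rule BB.tlift_lin[OF AA.T.ks b])
  show t: "tmap A g (tens B B x y) = tens A A (g x) (g y)" if "x \<in> carrier B" "y \<in> carrier B" for x y
    unfolding tmap_def using BB.tlift_tens[OF AA.T.ks b that] .
  show "tmap A g \<in> alg_hom (tensor B B) (tensor A A)"
  proof (rule alg_homI[OF lin])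
    show "tmap A g \<one>\<^bsub>tensor B B\<^esub> = \<one>\<^bsub>tensor A A\<^esub>"
      unfolding BB.tens_one AA.tens_one by (simp add: t alg_hom_one[OF g])
    fix x y assume "x \<in> carrier (tensor B B)" "y \<in> carrier (tensor B B)"
    then show "tmap A g (x \<otimes>\<^bsub>tensor B B\<^esub> y) = tmap A g x \<otimes>\<^bsub>tensor A A\<^esub> tmap A g y"
      by (intro BB.tensor_map_mult[OF AA.T.kalg_axioms lin])
        (simp_all add: t alg_hom_mult[OF g] AA.tens_mult gc)
  qed
qed

context base_maps
begin

text \<open>Elements of \<open>A \<otimes> A\<close> whose left multiplication descends to \<open>A \<otimes>\<^sub>M A\<close>.\<close>

definition stab where "stab = {x \<in> carrier (tensor A A). \<forall>u\<in>null. x \<otimes>\<^bsub>tensor A A\<^esub> u \<in> null}"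

text \<open>
  Left multiplication by \<open>p \<otimes> q\<close> sends the generator of the null space for \<open>l\<close> to the one for \<open>h l\<close>.
\<close>

lemma stab_tens:
  assumes p: "p \<in> carrier A" and q: "q \<in> carrier A" and h: "\<And>l. l \<in> carrier M ==> h l \<in> carrier M"
    and pt: "\<And>l. l \<in> carrier M ==> p \<otimes> t l = t (h l) \<otimes> p"
    and qs: "\<And>l. l \<in> carrier M ==> q \<otimes> s l = s (h l) \<otimes> q"
  shows "tens A A p q \<in> stab"
proof -
  have "tens A A p q \<otimes>\<^bsub>tensor A A\<^esub> u \<in> null" if u: "u \<in> null" for u
  proof (rule null_image[OF AA.T.mult_left_lin AA.T.ks null_sub _ u])
    show "tens A A p q \<in> carrier (tensor A A)" using p q by simp
    fix l a b assume c: "l \<in> carrier M" "a \<in> carrier A" "b \<in> carrier A"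
    have 1: "p \<otimes> (t l \<otimes> a) = t (h l) \<otimes> (p \<otimes> a)"
      using c p h pt[OF c(1)] by (simp add: A.m_assoc[symmetric])
    have 2: "q \<otimes> (s l \<otimes> b) = s (h l) \<otimes> (q \<otimes> b)"
      using c q h qs[OF c(1)] by (simp add: A.m_assoc[symmetric])
    show "tens A A p q \<otimes>\<^bsub>tensor A A\<^esub> tens A A (t l \<otimes> a) b \<ominus>\<^bsub>tensor A A\<^esub>
        tens A A p q \<otimes>\<^bsub>tensor A A\<^esub> tens A A a (s l \<otimes> b) \<in> null"
      using c p q h gens_null[of "h l" "p \<otimes> a" "q \<otimes> b"] by (simp add: AA.tens_mult 1 2)
  qed
  then show ?thesis using p q by (simp add: stab_def)
qed

lemma stab_add: "[|x \<in> stab; y \<in> stab|] ==> x \<oplus>\<^bsub>tensor A A\<^esub> y \<in> stab"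
  using subspace_add[OF null_sub AA.T.ks]
  by (simp add: stab_def AA.T.l_distr null_carrier)

lemma stab_zero: "\<zero>\<^bsub>tensor A A\<^esub> \<in> stab"
  using subspace_zero[OF null_sub AA.T.ks] by (simp add: stab_def null_carrier)

lemma stab_finsum: "[|finite S; \<And>i. i \<in> S ==> f i \<in> stab|] ==> (\<Oplus>\<^bsub>tensor A A\<^esub>i\<in>S. f i) \<in> stab"
proof (induction S rule: finite_induct)
  case (insert x S)
  have c: "f i \<in> carrier (tensor A A)" if "i \<in> insert x S" for i
    using insert.prems[OF that] by (simp add: stab_def)
  have "(\<Oplus>\<^bsub>tensor A A\<^esub>i\<in>insert x S. f i) = f x \<oplus>\<^bsub>tensor A A\<^esub> (\<Oplus>\<^bsub>tensor A A\<^esub>i\<in>S. f i)"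
    using insert.hyps c by (intro AA.T.finsum_insert) auto
  then show ?case using insert by (simp add: stab_add)
qed (simp add: stab_zero)

lemma over_mult:
  assumes x: "x \<in> stab" and y: "y \<in> carrier (tensor A A)"
  shows "(null +>\<^bsub>tensor A A\<^esub> x) \<otimes>\<^bsub>tensor_over A M s t\<^esub> (null +>\<^bsub>tensor A A\<^esub> y)
    = null +>\<^bsub>tensor A A\<^esub> (x \<otimes>\<^bsub>tensor A A\<^esub> y)"
  unfolding tensor_over_def
  by (rule quot_mult[OF AA.T.kalg_axioms null_sub _ y])
    (use x in \<open>simp_all add: stab_def null_right\<close>)

lemma over_one: "\<one>\<^bsub>tensor_over A M s t\<^esub> = null +>\<^bsub>tensor A A\<^esub> \<one>\<^bsub>tensor A A\<^esub>"
  by (simp add: tensor_over_def quot_alg_simps)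

end

context dyb
begin

abbreviation "ASS \<equiv> tensor AS AS"
abbreviation "TO \<equiv> tensor_over AS M sa ta"
abbreviation "cls x \<equiv> Sq.Bb.null +>\<^sub>ASS x"

lemmas ASS_kspace = Sq.Bb.AA.T.ks
lemmas TO_kspace = Sq.Bb.kspace_over
lemmas cls_lin = Sq.Bb.over_proj_lin

text \<open>Representatives in \<open>A\<^sub>\<sigma> \<otimes> A\<^sub>\<sigma>\<close> of the comultiplication of the generators.\<close>

definition kap :: "('k, 'r, 'l, 'x) lett => ('k, ('k, 'r, 'l, 'x) asig, ('k, 'r, 'l, 'x) asig) tens" where
  "kap z = (case z of Scal u => tlift ASS (\<lambda>f g. tens AS AS (sa f) (ta g)) u
     | L a b => (\<Oplus>\<^sub>ASS c\<in>X. tens AS AS (aw [L a c]) (aw [L c b]))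
     | Linv a b => (\<Oplus>\<^sub>ASS c\<in>X. tens AS AS (aw [Linv c b]) (aw [Linv a c])))"

definition kapo where
  "kapo z = (case z of Scal u => tlift TO (\<lambda>f g. tens_over AS M sa ta (sa f) (ta g)) u
     | L a b => (\<Oplus>\<^sub>TO c\<in>X. tens_over AS M sa ta (aw [L a c]) (aw [L c b]))
     | Linv a b => (\<Oplus>\<^sub>TO c\<in>X. tens_over AS M sa ta (aw [Linv c b]) (aw [Linv a c])))"

lemma asig_comultL_eq: "asig_comultL R X deg \<sigma> = induced (alg_ext TO kapo)"
  unfolding asig_comultL_def kapo_def Let_def ..

lemma to_eq: "tens_over AS M sa ta a b = cls (tens AS AS a b)"
  by (simp add: tens_over_def)

lemma sta_bilin: "bilin M (opp M) ASS (\<lambda>f g. tens AS AS (sa f) (ta g))"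
  using bilin_comp[OF Sq.Bb.AA.tens_bilin Sq.S_lin Sq.T_lin] by (simp add: bilin_def lin_map_opp)

lemma kap_Scal_lin: "(\<lambda>u. kap (Scal u)) \<in> lin_map (tensor M (opp M)) ASS"
  unfolding kap_def using MO.tlift_lin[OF ASS_kspace sta_bilin] by simp

lemma kap_Scal: "[|f \<in> carrier M; g \<in> carrier M|] ==>
    kap (Scal (tens M (opp M) f g)) = tens AS AS (sa f) (ta g)"
  by (simp add: kap_def MO.tlift_tens[OF ASS_kspace sta_bilin])

lemma kapo_kap:
  assumes z: "z \<in> LS" shows "kapo z = cls (kap z)"
proof (cases z)
  case (Scal u)
  have b: "bilin M (opp M) TO (\<lambda>f g. cls (tens AS AS (sa f) (ta g)))"
    using sta_bilin unfolding bilin_def by (auto intro: lin_map_comp[OF _ cls_lin])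
  have "tlift TO (\<lambda>f g. cls (tens AS AS (sa f) (ta g))) u = cls (kap (Scal u))"
  proof (rule MO.tensor_map_eqI[OF MO.tlift_lin[OF TO_kspace b] lin_map_comp[OF kap_Scal_lin cls_lin]])
    show "u \<in> carrier (tensor M (opp M))" using z Scal by (simp add: base_env_def)
    fix f g assume "f \<in> carrier M" "g \<in> carrier (opp M)"
    then show "tlift TO (\<lambda>f g. cls (tens AS AS (sa f) (ta g))) (tens M (opp M) f g)
        = cls (kap (Scal (tens M (opp M) f g)))"
      using kap_Scal[of f g] by (subst MO.tlift_tens[OF TO_kspace b]) simp_all
  qed
  then show ?thesis by (simp add: Scal kapo_def to_eq)
next
  case (L a b)
  have "cls (\<Oplus>\<^sub>ASS c\<in>X. tens AS AS (aw [L a c]) (aw [L c b]))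
      = (\<Oplus>\<^sub>TO c\<in>X. cls (tens AS AS (aw [L a c]) (aw [L c b])))"
    by (rule lin_map_finsum[OF ASS_kspace TO_kspace cls_lin]) (use z L in simp)
  then show ?thesis by (simp add: L kap_def kapo_def to_eq)
next
  case (Linv a b)
  have "cls (\<Oplus>\<^sub>ASS c\<in>X. tens AS AS (aw [Linv c b]) (aw [Linv a c]))
      = (\<Oplus>\<^sub>TO c\<in>X. cls (tens AS AS (aw [Linv c b]) (aw [Linv a c])))"
    by (rule lin_map_finsum[OF ASS_kspace TO_kspace cls_lin]) (use z Linv in simp)
  then show ?thesis by (simp add: Linv kap_def kapo_def to_eq)
qed

lemma kap_stab:
  assumes z: "z \<in> LS" shows "kap z \<in> Sq.Bb.stab"
proof (cases z)
  case (Scal u)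
  have "u \<in> carrier (tensor M (opp M))" using z Scal by (simp add: base_env_def)
  then have "kap (Scal u) \<in> Sq.Bb.stab"
  proof (induction rule: MO.tensor_induct)
    case (pure f g)
    then have c: "f \<in> carrier M" "g \<in> carrier M" by simp_all
    show ?case unfolding kap_Scal[OF c]
      by (rule Sq.Bb.stab_tens[where h = "\<lambda>l. l"]) (use c in \<open>simp_all add: Sq.TS\<close>)
  next
    case (add x y)
    then show ?case by (simp add: lin_map_add[OF kap_Scal_lin] Sq.Bb.stab_add)
  qed
  then show ?thesis using Scal by simp
next
  case (L a b)
  have "tens AS AS (aw [L a c]) (aw [L c b]) \<in> Sq.Bb.stab" if "c \<in> X" for c
    by (rule Sq.Bb.stab_tens[where h = "sh c"]) (use that z L in \<open>simp_all add: Sq.el_S Sq.el_T\<close>)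
  then show ?thesis unfolding kap_def L by (simp add: Sq.Bb.stab_finsum)
next
  case (Linv a b)
  have "tens AS AS (aw [Linv c b]) (aw [Linv a c]) \<in> Sq.Bb.stab" if "c \<in> X" for c
    by (rule Sq.Bb.stab_tens[where h = "shi c"])
      (use that z Linv in \<open>simp_all add: Sq.S_N Sq.T_N\<close>)
  then show ?thesis unfolding kap_def Linv by (simp add: Sq.Bb.stab_finsum)
qed

lemma kap_closed: "z \<in> LS ==> kap z \<in> carrier ASS"
  using kap_stab by (simp add: Sq.Bb.stab_def)

lemmas wp_closed = Sq.Bb.AA.T.word_prod_closed[of _ LS kap, OF _ kap_closed]

text \<open>
  The product in the quotient is computed on representatives because those of the letters stabilise
  the null space.
\<close>

lemma word_prod_kapo: "ws \<in> lists LS ==> word_prod TO kapo ws = cls (word_prod ASS kap ws)"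
proof (induction ws)
  case (Cons z ws)
  then show ?case
    using Sq.Bb.over_mult[OF kap_stab[of z] wp_closed[of ws]] by (simp add: kapo_kap)
qed (simp add: Sq.Bb.over_one)

lemma comultL_lin: "alg_ext TO kapo \<in> lin_map FA TO"
  and comultL_word: "ws \<in> lists LS ==> alg_ext TO kapo (word ws) = cls (word_prod ASS kap ws)"
proof -
  have c: "word_prod TO kapo ws \<in> carrier TO" if "ws \<in> lists LS" for ws
    using lin_map_closed[OF cls_lin wp_closed[OF that]] by (simp add: word_prod_kapo[OF that])
  show "alg_ext TO kapo \<in> lin_map FA TO" by (rule alg_ext_lin[OF TO_kspace c])
  show "alg_ext TO kapo (word ws) = cls (word_prod ASS kap ws)" if "ws \<in> lists LS"
    using alg_ext_lin(2)[OF TO_kspace c that] by (simp add: word_prod_kapo[OF that])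
qed

text \<open>
  The comultiplication is evaluated on a representative, and only the part that survives
  multiplication by \<open>\<Delta>(1)\<close> is known to be independent of the choice.
\<close>

lemma asig_comult_rep:
  assumes "x \<in> carrier AS"
  obtains y where "y \<in> carrier FA" "x = Pa y"
    "asig_comult R eR X deg \<sigma> x = Sq.Bb.W (alg_ext TO kapo y)"
proof -
  obtain y where y: "y \<in> carrier FA" "x = Pa y" "induced (alg_ext TO kapo) x = alg_ext TO kapo y"
    using assms unfolding Asig_def by (rule induced_representative[OF FA.ks asig_sub])
  have "asig_comult R eR X deg \<sigma> x = Sq.Bb.W (asig_comultL R X deg \<sigma> x)"
    unfolding asig_comult_def
    by (rule Sq.Bb.wb_comult_eq[OF frob_elt_eR])
      (use lin_map_closed[OF comultL_lin y(1)] y(3) in \<open>simp add: asig_comultL_eq\<close>)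
  then show ?thesis using that y by (simp add: asig_comultL_eq)
qed

end

locale bialgebra_data = antipode_data R \<psi> I r1 r2 X deg \<sigma> A fp fm
  for R :: "('k::field, 'r) module" and \<psi> and I :: "'i set" and r1 r2
    and X :: "'x set" and deg :: "'x => 'l::finite => 'l" and \<sigma>
    and A :: "('k, 'a) module" (structure) and fp fm +
  fixes F \<Delta> \<epsilon>
  assumes F_hom: "F \<in> alg_hom AS A"
    and F_Phi: "\<forall>x\<in>carrier AW. F (Phi R X deg \<sigma> x) = fp x"
    and wb: "weak_bialgebra A \<Delta> \<epsilon>"
    and fp_wb: "fp \<in> weak_bialgebra_hom AW cw (aw_counit R \<psi>) A \<Delta> \<epsilon>"
begin

abbreviation "TA \<equiv> tensor A A"
abbreviation "ta2 \<equiv> tens A A"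
abbreviation "EA \<equiv> Aq.Bb.E"

lemmas F_lin = alg_hom_lin[OF F_hom]
lemmas F_closed [simp] = lin_map_closed[OF F_lin]
lemmas TA_kspace = Aq.Bb.AA.T.ks

lemma Delta_lin: "\<Delta> \<in> lin_map A TA" and eps_lin: "\<epsilon> \<in> lin_map A scalars"
  using wb by (simp_all add: weak_bialgebra_def coalgebra_def)

lemmas Delta_closed [simp] = lin_map_closed[OF Delta_lin]

lemma Delta_mult: "[|x \<in> carrier A; y \<in> carrier A|] ==> \<Delta> (x \<otimes> y) = \<Delta> x \<otimes>\<^sub>TA \<Delta> y"
  using wb by (simp add: weak_bialgebra_def)

lemma Delta_fp: "x \<in> carrier AW ==> \<Delta> (fp x) = tmap A fp (cw x)"
  using fp_wb by (simp add: weak_bialgebra_hom_def tmap_def)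

lemma eps_fp: "x \<in> carrier AW ==> \<epsilon> (fp x) = aw_counit R \<psi> x"
  using fp_wb by (simp add: weak_bialgebra_hom_def)

lemma F_letter: "z \<in> LS ==> F (aw [z]) = Ai.gen z"
  by (rule Ai.AS_hom_letter[OF F_hom Phi_hom_values[OF F_Phi]])

lemma F_L: "[|a \<in> X; b \<in> X|] ==> F (aw [L a b]) = lp a b"
  and F_Linv: "[|a \<in> X; b \<in> X|] ==> F (aw [Linv a b]) = Ak.km a b"
  by (subst F_letter; simp add: Ai.gen_def)+

lemma F_Scal: "[|f \<in> carrier M; g \<in> carrier M|] ==> F (aw [Scal (bt R f g)]) = Sp f \<otimes> Tp g"
  by (subst F_letter) (simp_all add: Ai.gen_Scal)

lemmas fpt_hom = tmap_hom[OF A.kalg_axioms W.kalg_axioms fp_hom]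
lemmas fpt_tens = tmap_tens[OF A.kalg_axioms W.kalg_axioms fp_hom]
lemmas Ft_hom = tmap_hom[OF A.kalg_axioms As.kalg_axioms F_hom]
lemmas Ft_tens = tmap_tens[OF A.kalg_axioms As.kalg_axioms F_hom]
lemmas Ft_lin = alg_hom_lin[OF Ft_hom]
lemmas Ft_closed [simp] = lin_map_closed[OF Ft_lin]

lemma fpt_EW: "tmap A fp EW = EA"
  unfolding Wq.Bb.E_def Aq.Bb.E_def
  by (subst lin_map_finsum[OF WW_kspace TA_kspace alg_hom_lin[OF fpt_hom]])
    (auto simp: fpt_tens Sp_def Tp_def intro!: Aq.Bb.AA.T.finsum_eqI)

lemma Ft_E: "tmap A F Sq.Bb.E = EA"
  unfolding Sq.Bb.E_def Aq.Bb.E_def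
  by (subst lin_map_finsum[OF ASS_kspace TA_kspace Ft_lin])
    (auto simp: Ft_tens Phi_hom_values[OF F_Phi] intro!: Aq.Bb.AA.T.finsum_eqI)

lemma Delta_one: "\<Delta> \<one> = EA"
  using Delta_fp[OF W.one_closed] by (simp add: alg_hom_one[OF fp_hom] cw_one fpt_EW)

lemma Delta_st: "[|f \<in> carrier M; g \<in> carrier M|] ==> \<Delta> (Sp f \<otimes> Tp g) = EA \<otimes>\<^sub>TA ta2 (Sp f) (Tp g)"
  using Delta_fp[of "sw f \<otimes>\<^sub>AW tw g"]
  by (simp add: cw_st alg_hom_mult[OF fpt_hom] fpt_EW fpt_tens fp_mult Sp_def Tp_def)

lemma Delta_l:
  assumes X: "a \<in> X" "b \<in> X"
  shows "\<Delta> (lp a b) = EA \<otimes>\<^sub>TA (\<Oplus>\<^sub>TA c\<in>X. ta2 (lp a c) (lp c b))"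
proof -
  note o = M.M.one_closed
  have "cw (Lw a b) = EW \<otimes>\<^sub>WW (\<Oplus>\<^sub>WW c\<in>X. tt (Lw a c) (Lw c b))"
  proof -
    have "(\<Oplus>\<^sub>WW c\<in>X. tt (sw \<one>\<^sub>M \<otimes>\<^sub>AW Lw a c) (tw \<one>\<^sub>M \<otimes>\<^sub>AW Lw c b))
        = (\<Oplus>\<^sub>WW c\<in>X. tt (Lw a c) (Lw c b))"
      by (rule Wq.Bb.AA.T.finsum_eqI) (use X in \<open>auto simp: Wq.S_one Wq.T_one\<close>)
    then show ?thesis using cw_stL[OF o o X] X by (simp add: Wq.S_one Wq.T_one)
  qed
  moreover have "tmap A fp (\<Oplus>\<^sub>WW c\<in>X. tt (Lw a c) (Lw c b)) = (\<Oplus>\<^sub>TA c\<in>X. ta2 (lp a c) (lp c b))"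
    by (subst lin_map_finsum[OF WW_kspace TA_kspace alg_hom_lin[OF fpt_hom]])
      (use X in \<open>auto simp: fpt_tens lp_def intro!: Aq.Bb.AA.T.finsum_eqI\<close>)
  moreover have "(\<Oplus>\<^sub>WW c\<in>X. tt (Lw a c) (Lw c b)) \<in> carrier WW"
    using X by (intro Wq.Bb.AA.T.finsum_closed) auto
  ultimately show ?thesis
    using Delta_fp[OF Lw_closed[OF X]] by (simp add: alg_hom_mult[OF fpt_hom] fpt_EW lp_def)
qed

lemma EA_Delta: "x \<in> carrier A ==> EA \<otimes>\<^sub>TA \<Delta> x = \<Delta> x \<and> \<Delta> x \<otimes>\<^sub>TA EA = \<Delta> x"
  unfolding Delta_one[symmetric] by (simp flip: Delta_mult)

text \<open>
  The matrices \<open>\<Sum>\<^sub>c L\<^sub>a\<^sub>c \<otimes> L\<^sub>c\<^sub>b\<close> and \<open>\<Sum>\<^sub>c (L\<^sup>-\<^sup>1)\<^sub>c\<^sub>b \<otimes> (L\<^sup>-\<^sup>1)\<^sub>a\<^sub>c\<close> are inverse to each other.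
\<close>

lemma tensor_matrix_inverse:
  assumes X: "a \<in> X" "b \<in> X"
  shows "(\<Oplus>\<^sub>TA c\<in>X. (\<Oplus>\<^sub>TA d\<in>X. ta2 (lp a d) (lp d c)) \<otimes>\<^sub>TA (\<Oplus>\<^sub>TA e\<in>X. ta2 (Ak.km e b) (Ak.km c e)))
    = (if a = b then \<one>\<^sub>TA else \<zero>\<^sub>TA)"
proof -
  note T = Aq.Bb.AA.T.finsum_eqI and cl = Aq.Bb.AA.T.finsum_closed
  let ?t = "\<lambda>d e c. ta2 (lp a d \<otimes> Ak.km e b) (lp d c \<otimes> Ak.km c e)"
  have "(\<Oplus>\<^sub>TA c\<in>X. (\<Oplus>\<^sub>TA d\<in>X. ta2 (lp a d) (lp d c)) \<otimes>\<^sub>TA (\<Oplus>\<^sub>TA e\<in>X. ta2 (Ak.km e b) (Ak.km c e)))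
      = (\<Oplus>\<^sub>TA c\<in>X. \<Oplus>\<^sub>TA d\<in>X. \<Oplus>\<^sub>TA e\<in>X. ?t d e c)"
  proof (rule T)
    fix c assume c: "c \<in> X"
    have "(\<Oplus>\<^sub>TA d\<in>X. ta2 (lp a d) (lp d c)) \<otimes>\<^sub>TA (\<Oplus>\<^sub>TA e\<in>X. ta2 (Ak.km e b) (Ak.km c e))
        = (\<Oplus>\<^sub>TA d\<in>X. \<Oplus>\<^sub>TA e\<in>X. ta2 (lp a d) (lp d c) \<otimes>\<^sub>TA ta2 (Ak.km e b) (Ak.km c e))"
      by (rule Aq.Bb.AA.T.finsum_mult) (use X c in auto)
    also have "\<dots> = (\<Oplus>\<^sub>TA d\<in>X. \<Oplus>\<^sub>TA e\<in>X. ?t d e c)"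
      by (rule T, rule T) (use X c in \<open>auto simp: Aq.Bb.AA.tens_mult intro!: cl\<close>)
    finally show "(\<Oplus>\<^sub>TA d\<in>X. ta2 (lp a d) (lp d c)) \<otimes>\<^sub>TA (\<Oplus>\<^sub>TA e\<in>X. ta2 (Ak.km e b) (Ak.km c e))
        = (\<Oplus>\<^sub>TA d\<in>X. \<Oplus>\<^sub>TA e\<in>X. ?t d e c)" .
  qed (use X in \<open>auto intro!: cl\<close>)
  also have "\<dots> = (\<Oplus>\<^sub>TA d\<in>X. \<Oplus>\<^sub>TA c\<in>X. \<Oplus>\<^sub>TA e\<in>X. ?t d e c)"
    by (rule Aq.Bb.AA.T.finsum_swap) (use X in \<open>auto intro!: cl\<close>)
  also have "\<dots> = (\<Oplus>\<^sub>TA d\<in>X. \<Oplus>\<^sub>TA e\<in>X. \<Oplus>\<^sub>TA c\<in>X. ?t d e c)"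
    by (rule T, rule Aq.Bb.AA.T.finsum_swap) (use X in \<open>auto intro!: cl\<close>)
  also have "\<dots> = (\<Oplus>\<^sub>TA d\<in>X. \<Oplus>\<^sub>TA e\<in>X. if d = e then ta2 (lp a d \<otimes> Ak.km e b) \<one> else \<zero>\<^sub>TA)"
  proof (rule T, rule T)
    fix d e assume de: "d \<in> X" "e \<in> X"
    have "(\<Oplus>\<^sub>TA c\<in>X. ?t d e c) = ta2 (lp a d \<otimes> Ak.km e b) (\<Oplus>c\<in>X. lp d c \<otimes> Ak.km c e)"
      by (rule Aq.Bb.AA.tens_sum_right[symmetric]) (use X de in auto)
    also have "\<dots> = (if d = e then ta2 (lp a d \<otimes> Ak.km e b) \<one> else \<zero>\<^sub>TA)"
      using X de by (simp add: Ak.el_km)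
    finally show "(\<Oplus>\<^sub>TA c\<in>X. ?t d e c) = (if d = e then ta2 (lp a d \<otimes> Ak.km e b) \<one> else \<zero>\<^sub>TA)" .
  qed (use X in \<open>auto intro!: cl\<close>)
  also have "\<dots> = (\<Oplus>\<^sub>TA d\<in>X. ta2 (lp a d \<otimes> Ak.km d b) \<one>)"
    by (rule T, subst Aq.Bb.AA.T.finsum_delta') (use X in auto)
  also have "\<dots> = ta2 (\<Oplus>d\<in>X. lp a d \<otimes> Ak.km d b) \<one>"
    by (rule Aq.Bb.AA.tens_sum_left[symmetric]) (use X in auto)
  finally show ?thesis using X by (simp add: Ak.el_km Aq.Bb.AA.tens_one)
qed

text \<open>
  Both sides are inverse to the matrix \<open>\<Delta>(lp a b)\<close> with \<open>\<Delta>(1)\<close> as unit.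
\<close>

lemma Delta_k:
  assumes X: "a \<in> X" "b \<in> X"
  shows "\<Delta> (Ak.km a b) = EA \<otimes>\<^sub>TA (\<Oplus>\<^sub>TA c\<in>X. ta2 (Ak.km c b) (Ak.km a c))"
proof (rule Aq.Bb.AA.T.inverse_matrix_unique[where X = X and u = EA and e = "\<lambda>a b. \<Delta> (lp a b)"
      and n = "\<lambda>a b. \<Delta> (Ak.km a b)" and n' = "\<lambda>a b. EA \<otimes>\<^sub>TA (\<Oplus>\<^sub>TA c\<in>X. ta2 (Ak.km c b) (Ak.km a c))"])
  note cl = Aq.Bb.AA.T.finsum_closed
  have kc: "(\<Oplus>\<^sub>TA c\<in>X. ta2 (Ak.km c b) (Ak.km a c)) \<in> carrier TA" if "a \<in> X" "b \<in> X" for a b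
    using that by (intro cl) auto
  have lc: "(\<Oplus>\<^sub>TA c\<in>X. ta2 (lp a c) (lp c b)) \<in> carrier TA" if "a \<in> X" "b \<in> X" for a b
    using that by (intro cl) auto
  have EE: "EA \<otimes>\<^sub>TA EA = EA" using EA_Delta[OF A.one_closed] by (simp add: Delta_one)
  fix a b assume X: "a \<in> X" "b \<in> X"
  show "\<Delta> (Ak.km a b) \<in> carrier TA \<and> \<Delta> (lp a b) \<in> carrier TA \<and>
      EA \<otimes>\<^sub>TA (\<Oplus>\<^sub>TA c\<in>X. ta2 (Ak.km c b) (Ak.km a c)) \<in> carrier TA"
    using X kc[OF X] by simp
  show "\<Delta> (Ak.km a b) \<otimes>\<^sub>TA EA = \<Delta> (Ak.km a b) \<and>
      EA \<otimes>\<^sub>TA (EA \<otimes>\<^sub>TA (\<Oplus>\<^sub>TA c\<in>X. ta2 (Ak.km c b) (Ak.km a c)))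
      = EA \<otimes>\<^sub>TA (\<Oplus>\<^sub>TA c\<in>X. ta2 (Ak.km c b) (Ak.km a c))"
    using X kc[OF X] by (simp add: EA_Delta EE flip: Aq.Bb.AA.T.m_assoc)
  have "(\<Oplus>\<^sub>TA c\<in>X. \<Delta> (Ak.km a c) \<otimes>\<^sub>TA \<Delta> (lp c b)) = \<Delta> (\<Oplus>c\<in>X. Ak.km a c \<otimes> lp c b)"
    by (subst lin_map_finsum[OF A.ks TA_kspace Delta_lin])
      (use X in \<open>auto simp: Delta_mult intro!: Aq.Bb.AA.T.finsum_eqI\<close>)
  then show "(\<Oplus>\<^sub>TA c\<in>X. \<Delta> (Ak.km a c) \<otimes>\<^sub>TA \<Delta> (lp c b)) = (if a = b then EA else \<zero>\<^sub>TA)"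
    using X by (simp add: Ak.km_el Delta_one lin_map_zero[OF A.ks TA_kspace Delta_lin])
  have "(\<Oplus>\<^sub>TA c\<in>X. \<Delta> (lp a c) \<otimes>\<^sub>TA (EA \<otimes>\<^sub>TA (\<Oplus>\<^sub>TA e\<in>X. ta2 (Ak.km e b) (Ak.km c e))))
      = (\<Oplus>\<^sub>TA c\<in>X. EA \<otimes>\<^sub>TA ((\<Oplus>\<^sub>TA d\<in>X. ta2 (lp a d) (lp d c)) \<otimes>\<^sub>TA (\<Oplus>\<^sub>TA e\<in>X. ta2 (Ak.km e b) (Ak.km c e))))"
  proof (rule Aq.Bb.AA.T.finsum_eqI)
    fix c assume c: "c \<in> X"
    show "\<Delta> (lp a c) \<otimes>\<^sub>TA (EA \<otimes>\<^sub>TA (\<Oplus>\<^sub>TA e\<in>X. ta2 (Ak.km e b) (Ak.km c e)))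
      = EA \<otimes>\<^sub>TA ((\<Oplus>\<^sub>TA d\<in>X. ta2 (lp a d) (lp d c)) \<otimes>\<^sub>TA (\<Oplus>\<^sub>TA e\<in>X. ta2 (Ak.km e b) (Ak.km c e)))"
      using X c kc[OF c X(2)] lc[OF X(1) c] EA_Delta[of "lp a c"] Delta_l[OF X(1) c]
      by (simp flip: Aq.Bb.AA.T.m_assoc)
    show "EA \<otimes>\<^sub>TA ((\<Oplus>\<^sub>TA d\<in>X. ta2 (lp a d) (lp d c)) \<otimes>\<^sub>TA (\<Oplus>\<^sub>TA e\<in>X. ta2 (Ak.km e b) (Ak.km c e))) \<in> carrier TA"
      using kc[OF c X(2)] lc[OF X(1) c] by simp
  qed
  also have "\<dots> = EA \<otimes>\<^sub>TA (\<Oplus>\<^sub>TA c\<in>X. (\<Oplus>\<^sub>TA d\<in>X. ta2 (lp a d) (lp d c)) \<otimes>\<^sub>TA (\<Oplus>\<^sub>TA e\<in>X. ta2 (Ak.km e b) (Ak.km c e)))"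
    by (rule Aq.Bb.AA.T.finsum_rdistr[symmetric]) (use X kc lc in auto)
  finally show "(\<Oplus>\<^sub>TA c\<in>X. \<Delta> (lp a c) \<otimes>\<^sub>TA (EA \<otimes>\<^sub>TA (\<Oplus>\<^sub>TA e\<in>X. ta2 (Ak.km e b) (Ak.km c e))))
      = (if a = b then EA else \<zero>\<^sub>TA)"
    using tensor_matrix_inverse[OF X] by simp
qed (use X in auto)

lemma Delta_letter:
  assumes z: "z \<in> LS" shows "\<Delta> (F (aw [z])) = EA \<otimes>\<^sub>TA tmap A F (kap z)"
proof (cases z)
  case (Scal u)
  have 1: "(\<lambda>u. F (aw [Scal u])) \<in> lin_map (tensor M (opp M)) A"
    using rep_comp[OF A.kalg_axioms F_hom] by (simp add: asig_rep_def alg_hom_lin base_env_def)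
  have "\<Delta> (F (aw [Scal u])) = EA \<otimes>\<^sub>TA tmap A F (kap (Scal u))"
  proof (rule MO.tensor_map_eqI[OF lin_map_comp[OF 1 Delta_lin]
        lin_map_comp[OF lin_map_comp[OF kap_Scal_lin Ft_lin] Aq.Bb.AA.T.mult_left_lin]])
    show "EA \<in> carrier TA" by simp
    show "u \<in> carrier (tensor M (opp M))" using z Scal by (simp add: base_env_def)
    fix f g assume "f \<in> carrier M" "g \<in> carrier (opp M)"
    then have c: "f \<in> carrier M" "g \<in> carrier M" by simp_all
    show "\<Delta> (F (aw [Scal (tens M (opp M) f g)])) = EA \<otimes>\<^sub>TA tmap A F (kap (Scal (tens M (opp M) f g)))"
      unfolding kap_Scal[OF c] F_Scal[OF c, unfolded bt_def] Delta_st[OF c]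
      using c by (simp add: Ft_tens Phi_hom_values[OF F_Phi])
  qed
  then show ?thesis using Scal by simp
next
  case (L a b)
  then have X: "a \<in> X" "b \<in> X" using z by simp_all
  have "tmap A F (kap z) = (\<Oplus>\<^sub>TA c\<in>X. ta2 (lp a c) (lp c b))"
    unfolding L kap_def letter.case
    by (subst lin_map_finsum[OF ASS_kspace TA_kspace Ft_lin])
      (use X in \<open>auto simp: Ft_tens F_L intro!: Aq.Bb.AA.T.finsum_eqI\<close>)
  then show ?thesis using X by (simp add: L F_L Delta_l)
next
  case (Linv a b)
  then have X: "a \<in> X" "b \<in> X" using z by simp_all
  have "tmap A F (kap z) = (\<Oplus>\<^sub>TA c\<in>X. ta2 (Ak.km c b) (Ak.km a c))"
    unfolding Linv kap_def letter.case
    by (subst lin_map_finsum[OF ASS_kspace TA_kspace Ft_lin])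
      (use X in \<open>auto simp: Ft_tens F_Linv intro!: Aq.Bb.AA.T.finsum_eqI\<close>)
  then show ?thesis using X by (simp add: Linv F_Linv Delta_k)
qed

text \<open>
  The idempotent \<open>EA = \<Delta>(1)\<close> appearing after each letter is absorbed since it is a right unit for
  values of \<open>\<Delta>\<close>.
\<close>

lemma Delta_word:
  "ws \<in> lists LS ==> \<Delta> (F (aw ws)) = EA \<otimes>\<^sub>TA tmap A F (word_prod ASS kap ws)"
proof (induction ws)
  case Nil
  then show ?case by (simp add: aw_Nil alg_hom_one[OF F_hom] Delta_one alg_hom_one[OF Ft_hom])
next
  case (Cons z ws)
  then have z: "z \<in> LS" and ws: "ws \<in> lists LS" by simp_all
  note c = kap_closed[OF z] wp_closed[OF ws]
  have "\<Delta> (F (aw (z # ws))) = \<Delta> (F (aw [z])) \<otimes>\<^sub>TA \<Delta> (F (aw ws))"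
    unfolding aw_Cons[OF z ws] using z ws by (simp add: alg_hom_mult[OF F_hom] Delta_mult)
  also have "\<dots> = \<Delta> (F (aw [z])) \<otimes>\<^sub>TA EA \<otimes>\<^sub>TA tmap A F (word_prod ASS kap ws)"
    using z ws c Cons.IH[OF ws] by (simp add: Aq.Bb.AA.T.m_assoc)
  also have "\<Delta> (F (aw [z])) \<otimes>\<^sub>TA EA = EA \<otimes>\<^sub>TA tmap A F (kap z)"
    using z EA_Delta[of "F (aw [z])"] by (simp add: Delta_letter)
  finally show ?case using c by (simp add: alg_hom_mult[OF Ft_hom] Aq.Bb.AA.T.m_assoc)
qed

lemma comult_compatible:
  assumes x: "x \<in> carrier AS"
  shows "\<Delta> (F x) = tmap A F (asig_comult R eR X deg \<sigma> x)"
proof -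
  obtain y where y: "y \<in> carrier FA" "x = Pa y" "asig_comult R eR X deg \<sigma> x = Sq.Bb.W (alg_ext TO kapo y)"
    by (rule asig_comult_rep[OF x])
  have "\<Delta> (F (Pa y)) = tmap A F (Sq.Bb.W (alg_ext TO kapo y))"
  proof (rule free_alg_lin_eqI[OF TA_kspace lin_map_comp[OF lin_map_comp[OF Pa_lin F_lin] Delta_lin]
        lin_map_comp[OF lin_map_comp[OF comultL_lin Sq.Bb.W_lin] Ft_lin] _ y(1)])
    fix ws :: "('k, 'r, 'l, 'x) lett list" assume ws: "ws \<in> lists LS"
    show "\<Delta> (F (Pa (word ws))) = tmap A F (Sq.Bb.W (alg_ext TO kapo (word ws)))"
    proof -
      have "Sq.Bb.W (alg_ext TO kapo (word ws)) = Sq.Bb.E \<otimes>\<^sub>ASS word_prod ASS kap ws"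
        unfolding comultL_word[OF ws] by (rule Sq.Bb.W_coset[OF wp_closed[OF ws]])
      then show ?thesis
        unfolding Pa_word Delta_word[OF ws]
        using wp_closed[OF ws] by (simp only: alg_hom_mult[OF Ft_hom] Ft_E Sq.Bb.E_closed)
    qed
  qed
  then show ?thesis using y by simp
qed

end

section \<open>Compatibility with counits\<close>

context dyb
begin

text \<open>The operators on \<open>M\<close> by which the generators act.\<close>

definition chi :: "('k, 'r, 'l, 'x) lett => ('l => 'r) => ('l => 'r)" where
  "chi z = (case z of Scal u => tlift EM (\<lambda>f g. \<lambda>h\<in>carrier M. f \<otimes>\<^sub>M h \<otimes>\<^sub>M g) u
     | L a b => (if a = b then (\<lambda>h\<in>carrier M. sh a h) else \<zero>\<^sub>EM)
     | Linv a b => (if a = b then (\<lambda>h\<in>carrier M. shi a h) else \<zero>\<^sub>EM))"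

lemma asig_pi_eq: "asig_pi R deg x = induced (alg_ext EM chi) x \<one>\<^sub>M"
  unfolding asig_pi_def asig_chi_def chi_def Let_def ..

lemma sandwich_bilin: "bilin M (opp M) EM (\<lambda>f g. \<lambda>h\<in>carrier M. f \<otimes>\<^sub>M h \<otimes>\<^sub>M g)"
proof -
  have c: "(\<lambda>h\<in>carrier M. f \<otimes>\<^sub>M h \<otimes>\<^sub>M g) \<in> carrier EM" if "f \<in> carrier M" "g \<in> carrier M" for f g
    by (rule end_alg_carrierI[OF M.M.ks
          lin_map_comp[OF M.M.mult_left_lin[OF that(1)] M.M.mult_right_lin[OF that(2)]]])
  show ?thesis
    unfolding bilin_def lin_map_opp opp_simps
    by (intro conjI ballI lin_mapI c)
      (simp_all add: end_alg_simps restrict_def fun_eq_iff M.M.l_distr M.M.r_distr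
        M.M.smult_mult_left M.M.smult_mult_right)
qed

lemma chi_Scal_lin: "(\<lambda>u. chi (Scal u)) \<in> lin_map (tensor M (opp M)) EM"
  unfolding chi_def using MO.tlift_lin[OF EM.ks sandwich_bilin] by simp

lemma chi_Scal: "[|f \<in> carrier M; g \<in> carrier M; h \<in> carrier M|] ==>
    chi (Scal (tens M (opp M) f g)) h = f \<otimes>\<^sub>M h \<otimes>\<^sub>M g"
  by (simp add: chi_def MO.tlift_tens[OF EM.ks sandwich_bilin])

lemma chi_closed:
  assumes "z \<in> LS" shows "chi z \<in> carrier EM"
proof (cases z)
  case (Scal u)
  then show ?thesis
    using assms lin_map_closed[OF chi_Scal_lin, of u] by (simp add: base_env_def)
qed (auto simp: chi_def intro!: end_alg_carrierI[OF M.M.ks shift_lin])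

lemmas wchi_closed = EM.word_prod_closed[of _ LS chi, OF _ chi_closed]

lemma EM_value_closed: "[|g \<in> carrier EM; h \<in> carrier M|] ==> g h \<in> carrier M"
  by (auto simp: end_alg_simps dest: lin_map_closed)

lemma chi_L: "h \<in> carrier M ==> chi (L a b) h = (if a = b then sh a h else \<zero>\<^sub>M)"
  and chi_Linv: "h \<in> carrier M ==> chi (Linv a b) h = (if a = b then shi a h else \<zero>\<^sub>M)"
  by (simp_all add: chi_def end_alg_simps)

end

context bialgebra_data
begin

text \<open>
  This is the weak multiplicativity \<open>\<epsilon>(a b\<^sub>2) \<epsilon>(b\<^sub>1 x) = \<epsilon>(a b x)\<close> at \<open>b = 1\<close>. It implies that values of
  \<open>\<epsilon>\<close> need to be compared only after multiplication by \<open>T f\<close> from the left.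
\<close>

lemma eps_split:
  assumes a: "a \<in> carrier A" and x: "x \<in> carrier A"
  shows "\<epsilon> (a \<otimes> x) = (\<Oplus>\<^bsub>scalars\<^esub>j\<in>J. \<epsilon> (a \<otimes> Sp (f2 j)) * \<epsilon> (Tp (f1 j) \<otimes> x))"
proof -
  have ml: "(\<lambda>r. r * c) \<in> lin_map scalars scalars" "(\<lambda>r. c * r) \<in> lin_map scalars scalars" for c :: 'k
    by (rule lin_mapI; simp add: algebra_simps)+
  have b: "bilin A A scalars (\<lambda>u v. \<epsilon> (a \<otimes> v) * \<epsilon> (u \<otimes> x))"
    by (intro bilinI lin_map_comp[OF lin_map_comp[OF A.mult_left_lin[OF a] eps_lin] ml(1)]
        lin_map_comp[OF lin_map_comp[OF A.mult_right_lin[OF x] eps_lin] ml(2)])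
  have "\<forall>a\<in>carrier A. \<forall>b\<in>carrier A. \<forall>c\<in>carrier A.
      tlift scalars (\<lambda>u v. \<epsilon> (a \<otimes> v) * \<epsilon> (u \<otimes> c)) (\<Delta> b) = \<epsilon> (a \<otimes> b \<otimes> c)"
    using wb unfolding weak_bialgebra_def by blast
  then have "\<epsilon> (a \<otimes> \<one> \<otimes> x)
      = tlift scalars (\<lambda>u v. \<epsilon> (a \<otimes> v) * \<epsilon> (u \<otimes> x)) (\<Delta> \<one>)"
    using a x by simp
  also have "\<dots> = (\<Oplus>\<^bsub>scalars\<^esub>j\<in>J. \<epsilon> (a \<otimes> Sp (f2 j)) * \<epsilon> (Tp (f1 j) \<otimes> x))"
    unfolding Delta_one Aq.Bb.E_def
    by (rule Aq.Bb.AA.tlift_sum[OF kspace_scalars b]) auto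
  finally show ?thesis using a x by simp
qed

lemma eps_cong:
  assumes xy: "x \<in> carrier A" "y \<in> carrier A"
    and eq: "\<And>f. f \<in> carrier M ==> \<epsilon> (Tp f \<otimes> x) = \<epsilon> (Tp f \<otimes> y)" and a: "a \<in> carrier A"
  shows "\<epsilon> (a \<otimes> x) = \<epsilon> (a \<otimes> y)"
proof -
  interpret K: kspace "scalars :: ('k, 'k) module" by (rule kspace_scalars)
  show ?thesis
    unfolding eps_split[OF a xy(1)] eps_split[OF a xy(2)] by (rule K.finsum_eqI) (simp_all add: eq)
qed

lemma eps_st:
  assumes "f \<in> carrier M" "g \<in> carrier M"
  shows "\<epsilon> (Sp f \<otimes> Tp g) = frob_form \<psi> (f \<otimes>\<^sub>M g)"
  using eps_fp[of "sw f \<otimes>\<^sub>AW tw g"] assms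
  by (simp add: fp_mult Sp_def Tp_def aw_counit_def wb_counit_def pw_st)

lemma eps_T_S: "[|f \<in> carrier M; g \<in> carrier M|] ==> \<epsilon> (Tp g \<otimes> Sp f) = frob_form \<psi> (f \<otimes>\<^sub>M g)"
  by (simp add: Aq.TS eps_st)

lemma eps_zero: "\<epsilon> \<zero> = 0"
  using lin_map_zero[OF A.ks kspace_scalars eps_lin] by simp

lemma eps_l:
  assumes X: "a \<in> X" "b \<in> X" and h: "h \<in> carrier M" and x: "x \<in> carrier A"
  shows "\<epsilon> (x \<otimes> (lp a b \<otimes> Sp h)) = (if a = b then \<epsilon> (x \<otimes> Sp (sh a h)) else 0)"
proof -
  have "\<epsilon> (x \<otimes> (lp a b \<otimes> Sp h)) = \<epsilon> (x \<otimes> (if a = b then Sp (sh a h) else \<zero>))"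
  proof (rule eps_cong[OF _ _ _ x])
    fix f assume f: "f \<in> carrier M"
    have "Tp f \<otimes> (lp a b \<otimes> Sp h) = Tp f \<otimes> Sp (sh a h) \<otimes> lp a b"
      using X h f by (simp add: Aq.el_S A.m_assoc)
    also have "\<dots> = fp (stL (sh a h) f a b)" using X h f by (simp add: Aq.TS fp_stL)
    finally show "\<epsilon> (Tp f \<otimes> (lp a b \<otimes> Sp h)) = \<epsilon> (Tp f \<otimes> (if a = b then Sp (sh a h) else \<zero>))"
      using X h f by (simp add: eps_fp counit_stL eps_T_S eps_zero)
  qed (use X h in auto)
  then show ?thesis using x by (simp add: eps_zero split: if_splits)
qed

text \<open>
  Every generator acts on \<open>S(h)\<close>, seen through \<open>\<epsilon>\<close>, by the operator \<open>\<chi>\<close>. For \<open>L\<^sup>-\<^sup>1\<close> this follows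
  from the case of \<open>L\<close> and \<open>\<Sum>\<^sub>b (L\<^sup>-\<^sup>1)\<^sub>a\<^sub>b L\<^sub>b\<^sub>c = \<delta>\<close>.
\<close>

lemma eps_letter:
  assumes z: "z \<in> LS" and h: "h \<in> carrier M" and x: "x \<in> carrier A"
  shows "\<epsilon> (x \<otimes> (F (aw [z]) \<otimes> Sp h)) = \<epsilon> (x \<otimes> Sp (chi z h))"
proof (cases z)
  case (Scal u)
  have 1: "(\<lambda>u. F (aw [Scal u])) \<in> lin_map (tensor M (opp M)) A"
    using rep_comp[OF A.kalg_axioms F_hom] by (simp add: asig_rep_def alg_hom_lin base_env_def)
  have "\<epsilon> (x \<otimes> (F (aw [Scal u]) \<otimes> Sp h)) = \<epsilon> (x \<otimes> Sp (chi (Scal u) h))"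
  proof (rule MO.tensor_map_eqI[OF
        lin_map_comp[OF lin_map_comp[OF lin_map_comp[OF 1 A.mult_right_lin] A.mult_left_lin] eps_lin]
        lin_map_comp[OF lin_map_comp[OF lin_map_comp[OF lin_map_comp[OF chi_Scal_lin
          end_alg_eval_lin[OF h]] Aq.S_lin] A.mult_left_lin] eps_lin]])
    show "Sp h \<in> carrier A" "x \<in> carrier A" "x \<in> carrier A" using h x by simp_all
    show "u \<in> carrier (tensor M (opp M))" using z Scal by (simp add: base_env_def)
    fix f g assume "f \<in> carrier M" "g \<in> carrier (opp M)"
    then have c: "f \<in> carrier M" "g \<in> carrier M" by simp_all
    show "\<epsilon> (x \<otimes> (F (aw [Scal (tens M (opp M) f g)]) \<otimes> Sp h))
        = \<epsilon> (x \<otimes> Sp (chi (Scal (tens M (opp M) f g)) h))"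
      unfolding F_Scal[OF c, unfolded bt_def] chi_Scal[OF c h]
    proof (rule eps_cong[OF _ _ _ x])
      fix f' assume f': "f' \<in> carrier M"
      have "Tp f' \<otimes> (Sp f \<otimes> Tp g \<otimes> Sp h) = (Tp f' \<otimes> Sp f) \<otimes> (Tp g \<otimes> Sp h)"
        using c h f' by (simp add: A.m_assoc)
      also have "\<dots> = Sp f \<otimes> (Tp f' \<otimes> Sp h) \<otimes> Tp g"
        unfolding Aq.TS[OF c(1) f'] Aq.TS[OF h c(2)] using c h f' by (simp add: A.m_assoc)
      also have "\<dots> = Sp (f \<otimes>\<^sub>M h) \<otimes> Tp (g \<otimes>\<^sub>M f')"
        unfolding Aq.TS[OF h f'] using c h f' by (simp add: Aq.S_mult Aq.T_mult A.m_assoc)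
      finally show "\<epsilon> (Tp f' \<otimes> (Sp f \<otimes> Tp g \<otimes> Sp h)) = \<epsilon> (Tp f' \<otimes> Sp (f \<otimes>\<^sub>M h \<otimes>\<^sub>M g))"
        using c h f' by (simp only: eps_st eps_T_S M.M.m_closed M.M.m_assoc)
    qed (use c h in auto)
  qed
  then show ?thesis using Scal by simp
next
  case (L a b)
  then show ?thesis
    using z h x by (simp add: F_L chi_L eps_l Aq.S_zero eps_zero)
next
  case (Linv a c)
  then have X: "a \<in> X" "c \<in> X" using z by simp_all
  interpret K: kspace "scalars :: ('k, 'k) module" by (rule kspace_scalars)
  let ?h = "shi c h"
  have hc: "?h \<in> carrier M" using h by simp
  have "(\<Oplus>b\<in>X. x \<otimes> Ak.km a b \<otimes> (lp b c \<otimes> Sp ?h))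
      = x \<otimes> ((\<Oplus>b\<in>X. Ak.km a b \<otimes> lp b c) \<otimes> Sp ?h)"
    using X hc x by (subst A.finsum_ldistr, simp, simp, simp, subst A.finsum_rdistr)
      (auto simp: A.m_assoc intro!: A.finsum_eqI)
  also have "\<dots> = (if a = c then x \<otimes> Sp ?h else \<zero>)"
    using X hc x by (simp add: Ak.km_el)
  finally have "\<epsilon> (if a = c then x \<otimes> Sp ?h else \<zero>)
      = \<epsilon> (\<Oplus>b\<in>X. x \<otimes> Ak.km a b \<otimes> (lp b c \<otimes> Sp ?h))" by simp
  also have "\<dots> = (\<Oplus>\<^bsub>scalars\<^esub>b\<in>X. \<epsilon> (x \<otimes> Ak.km a b \<otimes> (lp b c \<otimes> Sp ?h)))"
    by (rule lin_map_finsum[OF A.ks kspace_scalars eps_lin]) (use X hc x in auto)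
  also have "\<dots> = (\<Oplus>\<^bsub>scalars\<^esub>b\<in>X. if b = c then \<epsilon> (x \<otimes> Ak.km a b \<otimes> Sp (sh b ?h)) else \<zero>\<^bsub>scalars\<^esub>)"
    by (rule K.finsum_eqI) (use X hc x in \<open>simp_all add: eps_l\<close>)
  also have "\<dots> = \<epsilon> (x \<otimes> Ak.km a c \<otimes> Sp h)"
    by (subst K.finsum_delta) (use X in simp_all)
  finally show ?thesis
    using X h x by (simp add: Linv F_Linv chi_Linv A.m_assoc Aq.S_zero eps_zero split: if_splits)
qed

lemma eps_word:
  "[|ws \<in> lists LS; x \<in> carrier A|] ==>
   \<epsilon> (x \<otimes> F (aw ws)) = \<epsilon> (x \<otimes> Sp (word_prod EM chi ws \<one>\<^sub>M))"
proof (induction ws arbitrary: x)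
  case Nil
  then show ?case by (simp add: aw_Nil alg_hom_one[OF F_hom] end_alg_simps Aq.S_one)
next
  case (Cons z ws)
  then have z: "z \<in> LS" and ws: "ws \<in> lists LS" and x: "x \<in> carrier A" by simp_all
  let ?h = "word_prod EM chi ws \<one>\<^sub>M"
  have hc: "?h \<in> carrier M" by (rule EM_value_closed[OF wchi_closed[OF ws] M.M.one_closed])
  have "\<epsilon> (x \<otimes> F (aw (z # ws))) = \<epsilon> ((x \<otimes> F (aw [z])) \<otimes> F (aw ws))"
    unfolding aw_Cons[OF z ws] using z ws x by (simp add: alg_hom_mult[OF F_hom] A.m_assoc)
  also have "\<dots> = \<epsilon> (x \<otimes> F (aw [z]) \<otimes> Sp ?h)"
    by (rule Cons.IH[OF ws]) (use z x in simp)
  also have "\<dots> = \<epsilon> (x \<otimes> Sp (chi z ?h))"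
    using eps_letter[OF z hc x] z x hc by (simp add: A.m_assoc)
  finally show ?case by (simp add: end_alg_simps)
qed

lemma counit_compatible:
  assumes x: "x \<in> carrier AS"
  shows "\<epsilon> (F x) = asig_counit R \<psi> deg x"
proof -
  have c: "word_prod EM chi ws \<in> carrier EM" if "ws \<in> lists LS" for ws
    by (rule wchi_closed[OF that])
  have lin: "alg_ext EM chi \<in> lin_map FA EM" by (rule alg_ext_lin[OF EM.ks c])
  have word: "alg_ext EM chi (word ws) = word_prod EM chi ws" if "ws \<in> lists LS" for ws
    by (rule alg_ext_lin(2)[OF EM.ks c that])
  obtain y where y: "y \<in> carrier FA" "x = Pa y" "induced (alg_ext EM chi) x = alg_ext EM chi y"
    using x unfolding Asig_def by (rule induced_representative[OF FA.ks asig_sub])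
  have "\<epsilon> (F (Pa y)) = frob_form \<psi> (alg_ext EM chi y \<one>\<^sub>M)"
  proof (rule free_alg_lin_eqI[OF kspace_scalars lin_map_comp[OF lin_map_comp[OF Pa_lin F_lin] eps_lin]
        lin_map_comp[OF lin_map_comp[OF lin end_alg_eval_lin[OF M.M.one_closed]] M.\<psi>_lin] _ y(1)])
    fix ws :: "('k, 'r, 'l, 'x) lett list" assume ws: "ws \<in> lists LS"
    let ?h = "word_prod EM chi ws \<one>\<^sub>M"
    have hc: "?h \<in> carrier M" by (rule EM_value_closed[OF wchi_closed[OF ws] M.M.one_closed])
    have "\<epsilon> (F (aw ws)) = \<epsilon> (Sp ?h)" using eps_word[OF ws A.one_closed] ws hc by simp
    also have "\<dots> = frob_form \<psi> ?h"
      using eps_st[OF hc M.M.one_closed] hc by (simp add: Aq.T_one)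
    finally show "\<epsilon> (F (Pa (word ws))) = frob_form \<psi> (alg_ext EM chi (word ws) \<one>\<^sub>M)"
      unfolding Pa_word word[OF ws] .
  qed
  then show ?thesis using y by (simp add: asig_counit_def wb_counit_def asig_pi_eq)
qed

theorem ext_weak_bialgebra_hom:
  "F \<in> weak_bialgebra_hom AS (asig_comult R eR X deg \<sigma>) (asig_counit R \<psi> deg) A \<Delta> \<epsilon>"
  using F_hom comult_compatible counit_compatible by (simp add: weak_bialgebra_hom_def tmap_def)

end

section \<open>The theorem\<close>

theorem theorem5p7:
  fixes R :: "('k::field, 'r) module"
    and \<psi> :: "'r \<Rightarrow> 'k"
    and e :: "('k, 'r, 'r) tens"
    and X :: "'x set"
    and deg :: "'x \<Rightarrow> 'l::finite \<Rightarrow> 'l"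
    and \<sigma> :: "'x \<Rightarrow> 'x \<Rightarrow> 'x \<Rightarrow> 'x \<Rightarrow> 'l \<Rightarrow> 'r"
  assumes "kalgebra R"
    and "idempotent_frobenius_system R \<psi> e"
    and "finite X"
    and "\<And>x. x \<in> X \<Longrightarrow> bij (deg x)"
    and "\<And>a b c d l. \<lbrakk>a \<in> X; b \<in> X; c \<in> X; d \<in> X\<rbrakk> \<Longrightarrow> \<sigma> a b c d l \<in> center R"
    and "\<And>a b c d l. \<lbrakk>a \<in> X; b \<in> X; c \<in> X; d \<in> X;
            l \<triangleleft> deg d \<triangleleft> deg b \<noteq> l \<triangleleft> deg c \<triangleleft> deg a\<rbrakk> \<Longrightarrow> \<sigma> b d a c l = \<zero>\<^bsub>R\<^esub>"
    and "rigid R X deg \<sigma>"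
  shows "\<forall>(A :: ('k, 'a) module) fp fm.
    kalgebra A \<and> fp \<in> alg_hom (Aw R X deg \<sigma>) A \<and>
    antipode_of (Aw R X deg \<sigma>) (aw_comult R e X deg \<sigma>) (aw_counit R \<psi>) A fp fm \<longrightarrow>
      (\<exists>!F. F \<in> extensional (carrier (Asig R X deg \<sigma>)) \<and> F \<in> alg_hom (Asig R X deg \<sigma>) A \<and>
            (\<forall>x\<in>carrier (Aw R X deg \<sigma>). F (Phi R X deg \<sigma> x) = fp x)) \<and>
      (\<forall>F \<Delta> \<epsilon>.
         F \<in> alg_hom (Asig R X deg \<sigma>) A \<and>
         (\<forall>x\<in>carrier (Aw R X deg \<sigma>). F (Phi R X deg \<sigma> x) = fp x) \<and>
         weak_bialgebra A \<Delta> \<epsilon> \<and>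
         fp \<in> weak_bialgebra_hom (Aw R X deg \<sigma>) (aw_comult R e X deg \<sigma>) (aw_counit R \<psi>) A \<Delta> \<epsilon> \<longrightarrow>
         F \<in> weak_bialgebra_hom (Asig R X deg \<sigma>) (asig_comult R e X deg \<sigma>) (asig_counit R \<psi> deg)
               A \<Delta> \<epsilon>)"
proof (intro allI impI, elim conjE, intro conjI allI impI)
  fix A :: "('k, 'a) module" and fp fm
  assume asm: "kalgebra A" "fp \<in> alg_hom (Aw R X deg \<sigma>) A"
    "antipode_of (Aw R X deg \<sigma>) (aw_comult R e X deg \<sigma>) (aw_counit R \<psi>) A fp fm"
  have R: "kalg R" using assms(1) by (simp add: kalgebra_iff)
  obtain I :: "('r \<times> 'r) set" and r1 r2 where fr: "frob R \<psi> I r1 r2"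
    and e: "e = (\<Oplus>\<^bsub>tensor R R\<^esub>i\<in>I. tens R R (r1 i) (r2 i))"
    by (rule frob_exists[OF R assms(2)])
  interpret d: dyb R \<psi> I r1 r2 X deg \<sigma>
    by (intro dyb.intro fr dyb_axioms.intro assms(3-6))
  have e: "e = d.eR" unfolding e d.eR_def ..
  interpret a: antipode_data R \<psi> I r1 r2 X deg \<sigma> A fp fm
    by (intro antipode_data.intro d.dyb_axioms antipode_data_axioms.intro)
      (use asm e in \<open>simp_all add: kalgebra_iff\<close>)
  show "\<exists>!F. F \<in> extensional (carrier (Asig R X deg \<sigma>)) \<and> F \<in> alg_hom (Asig R X deg \<sigma>) A \<and>
      (\<forall>x\<in>carrier (Aw R X deg \<sigma>). F (Phi R X deg \<sigma> x) = fp x)"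
    by (rule a.universal_property)
  fix F \<Delta> \<epsilon>
  assume F: "F \<in> alg_hom (Asig R X deg \<sigma>) A \<and>
    (\<forall>x\<in>carrier (Aw R X deg \<sigma>). F (Phi R X deg \<sigma> x) = fp x) \<and> weak_bialgebra A \<Delta> \<epsilon> \<and>
    fp \<in> weak_bialgebra_hom (Aw R X deg \<sigma>) (aw_comult R e X deg \<sigma>) (aw_counit R \<psi>) A \<Delta> \<epsilon>"
  interpret b: bialgebra_data R \<psi> I r1 r2 X deg \<sigma> A fp fm F \<Delta> \<epsilon>
    by (intro bialgebra_data.intro a.antipode_data_axioms bialgebra_data_axioms.intro)
      (use F e in simp_all)
  show "F \<in> weak_bialgebra_hom (Asig R X deg \<sigma>) (asig_comult R e X deg \<sigma>) (asig_counit R \<psi> deg) A \<Delta> \<epsilon>"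
    using b.ext_weak_bialgebra_hom unfolding e .
qed

end
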